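(* Let $X$ be an isolated invariant continuum for a homeomorphism $f$. Denote by $d$ the greatest common divisor of the periods of the essential quasicomponents of $W^u_\infty\setminus(X\cup\{\infty\})$. Assume that $X$ has finitely generated cohomology in all higher degrees, so that the Euler characteristic $\chi(X)$ is well defined. Then $$\chi(W^u_\infty,\infty)\equiv\chi(X)\mod d.$$
   Context: Setting. $M$ is a locally compact, paracompact Hausdorff space and $f\colon D\to M$ is a homeomorphism from an open set $D\subseteq M$ onto its image. $\check H^*$ denotes Čech cohomology with coefficients in the field $\mathbb K$, where $\mathbb K=\mathbb Q$ or $\mathbb C$, and $\chi$ is the alternating sum of the dimensions of the Čech cohomology groups. For $A\subseteq D$, $\mathrm{Inv}(A)$ is the set of $p\in A$ for which there is a sequence $(p_i)_{i\in\mathbb Z}$ in $A$ with $p_0=p$ and $f(p_i)=p_{i+1}$ for all $i$. A compact set $X\subseteq D$ with $f(X)=X$ is an isolated invariant set if it has a compact neighbourhood $A\subseteq D$ with $X=\mathrm{Inv}(A)$ (such $A$ is an isolating neighbourhood of $X$). A continuum is a nonempty compact connected set. Index pairs. An index pair for $f$ and $X$ is a pair of compact sets $L\subseteq N\subseteq D$ such that (i) $\overline{N\setminus L}$ is an isolating neighbourhood of $X$ and $X\cap L=\emptyset$; (ii) $f(N\setminus L)\subseteq N$; (iii) $f(L)\cap N\subseteq L$. The index map is the continuous map $f_\#\colon (N/L,[L])\to(N/L,[L])$ of the pointed quotient space given by $f_\#(p)=f(p)$ if $p,f(p)\in N\setminus L$ and $f_\#(p)=[L]$ otherwise (if $L=\emptyset$,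 $N/L$ is $N$ with a disjoint base point added). Compactified unstable manifold. $W^u_\infty$ is the inverse limit of $N/L\xleftarrow{f_\#}N/L\xleftarrow{f_\#}\cdots$, i.e. the compact Hausdorff space of sequences $\xi=(\xi_i)_{i\ge0}$ in $N/L$ with $f_\#(\xi_{i+1})=\xi_i$; the point $\infty$ is the constant sequence $([L],[L],\ldots)$. The map $\tilde f(\xi_0,\xi_1,\ldots)=(f_\#(\xi_0),\xi_0,\xi_1,\ldots)$ is a homeomorphism of $W^u_\infty$ fixing $\infty$. The compact $\tilde f$-invariant set $\{\xi\in W^u_\infty:\xi_i\in X\text{ for all }i\}$ is identified with $X$ via $\xi\mapsto\xi_0$ (a homeomorphism, since $f|_X$ is a homeomorphism of $X$). (Up to homeomorphism and conjugation these objects do not depend on the index pair.) Quasicomponents. The quasicomponent of a point $z$ in a space $Z$ is the intersection of all clopen subsets of $Z$ containing $z$. A quasicomponent $F$ of $W^u_\infty\setminus(X\cup\{\infty\})$ is essential if its closure in $W^u_\infty$ contains $\infty$ and meets $X$. There are finitely many essential quasicomponents and $\tilde f$ permutes them; the period of $F$ is the least $r\ge1$ with $\tilde f^r(F)=F$. If there are none, $d=0$ and congruence mod $0$ means equality. Standing assumption. $X$ has an index pair $(N,L)$ such that $\check H^q(N/L;\mathbb K)$ is finite dimensional in every degree (automatic if $M$ is a locally compact metrizable absolute neighbourhood retract, e.g. a topological manifold); consequently $\check H^q(W^u_\infty;\mathbb K)$ is finite dimensional in every degree $q$.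
   Formalization: It is assumed in addition that the cohomology of X and that of the pair (W^u_∞, ∞) are nonzero in only finitely many degrees, so that both Euler characteristics are defined; for the pair this does not follow from the stated assumptions. *)

theory Defs
  imports
    "HOL-Analysis.Analysis"
    "HOL-Number_Theory.Cong"
    "Jordan_Normal_Form.VS_Connect"
begin

section \<open>Cech cohomology of a pair\<close>

definition open_cover :: "'a topology \<Rightarrow> 'a set set \<Rightarrow> bool" where
  "open_cover Z \<U> \<longleftrightarrow> (\<forall>U\<in>\<U>. openin Z U) \<and> \<Union>\<U> = topspace Z"

definition paracompact_space :: "'a topology \<Rightarrow> bool" where
  "paracompact_space Z \<longleftrightarrow>
     (\<forall>\<U>. open_cover Z \<U> \<longrightarrow>
        (\<exists>\<V>. open_cover Z \<V> \<and> (\<forall>V\<in>\<V>. \<exists>U\<in>\<U>. V \<subseteq> U) \<and> locally_finite_in Z \<V>))"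

text \<open>
  Ordered simplices of the nerve: a \<open>q\<close>-simplex is a list of \<open>q + 1\<close> members of the cover,
  repetitions allowed, with a common point.
\<close>

definition nerve_simplices :: "'a set set \<Rightarrow> nat \<Rightarrow> 'a set list set" where
  "nerve_simplices \<U> q = {\<sigma>. length \<sigma> = Suc q \<and> set \<sigma> \<subseteq> \<U> \<and> \<Inter>(set \<sigma>) \<noteq> {}}"

text \<open>
  Cochains of the nerve of \<open>\<U>\<close> relative to the subcomplex of those simplices whose sets have a
  common point in \<open>A\<close>; for \<open>A = {}\<close> that subcomplex is empty and the cochains are the absolute
  ones. A cochain is represented by its extension by \<open>0\<close> to all lists.
\<close>

definition nerve_cochains :: "'a set set \<Rightarrow> 'a set \<Rightarrow> nat \<Rightarrow> ('a set list \<Rightarrow> 'k::field) set" where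
  "nerve_cochains \<U> A q =
     {c. \<forall>\<sigma>. c \<sigma> \<noteq> 0 \<longrightarrow> \<sigma> \<in> nerve_simplices \<U> q \<and> \<Inter>(set \<sigma>) \<inter> A = {}}"

definition nerve_coboundary ::
    "'a set set \<Rightarrow> nat \<Rightarrow> ('a set list \<Rightarrow> 'k::field) \<Rightarrow> 'a set list \<Rightarrow> 'k" where
  "nerve_coboundary \<U> q c \<sigma> =
     (if \<sigma> \<in> nerve_simplices \<U> (Suc q)
      then \<Sum>i\<le>Suc q. (-1) ^ i * c (take i \<sigma> @ drop (Suc i) \<sigma>) else 0)"

definition nerve_cocycles :: "'a set set \<Rightarrow> 'a set \<Rightarrow> nat \<Rightarrow> ('a set list \<Rightarrow> 'k::field) set" where
  "nerve_cocycles \<U> A q = {c \<in> nerve_cochains \<U> A q. nerve_coboundary \<U> q c = (\<lambda>_. 0)}"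

definition nerve_coboundaries :: "'a set set \<Rightarrow> 'a set \<Rightarrow> nat \<Rightarrow> ('a set list \<Rightarrow> 'k::field) set" where
  "nerve_coboundaries \<U> A q =
     (case q of 0 \<Rightarrow> {\<lambda>_. 0} | Suc j \<Rightarrow> nerve_coboundary \<U> j ` nerve_cochains \<U> A j)"

definition refinement_map :: "'a set set \<Rightarrow> 'a set set \<Rightarrow> ('a set \<Rightarrow> 'a set) \<Rightarrow> bool" where
  "refinement_map \<W> \<U> p \<longleftrightarrow> (\<forall>W\<in>\<W>. p W \<in> \<U> \<and> W \<subseteq> p W)"

definition nerve_pullback ::
    "'a set set \<Rightarrow> nat \<Rightarrow> ('a set \<Rightarrow> 'a set) \<Rightarrow> ('a set list \<Rightarrow> 'k::field) \<Rightarrow> 'a set list \<Rightarrow> 'k" where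
  "nerve_pullback \<W> q p c \<sigma> = (if \<sigma> \<in> nerve_simplices \<W> q then c (map p \<sigma>) else 0)"

text \<open>
  The direct limit of the cohomology of the nerves over all open covers, ordered by refinement:
  an element is represented by a cover and a cocycle of its nerve, and two representatives are
  identified when their pullbacks to some common refinement are cohomologous.
\<close>

definition cech_cocycles ::
    "'a topology \<Rightarrow> 'a set \<Rightarrow> nat \<Rightarrow> ('a set set \<times> ('a set list \<Rightarrow> 'k::field)) set" where
  "cech_cocycles Z A q = {(\<U>, c). open_cover Z \<U> \<and> c \<in> nerve_cocycles \<U> A q}"

definition cech_rel ::
    "'a topology \<Rightarrow> 'a set \<Rightarrow> nat \<Rightarrow> ('a set set \<times> ('a set list \<Rightarrow> 'k::field)) rel" where
  "cech_rel Z A q =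
     {((\<U>, c), (\<V>, e)). (\<U>, c) \<in> cech_cocycles Z A q \<and> (\<V>, e) \<in> cech_cocycles Z A q \<and>
        (\<exists>\<W> p r. open_cover Z \<W> \<and> refinement_map \<W> \<U> p \<and> refinement_map \<W> \<V> r \<and>
           (\<lambda>\<sigma>. nerve_pullback \<W> q p c \<sigma> - nerve_pullback \<W> q r e \<sigma>)
             \<in> nerve_coboundaries \<W> A q)}"

definition cech_add ::
    "'a topology \<Rightarrow> 'a set \<Rightarrow> nat \<Rightarrow> ('a set set \<times> ('a set list \<Rightarrow> 'k::field)) set \<Rightarrow>
       ('a set set \<times> ('a set list \<Rightarrow> 'k)) set \<Rightarrow> ('a set set \<times> ('a set list \<Rightarrow> 'k)) set" where
  "cech_add Z A q x y = cech_rel Z A q ``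
     {(\<W>, \<lambda>\<sigma>. nerve_pullback \<W> q p c \<sigma> + nerve_pullback \<W> q r e \<sigma>) | \<W> p r \<U> c \<V> e.
        (\<U>, c) \<in> x \<and> (\<V>, e) \<in> y \<and> open_cover Z \<W> \<and>
        refinement_map \<W> \<U> p \<and> refinement_map \<W> \<V> r}"

definition cech_smult ::
    "'a topology \<Rightarrow> 'a set \<Rightarrow> nat \<Rightarrow> 'k::field \<Rightarrow> ('a set set \<times> ('a set list \<Rightarrow> 'k)) set \<Rightarrow>
       ('a set set \<times> ('a set list \<Rightarrow> 'k)) set" where
  "cech_smult Z A q a x = cech_rel Z A q `` {(\<U>, \<lambda>\<sigma>. a * c \<sigma>) | \<U> c. (\<U>, c) \<in> x}"

definition cech_zero ::
    "'a topology \<Rightarrow> 'a set \<Rightarrow> nat \<Rightarrow> ('a set set \<times> ('a set list \<Rightarrow> 'k::field)) set" where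
  "cech_zero Z A q = cech_rel Z A q `` {({topspace Z}, \<lambda>_. 0)}"

text \<open>
  The cohomology of the pair \<open>(Z, A)\<close>, for \<open>A\<close> closed in \<open>Z\<close>, as a vector space over the
  field \<open>class_ring\<close>. The record type demands the fields \<open>mult\<close> and
  \<open>one\<close>, which have no meaning for a module and get dummy values.
\<close>

definition cech_cohomology ::
    "'a topology \<Rightarrow> 'a set \<Rightarrow> nat \<Rightarrow> ('k::field, ('a set set \<times> ('a set list \<Rightarrow> 'k)) set) module" where
  "cech_cohomology Z A q =
     \<lparr>carrier = cech_cocycles Z A q // cech_rel Z A q,
      monoid.mult = (\<lambda>_ _. cech_zero Z A q), one = cech_zero Z A q,
      ring.zero = cech_zero Z A q, add = cech_add Z A q,
      module.smult = cech_smult Z A q\<rparr>"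

definition cech_fin_dim :: "'k::field itself \<Rightarrow> 'a topology \<Rightarrow> 'a set \<Rightarrow> nat \<Rightarrow> bool" where
  "cech_fin_dim _ Z A q \<longleftrightarrow>
     vectorspace.fin_dim (class_ring :: 'k ring) (cech_cohomology Z A q)"

definition cech_dim :: "'k::field itself \<Rightarrow> 'a topology \<Rightarrow> 'a set \<Rightarrow> nat \<Rightarrow> nat" where
  "cech_dim _ Z A q =
     vectorspace.dim (class_ring :: 'k ring) (cech_cohomology Z A q)"

definition cech_support :: "'k::field itself \<Rightarrow> 'a topology \<Rightarrow> 'a set \<Rightarrow> nat set" where
  "cech_support _ Z A =
     {q. carrier (cech_cohomology Z A q :: ('k, _) module) \<noteq> {cech_zero Z A q}}"

text \<open>
  Meaningful when the cohomology is finite dimensional in every degree and \<open>cech_support\<close> is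
  finite.
\<close>

definition euler_char :: "'k::field itself \<Rightarrow> 'a topology \<Rightarrow> 'a set \<Rightarrow> int" where
  "euler_char k Z A = (\<Sum>q\<in>cech_support k Z A. (-1) ^ q * int (cech_dim k Z A q))"


section \<open>Isolated invariant sets and index pairs\<close>

definition invariant_part :: "('a \<Rightarrow> 'a) \<Rightarrow> 'a set \<Rightarrow> 'a set" where
  "invariant_part f A = {p. \<exists>s::int \<Rightarrow> 'a. (\<forall>i. s i \<in> A \<and> f (s i) = s (i + 1)) \<and> s 0 = p}"

definition isolating_neighbourhood ::
    "'a topology \<Rightarrow> 'a set \<Rightarrow> ('a \<Rightarrow> 'a) \<Rightarrow> 'a set \<Rightarrow> 'a set \<Rightarrow> bool" where
  "isolating_neighbourhood M D f X A \<longleftrightarrow>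
     compactin M A \<and> A \<subseteq> D \<and> X \<subseteq> M interior_of A \<and> X = invariant_part f A"

definition isolated_invariant :: "'a topology \<Rightarrow> 'a set \<Rightarrow> ('a \<Rightarrow> 'a) \<Rightarrow> 'a set \<Rightarrow> bool" where
  "isolated_invariant M D f X \<longleftrightarrow>
     compactin M X \<and> X \<subseteq> D \<and> f ` X = X \<and> (\<exists>A. isolating_neighbourhood M D f X A)"

definition index_pair ::
    "'a topology \<Rightarrow> 'a set \<Rightarrow> ('a \<Rightarrow> 'a) \<Rightarrow> 'a set \<Rightarrow> 'a set \<Rightarrow> 'a set \<Rightarrow> bool" where
  "index_pair M D f X N L \<longleftrightarrow>
     compactin M L \<and> compactin M N \<and> L \<subseteq> N \<and> N \<subseteq> D \<and>
     isolating_neighbourhood M D f X (M closure_of (N - L)) \<and> X \<inter> L = {} \<and>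
     f ` (N - L) \<subseteq> N \<and> f ` L \<inter> N \<subseteq> L"

text \<open>
  In \<open>N/L\<close> the base point \<open>[L]\<close> is \<open>None\<close> and a point \<open>p\<close> of \<open>N - L\<close> is \<open>Some p\<close>. For
  \<open>L = {}\<close> the definition below makes \<open>None\<close> an isolated point.
\<close>

definition collapse :: "'a set \<Rightarrow> 'a \<Rightarrow> 'a option" where
  "collapse L p = (if p \<in> L then None else Some p)"

definition pointed_quotient :: "'a topology \<Rightarrow> 'a set \<Rightarrow> 'a set \<Rightarrow> 'a option topology" where
  "pointed_quotient M N L = topology (\<lambda>U.
     U \<subseteq> insert None (Some ` (N - L)) \<and> openin (subtopology M N) {p \<in> N. collapse L p \<in> U})"

lemma openin_pointed_quotient:
  "openin (pointed_quotient M N L) U \<longleftrightarrow>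
     U \<subseteq> insert None (Some ` (N - L)) \<and> openin (subtopology M N) {p \<in> N. collapse L p \<in> U}"
proof -
  let ?P = "\<lambda>U. U \<subseteq> insert None (Some ` (N - L)) \<and>
              openin (subtopology M N) {p \<in> N. collapse L p \<in> U}"
  have "istopology ?P"
    unfolding istopology_def
  proof (rule conjI; intro allI impI)
    fix S T assume S: "?P S" and T: "?P T"
    have eq: "{p \<in> N. collapse L p \<in> S \<inter> T}
                = {p \<in> N. collapse L p \<in> S} \<inter> {p \<in> N. collapse L p \<in> T}"
      unfolding set_eq_iff Int_iff mem_Collect_eq by meson
    have "openin (subtopology M N) ({p \<in> N. collapse L p \<in> S} \<inter> {p \<in> N. collapse L p \<in> T})"
      by (rule openin_Int[OF conjunct2[OF S] conjunct2[OF T]])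
    then show "?P (S \<inter> T)"
      unfolding eq using le_infI1[OF conjunct1[OF S]] by (rule conjI[rotated])
  next
    fix \<K> assume K: "\<forall>S\<in>\<K>. ?P S"
    have eq: "{p \<in> N. collapse L p \<in> \<Union>\<K>} = \<Union>((\<lambda>S. {p \<in> N. collapse L p \<in> S}) ` \<K>)"
      by (simp add: set_eq_iff)
    have sub: "\<Union>\<K> \<subseteq> insert None (Some ` (N - L))"
      using K by (meson Sup_least)
    have "openin (subtopology M N) (\<Union>((\<lambda>S. {p \<in> N. collapse L p \<in> S}) ` \<K>))"
    proof (rule openin_Union)
      fix V assume "V \<in> (\<lambda>S. {p \<in> N. collapse L p \<in> S}) ` \<K>"
      then obtain S where "S \<in> \<K>" and V: "V = {p \<in> N. collapse L p \<in> S}"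
        by (rule imageE)
      show "openin (subtopology M N) V"
        unfolding V by (rule conjunct2[OF bspec[OF K \<open>S \<in> \<K>\<close>]])
    qed
    then show "?P (\<Union>\<K>)"
      unfolding eq using sub by (rule conjI[rotated])
  qed
  then show ?thesis
    unfolding pointed_quotient_def by (rule fun_cong[OF topology_inverse'])
qed

definition index_map :: "('a \<Rightarrow> 'a) \<Rightarrow> 'a set \<Rightarrow> 'a set \<Rightarrow> 'a option \<Rightarrow> 'a option" where
  "index_map f N L z = (case z of None \<Rightarrow> None
     | Some p \<Rightarrow> if p \<in> N - L \<and> f p \<in> N - L then Some (f p) else None)"


section \<open>The compactified unstable manifold\<close>

definition unstable_space ::
    "'a topology \<Rightarrow> ('a \<Rightarrow> 'a) \<Rightarrow> 'a set \<Rightarrow> 'a set \<Rightarrow> (nat \<Rightarrow> 'a option) topology" where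
  "unstable_space M f N L =
     subtopology (product_topology (\<lambda>_. pointed_quotient M N L) UNIV)
       {\<xi>. \<forall>i. index_map f N L (\<xi> (Suc i)) = \<xi> i}"

definition unstable_infinity :: "nat \<Rightarrow> 'a option" where
  "unstable_infinity = (\<lambda>_. None)"

definition unstable_homeo ::
    "('a \<Rightarrow> 'a) \<Rightarrow> 'a set \<Rightarrow> 'a set \<Rightarrow> (nat \<Rightarrow> 'a option) \<Rightarrow> nat \<Rightarrow> 'a option" where
  "unstable_homeo f N L \<xi> = (\<lambda>i. case i of 0 \<Rightarrow> index_map f N L (\<xi> 0) | Suc j \<Rightarrow> \<xi> j)"

definition unstable_core ::
    "'a topology \<Rightarrow> ('a \<Rightarrow> 'a) \<Rightarrow> 'a set \<Rightarrow> 'a set \<Rightarrow> 'a set \<Rightarrow> (nat \<Rightarrow> 'a option) set" where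
  "unstable_core M f N L X = {\<xi> \<in> topspace (unstable_space M f N L). \<forall>i. \<xi> i \<in> Some ` X}"

definition essential_quasicomponents ::
    "'a topology \<Rightarrow> ('a \<Rightarrow> 'a) \<Rightarrow> 'a set \<Rightarrow> 'a set \<Rightarrow> 'a set \<Rightarrow> (nat \<Rightarrow> 'a option) set set" where
  "essential_quasicomponents M f N L X =
     (let W = unstable_space M f N L; C = unstable_core M f N L X in
       {F \<in> quasi_components_of (subtopology W (topspace W - (C \<union> {unstable_infinity}))).
          unstable_infinity \<in> W closure_of F \<and> W closure_of F \<inter> C \<noteq> {}})"

definition quasicomponent_period ::
    "('a \<Rightarrow> 'a) \<Rightarrow> 'a set \<Rightarrow> 'a set \<Rightarrow> (nat \<Rightarrow> 'a option) set \<Rightarrow> nat" where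
  "quasicomponent_period f N L F = (LEAST r. 1 \<le> r \<and> (unstable_homeo f N L ^^ r) ` F = F)"

text \<open>With no essential quasicomponents this is \<open>Gcd {} = 0\<close>.\<close>

definition period_gcd :: "'a topology \<Rightarrow> ('a \<Rightarrow> 'a) \<Rightarrow> 'a set \<Rightarrow> 'a set \<Rightarrow> 'a set \<Rightarrow> nat" where
  "period_gcd M f N L X = Gcd (quasicomponent_period f N L ` essential_quasicomponents M f N L X)"

end

theory Submission
  imports Defs "HOL-Library.Function_Algebras"
begin

text \<open>
  The pair \<open>(X \<union> {\<infinity>}, {\<infinity>})\<close> has the cohomology of \<open>X\<close>, so the exact sequence of the triple
  \<open>(W, X \<union> {\<infinity>}, {\<infinity>})\<close>, where \<open>W\<close> is the compactified unstable manifold, writes the difference of the two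
  Euler characteristics as the alternating sum of the dimensions of \<open>H(W, X \<union> {\<infinity>})\<close>. It suffices that
  \<open>d\<close> divides each of them. The homeomorphism pushes all other points from \<open>X\<close> to \<open>\<infinity>\<close>, and \<open>d\<close> divides the
  periods, so there is a locally constant map from the complement of \<open>X \<union> {\<infinity>}\<close> to \<open>{0..<d}\<close> that the
  homeomorphism increases by 1 modulo \<open>d\<close>. Its fibres split \<open>H(W, X \<union> {\<infinity>})\<close> into \<open>d\<close> summands that
  the homeomorphism permutes cyclically, hence of equal dimension.

  On compact Hausdorff spaces the Cech cohomology is that of the Alexander--Spanier cochains, functions
  on lists of points modulo those that vanish on all small lists. A point map need not be continuous to
  pull such cochains back, it only has to preserve smallness of lists. This gives tautness of closed
  subsets and continuity along the inverse limit.
\<close>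

section \<open>Dimensions of quotients of function spaces\<close>

text \<open>Finiteness of the essential quasicomponents, on which the labelling by residues rests,
  is itself cohomological: disjoint clopen sets around distinct ones give linearly independent
  classes in degree 1 of the pair \<open>(W, X \<union> {\<infinity>})\<close>. The labelling
  extends to a locally constant function that is equivariant only up to a defect, carried by a
  clopen set that meets no essential quasicomponent. Such a set is the union of a clopen set away
  from \<infinity> and one away from \<open>X\<close>; the defect is summed along forward orbits on
  the first and along backward orbits on the second, and both sums are locally finite.

  The fibres are clopen only off \<open>X \<union> {\<infinity>}\<close>. Cutting a cochain along
  them commutes with the coboundary, up to small lists, if the cochain vanishes near
  \<open>X \<union> {\<infinity>}\<close>; tautness provides such cochains.

  Finite dimension reaches the pair from two ends: from \<open>N/L\<close> by continuity along the
  inverse limit, and from \<open>X\<close>, where connectedness supplies degree 0. For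
  \<open>d = 0\<close> every positive \<open>n\<close> may take the place of \<open>d\<close>, so
  the dimensions vanish.\<close>

definition fscale :: "'k::field \<Rightarrow> ('x \<Rightarrow> 'k) \<Rightarrow> 'x \<Rightarrow> 'k" where
  "fscale a c = (\<lambda>x. a * c x)"

lemma fscale_apply [simp]: "fscale a c x = a * c x"
  by (simp add: fscale_def)

interpretation fs: vector_space "fscale :: 'k::field \<Rightarrow> ('x \<Rightarrow> 'k) \<Rightarrow> 'x \<Rightarrow> 'k"
  by unfold_locales (auto simp: fun_eq_iff algebra_simps)

interpretation fsp: vector_space_pair
    "fscale :: 'k::field \<Rightarrow> ('x \<Rightarrow> 'k) \<Rightarrow> 'x \<Rightarrow> 'k" "fscale :: 'k::field \<Rightarrow> ('y \<Rightarrow> 'k) \<Rightarrow> 'y \<Rightarrow> 'k"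
  by unfold_locales

definition flinear :: "(('x \<Rightarrow> 'k::field) \<Rightarrow> ('y \<Rightarrow> 'k)) \<Rightarrow> bool" where
  "flinear F \<longleftrightarrow> (\<forall>a b. F (a + b) = F a + F b) \<and> (\<forall>r a. F (fscale r a) = fscale r (F a))"

lemma flinear_linear: "flinear F \<longleftrightarrow> Vector_Spaces.linear fscale fscale F"
  by (auto simp: flinear_def Vector_Spaces.linear_iff fs.vector_space_axioms)

lemma flinear_diff: "flinear F \<Longrightarrow> F (a - b) = F a - F b"
  unfolding flinear_def by (metis eq_diff_eq)

lemma flinear_add: "flinear F \<Longrightarrow> F (a + b) = F a + F b"
  by (simp add: flinear_def)

lemma flinear_zero: "flinear F \<Longrightarrow> F 0 = 0"
  unfolding flinear_def by (metis add_cancel_right_right add_0)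

lemma flinear_scale: "flinear F \<Longrightarrow> F (fscale r a) = fscale r (F a)"
  by (simp add: flinear_def)

lemma flinear_sum: "flinear F \<Longrightarrow> F (\<Sum>i\<in>I. g i) = (\<Sum>i\<in>I. F (g i))"
  by (simp add: flinear_linear fsp.linear_sum)

lemma flinear_id: "flinear (\<lambda>x. x)"
  by (simp add: flinear_def)

lemma flinear_span_image: "flinear F \<Longrightarrow> fs.span (F ` S) = F ` fs.span S"
  by (simp add: flinear_linear fsp.linear_span_image)

abbreviation fsub :: "('x \<Rightarrow> 'k::field) set \<Rightarrow> bool" where
  "fsub \<equiv> fs.subspace"

lemma fsubI:
  assumes "0 \<in> S" "\<And>a b. a \<in> S \<Longrightarrow> b \<in> S \<Longrightarrow> a + b \<in> S" "\<And>r a. a \<in> S \<Longrightarrow> fscale r a \<in> S"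
  shows "fsub S"
  using assms by (auto simp: fs.subspace_def)

definition set_sum :: "('x \<Rightarrow> 'k::field) set \<Rightarrow> ('x \<Rightarrow> 'k) set \<Rightarrow> ('x \<Rightarrow> 'k) set" where
  "set_sum A B = {a + b | a b. a \<in> A \<and> b \<in> B}"

lemma fsub_set_sum: "fsub A \<Longrightarrow> fsub B \<Longrightarrow> fsub (set_sum A B)"
  unfolding set_sum_def by (rule fs.subspace_sums)

lemma set_sum_left: "fsub B \<Longrightarrow> A \<subseteq> set_sum A B"
  unfolding set_sum_def using fs.subspace_0 by (metis (mono_tags, lifting) add_0_right mem_Collect_eq subsetI)

lemma set_sum_right: "fsub A \<Longrightarrow> B \<subseteq> set_sum A B"
  unfolding set_sum_def using fs.subspace_0 by (metis (mono_tags, lifting) add_0_left mem_Collect_eq subsetI)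

lemma set_sum_least: "fsub C \<Longrightarrow> A \<subseteq> C \<Longrightarrow> B \<subseteq> C \<Longrightarrow> set_sum A B \<subseteq> C"
  unfolding set_sum_def by (auto intro: fs.subspace_add)

lemma set_sumI: "a \<in> A \<Longrightarrow> b \<in> B \<Longrightarrow> a + b \<in> set_sum A B"
  unfolding set_sum_def by blast

lemma set_sumE: "x \<in> set_sum A B \<Longrightarrow> (\<And>a b. a \<in> A \<Longrightarrow> b \<in> B \<Longrightarrow> x = a + b \<Longrightarrow> P) \<Longrightarrow> P"
  unfolding set_sum_def by blast

lemma fsub_diffD: "fsub B \<Longrightarrow> a - b \<in> B \<Longrightarrow> b \<in> B \<Longrightarrow> a \<in> B"
  by (metis diff_add_cancel fs.subspace_add)

definition qfd :: "('x \<Rightarrow> 'k::field) set \<Rightarrow> ('x \<Rightarrow> 'k) set \<Rightarrow> bool" where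
  "qfd Z B \<longleftrightarrow> (\<exists>T. finite T \<and> T \<subseteq> Z \<and> Z \<subseteq> set_sum B (fs.span T))"

text \<open>Counting generators of \<open>Z\<close> modulo \<open>B\<close> avoids a quotient type:
  every cohomology group stays a pair of subspaces of one function space. If \<open>qfd Z B\<close>
  fails, the \<open>LEAST\<close> is a fixed but meaningless number.\<close>

definition qdim :: "('x \<Rightarrow> 'k::field) set \<Rightarrow> ('x \<Rightarrow> 'k) set \<Rightarrow> nat" where
  "qdim Z B = (LEAST n. \<exists>T. finite T \<and> card T = n \<and> T \<subseteq> Z \<and> Z \<subseteq> set_sum B (fs.span T))"

lemma qdim_le: "finite T \<Longrightarrow> T \<subseteq> Z \<Longrightarrow> Z \<subseteq> set_sum B (fs.span T) \<Longrightarrow> qdim Z B \<le> card T"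
  unfolding qdim_def by (rule Least_le) blast

lemma qdim_witness:
  assumes "qfd Z B"
  obtains T where "finite T" "card T = qdim Z B" "T \<subseteq> Z" "Z \<subseteq> set_sum B (fs.span T)"
proof -
  have "\<exists>n T. finite T \<and> card T = n \<and> T \<subseteq> Z \<and> Z \<subseteq> set_sum B (fs.span T)"
    using assms unfolding qfd_def by blast
  then have "\<exists>T. finite T \<and> card T = qdim Z B \<and> T \<subseteq> Z \<and> Z \<subseteq> set_sum B (fs.span T)"
    unfolding qdim_def by (rule LeastI_ex)
  with that show thesis by blast
qed

text \<open>The hypotheses are those of an isomorphism \<open>Z / B \<rightarrow> Z' / B'\<close>,
  read off on representatives. Generating sets are carried forward by \<open>F\<close> and backward
  by lifting, and neither increases their size. If the quotients are not finite dimensional, both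
  \<open>qdim\<close> are the \<open>LEAST\<close> of the same empty predicate.\<close>

lemma quotient_iso:
  fixes F :: "('x \<Rightarrow> 'k::field) \<Rightarrow> ('y \<Rightarrow> 'k)"
  assumes F: "flinear F" and Z: "fsub Z" and B: "fsub B" and B': "fsub B'"
    and "\<And>z. z \<in> Z \<Longrightarrow> F z \<in> Z'"
    and surj: "\<And>w. w \<in> Z' \<Longrightarrow> \<exists>z\<in>Z. w - F z \<in> B'"
    and ker: "\<And>z. z \<in> Z \<Longrightarrow> F z \<in> B' \<longleftrightarrow> z \<in> B"
  shows "qfd Z B = qfd Z' B' \<and> qdim Z B = qdim Z' B'"
proof -
  have up: "\<exists>T'. finite T' \<and> card T' \<le> card T \<and> T' \<subseteq> Z' \<and> Z' \<subseteq> set_sum B' (fs.span T')"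
    if T: "finite T" "T \<subseteq> Z" "Z \<subseteq> set_sum B (fs.span T)" for T
  proof (intro exI[of _ "F ` T"] conjI)
    show "F ` T \<subseteq> Z'" using T assms(5) by blast
    show "Z' \<subseteq> set_sum B' (fs.span (F ` T))"
    proof
      fix w assume "w \<in> Z'"
      then obtain z where z: "z \<in> Z" "w - F z \<in> B'" using surj by blast
      then obtain b s where bs: "b \<in> B" "s \<in> fs.span T" "z = b + s" using T(3) by (blast elim: set_sumE)
      have "s \<in> Z" using bs T(2) Z by (metis fs.span_minimal subsetD)
      then have "b \<in> Z" using bs z Z by (metis add_diff_cancel_right' fs.subspace_diff)
      then have "F b \<in> B'" using bs ker by blast
      then have "(w - F z) + F b \<in> B'" using z B' by (simp add: fs.subspace_add)
      moreover have "w = ((w - F z) + F b) + F s" using bs by (simp add: flinear_add[OF F])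
      moreover have "F s \<in> fs.span (F ` T)" using bs(2) by (simp add: flinear_span_image[OF F])
      ultimately show "w \<in> set_sum B' (fs.span (F ` T))" using set_sumI by metis
    qed
  qed (use T card_image_le in auto)
  have down: "\<exists>T. finite T \<and> card T \<le> card T' \<and> T \<subseteq> Z \<and> Z \<subseteq> set_sum B (fs.span T)"
    if T: "finite T'" "T' \<subseteq> Z'" "Z' \<subseteq> set_sum B' (fs.span T')" for T'
  proof -
    from surj T(2) have "\<forall>w\<in>T'. \<exists>z. z \<in> Z \<and> w - F z \<in> B'" by blast
    then obtain g where g: "\<And>w. w \<in> T' \<Longrightarrow> g w \<in> Z \<and> w - F (g w) \<in> B'" by metis
    have gs: "fs.span (g ` T') \<subseteq> Z" using g Z by (intro fs.span_minimal) auto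
    \<comment> \<open>Each generator in \<open>T'\<close> is hit modulo \<open>B'\<close>, hence by
      linearity so is the whole span of \<open>T'\<close>; the lifts then span \<open>Z\<close>
      modulo the kernel \<open>B\<close>.\<close>
    have key: "\<exists>u\<in>fs.span (g ` T'). s - F u \<in> B'" if "s \<in> fs.span T'" for s
      using that
    proof (induction rule: fs.span_induct_alt)
      case base
      show ?case using fs.span_zero flinear_zero[OF F] fs.subspace_0[OF B'] by (metis diff_self)
    next
      case (step a x y)
      then obtain u where u: "u \<in> fs.span (g ` T')" "y - F u \<in> B'" by blast
      have "fscale a (g x) + u \<in> fs.span (g ` T')"
        using step u by (auto intro: fs.span_add fs.span_scale fs.span_base)
      moreover have "fscale a (x - F (g x)) + (y - F u) \<in> B'"
        using g step u B' by (simp add: fs.subspace_add fs.subspace_scale)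
      then have "(fscale a x + y) - F (fscale a (g x) + u) \<in> B'"
        by (simp add: flinear_add[OF F] flinear_scale[OF F] fs.scale_right_diff_distrib algebra_simps)
      ultimately show ?case by blast
    qed
    have "Z \<subseteq> set_sum B (fs.span (g ` T'))"
    proof
      fix z assume z: "z \<in> Z"
      then have "F z \<in> set_sum B' (fs.span T')" using assms(5) T by blast
      then obtain b s where bs: "b \<in> B'" "s \<in> fs.span T'" "F z = b + s" by (rule set_sumE)
      with key obtain u where u: "u \<in> fs.span (g ` T')" "s - F u \<in> B'" by blast
      have "F (z - u) = b + (s - F u)" using bs by (simp add: flinear_diff[OF F])
      also have "\<dots> \<in> B'" using bs u B' by (simp add: fs.subspace_add)
      finally have "z - u \<in> B" using ker z u gs Z by (metis fs.subspace_diff subsetD)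
      then show "z \<in> set_sum B (fs.span (g ` T'))" using u set_sumI by (metis diff_add_cancel)
    qed
    moreover have "g ` T' \<subseteq> Z" using g by blast
    ultimately show ?thesis using T card_image_le by (intro exI[of _ "g ` T'"]) auto
  qed
  have q: "qfd Z B = qfd Z' B'" unfolding qfd_def using up down by metis
  have "qdim Z B = qdim Z' B'"
  proof (cases "qfd Z B")
    case True
    from qdim_witness[OF True] obtain T where "finite T" "card T = qdim Z B" "T \<subseteq> Z" "Z \<subseteq> set_sum B (fs.span T)" .
    with up obtain T' where "finite T'" "card T' \<le> qdim Z B" "T' \<subseteq> Z'" "Z' \<subseteq> set_sum B' (fs.span T')" by metis
    then have 1: "qdim Z' B' \<le> qdim Z B" using qdim_le le_trans by blast
    from qdim_witness[of Z' B'] True q obtain T' where "finite T'" "card T' = qdim Z' B'" "T' \<subseteq> Z'" "Z' \<subseteq> set_sum B' (fs.span T')" by blast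
    with down obtain T where "finite T" "card T \<le> qdim Z' B'" "T \<subseteq> Z" "Z \<subseteq> set_sum B (fs.span T)" by metis
    then have 2: "qdim Z B \<le> qdim Z' B'" using qdim_le le_trans by blast
    from 1 2 show ?thesis by simp
  next
    case False
    then have "\<And>n. \<not> (\<exists>T. finite T \<and> card T = n \<and> T \<subseteq> Z \<and> Z \<subseteq> set_sum B (fs.span T))"
      "\<And>n. \<not> (\<exists>T. finite T \<and> card T = n \<and> T \<subseteq> Z' \<and> Z' \<subseteq> set_sum B' (fs.span T))"
      using q unfolding qfd_def by blast+
    then have "(\<lambda>n. \<exists>T. finite T \<and> card T = n \<and> T \<subseteq> Z \<and> Z \<subseteq> set_sum B (fs.span T)) =
      (\<lambda>n. \<exists>T. finite T \<and> card T = n \<and> T \<subseteq> Z' \<and> Z' \<subseteq> set_sum B' (fs.span T))" by metis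
    then show ?thesis using q unfolding qdim_def by simp
  qed
  with q show ?thesis ..
qed

text \<open>A basis of \<open>B\<close> is extended to the whole space and its vectors are sent to
  0. The resulting map plays the role of the quotient map by \<open>B\<close>, so that independence
  modulo \<open>B\<close> becomes ordinary independence of images.\<close>

lemma projection_exists:
  fixes B :: "('x \<Rightarrow> 'k::field) set"
  assumes "fsub B"
  obtains p :: "('x \<Rightarrow> 'k) \<Rightarrow> ('x \<Rightarrow> 'k)" where "flinear p" "\<And>x. p x = 0 \<longleftrightarrow> x \<in> B"
proof -
  obtain b where b: "b \<subseteq> B" "fs.independent b" "B \<subseteq> fs.span b"
    using fs.maximal_independent_subset by blast
  define e where "e = fs.extend_basis b"
  have e: "b \<subseteq> e" "fs.independent e" "fs.span e = UNIV"
    unfolding e_def using fs.extend_basis_superset[OF b(2)] fs.independent_extend_basis[OF b(2)]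
      fs.span_extend_basis[OF b(2)] .
  obtain p :: "('x \<Rightarrow> 'k) \<Rightarrow> ('x \<Rightarrow> 'k)" where p: "Vector_Spaces.linear fscale fscale p"
    "\<forall>x\<in>e. p x = (if x \<in> b then 0 else x)"
    using fsp.linear_independent_extend[OF e(2), of "\<lambda>x. if x \<in> b then 0 else x"] by blast
  have fp: "flinear p" using p by (simp add: flinear_linear)
  have z: "p x = 0" if "x \<in> fs.span b" for x
    using fsp.linear_eq_0_on_span[OF p(1), of b x] that p e(1) by (auto simp: subset_iff)
  have nz: "p y = y" if "y \<in> fs.span (e - b)" for y
    using that
  proof (induction rule: fs.span_induct_alt)
    case base show ?case by (rule flinear_zero[OF fp])
  next
    case (step a x y) then have "p x = x" using p by auto
    then show ?case using step(2) unfolding flinear_add[OF fp] flinear_scale[OF fp] by metis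
  qed
  show thesis
  proof (rule that[OF fp])
    fix x
    have "x \<in> fs.span (b \<union> (e - b))" using e by (simp add: Un_absorb1)
    then obtain u v where uv: "u \<in> fs.span b" "v \<in> fs.span (e - b)" "x = u + v"
      unfolding fs.span_Un by blast
    have px: "p x = v" using uv z nz by (simp add: flinear_add[OF fp])
    have bs: "fs.span b = B" using b assms by (metis fs.span_minimal subset_antisym)
    show "p x = 0 \<longleftrightarrow> x \<in> B"
    proof
      assume "p x = 0" then show "x \<in> B" using px uv bs by simp
    next
      assume "x \<in> B" then show "p x = 0" using z bs by simp
    qed
  qed
qed

lemma fsub_zero: "fsub {0}" by (rule fs.subspace_single_0)

lemma fsub_image: "flinear F \<Longrightarrow> fsub S \<Longrightarrow> fsub (F ` S)"
  by (auto simp: flinear_linear fsp.linear_subspace_image)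

lemma qfd_zero_basis:
  fixes P :: "('x \<Rightarrow> 'k::field) set"
  assumes "qfd P {0}"
  shows "\<exists>T. finite T \<and> P \<subseteq> fs.span T"
  using assms unfolding qfd_def set_sum_def by auto

lemma qdim_zero:
  fixes P :: "('x \<Rightarrow> 'k::field) set"
  assumes P: "fsub P" and S: "fs.independent S" "S \<subseteq> P" "P \<subseteq> fs.span S" "finite S"
  shows "qdim P {0} = card S"
proof (rule antisym)
  have ss: "\<And>T::('x \<Rightarrow> 'k) set. set_sum {0} (fs.span T) = fs.span T" by (auto simp: set_sum_def)
  show "qdim P {0} \<le> card S" using S by (intro qdim_le) (auto simp: ss)
  have "qfd P {0}" using S unfolding qfd_def ss by blast
  from qdim_witness[OF this] obtain T where "finite T" "card T = qdim P {0}" "T \<subseteq> P" "P \<subseteq> set_sum {0} (fs.span T)" .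
  then show "card S \<le> qdim P {0}" using S by (metis fs.independent_span_bound ss subset_trans)
qed

text \<open>A basis \<open>S\<close> of \<open>Q\<close> extends to a basis \<open>S'\<close> of
  \<open>P\<close>. The added vectors span \<open>P\<close> modulo \<open>Q\<close>, and no smaller
  set does, because together with \<open>S\<close> it would span \<open>P\<close>.\<close>

lemma quotient_add_zero:
  fixes P Q :: "('x \<Rightarrow> 'k::field) set"
  assumes P: "fsub P" and Q: "fsub Q" "Q \<subseteq> P" and fd: "qfd P {0}"
  shows "qfd P Q \<and> qfd Q {0} \<and> qdim P {0} = qdim P Q + qdim Q {0}"
proof -
  have ss: "\<And>T::('x \<Rightarrow> 'k) set. set_sum {0} (fs.span T) = fs.span T" by (auto simp: set_sum_def)
  obtain T0 where T0: "finite T0" "P \<subseteq> fs.span T0" using qfd_zero_basis[OF fd] by blast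
  obtain S where S: "S \<subseteq> Q" "fs.independent S" "Q \<subseteq> fs.span S"
    using fs.maximal_independent_subset by blast
  obtain S' where S': "S \<subseteq> S'" "S' \<subseteq> P" "fs.independent S'" "P \<subseteq> fs.span S'"
    using fs.maximal_independent_subset_extend[of S P] S Q by blast
  have fin: "finite S'" using fs.independent_span_bound[OF T0(1) S'(3)] S' T0 by (meson subset_trans)
  then have finS: "finite S" using S' finite_subset by blast
  have dP: "qdim P {0} = card S'" using qdim_zero P S' fin by blast
  have dQ: "qdim Q {0} = card S" using qdim_zero Q S finS by blast
  have fQ: "qfd Q {0}" unfolding qfd_def ss using S finS by blast
  have sQ: "fs.span S = Q" using S Q by (metis fs.span_minimal subset_antisym)
  have span: "P \<subseteq> set_sum Q (fs.span (S' - S))"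
  proof
    fix x assume "x \<in> P"
    then have "x \<in> fs.span (S \<union> (S' - S))" using S' by (metis Un_Diff_cancel2 Un_absorb1 Un_commute subsetD)
    then show "x \<in> set_sum Q (fs.span (S' - S))" unfolding fs.span_Un set_sum_def sQ .
  qed
  have qPQ: "qfd P Q" unfolding qfd_def using span fin S' by (intro exI[of _ "S' - S"]) auto
  have le1: "qdim P Q \<le> card (S' - S)" using span fin S' by (intro qdim_le) auto
  from qdim_witness[OF qPQ] obtain T where T: "finite T" "card T = qdim P Q" "T \<subseteq> P" "P \<subseteq> set_sum Q (fs.span T)" .
  have "P \<subseteq> fs.span (S \<union> T)" using T(4) unfolding set_sum_def fs.span_Un sQ .
  then have "card S' \<le> card (S \<union> T)"
    using fs.independent_span_bound[of "S \<union> T" S'] S' finS T by (meson finite_UnI subset_trans)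
  also have "\<dots> \<le> card S + qdim P Q" using T card_Un_le by metis
  finally have "card S' \<le> card S + qdim P Q" .
  moreover have "card (S' - S) = card S' - card S" using S' finS by (simp add: card_Diff_subset)
  moreover have "card S \<le> card S'" using S' fin by (simp add: card_mono)
  ultimately show ?thesis using dP dQ le1 qPQ fQ by linarith
qed

lemma quotient_via_projection:
  fixes B Z :: "('x \<Rightarrow> 'k::field) set"
  assumes p: "flinear p" "\<And>x. p x = 0 \<longleftrightarrow> x \<in> B" and Z: "fsub Z" and Y: "fsub Y" "B \<subseteq> Y" "Y \<subseteq> Z"
  shows "qfd Z Y = qfd (p ` Z) (p ` Y) \<and> qdim Z Y = qdim (p ` Z) (p ` Y)"
proof (rule quotient_iso[OF p(1) Z Y(1)])
  show "fsub (p ` Y)" using Y p fsub_image by blast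
  show "\<exists>z\<in>Z. w - p z \<in> p ` Y" if "w \<in> p ` Z" for w
    using that fs.subspace_0[OF \<open>fsub (p ` Y)\<close>] by force
  show "p z \<in> p ` Y \<longleftrightarrow> z \<in> Y" if "z \<in> Z" for z
  proof
    assume "p z \<in> p ` Y"
    then obtain y where y: "y \<in> Y" "p z = p y" by blast
    then have "p (z - y) = 0" by (simp add: flinear_diff[OF p(1)])
    then have "z - y \<in> Y" using p Y by blast
    then show "z \<in> Y" using y Y fsub_diffD by blast
  qed auto
qed auto

text \<open>A projection along \<open>B\<close> reduces the first part to the case
  \<open>B = 0\<close>; the second part joins generators of the two layers.\<close>

lemma quotient_add:
  fixes B Y Z :: "('x \<Rightarrow> 'k::field) set"
  assumes B: "fsub B" and Y: "fsub Y" and Z: "fsub Z" and "B \<subseteq> Y" "Y \<subseteq> Z"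
  shows "qfd Z B \<Longrightarrow> qfd Z Y \<and> qfd Y B \<and> qdim Z B = qdim Z Y + qdim Y B"
    and "qfd Z Y \<Longrightarrow> qfd Y B \<Longrightarrow> qfd Z B"
proof -
  obtain p :: "('x \<Rightarrow> 'k) \<Rightarrow> ('x \<Rightarrow> 'k)" where p: "flinear p" "\<And>x. p x = 0 \<longleftrightarrow> x \<in> B"
    using projection_exists[OF B] by metis
  have pB: "p ` B = {0}" using p fs.subspace_0[OF B] by (force simp: image_iff)
  note ZB = quotient_via_projection[OF p Z B subset_refl, unfolded pB]
  note YB = quotient_via_projection[OF p Y B subset_refl, unfolded pB]
  note ZY = quotient_via_projection[OF p Z Y assms(4,5)]
  show "qfd Z Y \<and> qfd Y B \<and> qdim Z B = qdim Z Y + qdim Y B" if "qfd Z B"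
    using quotient_add_zero[OF fsub_image[OF p(1) Z] fsub_image[OF p(1) Y] image_mono[OF assms(5)]]
      that ZB YB[OF assms(4)] ZB[OF order_trans[OF assms(4,5)]] ZY by simp
  show "qfd Z B" if "qfd Z Y" "qfd Y B"
  proof -
    from that obtain S T where "finite S" "S \<subseteq> Z" "Z \<subseteq> set_sum Y (fs.span S)" "finite T" "T \<subseteq> Y" "Y \<subseteq> set_sum B (fs.span T)"
      unfolding qfd_def by blast
    then have "Z \<subseteq> set_sum B (fs.span (S \<union> T))"
    proof -
      { fix z assume "z \<in> Z"
        then obtain y s where 1: "y \<in> Y" "s \<in> fs.span S" "z = y + s"
          using \<open>Z \<subseteq> set_sum Y (fs.span S)\<close> by (blast elim: set_sumE)
        then obtain b t where 2: "b \<in> B" "t \<in> fs.span T" "y = b + t"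
          using \<open>Y \<subseteq> set_sum B (fs.span T)\<close> by (blast elim: set_sumE)
        have "z = b + (s + t)" using 1 2 by (simp add: algebra_simps)
        moreover have "s + t \<in> fs.span (S \<union> T)" unfolding fs.span_Un using 1 2 by blast
        ultimately have "z \<in> set_sum B (fs.span (S \<union> T))" using 2 set_sumI by metis }
      then show ?thesis by blast
    qed
    moreover have "finite (S \<union> T)" "S \<union> T \<subseteq> Z" using \<open>finite S\<close> \<open>finite T\<close> \<open>S \<subseteq> Z\<close> \<open>T \<subseteq> Y\<close> assms by auto
    ultimately show ?thesis unfolding qfd_def by blast
  qed
qed

lemma qdim_self: "fsub Z \<Longrightarrow> qdim Z Z = 0" and qfd_self: "fsub Z \<Longrightarrow> qfd Z Z"
proof -
  assume Z: "fsub Z"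
  have "Z \<subseteq> set_sum Z (fs.span {})" by (simp add: set_sum_def)
  then show "qdim Z Z = 0" "qfd Z Z" using qdim_le[of "{}" Z Z] unfolding qfd_def by force+
qed

text \<open>Serves to bound a number of clopen sets by a dimension. Independence modulo
  \<open>B\<close> makes the images under a projection along \<open>B\<close> distinct and
  independent, so the exchange lemma applies.\<close>

lemma independent_mod_le_qdim:
  fixes v :: "nat \<Rightarrow> 'x \<Rightarrow> 'k::field"
  assumes B: "fsub B" and Z: "fsub Z" "B \<subseteq> Z" and fd: "qfd Z B" and v: "\<And>i. i < n \<Longrightarrow> v i \<in> Z"
    and ind: "\<And>a. (\<Sum>i<n. fscale (a i) (v i)) \<in> B \<Longrightarrow> \<forall>i<n. a i = 0"
  shows "n \<le> qdim Z B"
proof -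
  obtain p :: "('x \<Rightarrow> 'k) \<Rightarrow> ('x \<Rightarrow> 'k)" where p: "flinear p" "\<And>x. p x = 0 \<longleftrightarrow> x \<in> B"
    using projection_exists[OF B] by metis
  have inj: "inj_on (\<lambda>i. p (v i)) {..<n}"
  proof (rule inj_onI)
    fix i j assume ij: "i \<in> {..<n}" "j \<in> {..<n}" "p (v i) = p (v j)"
    show "i = j"
    proof (rule ccontr)
      assume ne: "i \<noteq> j"
      let ?a = "\<lambda>k. if k = i then 1 else if k = j then -1 else (0::'k)"
      have "(\<Sum>k<n. fscale (?a k) (v k)) = (\<Sum>k\<in>{i,j}. fscale (?a k) (v k))"
        using ij by (intro sum.mono_neutral_right) auto
      also have "\<dots> = v i - v j" using ne by (simp add: fun_eq_iff)
      also have "\<dots> \<in> B" using ij p flinear_diff[OF p(1)] by (metis diff_self)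
      finally show False using ind[of ?a] ij ne by fastforce
    qed
  qed
  have indep: "fs.independent ((\<lambda>i. p (v i)) ` {..<n})"
  proof (rule fs.independent_if_scalars_zero)
    fix f x assume s: "(\<Sum>x\<in>(\<lambda>i. p (v i)) ` {..<n}. fscale (f x) x) = 0" and x: "x \<in> (\<lambda>i. p (v i)) ` {..<n}"
    have "p (\<Sum>i<n. fscale (f (p (v i))) (v i)) = (\<Sum>i<n. fscale (f (p (v i))) (p (v i)))"
      by (simp add: flinear_sum[OF p(1)] flinear_scale[OF p(1)])
    also have "\<dots> = 0" using s by (simp add: sum.reindex[OF inj] o_def)
    finally have "(\<Sum>i<n. fscale (f (p (v i))) (v i)) \<in> B" using p by blast
    from ind[OF this] show "f x = 0" using x by auto
  qed simp
  have pB: "p ` B = {0}" using p fs.subspace_0[OF B] by (force simp: image_iff)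
  note ZB = quotient_via_projection[OF p Z(1) B subset_refl Z(2), unfolded pB]
  from qdim_witness[of "p ` Z" "{0}"] ZB fd obtain T where
    T: "finite T" "card T = qdim Z B" "p ` Z \<subseteq> set_sum {0} (fs.span T)" by metis
  have "(\<lambda>i. p (v i)) ` {..<n} \<subseteq> fs.span T" using T v by (auto simp: set_sum_def)
  then have "card ((\<lambda>i. p (v i)) ` {..<n}) \<le> card T"
    using fs.independent_span_bound[OF T(1) indep] by blast
  then show ?thesis using T card_image[OF inj] by simp
qed

text \<open>A finite independent subset of \<open>Z / B\<close> comes from a single stage
  \<open>I j\<close>, so it has at most \<open>m\<close> elements; a basis is therefore
  finite.\<close>

lemma qfd_directed_union:
  fixes I :: "nat \<Rightarrow> ('x \<Rightarrow> 'k::field) set"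
  assumes B: "fsub B" and I: "\<And>j. I j \<subseteq> I (Suc j)" and Z: "Z = (\<Union>j. I j)" "B \<subseteq> Z" "fsub Z"
    and T: "\<And>j. \<exists>T. finite T \<and> card T \<le> m \<and> I j \<subseteq> set_sum B (fs.span T)"
  shows "qfd Z B"
proof -
  obtain p :: "('x \<Rightarrow> 'k) \<Rightarrow> ('x \<Rightarrow> 'k)" where p: "flinear p" "\<And>x. p x = 0 \<longleftrightarrow> x \<in> B"
    using projection_exists[OF B] by metis
  have mono: "mono I" using I by (simp add: mono_iff_le_Suc)
  obtain S where S: "S \<subseteq> p ` Z" "fs.independent S" "p ` Z \<subseteq> fs.span S"
    using fs.maximal_independent_subset by blast
  have bound: "card S' \<le> m" if S': "S' \<subseteq> S" "finite S'" for S'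
  proof -
    have "\<exists>j. S' \<subseteq> p ` I j" using S'(2,1)
    proof (induction S')
      case (insert x F)
      then obtain j where j: "F \<subseteq> p ` I j" by blast
      have "x \<in> p ` (\<Union>j. I j)" using insert.prems S(1) unfolding Z(1) by blast
      then obtain k where k: "x \<in> p ` I k" unfolding image_UN by (rule UN_E)
      have jk: "p ` I j \<subseteq> p ` I (max j k)" "p ` I k \<subseteq> p ` I (max j k)"
        by (auto intro!: image_mono monoD[OF mono])
      have "insert x F \<subseteq> p ` I (max j k)"
        using subset_trans[OF j jk(1)] subsetD[OF jk(2) k] by (rule insert_subsetI[rotated])
      then show ?case ..
    qed simp
    then obtain j where j: "S' \<subseteq> p ` I j" by blast
    obtain T where T: "finite T" "card T \<le> m" "I j \<subseteq> set_sum B (fs.span T)" using assms by blast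
    have "p ` I j \<subseteq> fs.span (p ` T)"
    proof
      fix y assume "y \<in> p ` I j"
      then obtain b s where "b \<in> B" "s \<in> fs.span T" "y = p (b + s)" using T by (blast elim: set_sumE)
      moreover have "p b = 0" using \<open>b \<in> B\<close> p(2) by blast
      ultimately have "y = p s" unfolding flinear_add[OF p(1)] by simp
      then show "y \<in> fs.span (p ` T)" unfolding flinear_span_image[OF p(1)] using \<open>s \<in> fs.span T\<close> by blast
    qed
    then have "card S' \<le> card (p ` T)"
      using fs.independent_span_bound[of "p ` T" S'] j T S S' fs.independent_mono[of S S'] by (meson finite_imageI order_trans)
    then show ?thesis using T card_image_le by (meson le_trans)
  qed
  have "finite S"
  proof (rule ccontr)
    assume "infinite S"
    then obtain S' where "S' \<subseteq> S" "finite S'" "card S' = Suc m" by (meson infinite_arbitrarily_large)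
    with bound[of S'] show False by simp
  qed
  moreover have "set_sum {0} (fs.span S) = fs.span S" by (auto simp: set_sum_def)
  ultimately have "qfd (p ` Z) {0}" using S unfolding qfd_def by metis
  moreover have pB: "p ` B = {0}" using p fs.subspace_0[OF B] by (force simp: image_iff)
  ultimately show ?thesis using quotient_via_projection[OF p Z(3) B subset_refl Z(2), unfolded pB] by blast
qed

text \<open>\<open>Z / B\<close> is the direct sum of the images of the \<open>n\<close> projections
  \<open>e j\<close>, and \<open>u\<close> induces an automorphism that matches each summand with
  the next by \<open>shift\<close>. The conditions \<open>total\<close> and \<open>shift\<close> are
  asked only modulo \<open>B\<close>, since they will concern cochains that agree on small
  lists.\<close>

lemma cyclic_decomposition_dvd_qdim:
  fixes Z B :: "('x \<Rightarrow> 'k::field) set" and e :: "nat \<Rightarrow> ('x \<Rightarrow> 'k) \<Rightarrow> ('x \<Rightarrow> 'k)"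
  assumes Z: "fsub Z" and B: "fsub B" "B \<subseteq> Z" and fd: "qfd Z B" and n: "n > 0"
    and e: "\<And>j. flinear (e j)" "\<And>j z. z \<in> Z \<Longrightarrow> e j z \<in> Z" "\<And>j z. z \<in> B \<Longrightarrow> e j z \<in> B"
    and idem: "\<And>j z. e j (e j z) = e j z" "\<And>i j z. i < n \<Longrightarrow> j < n \<Longrightarrow> i \<noteq> j \<Longrightarrow> e i (e j z) = 0"
    and total: "\<And>z. z \<in> Z \<Longrightarrow> z - (\<Sum>j<n. e j z) \<in> B"
    and u: "flinear u" "\<And>z. z \<in> Z \<Longrightarrow> u z \<in> Z" "\<And>z. z \<in> Z \<Longrightarrow> u z \<in> B \<longleftrightarrow> z \<in> B"
      "\<And>w. w \<in> Z \<Longrightarrow> \<exists>z\<in>Z. w - u z \<in> B"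
    and shift: "\<And>j z. j < n \<Longrightarrow> z \<in> Z \<Longrightarrow> e j (u z) - u (e (Suc j mod n) z) \<in> B"
  shows "n dvd qdim Z B"
proof -
  \<comment> \<open>Modulo \<open>B\<close>, \<open>K i\<close> is the sum of the first
    \<open>i\<close> summands, so it climbs from \<open>B\<close> to \<open>Z\<close>;
    \<open>k i\<close> is the kernel of the projection to summand \<open>i\<close>.\<close>
  define K where "K i = {z \<in> Z. z - (\<Sum>j<i. e j z) \<in> B}" for i
  define k where "k i = {z \<in> Z. e i z \<in> B}" for i
  have lin: "flinear (\<lambda>z. z - (\<Sum>j<i. e j z))" for i
    unfolding flinear_def by (simp add: flinear_add[OF e(1)] flinear_scale[OF e(1)] sum.distrib
        fs.scale_sum_right fs.scale_right_diff_distrib)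
  have subpre: "fsub {z \<in> Z. F z \<in> B}" if F: "flinear F" for F :: "('x \<Rightarrow> 'k) \<Rightarrow> ('x \<Rightarrow> 'k)"
    using Z B by (intro fsubI) (auto simp: flinear_add[OF F] flinear_scale[OF F] flinear_zero[OF F]
        intro: fs.subspace_add fs.subspace_scale fs.subspace_0)
  have Ks: "fsub (K i)" "K i \<subseteq> Z" for i unfolding K_def using subpre[OF lin] by auto
  have ks: "fsub (k i)" "k i \<subseteq> Z" for i unfolding k_def using subpre[OF e(1)] by auto
  have K0: "K 0 = B" unfolding K_def using B by auto
  have Kn: "K n = Z" unfolding K_def using total by auto
  have KB: "B \<subseteq> K i" for i
  proof
    fix z assume "z \<in> B"
    then have "z - (\<Sum>j<i. e j z) \<in> B" using e(3) B by (intro fs.subspace_diff fs.subspace_sum) auto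
    then show "z \<in> K i" unfolding K_def using \<open>z \<in> B\<close> B by blast
  qed
  have esum: "e i (\<Sum>j<m. e j z) = (if i < m then e i z else 0)" if "i < n" "m \<le> n" for i m z
  proof -
    have "e i (\<Sum>j<m. e j z) = (\<Sum>j<m. if j = i then e i z else 0)"
      unfolding flinear_sum[OF e(1)] using that idem by (intro sum.cong) auto
    then show ?thesis by simp
  qed
  have KS: "K i \<subseteq> K (Suc i)" if i: "i < n" for i
  proof
    fix z assume z: "z \<in> K i"
    then have "e i (z - (\<Sum>j<i. e j z)) \<in> B" unfolding K_def using e(3) by blast
    then have "e i z \<in> B" using esum[of i i z] i by (simp add: flinear_diff[OF e(1)])
    then have "(z - (\<Sum>j<i. e j z)) - e i z \<in> B" using z B unfolding K_def by (blast intro: fs.subspace_diff)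
    then show "z \<in> K (Suc i)" using z unfolding K_def by (simp add: algebra_simps)
  qed
  \<comment> \<open>\<open>e i\<close> induces an isomorphism from \<open>Z / k i\<close> to
    \<open>K (Suc i) / K i\<close>.\<close>
  have step: "qdim Z (k i) = qdim (K (Suc i)) (K i)" if i: "i < n" for i
  proof (rule conjunct2[OF quotient_iso[OF e(1)[of i] Z ks(1) Ks(1)]])
    have ee: "(\<Sum>j<m. e j (e i z)) = (if i < m then e i z else 0)" if "m \<le> n" for m z
    proof -
      have "(\<Sum>j<m. e j (e i z)) = (\<Sum>j<m. if j = i then e i z else 0)"
        using that i idem by (intro sum.cong) auto
      then show ?thesis by simp
    qed
    show "e i z \<in> K (Suc i)" if "z \<in> Z" for z
    proof -
      have "e i z - (\<Sum>j<Suc i. e j (e i z)) = 0" using ee[of "Suc i"] i by simp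
      then show ?thesis unfolding K_def using e(2)[OF that] fs.subspace_0[OF B(1)] by simp
    qed
    show "\<exists>z\<in>Z. w - e i z \<in> K i" if w: "w \<in> K (Suc i)" for w
    proof
      show "w \<in> Z" using w Ks by blast
      have "(w - e i w) - (\<Sum>j<i. e j (w - e i w)) = w - (\<Sum>j<Suc i. e j w)"
        using ee[of i w] i by (simp add: flinear_diff[OF e(1)] sum_subtractf)
      then have "(w - e i w) - (\<Sum>j<i. e j (w - e i w)) \<in> B" using w unfolding K_def by (simp only: mem_Collect_eq)
      then show "w - e i w \<in> K i" using fs.subspace_diff[OF Z \<open>w \<in> Z\<close> e(2)[OF \<open>w \<in> Z\<close>]] unfolding K_def by blast
    qed
    show "e i z \<in> K i \<longleftrightarrow> z \<in> k i" if "z \<in> Z" for z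
      using that e(2) ee[of i z] i unfolding K_def k_def by simp
  qed
  \<comment> \<open>By \<open>shift\<close>, component \<open>i\<close> of \<open>u z\<close> is
    trivial exactly if component \<open>Suc i mod n\<close> of \<open>z\<close> is, so
    \<open>u\<close> identifies the two quotients.\<close>
  have kk: "qdim Z (k (Suc i mod n)) = qdim Z (k i)" if i: "i < n" for i
  proof (rule conjunct2[OF quotient_iso[OF u(1) Z ks(1) ks(1) u(2)]])
    show "\<exists>z\<in>Z. w - u z \<in> k i" if w: "w \<in> Z" for w
    proof -
      obtain z where "z \<in> Z" "w - u z \<in> B" using u(4)[OF w] by blast
      then show ?thesis unfolding k_def using that B e(3) by blast
    qed
    show "u z \<in> k i \<longleftrightarrow> z \<in> k (Suc i mod n)" if z: "z \<in> Z" for z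
    proof -
      have "e i (u z) \<in> B \<longleftrightarrow> u (e (Suc i mod n) z) \<in> B"
        using shift[OF i z] B(1) by (metis diff_add_cancel fs.subspace_add fs.subspace_diff add_diff_cancel_left')
      then show ?thesis unfolding k_def using z u e(2) by auto
    qed
  qed
  have const: "qdim Z (k i) = qdim Z (k 0)" if "i < n" for i using that
    by (induction i) (metis kk Suc_lessD mod_less)+
  have "i \<le> n \<Longrightarrow> qdim (K i) B = i * qdim Z (k 0)" for i
  proof (induction i)
    case 0 show ?case using qdim_self[OF B(1)] by (simp add: K0)
  next
    case (Suc i)
    have "qfd (K (Suc i)) B" using quotient_add(1)[OF B(1) Ks(1) Z KB Ks(2) fd] by blast
    then have "qdim (K (Suc i)) B = qdim (K (Suc i)) (K i) + qdim (K i) B"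
      using quotient_add(1)[OF B(1) Ks(1) Ks(1) KB KS] Suc by auto
    then show ?case using Suc step[of i] const[of i] by simp
  qed
  then show ?thesis using Kn by (metis dvd_triv_left order_refl)
qed

section \<open>Cochains on lists\<close>

text \<open>Recursion on the head turns the identities for the alternating sum into plain
  inductions; \<open>lcob_sum\<close> is the usual formula. On a one-point list the value is
  \<open>c []\<close>, which is why \<open>cochain\<close> later excludes the empty list.\<close>

fun lcob :: "('x list \<Rightarrow> 'k::field) \<Rightarrow> 'x list \<Rightarrow> 'k" where
  "lcob c [] = 0"
| "lcob c (x # \<sigma>) = c \<sigma> - lcob (\<lambda>\<tau>. c (x # \<tau>)) \<sigma>"

lemma lcob_add: "lcob (\<lambda>\<tau>. a \<tau> + b \<tau>) \<sigma> = lcob a \<sigma> + lcob b \<sigma>"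
  by (induction \<sigma> arbitrary: a b) auto

lemma lcob_scale: "lcob (\<lambda>\<tau>. r * a \<tau>) \<sigma> = r * lcob a \<sigma>"
  by (induction \<sigma> arbitrary: a) (auto simp: algebra_simps)

lemma lcob_zero_fun: "lcob (\<lambda>\<tau>. 0) \<sigma> = 0"
  by (induction \<sigma>) auto

lemma lcob_diff: "lcob (\<lambda>\<tau>. a \<tau> - b \<tau>) \<sigma> = lcob a \<sigma> - lcob b \<sigma>"
  by (induction \<sigma> arbitrary: a b) auto

lemma flinear_lcob: "flinear lcob"
  unfolding flinear_def plus_fun_def fscale_def fun_eq_iff by (simp add: lcob_add lcob_scale)

lemma lcob_lcob: "lcob (lcob c) \<sigma> = 0"
proof (induction \<sigma> arbitrary: c)
  case (Cons x \<sigma>)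
  then show ?case by (simp add: lcob_diff)
qed simp

lemma lcob_lcob_fun: "lcob (lcob c) = 0"
  by (simp add: fun_eq_iff lcob_lcob)

lemma lcob_map: "lcob (\<lambda>\<tau>. c (map f \<tau>)) \<sigma> = lcob c (map f \<sigma>)"
proof (induction \<sigma> arbitrary: c)
  case (Cons x \<sigma>)
  show ?case using Cons.IH[of "\<lambda>\<tau>. c (f x # \<tau>)"] by simp
qed simp

lemma lcob_cong:
  "(\<And>\<tau>. set \<tau> \<subseteq> set \<sigma> \<Longrightarrow> length \<sigma> = Suc (length \<tau>) \<Longrightarrow> a \<tau> = b \<tau>) \<Longrightarrow> lcob a \<sigma> = lcob b \<sigma>"
proof (induction \<sigma> arbitrary: a b)
  case (Cons x \<sigma>)
  have "a \<sigma> = b \<sigma>" using Cons.prems by auto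
  moreover have "lcob (\<lambda>\<tau>. a (x # \<tau>)) \<sigma> = lcob (\<lambda>\<tau>. b (x # \<tau>)) \<sigma>"
    using Cons.prems by (intro Cons.IH) (auto simp: subset_iff)
  ultimately show ?case by simp
qed simp

lemma lcob_length: "(\<And>\<tau>. c \<tau> \<noteq> 0 \<Longrightarrow> length \<tau> = l) \<Longrightarrow> lcob c \<sigma> \<noteq> 0 \<Longrightarrow> length \<sigma> = Suc l"
proof (rule ccontr)
  assume c: "\<And>\<tau>. c \<tau> \<noteq> 0 \<Longrightarrow> length \<tau> = l" and s: "lcob c \<sigma> \<noteq> 0" "length \<sigma> \<noteq> Suc l"
  have "lcob c \<sigma> = lcob (\<lambda>_. 0) \<sigma>"
  proof (rule lcob_cong)
    fix \<tau> :: "'a list" assume "length \<sigma> = Suc (length \<tau>)"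
    then show "c \<tau> = 0" using c[of \<tau>] s(2) by auto
  qed
  then show False using s(1) by (simp add: lcob_zero_fun)
qed

lemma lcob_sum:
  "lcob c \<sigma> = (\<Sum>i<length \<sigma>. (-1) ^ i * c (take i \<sigma> @ drop (Suc i) \<sigma>))"
proof (induction \<sigma> arbitrary: c)
  case (Cons x \<sigma>)
  have "(\<Sum>i<length (x # \<sigma>). (-1) ^ i * c (take i (x # \<sigma>) @ drop (Suc i) (x # \<sigma>)))
    = c \<sigma> + (\<Sum>i<length \<sigma>. (-1) ^ Suc i * c (x # (take i \<sigma> @ drop (Suc i) \<sigma>)))"
    unfolding list.size(4) add_Suc_right add_0_right sum.lessThan_Suc_shift by simp
  also have "\<dots> = c \<sigma> - lcob (\<lambda>\<tau>. c (x # \<tau>)) \<sigma>"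
    by (simp add: Cons.IH sum_negf)
  finally show ?case by simp
qed simp

text \<open>The prism operator: an alternating sum of \<open>c\<close> over the lists that follow
  \<open>f\<close> up to some point and \<open>g\<close> from that same point on. The point maps are
  arbitrary; \<open>lprism_homotopy\<close> makes it a chain homotopy between the pullbacks along
  them.\<close>

fun lprism :: "('y \<Rightarrow> 'x) \<Rightarrow> ('y \<Rightarrow> 'x) \<Rightarrow> ('x list \<Rightarrow> 'k::field) \<Rightarrow> 'y list \<Rightarrow> 'k" where
  "lprism f g c [] = 0"
| "lprism f g c (x # \<sigma>) = c (f x # g x # map g \<sigma>) - lprism f g (\<lambda>\<tau>. c (f x # \<tau>)) \<sigma>"

lemma lprism_diff: "lprism f g (\<lambda>\<tau>. a \<tau> - b \<tau>) \<sigma> = lprism f g a \<sigma> - lprism f g b \<sigma>"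
  by (induction \<sigma> arbitrary: a b) auto

lemma lprism_homotopy:
  "lcob (lprism f g c) \<sigma> + lprism f g (lcob c) \<sigma> = c (map g \<sigma>) - c (map f \<sigma>)"
proof (induction \<sigma> arbitrary: c)
  case (Cons x \<sigma>)
  let ?c = "\<lambda>\<tau>. c (f x # \<tau>)"
  have 1: "lcob (lprism f g c) (x # \<sigma>) = lprism f g c \<sigma>
      - lcob (\<lambda>\<tau>. c (f x # g x # \<tau>)) (map g \<sigma>) + lcob (lprism f g ?c) \<sigma>"
    by (simp add: lcob_diff lcob_map[of "\<lambda>\<tau>. c (f x # g x # \<tau>)"])
  have 2: "lprism f g (lcob c) (x # \<sigma>) = c (g x # map g \<sigma>) - c (f x # map g \<sigma>)
      + lcob (\<lambda>\<tau>. c (f x # g x # \<tau>)) (map g \<sigma>) - lprism f g c \<sigma> + lprism f g (lcob ?c) \<sigma>"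
    by (simp add: lprism_diff)
  show ?case using 1 2 Cons.IH[of ?c] by (simp add: algebra_simps)
qed simp

lemma lprism_zero:
  "(\<And>\<tau>. set \<tau> \<subseteq> f ` set \<sigma> \<union> g ` set \<sigma> \<Longrightarrow> length \<tau> = Suc (length \<sigma>) \<Longrightarrow> c \<tau> = 0) \<Longrightarrow> lprism f g c \<sigma> = 0"
proof (induction \<sigma> arbitrary: c)
  case (Cons x \<sigma>)
  have "lprism f g (\<lambda>\<tau>. c (f x # \<tau>)) \<sigma> = 0"
  proof (rule Cons.IH)
    fix \<tau> assume "set \<tau> \<subseteq> f ` set \<sigma> \<union> g ` set \<sigma>" "length \<tau> = Suc (length \<sigma>)"
    then show "c (f x # \<tau>) = 0" by (intro Cons.prems) auto
  qed
  then show ?case using Cons.prems[of "f x # g x # map g \<sigma>"] by auto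
qed simp

section \<open>Cohomology of pairs of complexes of list cochains\<close>

type_synonym ('x, 'k) complex = "nat \<Rightarrow> ('x list \<Rightarrow> 'k) set"

text \<open>The index counts the points of a list, so degree \<open>q\<close> sits at
  \<open>Suc q\<close> and index 0 must be trivial.\<close>

definition stable :: "('x, 'k::field) complex \<Rightarrow> bool" where
  "stable S \<longleftrightarrow> (\<forall>l. fsub (S l) \<and> lcob ` S l \<subseteq> S (Suc l)) \<and> S 0 \<subseteq> {0}"

definition zcyc :: "('x, 'k::field) complex \<Rightarrow> ('x, 'k) complex \<Rightarrow> ('x, 'k) complex" where
  "zcyc T S l = {c \<in> T l. lcob c \<in> S (Suc l)}"

text \<open>\<open>zcyc\<close> and \<open>bcob\<close> are the cocycles and coboundaries of the
  quotient complex \<open>T / S\<close>, pulled back to \<open>T\<close>. At \<open>l = 0\<close>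
  the truncated \<open>l - 1\<close> is harmless, because \<open>T 0\<close> is zero for a stable
  \<open>T\<close>.\<close>

definition bcob :: "('x, 'k::field) complex \<Rightarrow> ('x, 'k) complex \<Rightarrow> ('x, 'k) complex" where
  "bcob T S l = set_sum (lcob ` T (l - 1)) (S l)"

abbreviation hfd :: "('x, 'k::field) complex \<Rightarrow> ('x, 'k) complex \<Rightarrow> nat \<Rightarrow> bool" where
  "hfd T S l \<equiv> qfd (zcyc T S l) (bcob T S l)"

abbreviation hdim :: "('x, 'k::field) complex \<Rightarrow> ('x, 'k) complex \<Rightarrow> nat \<Rightarrow> nat" where
  "hdim T S l \<equiv> qdim (zcyc T S l) (bcob T S l)"

lemma stableD:
  assumes "stable S"
  shows "fsub (S l)" "c \<in> S l \<Longrightarrow> lcob c \<in> S (Suc l)" "S 0 = {0}" "0 \<in> S l"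
  using assms fs.subspace_0 unfolding stable_def by blast+

lemma fsub_zcyc: "stable T \<Longrightarrow> stable S \<Longrightarrow> fsub (zcyc T S l)"
  unfolding zcyc_def
  by (intro fsubI) (auto simp: flinear_add[OF flinear_lcob] flinear_scale[OF flinear_lcob]
      flinear_zero[OF flinear_lcob] intro: fs.subspace_add fs.subspace_scale fs.subspace_0 stableD)

lemma fsub_bcob: "stable T \<Longrightarrow> stable S \<Longrightarrow> fsub (bcob T S l)"
  unfolding bcob_def by (intro fsub_set_sum fsub_image flinear_lcob stableD)

lemma bcobI: "stable T \<Longrightarrow> b \<in> T (l - 1) \<Longrightarrow> s \<in> S l \<Longrightarrow> lcob b + s \<in> bcob T S l"
  unfolding bcob_def by (rule set_sumI) auto

lemma bcobE: "c \<in> bcob T S l \<Longrightarrow> (\<And>b s. b \<in> T (l - 1) \<Longrightarrow> s \<in> S l \<Longrightarrow> c = lcob b + s \<Longrightarrow> P) \<Longrightarrow> P"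
  unfolding bcob_def by (auto elim: set_sumE)

lemma lcob_zero [simp]: "lcob 0 = 0" by (rule flinear_zero[OF flinear_lcob])

lemma lcob_plus: "lcob (a + b) = lcob a + lcob b" by (rule flinear_add[OF flinear_lcob])

lemma lcob_minus: "lcob (a - b) = lcob a - lcob b" by (rule flinear_diff[OF flinear_lcob])

lemma small_bcob: "stable T \<Longrightarrow> S l \<subseteq> bcob T S l"
  unfolding bcob_def by (rule set_sum_right) (intro fsub_image flinear_lcob stableD)

lemma lcob_in_bcob: "stable T \<Longrightarrow> stable S \<Longrightarrow> b \<in> T (l - 1) \<Longrightarrow> lcob b \<in> bcob T S l"
  using bcobI[of T b l 0 S] stableD(4)[of S l] by simp

lemma bcob_zcyc:
  assumes "stable T" "stable S" "\<And>l. S l \<subseteq> T l"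
  shows "bcob T S l \<subseteq> zcyc T S l"
proof
  fix c assume "c \<in> bcob T S l"
  then obtain b s where bs: "b \<in> T (l - 1)" "s \<in> S l" "c = lcob b + s" by (rule bcobE)
  have "lcob b \<in> T l"
    using bs(1) stableD[OF assms(1)] by (cases l) auto
  then have "c \<in> T l" using bs assms(3) stableD(1)[OF assms(1)] by (auto intro: fs.subspace_add)
  moreover have "lcob c = lcob s" using bs by (simp add: lcob_plus lcob_lcob_fun)
  ultimately show "c \<in> zcyc T S l" unfolding zcyc_def using bs stableD[OF assms(2)] by simp
qed

section \<open>The long exact sequence of a triple of complexes\<close>

definition connecting_rank ::
    "('x, 'k::field) complex \<Rightarrow> ('x, 'k) complex \<Rightarrow> ('x, 'k) complex \<Rightarrow> nat \<Rightarrow> nat" where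
  "connecting_rank T S R l = qdim (zcyc T S l) (set_sum (zcyc T R l) (bcob T S l))"

context
  fixes T S R :: "('x, 'k::field) complex"
  assumes T: "stable T" and S: "stable S" and R: "stable R"
    and ST: "\<And>l. S l \<subseteq> T l" and RS: "\<And>l. R l \<subseteq> S l"
begin

lemma RT: "R l \<subseteq> T l" using ST RS by blast

lemma zcyc_TR_TS: "set_sum (zcyc T R l) (bcob T S l) \<subseteq> zcyc T S l"
  using RS ST bcob_zcyc[OF T S ST] by (intro set_sum_least fsub_zcyc T S) (auto simp: zcyc_def)

text \<open>The coboundary is the connecting map from the cohomology of \<open>T / S\<close> to that
  of \<open>S / R\<close>. Its kernel is the image of the cohomology of \<open>T / R\<close>, so
  \<open>connecting_rank\<close> is indeed its rank; its image consists of the classes of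
  \<open>S / R\<close> that die in \<open>T / R\<close>.\<close>

lemma connecting_image:
  "qfd (zcyc T S l) (set_sum (zcyc T R l) (bcob T S l)) =
      qfd (zcyc S R (Suc l) \<inter> bcob T R (Suc l)) (bcob S R (Suc l)) \<and>
   connecting_rank T S R l = qdim (zcyc S R (Suc l) \<inter> bcob T R (Suc l)) (bcob S R (Suc l))"
  unfolding connecting_rank_def
proof (rule quotient_iso[OF flinear_lcob])
  show "fsub (zcyc T S l)" by (rule fsub_zcyc[OF T S])
  show "fsub (set_sum (zcyc T R l) (bcob T S l))" by (intro fsub_set_sum fsub_zcyc fsub_bcob T S R)
  show "fsub (bcob S R (Suc l))" by (rule fsub_bcob[OF S R])
  fix z assume z: "z \<in> zcyc T S l"
  show "lcob z \<in> zcyc S R (Suc l) \<inter> bcob T R (Suc l)"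
    using z lcob_in_bcob[OF T R, of z "Suc l"] stableD(4)[OF R] unfolding zcyc_def by (simp add: lcob_lcob_fun)
  show "lcob z \<in> bcob S R (Suc l) \<longleftrightarrow> z \<in> set_sum (zcyc T R l) (bcob T S l)"
  proof
    assume "lcob z \<in> bcob S R (Suc l)"
    then obtain s r where sr: "s \<in> S l" "r \<in> R (Suc l)" "lcob z = lcob s + r" by (rule bcobE) simp
    have "z - s \<in> zcyc T R l" using z sr ST stableD(1)[OF T] unfolding zcyc_def
      by (auto simp: lcob_minus intro!: fs.subspace_diff)
    then have "(z - s) + s \<in> set_sum (zcyc T R l) (bcob T S l)"
      using sr small_bcob[OF T, of S l] by (intro set_sumI) auto
    then show "z \<in> set_sum (zcyc T R l) (bcob T S l)" by simp
  next
    assume "z \<in> set_sum (zcyc T R l) (bcob T S l)"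
    then obtain y b s where y: "y \<in> zcyc T R l" "s \<in> S l" "z = y + (lcob b + s)"
      by (blast elim: set_sumE bcobE)
    have "lcob z = lcob s + lcob y" using y by (simp add: lcob_plus lcob_lcob_fun add.commute)
    moreover have "lcob y \<in> R (Suc l)" using y by (simp add: zcyc_def)
    ultimately show "lcob z \<in> bcob S R (Suc l)" using bcobI[OF S, of s "Suc l"] y(2) by simp
  qed
next
  fix w assume "w \<in> zcyc S R (Suc l) \<inter> bcob T R (Suc l)"
  then obtain b r where b: "b \<in> T l" "r \<in> R (Suc l)" "w = lcob b + r" "w \<in> S (Suc l)"
    by (auto simp: zcyc_def elim!: bcobE)
  have "lcob b = w - r" using b by simp
  then have "lcob b \<in> S (Suc l)"
    using fs.subspace_diff[OF stableD(1)[OF S] b(4) subsetD[OF RS b(2)]] by simp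
  then have "b \<in> zcyc T S l" using b by (simp add: zcyc_def)
  moreover have "w - lcob b \<in> bcob S R (Suc l)" using b small_bcob[OF S, of R "Suc l"] by auto
  ultimately show "\<exists>z\<in>zcyc T S l. w - lcob z \<in> bcob S R (Suc l)" by blast
qed

lemma connecting_rank_0: "connecting_rank T S R 0 = 0"
proof -
  have "zcyc T S 0 = {0}" using stableD[OF T] stableD(4)[OF S] by (auto simp: zcyc_def)
  moreover have "set_sum (zcyc T R 0) (bcob T S 0) = {0}"
    using zcyc_TR_TS[of 0] calculation fs.subspace_0[OF fsub_set_sum[OF fsub_zcyc[OF T R] fsub_bcob[OF T S]], of 0 0] by blast
  ultimately show ?thesis unfolding connecting_rank_def by (simp add: qdim_self fsub_zero)
qed

text \<open>The cohomology of \<open>S / R\<close> modulo the classes that die in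
  \<open>T / R\<close> is its image there.\<close>

lemma inner_quotient:
  "qfd (zcyc S R l) (zcyc S R l \<inter> bcob T R l) = qfd (set_sum (bcob T R l) (zcyc S R l)) (bcob T R l) \<and>
   qdim (zcyc S R l) (zcyc S R l \<inter> bcob T R l) = qdim (set_sum (bcob T R l) (zcyc S R l)) (bcob T R l)"
proof (rule quotient_iso[OF flinear_id])
  show "fsub (zcyc S R l)" by (rule fsub_zcyc[OF S R])
  show "fsub (bcob T R l)" by (rule fsub_bcob[OF T R])
  show "fsub (zcyc S R l \<inter> bcob T R l)" by (intro fs.subspace_inter fsub_zcyc fsub_bcob T S R)
  show "z \<in> set_sum (bcob T R l) (zcyc S R l)" if "z \<in> zcyc S R l" for z
    using that set_sum_right[OF fsub_bcob[OF T R]] by blast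
  show "\<exists>z\<in>zcyc S R l. w - z \<in> bcob T R l" if "w \<in> set_sum (bcob T R l) (zcyc S R l)" for w
    using that by (rule set_sumE) (metis add_diff_cancel_right')
qed auto

lemma bcob_SR_TR: "bcob S R l \<subseteq> zcyc S R l \<inter> bcob T R l"
proof -
  have "bcob S R l \<subseteq> bcob T R l" unfolding bcob_def set_sum_def using ST by blast
  then show ?thesis using bcob_zcyc[OF S R RS] by blast
qed

text \<open>Exactness at \<open>T / R\<close>: modulo the image of the cohomology of
  \<open>S / R\<close>, it embeds in the cohomology of \<open>T / S\<close>.\<close>

lemma outer_quotient:
  "qfd (zcyc T R l) (set_sum (bcob T R l) (zcyc S R l)) = qfd (set_sum (zcyc T R l) (bcob T S l)) (bcob T S l) \<and>
   qdim (zcyc T R l) (set_sum (bcob T R l) (zcyc S R l)) = qdim (set_sum (zcyc T R l) (bcob T S l)) (bcob T S l)"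
proof (rule quotient_iso[OF flinear_id])
  show "fsub (zcyc T R l)" by (rule fsub_zcyc[OF T R])
  show "fsub (bcob T S l)" by (rule fsub_bcob[OF T S])
  show "fsub (set_sum (bcob T R l) (zcyc S R l))" by (intro fsub_set_sum fsub_zcyc fsub_bcob T S R)
  show "z \<in> set_sum (zcyc T R l) (bcob T S l)" if "z \<in> zcyc T R l" for z
    using that set_sum_left[OF fsub_bcob[OF T S]] by blast
  show "\<exists>z\<in>zcyc T R l. w - z \<in> bcob T S l" if "w \<in> set_sum (zcyc T R l) (bcob T S l)" for w
    using that by (rule set_sumE) (metis add_diff_cancel_left')
  show "z \<in> bcob T S l \<longleftrightarrow> z \<in> set_sum (bcob T R l) (zcyc S R l)" if z: "z \<in> zcyc T R l" for z
  proof
    assume "z \<in> bcob T S l"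
    then obtain b s where b: "b \<in> T (l - 1)" "s \<in> S l" "z = lcob b + s" by (rule bcobE)
    have "lcob s \<in> R (Suc l)" using z b by (simp add: zcyc_def lcob_plus lcob_lcob_fun)
    then have "s \<in> zcyc S R l" using b by (simp add: zcyc_def)
    then show "z \<in> set_sum (bcob T R l) (zcyc S R l)" using b lcob_in_bcob[OF T R b(1)] set_sumI by metis
  next
    have "bcob T R l \<subseteq> bcob T S l" unfolding bcob_def set_sum_def using RS by blast
    moreover have "zcyc S R l \<subseteq> bcob T S l" using small_bcob[OF T, of S l] by (auto simp: zcyc_def)
    moreover assume "z \<in> set_sum (bcob T R l) (zcyc S R l)"
    ultimately show "z \<in> bcob T S l" using set_sum_least[OF fsub_bcob[OF T S]] by blast
  qed
qed

lemma sub_TR: "set_sum (bcob T R l) (zcyc S R l) \<subseteq> zcyc T R l"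
  using ST bcob_zcyc[OF T R RT] by (intro set_sum_least fsub_zcyc T R) (auto simp: zcyc_def)

lemma mid_TS: "fsub (set_sum (zcyc T R l) (bcob T S l))" "bcob T S l \<subseteq> set_sum (zcyc T R l) (bcob T S l)"
  by (rule fsub_set_sum[OF fsub_zcyc[OF T R] fsub_bcob[OF T S]], rule set_sum_right[OF fsub_zcyc[OF T R]])

lemma mid_TR: "fsub (set_sum (bcob T R l) (zcyc S R l))" "bcob T R l \<subseteq> set_sum (bcob T R l) (zcyc S R l)"
  by (rule fsub_set_sum[OF fsub_bcob[OF T R] fsub_zcyc[OF S R]], rule set_sum_left[OF fsub_zcyc[OF S R]])

text \<open>Modulo the image of the connecting map, the cohomology of \<open>S / R\<close> embeds in
  that of \<open>T / R\<close>, and the connecting map has a finite-dimensional source.\<close>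

lemma long_exact_sequence_fd:
  assumes "hfd T R (Suc l)" "hfd T S l"
  shows "hfd S R (Suc l)"
proof (rule quotient_add(2)[OF fsub_bcob[OF S R] _ fsub_zcyc[OF S R] bcob_SR_TR Int_lower1])
  show "fsub (zcyc S R (Suc l) \<inter> bcob T R (Suc l))" by (intro fs.subspace_inter fsub_zcyc fsub_bcob T S R)
  have "qfd (zcyc T S l) (set_sum (zcyc T R l) (bcob T S l))"
    using quotient_add(1)[OF fsub_bcob[OF T S] _ fsub_zcyc[OF T S] _ zcyc_TR_TS assms(2)]
      mid_TS by simp
  then show "qfd (zcyc S R (Suc l) \<inter> bcob T R (Suc l)) (bcob S R (Suc l))" using connecting_image by blast
  have "qfd (set_sum (bcob T R (Suc l)) (zcyc S R (Suc l))) (bcob T R (Suc l))"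
    using quotient_add(1)[OF fsub_bcob[OF T R] _ fsub_zcyc[OF T R] _ sub_TR assms(1)]
      mid_TR by simp
  then show "qfd (zcyc S R (Suc l)) (zcyc S R (Suc l) \<inter> bcob T R (Suc l))" using inner_quotient by blast
qed

text \<open>Exactness cuts each of the three groups at index \<open>Suc l\<close> into two pieces.
  The pieces match in pairs except for the ranks of the two connecting maps at the ends, and these
  telescope in an alternating sum.\<close>

lemma long_exact_sequence_dim:
  assumes fd: "hfd T R (Suc l)" "hfd T S l" "hfd T S (Suc l)"
  shows "hdim T R (Suc l) + connecting_rank T S R l + connecting_rank T S R (Suc l)
    = hdim S R (Suc l) + hdim T S (Suc l)"
proof -
  have 1: "hdim S R (Suc l) = qdim (zcyc S R (Suc l)) (zcyc S R (Suc l) \<inter> bcob T R (Suc l)) + connecting_rank T S R l"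
    using quotient_add(1)[OF fsub_bcob[OF S R] _ fsub_zcyc[OF S R] bcob_SR_TR Int_lower1 long_exact_sequence_fd[OF fd(1,2)]]
      fs.subspace_inter[OF fsub_zcyc[OF S R] fsub_bcob[OF T R]] connecting_image by auto
  have 2: "hdim T R (Suc l) = qdim (zcyc T R (Suc l)) (set_sum (bcob T R (Suc l)) (zcyc S R (Suc l)))
      + qdim (set_sum (bcob T R (Suc l)) (zcyc S R (Suc l))) (bcob T R (Suc l))"
    using quotient_add(1)[OF fsub_bcob[OF T R] _ fsub_zcyc[OF T R] _ sub_TR fd(1)]
      mid_TR by simp
  have 3: "hdim T S (Suc l) = connecting_rank T S R (Suc l)
      + qdim (set_sum (zcyc T R (Suc l)) (bcob T S (Suc l))) (bcob T S (Suc l))"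
    unfolding connecting_rank_def
    using quotient_add(1)[OF fsub_bcob[OF T S] _ fsub_zcyc[OF T S] _ zcyc_TR_TS fd(3)]
      mid_TS by simp
  show ?thesis using 1 2 3 inner_quotient[of "Suc l"] outer_quotient[of "Suc l"] by linarith
qed

lemma connecting_rank_le: "hfd T S l \<Longrightarrow> connecting_rank T S R l \<le> hdim T S l"
  unfolding connecting_rank_def
  using quotient_add(1)[OF fsub_bcob[OF T S] _ fsub_zcyc[OF T S] _ zcyc_TR_TS]
      mid_TS by simp

end

section \<open>Pullback along maps of points\<close>

definition pb :: "('y \<Rightarrow> 'x) \<Rightarrow> ('x list \<Rightarrow> 'k::field) \<Rightarrow> 'y list \<Rightarrow> 'k" where
  "pb f c = (\<lambda>\<sigma>. c (map f \<sigma>))"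

lemma pb_apply [simp]: "pb f c \<sigma> = c (map f \<sigma>)" by (simp add: pb_def)

lemma flinear_pb: "flinear (pb f)"
  unfolding flinear_def by (auto simp: fun_eq_iff)

lemma lcob_pb: "lcob (pb f c) = pb f (lcob c)"
  by (simp add: fun_eq_iff pb_def lcob_map)

lemma pb_comp: "pb f (pb g c) = pb (\<lambda>x. g (f x)) c"
  by (simp add: fun_eq_iff comp_def)

lemma pb_zcyc:
  assumes "\<And>l c. c \<in> T l \<Longrightarrow> pb f c \<in> T' l" "\<And>l c. c \<in> R l \<Longrightarrow> pb f c \<in> R' l" "c \<in> zcyc T R l"
  shows "pb f c \<in> zcyc T' R' l"
  using assms by (auto simp: zcyc_def lcob_pb)

lemma pb_bcob:
  assumes "\<And>l c. c \<in> T l \<Longrightarrow> pb f c \<in> T' l" "\<And>l c. c \<in> R l \<Longrightarrow> pb f c \<in> R' l" "c \<in> bcob T R l" "stable T'"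
  shows "pb f c \<in> bcob T' R' l"
proof -
  obtain b r where "b \<in> T (l - 1)" "r \<in> R l" "c = lcob b + r" using assms(3) by (rule bcobE)
  then have "pb f c = lcob (pb f b) + pb f r" by (simp add: lcob_pb flinear_add[OF flinear_pb])
  then show ?thesis using bcobI[of T' "pb f b" l "pb f r" R'] assms \<open>b \<in> _\<close> \<open>r \<in> _\<close> by simp
qed

definition vanish :: "('x list \<Rightarrow> 'k::field) \<Rightarrow> 'x set \<Rightarrow> bool" where
  "vanish c Q \<longleftrightarrow> (\<forall>\<sigma>. set \<sigma> \<subseteq> Q \<longrightarrow> c \<sigma> = 0)"

lemma vanishD: "vanish c Q \<Longrightarrow> set \<sigma> \<subseteq> Q \<Longrightarrow> c \<sigma> = 0"
  by (simp add: vanish_def)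

lemma vanish_mono: "vanish c Q \<Longrightarrow> P \<subseteq> Q \<Longrightarrow> vanish c P"
  by (auto simp: vanish_def)

lemma vanish_add: "vanish a Q \<Longrightarrow> vanish b Q \<Longrightarrow> vanish (a + b) Q"
  by (simp add: vanish_def)

lemma vanish_scale: "vanish a Q \<Longrightarrow> vanish (fscale r a) Q"
  by (simp add: vanish_def)

lemma vanish_lcob: "vanish c Q \<Longrightarrow> vanish (lcob c) Q"
  unfolding vanish_def
proof (intro allI impI)
  fix \<sigma> assume c: "\<forall>\<sigma>. set \<sigma> \<subseteq> Q \<longrightarrow> c \<sigma> = 0" "set \<sigma> \<subseteq> Q"
  have "lcob c \<sigma> = lcob (\<lambda>_. 0) \<sigma>"
    by (rule lcob_cong) (use c in auto)
  then show "lcob c \<sigma> = 0" by (simp add: lcob_zero_fun)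
qed

lemma vanish_pb: "vanish c Q \<Longrightarrow> f ` P \<subseteq> Q \<Longrightarrow> vanish (pb f c) P"
proof (unfold vanish_def, intro allI impI)
  fix \<sigma> assume "\<forall>\<sigma>. set \<sigma> \<subseteq> Q \<longrightarrow> c \<sigma> = 0" "f ` P \<subseteq> Q" "set \<sigma> \<subseteq> P"
  moreover from this have "set (map f \<sigma>) \<subseteq> Q" by auto
  ultimately show "pb f c \<sigma> = 0" unfolding pb_apply by blast
qed

lemma vanish_lprism: "vanish c Q \<Longrightarrow> f ` P \<subseteq> Q \<Longrightarrow> g ` P \<subseteq> Q \<Longrightarrow> vanish (lprism f g c) P"
proof (unfold vanish_def, intro allI impI lprism_zero)
  fix \<sigma> \<tau> assume "\<forall>\<sigma>. set \<sigma> \<subseteq> Q \<longrightarrow> c \<sigma> = 0" "f ` P \<subseteq> Q" "g ` P \<subseteq> Q" "set \<sigma> \<subseteq> P"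
    "set \<tau> \<subseteq> f ` set \<sigma> \<union> g ` set \<sigma>"
  have "f ` set \<sigma> \<subseteq> Q" "g ` set \<sigma> \<subseteq> Q"
    using subset_trans[OF image_mono[OF \<open>set \<sigma> \<subseteq> P\<close>]] \<open>f ` P \<subseteq> Q\<close> \<open>g ` P \<subseteq> Q\<close> by auto
  then have "set \<tau> \<subseteq> Q" using \<open>set \<tau> \<subseteq> f ` set \<sigma> \<union> g ` set \<sigma>\<close> by (meson Un_subset_iff subset_trans)
  then show "c \<tau> = 0" using \<open>\<forall>\<sigma>. set \<sigma> \<subseteq> Q \<longrightarrow> c \<sigma> = 0\<close> by simp
qed

text \<open>Excluding \<open>[]\<close> only affects index 0, which becomes trivial; the complex is
  thus not augmented.\<close>

definition cochain :: "('x, 'k::field) complex" where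
  "cochain l = {c. \<forall>\<sigma>. c \<sigma> \<noteq> 0 \<longrightarrow> length \<sigma> = l \<and> \<sigma> \<noteq> []}"

lemma cochainD: "c \<in> cochain l \<Longrightarrow> length \<sigma> \<noteq> l \<Longrightarrow> c \<sigma> = 0" "c \<in> cochain l \<Longrightarrow> c [] = 0"
  by (auto simp: cochain_def)

lemma fsub_cochain: "fsub (cochain l)"
  by (rule fsubI) (auto simp: cochain_def, (metis add_0)+)

lemma stable_cochain: "stable cochain"
  unfolding stable_def
proof (intro conjI allI)
  show "fsub (cochain l :: ('x list \<Rightarrow> 'k::field) set)" for l by (rule fsub_cochain)
  show "lcob ` cochain l \<subseteq> (cochain (Suc l) :: ('x list \<Rightarrow> 'k::field) set)" for l
  proof (rule image_subsetI)
    fix c :: "'x list \<Rightarrow> 'k" assume c: "c \<in> cochain l"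
    have "length \<sigma> = Suc l" if "lcob c \<sigma> \<noteq> 0" for \<sigma>
      by (rule lcob_length[OF _ that]) (use c cochainD in blast)
    then show "lcob c \<in> cochain (Suc l)" by (auto simp: cochain_def)
  qed
  show "cochain 0 \<subseteq> {0}" by (auto simp: cochain_def fun_eq_iff)
qed

lemma pb_cochain: "c \<in> cochain l \<Longrightarrow> pb f c \<in> cochain l"
  by (auto simp: cochain_def)

lemma lprism_cochain: "c \<in> cochain (Suc l) \<Longrightarrow> lprism f g c \<in> cochain l"
proof -
  assume c: "c \<in> cochain (Suc l)"
  have "lprism f g c \<sigma> = 0" if "length \<sigma> \<noteq> l" for \<sigma>
    by (rule lprism_zero) (use that cochainD(1)[OF c] in auto)
  then show ?thesis unfolding cochain_def using lprism.simps(1)[of f g c] by blast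
qed

text \<open>The homotopy formula turns closeness of two point maps into equality of the maps they
  induce in cohomology: what remains to be checked is where the two prism terms vanish.\<close>

lemma homotopic_bcob:
  assumes "stable T" "lprism f g c \<in> T l" "lprism f g (lcob c) \<in> R (Suc l)"
  shows "pb g c - pb f c \<in> bcob T R (Suc l)"
proof -
  have "pb g c - pb f c = lcob (lprism f g c) + lprism f g (lcob c)"
    by (simp add: fun_eq_iff lprism_homotopy)
  then show ?thesis using bcobI[OF assms(1), of "lprism f g c" "Suc l" "lprism f g (lcob c)" R] assms by simp
qed

section \<open>Locally vanishing cochains\<close>

text \<open>Alexander--Spanier cohomology of the pair \<open>(Z, A)\<close> in degree \<open>q\<close> is that of
  \<open>lzero Z A\<close> modulo \<open>lzero Z (topspace Z)\<close> at \<open>l = q + 1\<close>, the number of points of a simplex.\<close>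

definition lzero :: "'x topology \<Rightarrow> 'x set \<Rightarrow> ('x, 'k::field) complex" where
  "lzero Z A l = {c \<in> cochain l. \<forall>x\<in>topspace Z. \<exists>V. openin Z V \<and> x \<in> V \<and> vanish c (V \<inter> A)}"

lemma lzero_cochain: "c \<in> lzero Z A l \<Longrightarrow> c \<in> cochain l"
  by (simp add: lzero_def)

lemma lzeroD:
  assumes "c \<in> lzero Z A l" "x \<in> topspace Z"
  obtains V where "openin Z V" "x \<in> V" "vanish c (V \<inter> A)"
  using assms unfolding lzero_def by blast

lemma lzeroI:
  assumes "c \<in> cochain l" "\<And>x. x \<in> topspace Z \<Longrightarrow> \<exists>V. openin Z V \<and> x \<in> V \<and> vanish c (V \<inter> A)"
  shows "c \<in> lzero Z A l"
  using assms unfolding lzero_def by blast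

lemma vanish_empty: "c \<in> cochain l \<Longrightarrow> vanish c {}"
  by (simp add: vanish_def cochainD)

lemma lzeroI_closed:
  assumes "closedin Z A" "c \<in> cochain l" "\<And>x. x \<in> A \<Longrightarrow> \<exists>V. openin Z V \<and> x \<in> V \<and> vanish c (V \<inter> A)"
  shows "c \<in> lzero Z A l"
proof (rule lzeroI[OF assms(2)])
  fix x assume x: "x \<in> topspace Z"
  show "\<exists>V. openin Z V \<and> x \<in> V \<and> vanish c (V \<inter> A)"
  proof (cases "x \<in> A")
    case False
    have "(topspace Z - A) \<inter> A = {}" by blast
    then have "vanish c ((topspace Z - A) \<inter> A)" using vanish_empty[OF assms(2)] by metis
    then show ?thesis using False x assms(1) by blast
  qed (use assms in blast)
qed

lemma lzero_empty: "lzero Z {} l = cochain l"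
  unfolding lzero_def using vanish_empty by (auto intro: openin_topspace)

lemma lzero_mono: "A \<subseteq> B \<Longrightarrow> lzero Z B l \<subseteq> lzero Z A l"
proof
  fix c :: "'a list \<Rightarrow> 'k::field" assume A: "A \<subseteq> B" and c: "c \<in> lzero Z B l"
  show "c \<in> lzero Z A l"
  proof (rule lzeroI[OF lzero_cochain[OF c]])
    fix x assume "x \<in> topspace Z"
    from lzeroD[OF c this] obtain V where "openin Z V" "x \<in> V" "vanish c (V \<inter> B)" .
    then show "\<exists>V. openin Z V \<and> x \<in> V \<and> vanish c (V \<inter> A)" using vanish_mono[of c "V \<inter> B" "V \<inter> A"] A by blast
  qed
qed

lemma lzero_vanish: "c \<in> cochain l \<Longrightarrow> vanish c A \<Longrightarrow> c \<in> lzero Z A l"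
  by (intro lzeroI exI[of _ "topspace Z"]) (auto intro: vanish_mono)

lemma stable_lzero: "stable (lzero Z A)"
  unfolding stable_def
proof (intro conjI allI)
  show "fsub (lzero Z A l :: ('a list \<Rightarrow> 'k::field) set)" for l
  proof (rule fsubI)
    show "0 \<in> lzero Z A l" by (rule lzero_vanish) (auto simp: vanish_def cochain_def)
    show "a + b \<in> lzero Z A l" if "a \<in> lzero Z A l" "b \<in> lzero Z A l" for a b :: "'a list \<Rightarrow> 'k::field"
    proof (rule lzeroI)
      show "a + b \<in> cochain l" using that fsub_cochain lzero_cochain by (meson fs.subspace_add)
      fix x assume x: "x \<in> topspace Z"
      from lzeroD[OF that(1) x] obtain V where V: "openin Z V" "x \<in> V" "vanish a (V \<inter> A)" .
      from lzeroD[OF that(2) x] obtain U where U: "openin Z U" "x \<in> U" "vanish b (U \<inter> A)" .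
      have "vanish (a + b) (V \<inter> U \<inter> A)"
        by (rule vanish_add; rule vanish_mono[OF V(3)] vanish_mono[OF U(3)]; blast)
      then show "\<exists>V. openin Z V \<and> x \<in> V \<and> vanish (a + b) (V \<inter> A)" using U V by (meson IntI openin_Int)
    qed
    show "fscale r a \<in> lzero Z A l" if "a \<in> lzero Z A l" for r and a :: "'a list \<Rightarrow> 'k::field"
    proof (rule lzeroI)
      show "fscale r a \<in> cochain l" by (rule fs.subspace_scale[OF fsub_cochain lzero_cochain[OF that]])
      show "\<exists>V. openin Z V \<and> x \<in> V \<and> vanish (fscale r a) (V \<inter> A)" if "x \<in> topspace Z" for x
        using lzeroD[OF \<open>a \<in> lzero Z A l\<close> that] vanish_scale by metis
    qed
  qed
  show "lcob ` lzero Z A l \<subseteq> (lzero Z A (Suc l) :: ('a list \<Rightarrow> 'k::field) set)" for l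
  proof (rule image_subsetI, rule lzeroI)
    fix c :: "'a list \<Rightarrow> 'k::field" assume c: "c \<in> lzero Z A l"
    show "lcob c \<in> cochain (Suc l)" by (rule stableD(2)[OF stable_cochain lzero_cochain[OF c]])
    show "\<exists>V. openin Z V \<and> x \<in> V \<and> vanish (lcob c) (V \<inter> A)" if "x \<in> topspace Z" for x
      using lzeroD[OF c that] vanish_lcob by metis
  qed
  show "lzero Z A 0 \<subseteq> ({0} :: ('a list \<Rightarrow> 'k::field) set)"
    using lzero_cochain stableD(3)[OF stable_cochain] by blast
qed

lemma pb_lzero:
  assumes c: "c \<in> cochain l"
    and "\<And>x. x \<in> topspace Z \<Longrightarrow> \<exists>V Q. openin Z V \<and> x \<in> V \<and> vanish c Q \<and> f ` (V \<inter> A) \<subseteq> Q"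
  shows "pb f c \<in> lzero Z A l"
  using assms(2) by (intro lzeroI pb_cochain[OF c]) (meson vanish_pb)

lemma lprism_lzero:
  assumes c: "c \<in> cochain (Suc l)"
    and "\<And>x. x \<in> topspace Z \<Longrightarrow>
      \<exists>V Q. openin Z V \<and> x \<in> V \<and> vanish c Q \<and> f ` (V \<inter> A) \<subseteq> Q \<and> g ` (V \<inter> A) \<subseteq> Q"
  shows "lprism f g c \<in> lzero Z A l"
  using assms(2) by (intro lzeroI lprism_cochain[OF c]) (meson vanish_lprism)

lemma pb_lzero_continuous:
  assumes f: "continuous_map Z Z' f" "f ` A \<subseteq> A'" and c: "c \<in> lzero Z' A' l"
  shows "pb f c \<in> lzero Z A l"
proof (rule pb_lzero[OF lzero_cochain[OF c]])
  fix x assume x: "x \<in> topspace Z"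
  then have "f x \<in> topspace Z'" using f(1) by (meson continuous_map_image_subset_topspace image_subset_iff)
  from lzeroD[OF c this] obtain V where V: "openin Z' V" "f x \<in> V" "vanish c (V \<inter> A')" .
  show "\<exists>V Q. openin Z V \<and> x \<in> V \<and> vanish c Q \<and> f ` (V \<inter> A) \<subseteq> Q"
    using openin_continuous_map_preimage[OF f(1) V(1)] x V f(2)
    by (intro exI[of _ "{x \<in> topspace Z. f x \<in> V}"] exI[of _ "V \<inter> A'"]) auto
qed

section \<open>Refinements in compact Hausdorff spaces\<close>

text \<open>Take a finite subcover by open sets \<open>O' k\<close>, each inside a closed
  \<open>C k \<subseteq> N k\<close>. The index \<open>\<kappa> x\<close> satisfies
  \<open>x \<in> O' (\<kappa> x)\<close>, and \<open>V y\<close> avoids every \<open>C k\<close>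
  that does not contain \<open>y\<close>. So \<open>x \<in> V y\<close> forces
  \<open>y \<in> C (\<kappa> x)\<close> and hence \<open>V y \<subseteq> N (\<kappa> x)\<close>. It
  matters that \<open>\<kappa>\<close> depends on \<open>x\<close> alone.\<close>

lemma barycentric_refinement:
  assumes Z: "compact_space Z" "Hausdorff_space Z"
    and N: "\<And>x. x \<in> topspace Z \<Longrightarrow> openin Z (N x) \<and> x \<in> N x"
  obtains \<kappa> V where "\<And>x. x \<in> topspace Z \<Longrightarrow> \<kappa> x \<in> topspace Z"
    "\<And>y. y \<in> topspace Z \<Longrightarrow> openin Z (V y) \<and> y \<in> V y"
    "\<And>x y. y \<in> topspace Z \<Longrightarrow> x \<in> V y \<Longrightarrow> V y \<subseteq> N (\<kappa> x)"
proof -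
  have "\<forall>x\<in>topspace Z. \<exists>O' C. openin Z O' \<and> closedin Z C \<and> x \<in> O' \<and> O' \<subseteq> C \<and> C \<subseteq> N x"
  proof
    fix x assume x: "x \<in> topspace Z"
    have "regular_space Z" by (rule compact_Hausdorff_imp_regular_space[OF Z])
    moreover have "closedin Z (topspace Z - N x)" "x \<in> topspace Z - (topspace Z - N x)"
      using N[OF x] x by auto
    ultimately have "\<exists>U V. openin Z U \<and> openin Z V \<and> x \<in> U \<and> topspace Z - N x \<subseteq> V \<and> disjnt U V"
      unfolding regular_space_def by simp
    then obtain U V where UV: "openin Z U" "openin Z V" "x \<in> U" "topspace Z - N x \<subseteq> V" "disjnt U V"
      by (elim exE conjE)
    then show "\<exists>O' C. openin Z O' \<and> closedin Z C \<and> x \<in> O' \<and> O' \<subseteq> C \<and> C \<subseteq> N x"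
      using openin_subset[OF UV(1)]
      by (intro exI[of _ U] exI[of _ "topspace Z - V"]) (auto simp: disjnt_def)
  qed
  then obtain O' C where OC: "\<And>x. x \<in> topspace Z \<Longrightarrow>
      openin Z (O' x) \<and> closedin Z (C x) \<and> x \<in> O' x \<and> O' x \<subseteq> C x \<and> C x \<subseteq> N x" by metis
  have "compactin Z (topspace Z)" using Z by (simp add: compact_space_def)
  then have "\<exists>\<F>. finite \<F> \<and> \<F> \<subseteq> O' ` topspace Z \<and> topspace Z \<subseteq> \<Union>\<F>"
    using OC by (intro compactinD) auto
  then obtain F where F: "finite F" "F \<subseteq> topspace Z" "topspace Z \<subseteq> (\<Union>x\<in>F. O' x)"
    by (metis finite_subset_image)
  define \<kappa> where "\<kappa> x = (SOME k. k \<in> F \<and> x \<in> O' k)" for x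
  have \<kappa>: "\<kappa> x \<in> F \<and> x \<in> O' (\<kappa> x)" if "x \<in> topspace Z" for x
    unfolding \<kappa>_def by (rule someI_ex) (use that F in blast)
  define V where "V y = (\<Inter>k\<in>F. if y \<in> C k then N k else topspace Z - C k) \<inter> topspace Z" for y
  show thesis
  proof
    show "\<kappa> x \<in> topspace Z" if "x \<in> topspace Z" for x using \<kappa>[OF that] F by blast
    show "openin Z (V y) \<and> y \<in> V y" if y: "y \<in> topspace Z" for y
    proof
      show "openin Z (V y)" unfolding V_def using F N OC by (intro openin_INT) (auto intro!: openin_diff)
      show "y \<in> V y" unfolding V_def using y OC F by auto
    qed
    show "V y \<subseteq> N (\<kappa> x)" if y: "y \<in> topspace Z" "x \<in> V y" for x y
    proof -
      have x: "x \<in> topspace Z" using y by (simp add: V_def)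
      then have "x \<in> C (\<kappa> x)" "\<kappa> x \<in> F" using \<kappa> OC F by blast+
      then have "y \<in> C (\<kappa> x)" using y unfolding V_def by (auto split: if_splits)
      then show ?thesis using \<open>\<kappa> x \<in> F\<close> unfolding V_def by auto
    qed
  qed
qed

text \<open>Two barycentric refinements in a row: a common point \<open>z\<close> of
  \<open>V x\<close> and \<open>V y\<close> puts both sets, and so the point \<open>x\<close>, into
  \<open>U (\<mu> z)\<close>, where the first refinement applies.\<close>

lemma star_refinement:
  assumes Z: "compact_space Z" "Hausdorff_space Z"
    and N: "\<And>x. x \<in> topspace Z \<Longrightarrow> openin Z (N x) \<and> x \<in> N x"
  obtains \<kappa> V where "\<And>x. x \<in> topspace Z \<Longrightarrow> \<kappa> x \<in> topspace Z"
    "\<And>y. y \<in> topspace Z \<Longrightarrow> openin Z (V y) \<and> y \<in> V y"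
    "\<And>x y. x \<in> topspace Z \<Longrightarrow> y \<in> topspace Z \<Longrightarrow> V x \<inter> V y \<noteq> {} \<Longrightarrow> V y \<subseteq> N (\<kappa> x)"
proof -
  obtain \<kappa> U where U: "\<And>x. x \<in> topspace Z \<Longrightarrow> \<kappa> x \<in> topspace Z"
    "\<And>y. y \<in> topspace Z \<Longrightarrow> openin Z (U y) \<and> y \<in> U y"
    "\<And>x y. y \<in> topspace Z \<Longrightarrow> x \<in> U y \<Longrightarrow> U y \<subseteq> N (\<kappa> x)"
    using barycentric_refinement[OF Z N] by metis
  obtain \<mu> V where V: "\<And>x. x \<in> topspace Z \<Longrightarrow> \<mu> x \<in> topspace Z"
    "\<And>y. y \<in> topspace Z \<Longrightarrow> openin Z (V y) \<and> y \<in> V y"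
    "\<And>x y. y \<in> topspace Z \<Longrightarrow> x \<in> V y \<Longrightarrow> V y \<subseteq> U (\<mu> x)"
    using barycentric_refinement[OF Z U(2)] by metis
  show thesis
  proof (rule that[OF U(1) V(2)])
    fix x y assume xy: "x \<in> topspace Z" "y \<in> topspace Z" "V x \<inter> V y \<noteq> {}"
    then obtain z where z: "z \<in> V x" "z \<in> V y" by blast
    then have "z \<in> topspace Z" using V(2)[OF xy(1)] openin_subset by blast
    have "V x \<subseteq> U (\<mu> z)" "V y \<subseteq> U (\<mu> z)" using V(3) xy z by blast+
    moreover have "x \<in> U (\<mu> z)" using calculation V(2)[OF xy(1)] by blast
    ultimately show "V y \<subseteq> N (\<kappa> x)" using U(3)[OF V(1)[OF \<open>z \<in> topspace Z\<close>]] by blast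
  qed
qed

section \<open>Tautness\<close>

text \<open>While \<open>lzero Z B\<close> asks for vanishing on small lists of points of
  \<open>B\<close>, this asks for it on small lists of any points close to \<open>B\<close>.
  Tautness says that both compute the same cohomology.\<close>

definition near :: "'x topology \<Rightarrow> 'x set \<Rightarrow> ('x, 'k::field) complex" where
  "near Z B l = {c \<in> cochain l. \<forall>x\<in>B \<inter> topspace Z. \<exists>V. openin Z V \<and> x \<in> V \<and> vanish c V}"

lemma near_cochain: "c \<in> near Z B l \<Longrightarrow> c \<in> cochain l"
  by (simp add: near_def)

lemma nearD:
  assumes "c \<in> near Z B l" "x \<in> B \<inter> topspace Z"
  obtains V where "openin Z V" "x \<in> V" "vanish c V"
  using assms unfolding near_def by blast

lemma nearI:
  assumes "c \<in> cochain l" "\<And>x. x \<in> B \<inter> topspace Z \<Longrightarrow> \<exists>V. openin Z V \<and> x \<in> V \<and> vanish c V"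
  shows "c \<in> near Z B l"
  using assms unfolding near_def by blast

lemma near_subset_lzero:
  assumes B: "closedin Z B"
  shows "near Z B l \<subseteq> lzero Z B l"
proof
  fix c :: "'a list \<Rightarrow> 'k::field" assume c: "c \<in> near Z B l"
  show "c \<in> lzero Z B l"
  proof (rule lzeroI_closed[OF B near_cochain[OF c]])
    fix x assume "x \<in> B"
    then have "x \<in> B \<inter> topspace Z" using closedin_subset[OF B] by blast
    from nearD[OF c this] obtain V where "openin Z V" "x \<in> V" "vanish c V" .
    then show "\<exists>V. openin Z V \<and> x \<in> V \<and> vanish c (V \<inter> B)" using vanish_mono[of c V "V \<inter> B"] by blast
  qed
qed

lemma lzero_subset_near: "lzero Z (topspace Z) l \<subseteq> near Z B l"
proof
  fix c :: "'a list \<Rightarrow> 'k::field" assume c: "c \<in> lzero Z (topspace Z) l"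
  show "c \<in> near Z B l"
  proof (rule nearI[OF lzero_cochain[OF c]])
    fix x assume "x \<in> B \<inter> topspace Z"
    then have "x \<in> topspace Z" by blast
    from lzeroD[OF c this] obtain V where "openin Z V" "x \<in> V" "vanish c (V \<inter> topspace Z)" .
    then show "\<exists>V. openin Z V \<and> x \<in> V \<and> vanish c V" by (metis inf.absorb_iff1 openin_subset)
  qed
qed

lemma stable_near: "stable (near Z B)"
  unfolding stable_def
proof (intro conjI allI)
  show "fsub (near Z B l :: ('a list \<Rightarrow> 'k::field) set)" for l
  proof (rule fsubI)
    show "0 \<in> near Z B l"
      by (intro nearI exI[of _ "topspace Z"]) (auto simp: vanish_def cochain_def)
    show "a + b \<in> near Z B l" if "a \<in> near Z B l" "b \<in> near Z B l" for a b :: "'a list \<Rightarrow> 'k::field"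
    proof (rule nearI)
      show "a + b \<in> cochain l" using that fsub_cochain near_cochain by (meson fs.subspace_add)
      fix x assume x: "x \<in> B \<inter> topspace Z"
      from nearD[OF that(1) x] obtain V where V: "openin Z V" "x \<in> V" "vanish a V" .
      from nearD[OF that(2) x] obtain U where U: "openin Z U" "x \<in> U" "vanish b U" .
      have "vanish (a + b) (V \<inter> U)"
        by (rule vanish_add; rule vanish_mono[OF V(3)] vanish_mono[OF U(3)]; blast)
      then show "\<exists>V. openin Z V \<and> x \<in> V \<and> vanish (a + b) V" using U V by (meson IntI openin_Int)
    qed
    show "fscale r a \<in> near Z B l" if "a \<in> near Z B l" for r and a :: "'a list \<Rightarrow> 'k::field"
    proof (rule nearI)
      show "fscale r a \<in> cochain l" by (rule fs.subspace_scale[OF fsub_cochain near_cochain[OF that]])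
      show "\<exists>V. openin Z V \<and> x \<in> V \<and> vanish (fscale r a) V" if "x \<in> B \<inter> topspace Z" for x
        using nearD[OF \<open>a \<in> near Z B l\<close> that] vanish_scale by metis
    qed
  qed
  show "lcob ` near Z B l \<subseteq> (near Z B (Suc l) :: ('a list \<Rightarrow> 'k::field) set)" for l
  proof (rule image_subsetI, rule nearI)
    fix c :: "'a list \<Rightarrow> 'k::field" assume c: "c \<in> near Z B l"
    show "lcob c \<in> cochain (Suc l)" by (rule stableD(2)[OF stable_cochain near_cochain[OF c]])
    show "\<exists>V. openin Z V \<and> x \<in> V \<and> vanish (lcob c) V" if "x \<in> B \<inter> topspace Z" for x
      using nearD[OF c that] vanish_lcob by metis
  qed
  show "near Z B 0 \<subseteq> ({0} :: ('a list \<Rightarrow> 'k::field) set)"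
    using near_cochain stableD(3)[OF stable_cochain] by blast
qed

text \<open>Tautness uses a discontinuous map \<open>r\<close> close to the identity that maps a neighbourhood of
  \<open>B\<close> into \<open>B\<close>; pulling back along \<open>r\<close> makes a cochain vanish near \<open>B\<close>.\<close>

lemma near_retraction:
  assumes Z: "compact_space Z" "Hausdorff_space Z" and B: "closedin Z B"
    and N: "\<And>x. x \<in> topspace Z \<Longrightarrow> openin Z (N x) \<and> x \<in> N x"
  obtains \<kappa> V r where "\<And>y. y \<in> topspace Z \<Longrightarrow> \<kappa> y \<in> topspace Z \<and> openin Z (V y) \<and> y \<in> V y"
    "\<And>y. y \<in> topspace Z \<Longrightarrow> V y \<subseteq> N (\<kappa> y) \<and> r ` V y \<subseteq> N (\<kappa> y)"
    "\<And>y. y \<in> B \<Longrightarrow> r ` V y \<subseteq> B"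
proof -
  obtain \<kappa> V where V: "\<And>x. x \<in> topspace Z \<Longrightarrow> \<kappa> x \<in> topspace Z"
    "\<And>y. y \<in> topspace Z \<Longrightarrow> openin Z (V y) \<and> y \<in> V y"
    "\<And>x y. x \<in> topspace Z \<Longrightarrow> y \<in> topspace Z \<Longrightarrow> V x \<inter> V y \<noteq> {} \<Longrightarrow> V y \<subseteq> N (\<kappa> x)"
    using star_refinement[OF Z N] by metis
  have BZ: "B \<subseteq> topspace Z" using B closedin_subset by blast
  define r where "r x = (if \<exists>b\<in>B. x \<in> V b then SOME b. b \<in> B \<and> x \<in> V b else x)" for x
  have r: "r x \<in> B \<and> x \<in> V (r x)" if "b \<in> B" "x \<in> V b" for x b
  proof -
    have "r x = (SOME b. b \<in> B \<and> x \<in> V b)" using that by (auto simp: r_def)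
    then show ?thesis using someI[of "\<lambda>b. b \<in> B \<and> x \<in> V b" b] that by simp
  qed
  show thesis
  proof (rule that)
    fix y assume y: "y \<in> topspace Z"
    have Vy: "V y \<subseteq> N (\<kappa> y)" using V(3)[OF y y] V(2)[OF y] by blast
    have "r x \<in> N (\<kappa> y)" if x: "x \<in> V y" for x
    proof (cases "\<exists>b\<in>B. x \<in> V b")
      case True
      then have rx: "r x \<in> B" "x \<in> V (r x)" using r by blast+
      then have rZ: "r x \<in> topspace Z" using BZ by blast
      show ?thesis using V(3)[OF y rZ] V(2)[OF rZ] x rx by blast
    next
      case False
      then have "r x = x" by (simp add: r_def)
      then show ?thesis using x Vy by auto
    qed
    with Vy show "V y \<subseteq> N (\<kappa> y) \<and> r ` V y \<subseteq> N (\<kappa> y)" by blast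
    show "\<kappa> y \<in> topspace Z \<and> openin Z (V y) \<and> y \<in> V y" using V y by blast
  next
    show "r ` V y \<subseteq> B" if "y \<in> B" for y using r that by blast
  qed
qed

context
  fixes Z :: "'x topology" and B :: "'x set"
  assumes Z: "compact_space Z" "Hausdorff_space Z" and B: "closedin Z B"
begin

abbreviation (input) RR :: "('x, 'k::field) complex" where "RR \<equiv> lzero Z (topspace Z)"

lemma common_neighbourhoods:
  fixes a :: "'x list \<Rightarrow> 'k::field"
  assumes "a \<in> RR l" "b \<in> lzero Z B l'"
  obtains N where "\<And>x. x \<in> topspace Z \<Longrightarrow> openin Z (N x) \<and> x \<in> N x \<and> vanish a (N x) \<and> vanish b (N x \<inter> B)"
proof -
  have "\<exists>N. openin Z N \<and> x \<in> N \<and> vanish a N \<and> vanish b (N \<inter> B)" if x: "x \<in> topspace Z" for x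
  proof -
    from lzeroD[OF assms(1) x] obtain V where V: "openin Z V" "x \<in> V" "vanish a (V \<inter> topspace Z)" .
    from lzeroD[OF assms(2) x] obtain U where U: "openin Z U" "x \<in> U" "vanish b (U \<inter> B)" .
    have "vanish a (V \<inter> U)" by (rule vanish_mono[OF V(3)]) (use openin_subset[OF V(1)] in blast)
    moreover have "vanish b (V \<inter> U \<inter> B)" by (rule vanish_mono[OF U(3)]) blast
    ultimately show ?thesis using U V by (meson IntI openin_Int)
  qed
  then show thesis using that by metis
qed

text \<open>Small lists stay small under \<open>r\<close>, and close to \<open>B\<close> they move
  into \<open>B\<close>, where \<open>c\<close> vanishes on them. The homotopy from \<open>r\<close>
  to the identity respects both conditions.\<close>

lemma taut_surjective:
  fixes c :: "'x list \<Rightarrow> 'k::field"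
  assumes c: "c \<in> zcyc (lzero Z B) RR (Suc l)"
  shows "\<exists>z\<in>zcyc (near Z B) RR (Suc l). c - z \<in> bcob (lzero Z B) RR (Suc l)"
proof -
  have c1: "c \<in> lzero Z B (Suc l)" "lcob c \<in> RR (Suc (Suc l))" using c by (auto simp: zcyc_def)
  obtain N where N: "\<And>x. x \<in> topspace Z \<Longrightarrow> openin Z (N x) \<and> x \<in> N x \<and> vanish (lcob c) (N x) \<and> vanish c (N x \<inter> B)"
    using common_neighbourhoods[OF c1(2,1)] by metis
  obtain \<kappa> V r where V: "\<And>y. y \<in> topspace Z \<Longrightarrow> \<kappa> y \<in> topspace Z \<and> openin Z (V y) \<and> y \<in> V y"
    "\<And>y. y \<in> topspace Z \<Longrightarrow> V y \<subseteq> N (\<kappa> y) \<and> r ` V y \<subseteq> N (\<kappa> y)"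
    "\<And>y. y \<in> B \<Longrightarrow> r ` V y \<subseteq> B"
    using near_retraction[OF Z B, of N] N by metis
  have "pb r c \<in> near Z B (Suc l)"
  proof (rule nearI[OF pb_cochain[OF lzero_cochain[OF c1(1)]]])
    fix x assume x: "x \<in> B \<inter> topspace Z"
    have "vanish (pb r c) (V x)"
      by (rule vanish_pb[of c "N (\<kappa> x) \<inter> B"]) (use V[of x] N[of "\<kappa> x"] x in auto)
    then show "\<exists>V. openin Z V \<and> x \<in> V \<and> vanish (pb r c) V" using V x by blast
  qed
  moreover have "pb r (lcob c) \<in> RR (Suc (Suc l))"
  proof (rule pb_lzero[OF lzero_cochain[OF c1(2)]])
    fix x assume x: "x \<in> topspace Z"
    show "\<exists>V Q. openin Z V \<and> x \<in> V \<and> vanish (lcob c) Q \<and> r ` (V \<inter> topspace Z) \<subseteq> Q"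
      by (rule exI[of _ "V x"], rule exI[of _ "N (\<kappa> x)"]) (use V(1,2)[OF x] N[of "\<kappa> x"] in blast)
  qed
  ultimately have z: "pb r c \<in> zcyc (near Z B) RR (Suc l)" by (simp add: zcyc_def lcob_pb)
  have "pb (\<lambda>x. x) c - pb r c \<in> bcob (lzero Z B) RR (Suc l)"
  proof (rule homotopic_bcob[OF stable_lzero])
    show "lprism r (\<lambda>x. x) c \<in> lzero Z B l"
    proof (rule lprism_lzero[OF lzero_cochain[OF c1(1)]])
      fix x assume x: "x \<in> topspace Z"
      show "\<exists>V Q. openin Z V \<and> x \<in> V \<and> vanish c Q \<and> r ` (V \<inter> B) \<subseteq> Q \<and> (\<lambda>x. x) ` (V \<inter> B) \<subseteq> Q"
      proof (rule exI[of _ "V x"], rule exI[of _ "N (\<kappa> x) \<inter> B"], intro conjI)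
        show "r ` (V x \<inter> B) \<subseteq> N (\<kappa> x) \<inter> B"
        proof (rule image_subsetI)
          fix y assume y: "y \<in> V x \<inter> B"
          then have "y \<in> V y" using V(1) closedin_subset[OF B] by blast
          then show "r y \<in> N (\<kappa> x) \<inter> B" using V(3)[of y] V(2)[OF x] y by blast
        qed
      qed (use V(1,2)[OF x] N[of "\<kappa> x"] in auto)
    qed
    show "lprism r (\<lambda>x. x) (lcob c) \<in> RR (Suc l)"
    proof (rule lprism_lzero[OF lzero_cochain[OF c1(2)]])
      fix x assume x: "x \<in> topspace Z"
      show "\<exists>V Q. openin Z V \<and> x \<in> V \<and> vanish (lcob c) Q \<and> r ` (V \<inter> topspace Z) \<subseteq> Q \<and> (\<lambda>x. x) ` (V \<inter> topspace Z) \<subseteq> Q"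
        by (rule exI[of _ "V x"], rule exI[of _ "N (\<kappa> x)"]) (use V(1,2)[OF x] N[of "\<kappa> x"] in auto)
    qed
  qed
  moreover have "pb (\<lambda>x. x) c = c" by (simp add: fun_eq_iff)
  ultimately show ?thesis using z by auto
qed

lemma taut_injective:
  fixes c :: "'x list \<Rightarrow> 'k::field"
  assumes c: "c \<in> zcyc (near Z B) RR (Suc l)" "c \<in> bcob (lzero Z B) RR (Suc l)"
  shows "c \<in> bcob (near Z B) RR (Suc l)"
proof -
  have c1: "c \<in> near Z B (Suc l)" "lcob c \<in> RR (Suc (Suc l))" using c by (auto simp: zcyc_def)
  obtain b n where bn: "b \<in> lzero Z B l" "n \<in> RR (Suc l)" "c = lcob b + n"
    using c(2) by (rule bcobE) simp
  obtain N1 where N1: "\<And>x. x \<in> topspace Z \<Longrightarrow> openin Z (N1 x) \<and> x \<in> N1 x \<and> vanish (lcob c) (N1 x) \<and> vanish b (N1 x \<inter> B)"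
    using common_neighbourhoods[OF c1(2) bn(1)] by metis
  obtain N2 where N2: "\<And>x. x \<in> topspace Z \<Longrightarrow> openin Z (N2 x) \<and> x \<in> N2 x \<and> vanish n (N2 x) \<and> vanish b (N2 x \<inter> B)"
    using common_neighbourhoods[OF bn(2,1)] by metis
  \<comment> \<open>Each neighbourhood kills \<open>c\<close> or misses \<open>B\<close>, so an
    \<open>N x\<close> that meets \<open>B\<close> kills \<open>c\<close>. This makes the prism term
    of \<open>c\<close> vanish on a neighbourhood of \<open>B\<close>, as \<open>near\<close>
    demands.\<close>
  have "\<exists>N3. openin Z N3 \<and> x \<in> N3 \<and> (x \<in> B \<longrightarrow> vanish c N3) \<and> (x \<notin> B \<longrightarrow> N3 \<inter> B = {})"
    if x: "x \<in> topspace Z" for x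
  proof (cases "x \<in> B")
    case True
    then have "x \<in> B \<inter> topspace Z" using x by blast
    from nearD[OF c1(1) this] True show ?thesis by metis
  next
    case False
    then show ?thesis using B x by (intro exI[of _ "topspace Z - B"]) auto
  qed
  then obtain N3 where N3: "\<And>x. x \<in> topspace Z \<Longrightarrow> openin Z (N3 x) \<and> x \<in> N3 x \<and>
      (x \<in> B \<longrightarrow> vanish c (N3 x)) \<and> (x \<notin> B \<longrightarrow> N3 x \<inter> B = {})" by metis
  define N where "N x = N1 x \<inter> N2 x \<inter> N3 x" for x
  have No: "openin Z (N x) \<and> x \<in> N x" if "x \<in> topspace Z" for x
    unfolding N_def using N1[OF that] N2[OF that] N3[OF that] by blast
  have Nv: "vanish (lcob c) (N x)" "vanish n (N x)" "vanish b (N x \<inter> B)" if "x \<in> topspace Z" for x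
    using vanish_mono[of "lcob c" "N1 x" "N x"] vanish_mono[of n "N2 x" "N x"]
      vanish_mono[of b "N1 x \<inter> B" "N x \<inter> B"] N1[OF that] N2[OF that] unfolding N_def by blast+
  have Nc: "vanish c (N x)" if "x \<in> topspace Z" "N x \<inter> B \<noteq> {}" for x
    using vanish_mono[of c "N3 x" "N x"] N3[OF that(1)] that(2) unfolding N_def by blast
  obtain \<kappa> V r where V: "\<And>y. y \<in> topspace Z \<Longrightarrow> \<kappa> y \<in> topspace Z \<and> openin Z (V y) \<and> y \<in> V y"
    "\<And>y. y \<in> topspace Z \<Longrightarrow> V y \<subseteq> N (\<kappa> y) \<and> r ` V y \<subseteq> N (\<kappa> y)"
    "\<And>y. y \<in> B \<Longrightarrow> r ` V y \<subseteq> B"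
    using near_retraction[OF Z B No] by metis
  have "pb r b \<in> near Z B l"
  proof (rule nearI[OF pb_cochain[OF lzero_cochain[OF bn(1)]]])
    fix x assume x: "x \<in> B \<inter> topspace Z"
    have "vanish (pb r b) (V x)"
      by (rule vanish_pb[of b "N (\<kappa> x) \<inter> B"]) (use V[of x] Nv[of "\<kappa> x"] x in auto)
    then show "\<exists>V. openin Z V \<and> x \<in> V \<and> vanish (pb r b) V" using V x by blast
  qed
  moreover have "pb r n \<in> RR (Suc l)"
  proof (rule pb_lzero[OF lzero_cochain[OF bn(2)]])
    fix x assume x: "x \<in> topspace Z"
    show "\<exists>V Q. openin Z V \<and> x \<in> V \<and> vanish n Q \<and> r ` (V \<inter> topspace Z) \<subseteq> Q"
      by (rule exI[of _ "V x"], rule exI[of _ "N (\<kappa> x)"]) (use V(1,2)[OF x] Nv[of "\<kappa> x"] in blast)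
  qed
  moreover have "pb r c = lcob (pb r b) + pb r n"
    using bn(3) by (simp add: lcob_pb flinear_add[OF flinear_pb])
  ultimately have rc: "pb r c \<in> bcob (near Z B) RR (Suc l)"
    using bcobI[OF stable_near, of "pb r b" Z B "Suc l" "pb r n" RR] by simp
  have "pb (\<lambda>x. x) c - pb r c \<in> bcob (near Z B) RR (Suc l)"
  proof (rule homotopic_bcob[OF stable_near])
    show "lprism r (\<lambda>x. x) c \<in> near Z B l"
    proof (rule nearI[OF lprism_cochain[OF near_cochain[OF c1(1)]]])
      fix x assume x: "x \<in> B \<inter> topspace Z"
      have "vanish (lprism r (\<lambda>x. x) c) (V x)"
        by (rule vanish_lprism[OF Nc[of "\<kappa> x"]]) (use V[of x] x in auto)
      then show "\<exists>V. openin Z V \<and> x \<in> V \<and> vanish (lprism r (\<lambda>x. x) c) V" using V x by blast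
    qed
    show "lprism r (\<lambda>x. x) (lcob c) \<in> RR (Suc l)"
    proof (rule lprism_lzero[OF lzero_cochain[OF c1(2)]])
      fix x assume x: "x \<in> topspace Z"
      show "\<exists>V Q. openin Z V \<and> x \<in> V \<and> vanish (lcob c) Q \<and> r ` (V \<inter> topspace Z) \<subseteq> Q \<and> (\<lambda>x. x) ` (V \<inter> topspace Z) \<subseteq> Q"
        by (rule exI[of _ "V x"], rule exI[of _ "N (\<kappa> x)"]) (use V(1,2)[OF x] Nv[of "\<kappa> x"] in auto)
    qed
  qed
  from fs.subspace_add[OF fsub_bcob[OF stable_near stable_lzero] this rc]
  have "pb (\<lambda>x. x) c \<in> bcob (near Z B) RR (Suc l)" by simp
  then show ?thesis by (simp add: pb_def)
qed

lemma taut_hdim: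
  "hfd (near Z B) (RR :: ('x, 'k::field) complex) (Suc l) = hfd (lzero Z B) (RR :: ('x, 'k) complex) (Suc l) \<and>
   hdim (near Z B) (RR :: ('x, 'k) complex) (Suc l) = hdim (lzero Z B) (RR :: ('x, 'k) complex) (Suc l)"
proof (rule quotient_iso[OF flinear_id])
  show "fsub (zcyc (near Z B) (RR :: ('x, 'k) complex) (Suc l))" by (rule fsub_zcyc[OF stable_near stable_lzero])
  show "fsub (bcob (near Z B) (RR :: ('x, 'k) complex) (Suc l))" by (rule fsub_bcob[OF stable_near stable_lzero])
  show "fsub (bcob (lzero Z B) (RR :: ('x, 'k) complex) (Suc l))" by (rule fsub_bcob[OF stable_lzero stable_lzero])
  show "z \<in> zcyc (lzero Z B) RR (Suc l)" if "z \<in> zcyc (near Z B) RR (Suc l)" for z :: "'x list \<Rightarrow> 'k"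
    using that near_subset_lzero[OF B] unfolding zcyc_def by blast
  show "\<exists>z\<in>zcyc (near Z B) RR (Suc l). w - z \<in> bcob (lzero Z B) RR (Suc l)"
    if "w \<in> zcyc (lzero Z B) RR (Suc l)" for w :: "'x list \<Rightarrow> 'k" by (rule taut_surjective[OF that])
  show "z \<in> bcob (lzero Z B) RR (Suc l) \<longleftrightarrow> z \<in> bcob (near Z B) RR (Suc l)"
    if "z \<in> zcyc (near Z B) RR (Suc l)" for z :: "'x list \<Rightarrow> 'k"
  proof
    show "z \<in> bcob (near Z B) RR (Suc l)" if "z \<in> bcob (lzero Z B) RR (Suc l)"
      using taut_injective that \<open>z \<in> zcyc (near Z B) RR (Suc l)\<close> by blast
    show "z \<in> bcob (lzero Z B) RR (Suc l)" if "z \<in> bcob (near Z B) RR (Suc l)"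
      using that near_subset_lzero[OF B] unfolding bcob_def set_sum_def by blast
  qed
qed

end

section \<open>Equivariant clopen decompositions\<close>

lemma fsum_apply: "(\<Sum>i\<in>I. F i) x = (\<Sum>i\<in>I. F i x)" for F :: "'i \<Rightarrow> 'x \<Rightarrow> 'k::field"
  by (induction I rule: infinite_finite_induct) auto

definition restrict_cochain :: "'x set \<Rightarrow> ('x list \<Rightarrow> 'k::field) \<Rightarrow> 'x list \<Rightarrow> 'k" where
  "restrict_cochain Q c \<sigma> = (if \<sigma> \<noteq> [] \<and> set \<sigma> \<subseteq> Q then c \<sigma> else 0)"

lemma flinear_restrict: "flinear (restrict_cochain Q)"
  unfolding flinear_def by (auto simp: fun_eq_iff restrict_cochain_def)

lemma restrict_cochain_cochain: "c \<in> cochain l \<Longrightarrow> restrict_cochain Q c \<in> cochain l"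
  by (auto simp: cochain_def restrict_cochain_def)

lemma vanish_restrict: "vanish c P \<Longrightarrow> vanish (restrict_cochain Q c) P"
  by (simp add: vanish_def restrict_cochain_def)

lemma restrict_near: "c \<in> near Z B l \<Longrightarrow> restrict_cochain Q c \<in> near Z B l"
  by (rule nearI[OF restrict_cochain_cochain[OF near_cochain]]) (assumption, erule (1) nearD, metis vanish_restrict)

lemma restrict_lzero: "c \<in> lzero Z A l \<Longrightarrow> restrict_cochain Q c \<in> lzero Z A l"
  by (rule lzeroI[OF restrict_cochain_cochain[OF lzero_cochain]]) (assumption, erule (1) lzeroD, metis vanish_restrict)

lemma lcob_restrict_in:
  assumes c: "c \<in> cochain l" and P: "P \<subseteq> Q"
  shows "vanish (lcob (restrict_cochain Q c) - restrict_cochain Q (lcob c)) P"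
  unfolding vanish_def
proof (intro allI impI)
  fix \<sigma> assume s: "set \<sigma> \<subseteq> P"
  have "lcob (restrict_cochain Q c) \<sigma> = lcob c \<sigma>"
  proof (rule lcob_cong)
    fix \<tau> :: "'a list" assume "set \<tau> \<subseteq> set \<sigma>"
    then have "set \<tau> \<subseteq> Q" using s P by blast
    then show "restrict_cochain Q c \<tau> = c \<tau>" using cochainD(2)[OF c] by (auto simp: restrict_cochain_def)
  qed
  moreover have "set \<sigma> \<subseteq> Q" using s P by blast
  ultimately show "(lcob (restrict_cochain Q c) - restrict_cochain Q (lcob c)) \<sigma> = 0"
    by (auto simp: restrict_cochain_def)
qed

lemma lcob_restrict_out:
  assumes P: "P \<inter> Q = {}"
  shows "vanish (lcob (restrict_cochain Q c) - restrict_cochain Q (lcob c)) P"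
  unfolding vanish_def
proof (intro allI impI)
  fix \<sigma> assume s: "set \<sigma> \<subseteq> P"
  have *: "restrict_cochain Q a \<tau> = 0" if "set \<tau> \<subseteq> P" for a :: "'a list \<Rightarrow> 'b" and \<tau>
    using that P by (cases \<tau>) (auto simp: restrict_cochain_def)
  have "lcob (restrict_cochain Q c) \<sigma> = lcob (\<lambda>_. 0) \<sigma>" by (rule lcob_cong) (use * s in auto)
  then show "(lcob (restrict_cochain Q c) - restrict_cochain Q (lcob c)) \<sigma> = 0"
    using *[OF s] by (simp add: lcob_zero_fun)
qed

lemma vanish_lcob_restrict_commutator:
  assumes "vanish c P"
  shows "vanish (lcob (restrict_cochain Q c) - restrict_cochain Q (lcob c)) P"
  using vanish_lcob[OF vanish_restrict[OF assms, of Q]] vanish_restrict[OF vanish_lcob[OF assms], of Q]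
  by (simp add: vanish_def)

text \<open>Off \<open>B\<close> a small list lies inside \<open>Q\<close> or outside it, and near
  \<open>B\<close> the cochain itself vanishes. If it vanished only on lists within
  \<open>B\<close>, lists close to \<open>B\<close> that cross from \<open>Q\<close> to its
  complement could leave a defect.\<close>

lemma lcob_restrict_commute:
  assumes B: "closedin Z B" and c: "c \<in> near Z B l"
    and Q: "\<And>x. x \<in> topspace Z - B \<Longrightarrow> \<exists>V. openin Z V \<and> x \<in> V \<and> (V \<subseteq> Q \<or> V \<inter> Q = {})"
  shows "lcob (restrict_cochain Q c) - restrict_cochain Q (lcob c) \<in> lzero Z (topspace Z) (Suc l)"
proof (rule lzeroI)
  show "lcob (restrict_cochain Q c) - restrict_cochain Q (lcob c) \<in> cochain (Suc l)"
    using near_cochain[OF c] by (intro fs.subspace_diff[OF fsub_cochain] stableD(2)[OF stable_cochain] restrict_cochain_cochain)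
  fix x assume x: "x \<in> topspace Z"
  have "\<exists>V. openin Z V \<and> x \<in> V \<and> vanish (lcob (restrict_cochain Q c) - restrict_cochain Q (lcob c)) V"
  proof (cases "x \<in> B")
    case True
    then have "x \<in> B \<inter> topspace Z" using x by blast
    from nearD[OF c this] show ?thesis using vanish_lcob_restrict_commutator by metis
  next
    case False
    then obtain V where V: "openin Z V" "x \<in> V" "V \<subseteq> Q \<or> V \<inter> Q = {}" using Q[of x] x by auto
    then have "vanish (lcob (restrict_cochain Q c) - restrict_cochain Q (lcob c)) V"
      using lcob_restrict_in[OF near_cochain[OF c], of V Q] lcob_restrict_out[of V Q c] by (elim disjE) simp_all
    then show ?thesis using V by blast
  qed
  then show "\<exists>V. openin Z V \<and> x \<in> V \<and>
      vanish (lcob (restrict_cochain Q c) - restrict_cochain Q (lcob c)) (V \<inter> topspace Z)"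
    using vanish_mono by (metis Int_lower1)
qed

lemma pb_near:
  assumes f: "continuous_map Z Z' f" "f ` B \<subseteq> B'" and c: "c \<in> near Z' B' l"
  shows "pb f c \<in> near Z B l"
proof (rule nearI[OF pb_cochain[OF near_cochain[OF c]]])
  fix x assume x: "x \<in> B \<inter> topspace Z"
  then have "f x \<in> B' \<inter> topspace Z'" using f by (auto simp: continuous_map_def)
  from nearD[OF c this] obtain V where V: "openin Z' V" "f x \<in> V" "vanish c V" .
  have "vanish (pb f c) {x \<in> topspace Z. f x \<in> V}" by (rule vanish_pb[OF V(3)]) auto
  then show "\<exists>V. openin Z V \<and> x \<in> V \<and> vanish (pb f c) V"
    using openin_continuous_map_preimage[OF f(1) V(1)] x V by (intro exI[of _ "{x \<in> topspace Z. f x \<in> V}"]) auto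
qed

text \<open>The fibres of \<open>g\<close> give the projections and pullback along \<open>h\<close>
  the automorphism that \<open>cyclic_decomposition_dvd_qdim\<close> asks for. The computation takes
  place in \<open>near Z B\<close>, and tautness transfers the result to
  \<open>lzero Z B\<close>.\<close>

theorem equivariant_decomposition_dvd:
  fixes Z :: "'x topology" and g :: "'x \<Rightarrow> nat"
  assumes Z: "compact_space Z" "Hausdorff_space Z" and B: "closedin Z B"
    and hk: "homeomorphic_maps Z Z h k" "h ` B \<subseteq> B" "k ` B \<subseteq> B"
    and n: "n > 0" and g: "\<And>x. x \<in> topspace Z - B \<Longrightarrow> g x < n"
    and loc: "\<And>x. x \<in> topspace Z - B \<Longrightarrow> \<exists>V. openin Z V \<and> x \<in> V \<and> V \<inter> B = {} \<and> (\<forall>y\<in>V. g y = g x)"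
    and equi: "\<And>x. x \<in> topspace Z - B \<Longrightarrow> g (h x) = Suc (g x) mod n"
    and fd: "hfd (lzero Z B) (lzero Z (topspace Z) :: ('x, 'k::field) complex) (Suc l)"
  shows "n dvd hdim (lzero Z B) (lzero Z (topspace Z) :: ('x, 'k) complex) (Suc l)"
proof -
  define R :: "('x, 'k) complex" where "R = lzero Z (topspace Z)"
  define S :: "('x, 'k) complex" where "S = near Z B"
  define Q where "Q j = {x \<in> topspace Z - B. g x = j}" for j
  have R: "stable R" and S: "stable S" unfolding R_def S_def by (rule stable_lzero stable_near)+
  have RS: "R l \<subseteq> S l" for l unfolding R_def S_def by (rule lzero_subset_near)
  have BZ: "B \<subseteq> topspace Z" by (rule closedin_subset[OF B])
  have hc: "continuous_map Z Z h" "continuous_map Z Z k" using hk by (auto simp: homeomorphic_maps_def)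
  have hkx: "h (k x) = x" "k (h x) = x" if "x \<in> topspace Z" for x
    using hk(1) that by (auto simp: homeomorphic_maps_def)
  have top: "h x \<in> topspace Z" "k x \<in> topspace Z" if "x \<in> topspace Z" for x
    using hc that by (auto simp: continuous_map_def)
  have Qloc: "\<exists>V. openin Z V \<and> x \<in> V \<and> (V \<subseteq> Q j \<or> V \<inter> Q j = {})" if "x \<in> topspace Z - B" for x j
  proof -
    obtain V where V: "openin Z V" "x \<in> V" "V \<inter> B = {}" "\<forall>y\<in>V. g y = g x" using loc[OF \<open>x \<in> topspace Z - B\<close>] by blast
    show ?thesis
    proof (intro exI[of _ V] conjI V)
      show "V \<subseteq> Q j \<or> V \<inter> Q j = {}"
      proof (cases "g x = j")
        case True
        then have "V \<subseteq> Q j" using V(3,4) openin_subset[OF V(1)] unfolding Q_def by (simp add: subset_iff disjoint_iff)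
        then show ?thesis ..
      next
        case False
        then have "V \<inter> Q j = {}" using V(4) unfolding Q_def by (simp add: disjoint_iff)
        then show ?thesis ..
      qed
    qed
  qed
  have comm: "lcob (restrict_cochain (Q j) c) - restrict_cochain (Q j) (lcob c) \<in> R (Suc l)" if "c \<in> S l" for j c l
    using lcob_restrict_commute[OF B _ Qloc] that unfolding S_def R_def by blast
  have eR: "restrict_cochain (Q j) c \<in> R l" if "c \<in> R l" for j c l
    using that unfolding R_def by (rule restrict_lzero)
  have eS: "restrict_cochain (Q j) c \<in> S l" if "c \<in> S l" for j c l
    using that unfolding S_def by (rule restrict_near)
  have hS: "pb h c \<in> S l" "pb k c \<in> S l" if "c \<in> S l" for c l
    using that hc hk unfolding S_def by (blast intro: pb_near)+
  have hR: "pb h c \<in> R l" "pb k c \<in> R l" if "c \<in> R l" for c l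
    using that hc unfolding R_def by (blast intro: pb_lzero_continuous dest: continuous_map_image_subset_topspace)+
  have inR: "c \<in> R l" if "c \<in> cochain l" "\<And>\<sigma>. set \<sigma> \<subseteq> topspace Z \<Longrightarrow> c \<sigma> = 0" for c l
    unfolding R_def using that by (intro lzero_vanish) (auto simp: vanish_def)
  have Zco: "c \<in> cochain l" if "c \<in> zcyc S R l" for c l
    using that unfolding zcyc_def S_def by (blast dest: near_cochain)
  have map_top: "map h (map k \<sigma>) = \<sigma>" "map k (map h \<sigma>) = \<sigma>" if "set \<sigma> \<subseteq> topspace Z" for \<sigma>
    using that hkx by (auto simp: map_idI subset_iff)
  have hk_R: "c - pb h (pb k c) \<in> R l" "c - pb k (pb h c) \<in> R l" if "c \<in> cochain l" for c l
    using that map_top by (auto intro!: inR fs.subspace_diff[OF fsub_cochain] pb_cochain simp del: map_map)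
  have RB: "R l \<subseteq> bcob S R l" for l by (rule small_bcob[OF S])
  have "n dvd hdim S R (Suc l)"
  proof (rule cyclic_decomposition_dvd_qdim[where e = "\<lambda>j. restrict_cochain (Q j)" and u = "pb h"])
    show "fsub (zcyc S R (Suc l))" by (rule fsub_zcyc[OF S R])
    show fB: "fsub (bcob S R (Suc l))" by (rule fsub_bcob[OF S R])
    show "bcob S R (Suc l) \<subseteq> zcyc S R (Suc l)" by (rule bcob_zcyc[OF S R RS])
    show "hfd S R (Suc l)" unfolding S_def R_def using taut_hdim[OF Z B] fd by blast
    show "n > 0" by (rule n)
    show "flinear (restrict_cochain (Q j))" for j by (rule flinear_restrict)
    show "flinear (pb h)" by (rule flinear_pb)
    show "restrict_cochain (Q j) z \<in> zcyc S R (Suc l)" if "z \<in> zcyc S R (Suc l)" for j z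
    proof -
      have z: "z \<in> S (Suc l)" "lcob z \<in> R (Suc (Suc l))" using that by (auto simp: zcyc_def)
      have "(lcob (restrict_cochain (Q j) z) - restrict_cochain (Q j) (lcob z)) + restrict_cochain (Q j) (lcob z) \<in> R (Suc (Suc l))"
        by (rule fs.subspace_add[OF stableD(1)[OF R] comm[OF z(1)] eR[OF z(2)]])
      then show ?thesis using eS[OF z(1)] by (simp add: zcyc_def)
    qed
    show "restrict_cochain (Q j) z \<in> bcob S R (Suc l)" if zb: "z \<in> bcob S R (Suc l)" for j z
    proof -
      obtain b r where br: "b \<in> S l" "r \<in> R (Suc l)" "z = lcob b + r" using zb by (rule bcobE) simp
      let ?e = "restrict_cochain (Q j)"
      have "?e r - (lcob (?e b) - ?e (lcob b)) \<in> R (Suc l)"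
        by (rule fs.subspace_diff[OF stableD(1)[OF R] eR[OF br(2)] comm[OF br(1)]])
      then have "lcob (?e b) + (?e r - (lcob (?e b) - ?e (lcob b))) \<in> bcob S R (Suc l)"
        using eS[OF br(1)] by (intro bcobI[OF S]) auto
      then show ?thesis using br(3) by (simp add: flinear_add[OF flinear_restrict] add.commute)
    qed
    show "restrict_cochain (Q j) (restrict_cochain (Q j) z) = restrict_cochain (Q j) z" for j and z :: "'x list \<Rightarrow> 'k"
      by (auto simp: restrict_cochain_def fun_eq_iff)
    show "restrict_cochain (Q i) (restrict_cochain (Q j) z) = 0" if "i \<noteq> j" for i j and z :: "'x list \<Rightarrow> 'k"
    proof
      fix \<sigma> show "restrict_cochain (Q i) (restrict_cochain (Q j) z) \<sigma> = 0 \<sigma>"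
        using that by (cases \<sigma>) (auto simp: restrict_cochain_def Q_def)
    qed
    show "z - (\<Sum>j<n. restrict_cochain (Q j) z) \<in> bcob S R (Suc l)" if z: "z \<in> zcyc S R (Suc l)" for z
    proof -
      have zc: "z \<in> cochain (Suc l)" by (rule Zco[OF z])
      have zn: "z \<in> near Z B (Suc l)" using z by (simp add: zcyc_def S_def)
      \<comment> \<open>Near \<open>B\<close> the cochain \<open>z\<close> is zero on small lists;
        elsewhere a small list lies in a single fibre, so exactly one term of the sum
        survives.\<close>
      have "z - (\<Sum>j<n. restrict_cochain (Q j) z) \<in> R (Suc l)"
        unfolding R_def
      proof (rule lzeroI)
        show "z - (\<Sum>j<n. restrict_cochain (Q j) z) \<in> cochain (Suc l)"
          by (intro fs.subspace_diff[OF fsub_cochain] fs.subspace_sum[OF fsub_cochain] zc restrict_cochain_cochain)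
        fix x assume x: "x \<in> topspace Z"
        show "\<exists>V. openin Z V \<and> x \<in> V \<and> vanish (z - (\<Sum>j<n. restrict_cochain (Q j) z)) (V \<inter> topspace Z)"
        proof (cases "x \<in> B")
          case True
          then have "x \<in> B \<inter> topspace Z" using x by blast
          from nearD[OF zn this] obtain V where V: "openin Z V" "x \<in> V" "vanish z V" .
          have "vanish (z - (\<Sum>j<n. restrict_cochain (Q j) z)) (V \<inter> topspace Z)"
            using V(3) vanish_restrict[OF V(3)] by (simp add: vanish_def fsum_apply)
          then show ?thesis using V by blast
        next
          case False
          then have x': "x \<in> topspace Z - B" using x by blast
          then obtain V where V: "openin Z V" "x \<in> V" "V \<inter> B = {}" "\<forall>y\<in>V. g y = g x" using loc by blast
          have "vanish (z - (\<Sum>j<n. restrict_cochain (Q j) z)) (V \<inter> topspace Z)"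
            unfolding vanish_def
          proof (intro allI impI)
            fix \<sigma> assume s: "set \<sigma> \<subseteq> V \<inter> topspace Z"
            show "(z - (\<Sum>j<n. restrict_cochain (Q j) z)) \<sigma> = 0"
            proof (cases "\<sigma> = []")
              case True
              then show ?thesis using cochainD(2)[OF zc] by (simp add: fsum_apply restrict_cochain_def)
            next
              case False
              have "set \<sigma> \<subseteq> Q j \<longleftrightarrow> j = g x" for j
              proof -
                have gQ: "y \<in> Q j \<longleftrightarrow> j = g x" if "y \<in> set \<sigma>" for y
                proof -
                  have "y \<in> V" "y \<in> topspace Z" using s that by blast+
                  then have "y \<in> topspace Z - B" "g y = g x" using V(3,4) by blast+
                  then show ?thesis unfolding Q_def by auto
                qed
                have "hd \<sigma> \<in> set \<sigma>" using False by simp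
                then show ?thesis using gQ by (metis subsetD subsetI)
              qed
              then have "(\<Sum>j<n. restrict_cochain (Q j) z) \<sigma> = (\<Sum>j<n. if j = g x then z \<sigma> else 0)"
                unfolding fsum_apply using False by (intro sum.cong) (auto simp: restrict_cochain_def)
              also have "\<dots> = z \<sigma>" using g[OF x'] by simp
              finally show ?thesis by simp
            qed
          qed
          then show ?thesis using V by blast
        qed
      qed
      then show ?thesis using RB by blast
    qed
    show "pb h z \<in> zcyc S R (Suc l)" if "z \<in> zcyc S R (Suc l)" for z
      using pb_zcyc[of S h S R R] hS hR that by blast
    show "pb h z \<in> bcob S R (Suc l) \<longleftrightarrow> z \<in> bcob S R (Suc l)" if z: "z \<in> zcyc S R (Suc l)" for z
    proof
      assume "pb h z \<in> bcob S R (Suc l)"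
      then have "pb k (pb h z) \<in> bcob S R (Suc l)" using pb_bcob[of S k S R R] hS hR S by blast
      moreover have "z - pb k (pb h z) \<in> bcob S R (Suc l)" using hk_R(2)[OF Zco[OF z]] RB by blast
      ultimately show "z \<in> bcob S R (Suc l)" using fsub_diffD[OF fB] by blast
    next
      assume "z \<in> bcob S R (Suc l)"
      then show "pb h z \<in> bcob S R (Suc l)" using pb_bcob[of S h S R R] hS hR S by blast
    qed
    show "\<exists>z\<in>zcyc S R (Suc l). w - pb h z \<in> bcob S R (Suc l)" if w: "w \<in> zcyc S R (Suc l)" for w
    proof
      show "pb k w \<in> zcyc S R (Suc l)" using pb_zcyc[of S k S R R] hS hR w by blast
      show "w - pb h (pb k w) \<in> bcob S R (Suc l)" using hk_R(1)[OF Zco[OF w]] RB by blast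
    qed
    show "restrict_cochain (Q j) (pb h z) - pb h (restrict_cochain (Q (Suc j mod n)) z) \<in> bcob S R (Suc l)"
      if j: "j < n" and z: "z \<in> zcyc S R (Suc l)" for j z
    proof -
      \<comment> \<open>\<open>h\<close> raises labels by 1 modulo \<open>n\<close>, so restricting
        a pullback to label \<open>j\<close> means pulling back a restriction to label
        \<open>Suc j mod n\<close>.\<close>
      have Qh: "h x \<in> Q (Suc j mod n) \<longleftrightarrow> x \<in> Q j" if x: "x \<in> topspace Z" for x
      proof (cases "x \<in> B")
        case True
        then show ?thesis using hk(2) by (auto simp: Q_def)
      next
        case False
        have "h x \<notin> B" using hk(3) hkx(2)[OF x] False by (metis image_subset_iff)
        moreover have "Suc (g x) mod n = Suc j mod n \<longleftrightarrow> g x = j"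
          using g[of x] x False j by (auto simp: mod_Suc)
        ultimately show ?thesis using False x top equi[of x] by (auto simp: Q_def)
      qed
      have "restrict_cochain (Q j) (pb h z) - pb h (restrict_cochain (Q (Suc j mod n)) z) \<in> R (Suc l)"
      proof (rule inR)
        show "restrict_cochain (Q j) (pb h z) - pb h (restrict_cochain (Q (Suc j mod n)) z) \<in> cochain (Suc l)"
          by (intro fs.subspace_diff[OF fsub_cochain] pb_cochain restrict_cochain_cochain Zco[OF z])
        fix \<sigma> assume s: "set \<sigma> \<subseteq> topspace Z"
        then have "set (map h \<sigma>) \<subseteq> Q (Suc j mod n) \<longleftrightarrow> set \<sigma> \<subseteq> Q j" using Qh by (auto simp: subset_iff)
        then show "(restrict_cochain (Q j) (pb h z) - pb h (restrict_cochain (Q (Suc j mod n)) z)) \<sigma> = 0"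
          by (simp add: restrict_cochain_def)
      qed
      then show ?thesis using RB by blast
    qed
  qed
  then show ?thesis using taut_hdim[OF Z B, where 'k='k and l=l] unfolding S_def R_def by simp
qed

section \<open>Cech cohomology of compact Hausdorff spaces\<close>

text \<open>\<open>cls\<close> stands for the quotient map. Both notions of dimension are least
  sizes of generating sets, so it is enough to move these across: forward by \<open>cls\<close>,
  backward by chosen representatives. In the infinite-dimensional case both are the
  \<open>LEAST\<close> of an unsatisfiable predicate.\<close>

lemma quotient_vectorspace:
  fixes V :: "('k::field, 'c) module" and cls :: "('x \<Rightarrow> 'k) \<Rightarrow> 'c"
  assumes Z: "fsub Z" and B: "fsub B" and carr: "carrier V = cls ` Z"
    and eq: "\<And>v w. v \<in> Z \<Longrightarrow> w \<in> Z \<Longrightarrow> cls v = cls w \<longleftrightarrow> v - w \<in> B"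
    and add: "\<And>v w. v \<in> Z \<Longrightarrow> w \<in> Z \<Longrightarrow> add V (cls v) (cls w) = cls (v + w)"
    and smult: "\<And>a v. v \<in> Z \<Longrightarrow> module.smult V a (cls v) = cls (fscale a v)"
    and zero: "zero V = cls 0"
  shows "vectorspace.fin_dim class_ring V \<longleftrightarrow> qfd Z B" (is ?fd)
    and "vectorspace.dim class_ring V = qdim Z B" (is ?dim)
proof -
  have Zc: "v + w \<in> Z" "fscale a v \<in> Z" "0 \<in> Z" "- v \<in> Z" if "v \<in> Z" "w \<in> Z" for a v w
    using that Z by (auto intro: fs.subspace_add fs.subspace_scale fs.subspace_0 fs.subspace_neg)
  have Z0: "0 \<in> Z" using Z fs.subspace_0 by blast
  have ag: "abelian_group V"
  proof (rule abelian_groupI)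
    show "\<exists>y\<in>carrier V. y \<oplus>\<^bsub>V\<^esub> x = \<zero>\<^bsub>V\<^esub>" if x: "x \<in> carrier V" for x
    proof -
      obtain v where v: "v \<in> Z" "x = cls v" using x carr by blast
      then have "cls (- v) \<oplus>\<^bsub>V\<^esub> x = \<zero>\<^bsub>V\<^esub>" using add[of "- v" v] Zc(4) zero by simp
      then show ?thesis using v Zc(4) carr by blast
    qed
  qed (auto simp: carr add zero Zc Z0 ac_simps)
  have "module class_ring V"
  proof (rule Module.moduleI)
    show "cring (class_ring :: 'k ring)" by (rule class_cring.cring_axioms)
  qed (auto simp: ag carr add smult Zc Z0 fs.scale_left_distrib fs.scale_right_distrib class_ring_simps)
  then interpret VS: vectorspace class_ring V
    by (simp add: vectorspace_def class_field.field_axioms)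
  define rep where "rep u = (SOME v. v \<in> Z \<and> cls v = u)" for u
  have rep: "rep u \<in> Z \<and> cls (rep u) = u" if "u \<in> carrier V" for u
    unfolding rep_def by (rule someI_ex[of "\<lambda>v. v \<in> Z \<and> cls v = u"]) (use that carr in auto)
  have lc: "VS.lincomb a A = cls (\<Sum>u\<in>A. fscale (a u) (rep u)) \<and> (\<Sum>u\<in>A. fscale (a u) (rep u)) \<in> Z"
    if "finite A" "A \<subseteq> carrier V" for a A
    using that
  proof (induction A)
    case empty
    have "VS.lincomb a {} = cls 0" by (simp add: VS.lincomb_def zero)
    then show ?case using Z0 by (simp only: sum.empty)
  next
    case (insert u A)
    have sm: "a u \<odot>\<^bsub>V\<^esub> u \<in> carrier V" if "u \<in> carrier V" for u
      using rep[OF that] smult[of "rep u" "a u"] Zc(2) carr by (metis imageI)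
    have u: "u \<in> carrier V" using insert by blast
    have "VS.lincomb a (insert u A) = a u \<odot>\<^bsub>V\<^esub> u \<oplus>\<^bsub>V\<^esub> VS.lincomb a A"
      unfolding VS.lincomb_def using insert sm by (intro VS.finsum_insert) auto
    also have "a u \<odot>\<^bsub>V\<^esub> u = cls (fscale (a u) (rep u))" using smult[of "rep u" "a u"] rep[OF u] by simp
    finally have 1: "VS.lincomb a (insert u A) = cls (fscale (a u) (rep u)) \<oplus>\<^bsub>V\<^esub> VS.lincomb a A" .
    have 2: "(\<Sum>u\<in>insert u A. fscale (a u) (rep u)) = fscale (a u) (rep u) + (\<Sum>u\<in>A. fscale (a u) (rep u))"
      by (rule sum.insert[OF insert(1,2)])
    have 3: "VS.lincomb a A = cls (\<Sum>u\<in>A. fscale (a u) (rep u))" "(\<Sum>u\<in>A. fscale (a u) (rep u)) \<in> Z"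
      using insert by blast+
    have 4: "fscale (a u) (rep u) \<in> Z" using rep[OF u] Zc(2) by blast
    show ?case unfolding 1 2 3(1) using add[OF 4 3(2)] Zc(1)[OF 4 3(2)] by (rule conjI)
  qed
  have up: "VS.gen_set (cls ` T)" if T: "T \<subseteq> Z" "Z \<subseteq> set_sum B (fs.span T)" for T
  proof -
    have sub: "submodule class_ring (VS.span (cls ` T)) V"
      using T carr by (intro VS.span_is_submodule) auto
    have own: "cls ` T \<subseteq> VS.span (cls ` T)" using T carr by (intro VS.in_own_span) auto
    have sp: "s \<in> Z \<and> cls s \<in> VS.span (cls ` T)" if "s \<in> fs.span T" for s
      using that
    proof (induction rule: fs.span_induct_alt)
      case base
      have "cls 0 \<in> VS.span (cls ` T)" using submodule.zero_closed[OF sub] unfolding zero .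
      then show ?case by (rule conjI[OF Z0])
    next
      case (step a x y)
      have x: "x \<in> Z" "cls x \<in> VS.span (cls ` T)" using step T own by auto
      have y: "y \<in> Z" "cls y \<in> VS.span (cls ` T)" using step by blast+
      have "a \<odot>\<^bsub>V\<^esub> cls x \<oplus>\<^bsub>V\<^esub> cls y \<in> VS.span (cls ` T)"
        using submodule.m_closed[OF sub submodule.smult_closed[OF sub _ x(2)] y(2)] by simp
      then have "cls (fscale a x + y) \<in> VS.span (cls ` T)"
        unfolding smult[OF x(1)] add[OF Zc(2)[OF x(1) x(1)] y(1)] .
      with Zc(1)[OF Zc(2)[OF x(1) x(1)] y(1)] show ?case by (rule conjI)
    qed
    have "carrier V \<subseteq> VS.span (cls ` T)"
    proof
      fix u assume "u \<in> carrier V"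
      then obtain v where v: "v \<in> Z" "u = cls v" using carr by blast
      then obtain b s where "b \<in> B" "s \<in> fs.span T" "v = b + s" using T by (blast elim: set_sumE)
      then have "cls v = cls s" using eq[of v s] sp v by simp
      then show "u \<in> VS.span (cls ` T)" using v sp \<open>s \<in> fs.span T\<close> by simp
    qed
    moreover have "VS.span (cls ` T) \<subseteq> carrier V" using T carr by (intro VS.span_is_subset2) auto
    ultimately show ?thesis by blast
  qed
  have down: "rep ` A \<subseteq> Z \<and> Z \<subseteq> set_sum B (fs.span (rep ` A))" if A: "finite A" "A \<subseteq> carrier V" "VS.gen_set A" for A
  proof
    show "rep ` A \<subseteq> Z" using A rep by blast
    show "Z \<subseteq> set_sum B (fs.span (rep ` A))"
    proof
      fix v assume v: "v \<in> Z"
      then have "cls v \<in> VS.span A" using A carr by blast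
      then obtain A' a where A': "finite A'" "A' \<subseteq> A" "cls v = VS.lincomb a A'" unfolding VS.span_def by blast
      let ?s = "\<Sum>u\<in>A'. fscale (a u) (rep u)"
      have s: "cls v = cls ?s" "?s \<in> Z" using lc[OF A'(1)] A' A by auto
      then have "v - ?s \<in> B" using eq v by blast
      moreover have "?s \<in> fs.span (rep ` A)"
        using A' by (intro fs.span_sum fs.span_scale fs.span_base) auto
      ultimately show "v \<in> set_sum B (fs.span (rep ` A))" using set_sumI by (metis diff_add_cancel)
    qed
  qed
  show fd: ?fd
  proof
    assume "VS.fin_dim"
    then obtain A where A: "finite A" "A \<subseteq> carrier V" "VS.gen_set A" unfolding VS.fin_dim_def by blast
    show "qfd Z B" unfolding qfd_def using down[OF A] A(1) by (intro exI[of _ "rep ` A"]) simp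
  next
    assume "qfd Z B"
    then obtain T where T: "finite T" "T \<subseteq> Z" "Z \<subseteq> set_sum B (fs.span T)" unfolding qfd_def by blast
    show "VS.fin_dim" unfolding VS.fin_dim_def
      by (intro exI[of _ "cls ` T"]) (use T carr up[OF T(2,3)] in auto)
  qed
  let ?P = "\<lambda>n. \<exists>A. finite A \<and> card A = n \<and> A \<subseteq> carrier V \<and> VS.gen_set A"
  show ?dim
  proof (cases "qfd Z B")
    case True
    then obtain T where T: "finite T" "card T = qdim Z B" "T \<subseteq> Z" "Z \<subseteq> set_sum B (fs.span T)" by (rule qdim_witness)
    have "VS.dim \<le> card (cls ` T)" unfolding VS.dim_def
      by (rule Least_le, intro exI[of _ "cls ` T"]) (use T carr up[OF T(3,4)] in auto)
    then have 1: "VS.dim \<le> qdim Z B" using card_image_le[OF T(1), of cls] T(2) by simp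
    have "\<exists>n. ?P n" using fd True unfolding VS.fin_dim_def by blast
    then have "?P VS.dim" unfolding VS.dim_def by (rule LeastI_ex)
    then obtain A where A: "finite A" "card A = VS.dim" "A \<subseteq> carrier V" "VS.gen_set A" by blast
    have "qdim Z B \<le> card (rep ` A)" using down[OF A(1,3,4)] A(1) by (intro qdim_le) auto
    also have "\<dots> \<le> VS.dim" using card_image_le[OF A(1)] A(2) by metis
    finally show ?thesis using 1 by simp
  next
    case False
    then have "?P = (\<lambda>n. False)" using fd unfolding VS.fin_dim_def by blast
    moreover have "(\<lambda>n. \<exists>T. finite T \<and> card T = n \<and> T \<subseteq> Z \<and> Z \<subseteq> set_sum B (fs.span T)) = (\<lambda>n. False)"
      using False unfolding qfd_def by blast
    ultimately show ?thesis unfolding VS.dim_def qdim_def by simp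
  qed
qed

section \<open>Nerve cochains as list cochains\<close>

definition npull :: "'a set set \<Rightarrow> nat \<Rightarrow> ('a set \<Rightarrow> 'b) \<Rightarrow> ('b list \<Rightarrow> 'k::field) \<Rightarrow> 'a set list \<Rightarrow> 'k" where
  "npull \<W> q s c \<sigma> = (if \<sigma> \<in> nerve_simplices \<W> q then c (map s \<sigma>) else 0)"

lemma nerve_pullback_npull: "nerve_pullback = npull"
  by (simp add: fun_eq_iff nerve_pullback_def npull_def)

lemma nerve_face:
  "\<sigma> \<in> nerve_simplices \<W> (Suc q) \<Longrightarrow> set \<tau> \<subseteq> set \<sigma> \<Longrightarrow> length \<sigma> = Suc (length \<tau>) \<Longrightarrow> \<tau> \<in> nerve_simplices \<W> q"
  unfolding nerve_simplices_def using Inter_anti_mono[of "set \<tau>" "set \<sigma>"] by auto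

lemma nerve_coboundary_lcob:
  "\<sigma> \<in> nerve_simplices \<U> (Suc q) \<Longrightarrow> nerve_coboundary \<U> q c \<sigma> = lcob c \<sigma>"
  unfolding nerve_coboundary_def lcob_sum by (simp add: nerve_simplices_def lessThan_Suc_atMost)

text \<open>Vertices may be sent to objects of any type: besides a refinement map, \<open>s\<close>
  can be a choice of a point in each member of the cover.\<close>

lemma nerve_coboundary_npull:
  assumes "\<sigma> \<in> nerve_simplices \<W> (Suc q)"
  shows "nerve_coboundary \<W> q (npull \<W> q s c) \<sigma> = lcob c (map s \<sigma>)"
proof -
  have "lcob (npull \<W> q s c) \<sigma> = lcob (pb s c) \<sigma>"
    by (rule lcob_cong) (use nerve_face[OF assms] in \<open>auto simp: npull_def\<close>)
  then show ?thesis using nerve_coboundary_lcob[OF assms, of "npull \<W> q s c"] by (simp add: lcob_pb)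
qed

lemma nerve_cochains_cochain: "c \<in> nerve_cochains \<U> A q \<Longrightarrow> c \<in> cochain (Suc q)"
  unfolding nerve_cochains_def cochain_def nerve_simplices_def by auto

lemma npull_cochain: "npull \<W> q s c \<in> cochain (Suc q)"
  unfolding npull_def cochain_def nerve_simplices_def by auto

lemma nerve_coboundary_cochain: "nerve_coboundary \<W> q c \<in> cochain (Suc (Suc q))"
  unfolding nerve_coboundary_def cochain_def nerve_simplices_def by auto

lemma nerve_containing:
  "y \<in> V \<Longrightarrow> set \<sigma> \<subseteq> {U \<in> \<U>. V \<subseteq> U} \<Longrightarrow> length \<sigma> = Suc q \<Longrightarrow> \<sigma> \<in> nerve_simplices \<U> q"
  unfolding nerve_simplices_def by auto

lemma vanish_cochain:
  "c \<in> cochain l \<Longrightarrow> (\<And>\<sigma>. set \<sigma> \<subseteq> Q \<Longrightarrow> length \<sigma> = l \<Longrightarrow> c \<sigma> = 0) \<Longrightarrow> vanish c Q"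
  unfolding vanish_def using cochainD(1) by blast

lemma vanish_nerve_cochain:
  assumes "c \<in> nerve_cochains \<U> A q" "y \<in> V" "y \<in> A"
  shows "vanish c {U \<in> \<U>. V \<subseteq> U}"
proof (rule vanish_cochain[OF nerve_cochains_cochain[OF assms(1)]])
  fix \<sigma> assume "set \<sigma> \<subseteq> {U \<in> \<U>. V \<subseteq> U}"
  then have "y \<in> \<Inter>(set \<sigma>) \<inter> A" using assms by auto
  then show "c \<sigma> = 0" using assms(1) unfolding nerve_cochains_def by blast
qed

lemma vanish_nerve_cocycle:
  assumes "c \<in> nerve_cocycles \<U> A q" "y \<in> V"
  shows "vanish (lcob c) {U \<in> \<U>. V \<subseteq> U}"
proof (rule vanish_cochain)
  show "lcob c \<in> cochain (Suc (Suc q))"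
    using assms unfolding nerve_cocycles_def by (auto intro: stableD(2)[OF stable_cochain] nerve_cochains_cochain)
  fix \<sigma> assume "set \<sigma> \<subseteq> {U \<in> \<U>. V \<subseteq> U}" "length \<sigma> = Suc (Suc q)"
  then have "\<sigma> \<in> nerve_simplices \<U> (Suc q)" by (rule nerve_containing[OF assms(2)])
  then show "lcob c \<sigma> = 0" using nerve_coboundary_lcob[of \<sigma> \<U> q c] assms(1) by (simp add: nerve_cocycles_def)
qed

text \<open>Near each \<open>y\<close> one open set lies in all the chosen members, so small lists
  of points go to lists of members with a common point, that is to simplices of the nerve. An
  arbitrary choice of a member through each point would not ensure this.\<close>

definition selection :: "'a topology \<Rightarrow> 'a set set \<Rightarrow> ('a \<Rightarrow> 'a set) \<Rightarrow> bool" where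
  "selection Z \<U> f \<longleftrightarrow> (\<forall>x\<in>topspace Z. f x \<in> \<U>) \<and>
     (\<forall>y\<in>topspace Z. \<exists>V. openin Z V \<and> y \<in> V \<and> (\<forall>x\<in>V. V \<subseteq> f x))"

lemma selectionD:
  assumes "selection Z \<U> f" "y \<in> topspace Z"
  obtains V where "openin Z V" "y \<in> V" "f ` V \<subseteq> {U \<in> \<U>. V \<subseteq> U}"
proof -
  obtain V where V: "openin Z V" "y \<in> V" "\<forall>x\<in>V. V \<subseteq> f x" using assms unfolding selection_def by blast
  have "f ` V \<subseteq> {U \<in> \<U>. V \<subseteq> U}" using V openin_subset[OF V(1)] assms unfolding selection_def by blast
  then show thesis using that V by blast
qed

text \<open>Barycentric refinement gives exactly this: the member chosen at \<open>x\<close>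
  contains every \<open>V y\<close> through \<open>x\<close>.\<close>

lemma selection_exists:
  assumes "compact_space Z" "Hausdorff_space Z" "open_cover Z \<U>"
  shows "\<exists>f. selection Z \<U> f"
proof -
  have "\<forall>x\<in>topspace Z. \<exists>U\<in>\<U>. x \<in> U" using assms(3) unfolding open_cover_def by blast
  then obtain N where N: "\<And>x. x \<in> topspace Z \<Longrightarrow> N x \<in> \<U> \<and> x \<in> N x" by metis
  then have N': "openin Z (N x) \<and> x \<in> N x" if "x \<in> topspace Z" for x
    using assms(3) that unfolding open_cover_def by blast
  obtain \<kappa> V where V: "\<And>x. x \<in> topspace Z \<Longrightarrow> \<kappa> x \<in> topspace Z"
    "\<And>y. y \<in> topspace Z \<Longrightarrow> openin Z (V y) \<and> y \<in> V y"
    "\<And>x y. y \<in> topspace Z \<Longrightarrow> x \<in> V y \<Longrightarrow> V y \<subseteq> N (\<kappa> x)"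
    using barycentric_refinement[OF assms(1,2) N'] by metis
  show ?thesis unfolding selection_def
    by (intro exI[of _ "\<lambda>x. N (\<kappa> x)"]) (metis N V)
qed

lemma selection_refine:
  assumes "selection Z \<W> f" "refinement_map \<W> \<U> p"
  shows "selection Z \<U> (\<lambda>x. p (f x))"
  unfolding selection_def
proof (intro conjI ballI)
  show "p (f x) \<in> \<U>" if "x \<in> topspace Z" for x
    using assms that unfolding selection_def refinement_map_def by blast
  fix y assume "y \<in> topspace Z"
  from selectionD[OF assms(1) this] obtain V where V: "openin Z V" "y \<in> V" "f ` V \<subseteq> {U \<in> \<W>. V \<subseteq> U}" .
  then have "\<forall>x\<in>V. V \<subseteq> p (f x)" using assms(2) unfolding refinement_map_def by blast
  then show "\<exists>V. openin Z V \<and> y \<in> V \<and> (\<forall>x\<in>V. V \<subseteq> p (f x))" using V by blast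
qed

context
  fixes Z :: "'a topology" and A :: "'a set"
  assumes Z: "compact_space Z" "Hausdorff_space Z" and A: "closedin Z A"
begin

abbreviation (input) "CA \<equiv> lzero Z A"
abbreviation (input) "NZ \<equiv> lzero Z (topspace Z)"

lemma NZ_bcob: "NZ l \<subseteq> bcob CA NZ l"
  by (rule small_bcob[OF stable_lzero])

lemma fsub_b: "fsub (bcob CA NZ l)"
  by (rule fsub_bcob[OF stable_lzero stable_lzero])

lemma pb_selection_null:
  assumes f: "selection Z \<U> f" and c: "c \<in> cochain l"
    and "\<And>y V. y \<in> V \<Longrightarrow> vanish c {U \<in> \<U>. V \<subseteq> U}"
  shows "pb f c \<in> NZ l"
proof (rule pb_lzero[OF c])
  fix x assume "x \<in> topspace Z"
  from selectionD[OF f this] obtain V where V: "openin Z V" "x \<in> V" "f ` V \<subseteq> {U \<in> \<U>. V \<subseteq> U}" .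
  then show "\<exists>V Q. openin Z V \<and> x \<in> V \<and> vanish c Q \<and> f ` (V \<inter> topspace Z) \<subseteq> Q"
    using assms(3) by blast
qed

lemma pb_selection_rel:
  assumes f: "selection Z \<U> f" and c: "c \<in> nerve_cochains \<U> A q"
  shows "pb f c \<in> CA (Suc q)"
proof (rule lzeroI_closed[OF A pb_cochain[OF nerve_cochains_cochain[OF c]]])
  fix x assume x: "x \<in> A"
  then have "x \<in> topspace Z" using closedin_subset[OF A] by blast
  from selectionD[OF f this] obtain V where V: "openin Z V" "x \<in> V" "f ` V \<subseteq> {U \<in> \<U>. V \<subseteq> U}" .
  have "vanish (pb f c) (V \<inter> A)"
    by (rule vanish_pb[OF vanish_nerve_cochain[OF c V(2) x]]) (use V in blast)
  then show "\<exists>V. openin Z V \<and> x \<in> V \<and> vanish (pb f c) (V \<inter> A)" using V by blast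
qed

lemma pb_selection_zcyc:
  assumes f: "selection Z \<U> f" and c: "c \<in> nerve_cocycles \<U> A q"
  shows "pb f c \<in> zcyc CA NZ (Suc q)"
proof -
  have c': "c \<in> nerve_cochains \<U> A q" using c by (simp add: nerve_cocycles_def)
  have "pb f (lcob c) \<in> NZ (Suc (Suc q))"
    by (rule pb_selection_null[OF f stableD(2)[OF stable_cochain nerve_cochains_cochain[OF c']] vanish_nerve_cocycle[OF c]])
  then show ?thesis using pb_selection_rel[OF f c'] by (simp add: zcyc_def lcob_pb)
qed

text \<open>Near each point both selections take values in members that contain one common open set,
  so lists that mix the two are still simplices of the nerve.\<close>

lemma pb_selection_unique:
  assumes f: "selection Z \<U> f" and g: "selection Z \<U> g" and c: "c \<in> nerve_cocycles \<U> A q"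
  shows "pb g c - pb f c \<in> bcob CA NZ (Suc q)"
proof (rule homotopic_bcob[OF stable_lzero])
  have c': "c \<in> nerve_cochains \<U> A q" using c by (simp add: nerve_cocycles_def)
  have V: "\<exists>V. openin Z V \<and> x \<in> V \<and> f ` V \<subseteq> {U \<in> \<U>. V \<subseteq> U} \<and> g ` V \<subseteq> {U \<in> \<U>. V \<subseteq> U}" if x: "x \<in> topspace Z" for x
  proof -
    from selectionD[OF f x] obtain V where V: "openin Z V" "x \<in> V" "f ` V \<subseteq> {U \<in> \<U>. V \<subseteq> U}" .
    from selectionD[OF g x] obtain V' where V': "openin Z V'" "x \<in> V'" "g ` V' \<subseteq> {U \<in> \<U>. V' \<subseteq> U}" .
    show ?thesis using V V' by (intro exI[of _ "V \<inter> V'"]) (auto simp: image_subset_iff)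
  qed
  show "lprism f g c \<in> CA q"
  proof (rule lzeroI_closed[OF A lprism_cochain[OF nerve_cochains_cochain[OF c']]])
    fix x assume x: "x \<in> A"
    then have "x \<in> topspace Z" using closedin_subset[OF A] by blast
    from V[OF this] obtain V where V: "openin Z V" "x \<in> V" "f ` V \<subseteq> {U \<in> \<U>. V \<subseteq> U}" "g ` V \<subseteq> {U \<in> \<U>. V \<subseteq> U}"
      by blast
    have "vanish (lprism f g c) (V \<inter> A)"
      by (rule vanish_lprism[OF vanish_nerve_cochain[OF c' V(2) x]]) (use V in blast)+
    then show "\<exists>V. openin Z V \<and> x \<in> V \<and> vanish (lprism f g c) (V \<inter> A)" using V by blast
  qed
  show "lprism f g (lcob c) \<in> NZ (Suc q)"
  proof (rule lprism_lzero[OF stableD(2)[OF stable_cochain nerve_cochains_cochain[OF c']]])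
    fix x assume x: "x \<in> topspace Z"
    from V[OF x] obtain V where V: "openin Z V" "x \<in> V" "f ` V \<subseteq> {U \<in> \<U>. V \<subseteq> U}" "g ` V \<subseteq> {U \<in> \<U>. V \<subseteq> U}"
      by blast
    then show "\<exists>V Q. openin Z V \<and> x \<in> V \<and> vanish (lcob c) Q \<and> f ` (V \<inter> topspace Z) \<subseteq> Q \<and> g ` (V \<inter> topspace Z) \<subseteq> Q"
      using vanish_nerve_cocycle[OF c V(2)] by blast
  qed
qed

text \<open>For cocycles the class of the result does not depend on the chosen selection, by
  \<open>pb_selection_unique\<close>.\<close>

definition rep_of :: "'a set set \<times> ('a set list \<Rightarrow> 'k::field) \<Rightarrow> 'a list \<Rightarrow> 'k" where
  "rep_of x = pb (SOME f. selection Z (fst x) f) (snd x)"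

lemma rep_of_selection:
  assumes "open_cover Z \<U>"
  obtains f where "selection Z \<U> f" "\<And>c :: 'a set list \<Rightarrow> 'k::field. rep_of (\<U>, c) = pb f c"
proof -
  have "selection Z \<U> (SOME f. selection Z \<U> f)" using selection_exists[OF Z assms] by (rule someI_ex)
  then show thesis using that unfolding rep_of_def by simp
qed

lemma rep_of_zcyc: "x \<in> cech_cocycles Z A q \<Longrightarrow> rep_of x \<in> zcyc CA NZ (Suc q)"
proof -
  assume x: "x \<in> cech_cocycles Z A q"
  obtain \<U> c where xe: "x = (\<U>, c)" by (cases x)
  then have c: "open_cover Z \<U>" "c \<in> nerve_cocycles \<U> A q" using x by (auto simp: cech_cocycles_def)
  then show ?thesis using rep_of_selection[OF c(1)] pb_selection_zcyc[OF _ c(2)] xe by metis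
qed

lemma npull_cocycle:
  assumes "refinement_map \<W> \<U> p" "c \<in> nerve_cocycles \<U> A q"
  shows "npull \<W> q p c \<in> nerve_cocycles \<W> A q"
proof -
  have c': "c \<in> nerve_cochains \<U> A q" using assms by (simp add: nerve_cocycles_def)
  have nm: "map p \<sigma> \<in> nerve_simplices \<U> q'" if "\<sigma> \<in> nerve_simplices \<W> q'" for \<sigma> q'
    using that assms(1) unfolding nerve_simplices_def refinement_map_def by fastforce
  have "npull \<W> q p c \<in> nerve_cochains \<W> A q"
    unfolding nerve_cochains_def
  proof (clarsimp)
    fix \<sigma> assume "npull \<W> q p c \<sigma> \<noteq> 0"
    then have s: "\<sigma> \<in> nerve_simplices \<W> q" "c (map p \<sigma>) \<noteq> 0" by (auto simp: npull_def split: if_splits)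
    then have "\<Inter>(set (map p \<sigma>)) \<inter> A = {}" using c' unfolding nerve_cochains_def by blast
    moreover have "\<Inter>(set \<sigma>) \<subseteq> \<Inter>(set (map p \<sigma>))"
      using s(1) assms(1) unfolding nerve_simplices_def refinement_map_def by fastforce
    ultimately show "\<sigma> \<in> nerve_simplices \<W> q \<and> \<Inter>(set \<sigma>) \<inter> A = {}" using s(1) by blast
  qed
  moreover have "nerve_coboundary \<W> q (npull \<W> q p c) \<sigma> = 0" for \<sigma>
  proof (cases "\<sigma> \<in> nerve_simplices \<W> (Suc q)")
    case True
    show ?thesis unfolding nerve_coboundary_npull[OF True] nerve_coboundary_lcob[OF nm[OF True], symmetric]
      using assms(2) by (simp add: nerve_cocycles_def)
  qed (simp add: nerve_coboundary_def)
  ultimately show ?thesis by (simp add: nerve_cocycles_def fun_eq_iff)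
qed

lemma pb_npull_diff:
  assumes f: "selection Z \<W> f" and c: "c \<in> cochain (Suc q)"
  shows "pb f (npull \<W> q s c) - pb (\<lambda>x. s (f x)) c \<in> NZ (Suc q)"
proof -
  have "pb f (npull \<W> q s c - pb s c) \<in> NZ (Suc q)"
  proof (rule pb_selection_null[OF f])
    show co: "npull \<W> q s c - pb s c \<in> cochain (Suc q)"
      by (intro fs.subspace_diff[OF fsub_cochain] npull_cochain pb_cochain c)
    show "vanish (npull \<W> q s c - pb s c) {U \<in> \<W>. V \<subseteq> U}" if "y \<in> V" for y V
    proof (rule vanish_cochain[OF co])
      fix \<sigma> assume "set \<sigma> \<subseteq> {U \<in> \<W>. V \<subseteq> U}" "length \<sigma> = Suc q"
      then have "\<sigma> \<in> nerve_simplices \<W> q" by (rule nerve_containing[OF that])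
      then show "(npull \<W> q s c - pb s c) \<sigma> = 0" by (simp add: npull_def)
    qed
  qed
  then show ?thesis by (simp add: flinear_diff[OF flinear_pb] pb_comp)
qed

text \<open>Compatibility with the direct limit: a selection for the refinement followed by the
  refinement map is a selection for the coarser cover, and any two selections give cohomologous
  pullbacks.\<close>

lemma rep_of_refine:
  assumes "open_cover Z \<U>" "refinement_map \<W> \<U> p" "selection Z \<W> g" "c \<in> nerve_cocycles \<U> A q"
  shows "rep_of (\<U>, c) - pb g (npull \<W> q p c) \<in> bcob CA NZ (Suc q)"
proof -
  from rep_of_selection[OF assms(1)] obtain f where f: "selection Z \<U> f" "rep_of (\<U>, c) = pb f c" by metis
  have "pb f c - pb (\<lambda>x. p (g x)) c \<in> bcob CA NZ (Suc q)"
    by (rule pb_selection_unique[OF selection_refine[OF assms(3,2)] f(1) assms(4)])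
  moreover have "pb g (npull \<W> q p c) - pb (\<lambda>x. p (g x)) c \<in> bcob CA NZ (Suc q)"
    using pb_npull_diff[OF assms(3) nerve_cochains_cochain, of c \<U> A q p] NZ_bcob assms(4)
    by (auto simp: nerve_cocycles_def)
  ultimately have "(pb f c - pb (\<lambda>x. p (g x)) c) - (pb g (npull \<W> q p c) - pb (\<lambda>x. p (g x)) c) \<in> bcob CA NZ (Suc q)"
    by (rule fs.subspace_diff[OF fsub_b])
  then show ?thesis using f by simp
qed

lemma pb_nerve_coboundaries:
  assumes f: "selection Z \<W> f" and c: "c \<in> nerve_coboundaries \<W> A q"
  shows "pb f c \<in> bcob CA NZ (Suc q)"
proof (cases q)
  case 0
  then have "pb f c = 0" using c by (simp add: nerve_coboundaries_def fun_eq_iff)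
  then show ?thesis using fs.subspace_0[OF fsub_b] by simp
next
  case (Suc j)
  then obtain b where b: "b \<in> nerve_cochains \<W> A j" "c = nerve_coboundary \<W> j b"
    using c by (auto simp: nerve_coboundaries_def)
  have "pb f (nerve_coboundary \<W> j b - lcob b) \<in> NZ (Suc (Suc j))"
  proof (rule pb_selection_null[OF f])
    show co: "nerve_coboundary \<W> j b - lcob b \<in> cochain (Suc (Suc j))"
      by (intro fs.subspace_diff[OF fsub_cochain] nerve_coboundary_cochain stableD(2)[OF stable_cochain] nerve_cochains_cochain[OF b(1)])
    show "vanish (nerve_coboundary \<W> j b - lcob b) {U \<in> \<W>. V \<subseteq> U}" if "y \<in> V" for y V
    proof (rule vanish_cochain[OF co])
      fix \<sigma> assume "set \<sigma> \<subseteq> {U \<in> \<W>. V \<subseteq> U}" "length \<sigma> = Suc (Suc j)"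
      then have "\<sigma> \<in> nerve_simplices \<W> (Suc j)" by (rule nerve_containing[OF that])
      then show "(nerve_coboundary \<W> j b - lcob b) \<sigma> = 0" by (simp add: nerve_coboundary_lcob)
    qed
  qed
  then have "lcob (pb f b) + pb f (nerve_coboundary \<W> j b - lcob b) \<in> bcob CA NZ (Suc q)"
    using pb_selection_rel[OF f b(1)] Suc by (intro bcobI stable_lzero) auto
  then show ?thesis using b(2) by (simp add: flinear_diff[OF flinear_pb] lcob_pb)
qed

text \<open>For the way back from points to nerves each member of the cover gets a point
  \<open>s W\<close>, taken in \<open>A\<close> whenever possible so that relative cochains stay
  relative. All members through \<open>y\<close> lie in the one set \<open>N (\<kappa> y)\<close>,
  so simplices go to small lists.\<close>

lemma section_cover:
  assumes N: "\<And>x. x \<in> topspace Z \<Longrightarrow> openin Z (N x) \<and> x \<in> N x"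
  obtains \<W> s \<kappa> where "open_cover Z \<W>" "\<And>W. W \<in> \<W> \<Longrightarrow> s W \<in> W \<and> (W \<inter> A \<noteq> {} \<longrightarrow> s W \<in> A)"
    "\<And>y. y \<in> topspace Z \<Longrightarrow> \<kappa> y \<in> topspace Z" "\<And>y W. W \<in> \<W> \<Longrightarrow> y \<in> W \<Longrightarrow> W \<subseteq> N (\<kappa> y)"
proof -
  obtain \<kappa> V where V: "\<And>x. x \<in> topspace Z \<Longrightarrow> \<kappa> x \<in> topspace Z"
    "\<And>y. y \<in> topspace Z \<Longrightarrow> openin Z (V y) \<and> y \<in> V y"
    "\<And>x y. y \<in> topspace Z \<Longrightarrow> x \<in> V y \<Longrightarrow> V y \<subseteq> N (\<kappa> x)"
    using barycentric_refinement[OF Z N] by metis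
  have "\<exists>x. x \<in> W \<and> (W \<inter> A \<noteq> {} \<longrightarrow> x \<in> A)" if "W \<in> V ` topspace Z" for W
    using that V(2) by blast
  then obtain s where s: "\<And>W. W \<in> V ` topspace Z \<Longrightarrow> s W \<in> W \<and> (W \<inter> A \<noteq> {} \<longrightarrow> s W \<in> A)" by metis
  show thesis
  proof (rule that[OF _ s V(1)])
    show "open_cover Z (V ` topspace Z)" unfolding open_cover_def using V(2) openin_subset by blast
    show "W \<subseteq> N (\<kappa> y)" if "W \<in> V ` topspace Z" "y \<in> W" for y W using that V(3) by blast
  qed
qed

lemma npull_relative:
  assumes N: "\<And>x. x \<in> topspace Z \<Longrightarrow> vanish c (N x \<inter> A)"
    and W: "open_cover Z \<W>" "\<And>W. W \<in> \<W> \<Longrightarrow> s W \<in> W \<and> (W \<inter> A \<noteq> {} \<longrightarrow> s W \<in> A)"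
    "\<And>y. y \<in> topspace Z \<Longrightarrow> \<kappa> y \<in> topspace Z" "\<And>y W. W \<in> \<W> \<Longrightarrow> y \<in> W \<Longrightarrow> W \<subseteq> N (\<kappa> y)"
  shows "npull \<W> q s c \<in> nerve_cochains \<W> A q"
  unfolding nerve_cochains_def
proof (clarsimp, rule ccontr)
  fix \<sigma> assume ne: "npull \<W> q s c \<sigma> \<noteq> 0" and "\<not> (\<sigma> \<in> nerve_simplices \<W> q \<and> \<Inter>(set \<sigma>) \<inter> A = {})"
  moreover have s: "\<sigma> \<in> nerve_simplices \<W> q" "c (map s \<sigma>) \<noteq> 0" using ne by (auto simp: npull_def split: if_splits)
  ultimately obtain y where y: "y \<in> \<Inter>(set \<sigma>)" "y \<in> A" by blast
  have "set (map s \<sigma>) \<subseteq> N (\<kappa> y) \<inter> A"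
  proof
    fix z assume "z \<in> set (map s \<sigma>)"
    then obtain U where U: "U \<in> set \<sigma>" "z = s U" by auto
    then have "U \<in> \<W>" "y \<in> U" using s(1) y unfolding nerve_simplices_def by auto
    then show "z \<in> N (\<kappa> y) \<inter> A" using W(2)[of U] W(4)[of U y] y U by blast
  qed
  moreover have "\<kappa> y \<in> topspace Z" using y W(3) closedin_subset[OF A] by blast
  ultimately show False using N s(2) unfolding vanish_def by blast
qed

lemma section_subset:
  assumes "\<sigma> \<in> nerve_simplices \<W> q" and W: "open_cover Z \<W>" "\<And>W. W \<in> \<W> \<Longrightarrow> s W \<in> W \<and> (W \<inter> A \<noteq> {} \<longrightarrow> s W \<in> A)"
    "\<And>y. y \<in> topspace Z \<Longrightarrow> \<kappa> y \<in> topspace Z" "\<And>y W. W \<in> \<W> \<Longrightarrow> y \<in> W \<Longrightarrow> W \<subseteq> N (\<kappa> y)"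
  obtains y where "y \<in> topspace Z" "set (map s \<sigma>) \<subseteq> N y"
proof -
  obtain y where y: "y \<in> \<Inter>(set \<sigma>)" using assms(1) unfolding nerve_simplices_def by blast
  have s: "set \<sigma> \<subseteq> \<W>" "\<sigma> \<noteq> []" using assms(1) unfolding nerve_simplices_def by auto
  then have "hd \<sigma> \<in> \<W>" "y \<in> hd \<sigma>" using y hd_in_set by blast+
  then have "y \<in> topspace Z" using W(1) unfolding open_cover_def by blast
  moreover have "set (map s \<sigma>) \<subseteq> N (\<kappa> y)" using s y W(2,4) by (auto simp: subset_iff)
  ultimately show thesis using that W(3) by blast
qed

text \<open>The point cocycle is pulled back to a nerve along \<open>s\<close>. A selection followed
  by \<open>s\<close> stays close to the identity, and within \<open>A\<close> when it starts there,
  so pulling back once more returns the original class.\<close>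

lemma rep_of_surjective:
  fixes c :: "'a list \<Rightarrow> 'k::field"
  assumes c: "c \<in> zcyc CA NZ (Suc q)"
  shows "\<exists>x\<in>cech_cocycles Z A q. rep_of x - c \<in> bcob CA NZ (Suc q)"
proof -
  have c1: "c \<in> CA (Suc q)" "lcob c \<in> NZ (Suc (Suc q))" using c by (auto simp: zcyc_def)
  obtain N where N: "\<And>x. x \<in> topspace Z \<Longrightarrow> openin Z (N x) \<and> x \<in> N x \<and> vanish (lcob c) (N x) \<and> vanish c (N x \<inter> A)"
    using common_neighbourhoods[OF Z A c1(2,1)] by metis
  obtain \<W> s \<kappa> where W: "open_cover Z \<W>" "\<And>W. W \<in> \<W> \<Longrightarrow> s W \<in> W \<and> (W \<inter> A \<noteq> {} \<longrightarrow> s W \<in> A)"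
    "\<And>y. y \<in> topspace Z \<Longrightarrow> \<kappa> y \<in> topspace Z" "\<And>y W. W \<in> \<W> \<Longrightarrow> y \<in> W \<Longrightarrow> W \<subseteq> N (\<kappa> y)"
    using section_cover[of N] N by metis
  let ?e = "npull \<W> q s c"
  have "?e \<in> nerve_cochains \<W> A q" using npull_relative[of c N \<W> s \<kappa>] N W by blast
  moreover have "nerve_coboundary \<W> q ?e \<sigma> = 0" for \<sigma>
  proof (cases "\<sigma> \<in> nerve_simplices \<W> (Suc q)")
    case True
    from section_subset[OF True, of s \<kappa> N] W obtain y where "y \<in> topspace Z" "set (map s \<sigma>) \<subseteq> N y" by blast
    then have "lcob c (map s \<sigma>) = 0" using N vanishD by blast
    then show ?thesis unfolding nerve_coboundary_npull[OF True] .
  qed (simp add: nerve_coboundary_def)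
  ultimately have e: "?e \<in> nerve_cocycles \<W> A q" by (simp add: nerve_cocycles_def fun_eq_iff)
  from rep_of_selection[OF W(1)] obtain f where f: "selection Z \<W> f" "rep_of (\<W>, ?e) = pb f ?e" by metis
  have "pb (\<lambda>x. s (f x)) c - pb (\<lambda>x. x) c \<in> bcob CA NZ (Suc q)"
  proof (rule homotopic_bcob[OF stable_lzero])
    have V: "\<exists>V. openin Z V \<and> x \<in> V \<and> V \<subseteq> N (\<kappa> x) \<and> (\<lambda>x. s (f x)) ` V \<subseteq> N (\<kappa> x) \<and> (\<lambda>x. s (f x)) ` (V \<inter> A) \<subseteq> A"
      if x: "x \<in> topspace Z" for x
    proof -
      from selectionD[OF f(1) x] obtain V where V: "openin Z V" "x \<in> V" "f ` V \<subseteq> {U \<in> \<W>. V \<subseteq> U}" .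
      have fV: "f z \<in> \<W>" "V \<subseteq> f z" "f z \<subseteq> N (\<kappa> x)" if "z \<in> V" for z
        using that V W(4)[of "f z" x] by blast+
      have "s (f z) \<in> N (\<kappa> x)" "z \<in> N (\<kappa> x)" if "z \<in> V" for z using fV[OF that] W(2)[of "f z"] that by blast+
      moreover have "s (f z) \<in> A" if "z \<in> V" "z \<in> A" for z using fV[OF that(1)] W(2)[of "f z"] that by blast
      ultimately show ?thesis using V by (intro exI[of _ V]) blast
    qed
    show "lprism (\<lambda>x. x) (\<lambda>x. s (f x)) c \<in> CA q"
    proof (rule lprism_lzero[OF lzero_cochain[OF c1(1)]])
      fix x assume x: "x \<in> topspace Z"
      from V[OF x] obtain V where "openin Z V \<and> x \<in> V \<and> V \<subseteq> N (\<kappa> x) \<and> (\<lambda>x. s (f x)) ` V \<subseteq> N (\<kappa> x) \<and> (\<lambda>x. s (f x)) ` (V \<inter> A) \<subseteq> A" ..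
      then show "\<exists>V Q. openin Z V \<and> x \<in> V \<and> vanish c Q \<and> (\<lambda>x. x) ` (V \<inter> A) \<subseteq> Q \<and> (\<lambda>x. s (f x)) ` (V \<inter> A) \<subseteq> Q"
        using N[OF W(3)[OF x]] by (intro exI[of _ V] exI[of _ "N (\<kappa> x) \<inter> A"]) auto
    qed
    show "lprism (\<lambda>x. x) (\<lambda>x. s (f x)) (lcob c) \<in> NZ (Suc q)"
    proof (rule lprism_lzero[OF lzero_cochain[OF c1(2)]])
      fix x assume x: "x \<in> topspace Z"
      from V[OF x] obtain V where "openin Z V \<and> x \<in> V \<and> V \<subseteq> N (\<kappa> x) \<and> (\<lambda>x. s (f x)) ` V \<subseteq> N (\<kappa> x) \<and> (\<lambda>x. s (f x)) ` (V \<inter> A) \<subseteq> A" ..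
      then show "\<exists>V Q. openin Z V \<and> x \<in> V \<and> vanish (lcob c) Q \<and> (\<lambda>x. x) ` (V \<inter> topspace Z) \<subseteq> Q \<and> (\<lambda>x. s (f x)) ` (V \<inter> topspace Z) \<subseteq> Q"
        using N[OF W(3)[OF x]] by (intro exI[of _ V] exI[of _ "N (\<kappa> x)"]) auto
    qed
  qed
  moreover have "pb f ?e - pb (\<lambda>x. s (f x)) c \<in> bcob CA NZ (Suc q)"
    using pb_npull_diff[OF f(1) lzero_cochain[OF c1(1)], of s] NZ_bcob by blast
  ultimately have "(pb f ?e - pb (\<lambda>x. s (f x)) c) + (pb (\<lambda>x. s (f x)) c - pb (\<lambda>x. x) c) \<in> bcob CA NZ (Suc q)"
    by (intro fs.subspace_add[OF fsub_b])
  moreover have "pb (\<lambda>x. x) c = c" by (simp add: fun_eq_iff)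
  ultimately have "rep_of (\<W>, ?e) - c \<in> bcob CA NZ (Suc q)" using f(2) by simp
  moreover have "(\<W>, ?e) \<in> cech_cocycles Z A q" using W(1) e by (simp add: cech_cocycles_def)
  ultimately show ?thesis by blast
qed

text \<open>If the two pullbacks to points differ by the coboundary of \<open>b\<close> and a
  locally vanishing cochain, then \<open>b\<close> pulled back along a section bounds the difference
  on the nerve of a fine enough cover.\<close>

lemma rep_of_injective:
  fixes c e :: "'a set list \<Rightarrow> 'k::field"
  assumes c: "(\<U>, c) \<in> cech_cocycles Z A q" and e: "(\<V>, e) \<in> cech_cocycles Z A q"
    and d: "rep_of (\<U>, c) - rep_of (\<V>, e) \<in> bcob CA NZ (Suc q)"
  shows "((\<U>, c), (\<V>, e)) \<in> cech_rel Z A q"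
proof -
  have oc: "open_cover Z \<U>" "open_cover Z \<V>" using c e by (auto simp: cech_cocycles_def)
  from rep_of_selection[OF oc(1)] obtain f where f: "selection Z \<U> f" "rep_of (\<U>, c) = pb f c" by metis
  from rep_of_selection[OF oc(2)] obtain g where g: "selection Z \<V> g" "rep_of (\<V>, e) = pb g e" by metis
  obtain b n where bn: "b \<in> CA q" "n \<in> NZ (Suc q)" "pb f c - pb g e = lcob b + n"
    using d f g by (auto elim!: bcobE)
  obtain N0 where N0: "\<And>x. x \<in> topspace Z \<Longrightarrow> openin Z (N0 x) \<and> x \<in> N0 x \<and> vanish n (N0 x) \<and> vanish b (N0 x \<inter> A)"
    using common_neighbourhoods[OF Z A bn(2,1)] by metis
  \<comment> \<open>Besides killing \<open>n\<close>, and \<open>b\<close> within \<open>A\<close>,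
    the neighbourhoods are contained in the members selected at their own points; hence
    \<open>f (s W)\<close> and \<open>g (s W)\<close> define refinement maps.\<close>
  have "\<exists>N. openin Z N \<and> x \<in> N \<and> vanish n N \<and> vanish b (N \<inter> A) \<and> (\<forall>z\<in>N. N \<subseteq> f z) \<and> (\<forall>z\<in>N. N \<subseteq> g z)"
    if x: "x \<in> topspace Z" for x
  proof -
    from selectionD[OF f(1) x] obtain V where V: "openin Z V" "x \<in> V" "f ` V \<subseteq> {U \<in> \<U>. V \<subseteq> U}" .
    from selectionD[OF g(1) x] obtain V' where V': "openin Z V'" "x \<in> V'" "g ` V' \<subseteq> {U \<in> \<V>. V' \<subseteq> U}" .
    let ?N = "N0 x \<inter> V \<inter> V'"
    have "vanish n ?N" "vanish b (?N \<inter> A)"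
      using vanish_mono[of n "N0 x" ?N] vanish_mono[of b "N0 x \<inter> A" "?N \<inter> A"] N0[OF x] by blast+
    moreover have "openin Z ?N" using N0[OF x] V V' by (intro openin_Int) auto
    ultimately show ?thesis using N0[OF x] V V' by (intro exI[of _ ?N]) blast
  qed
  then obtain N where N: "\<And>x. x \<in> topspace Z \<Longrightarrow> openin Z (N x) \<and> x \<in> N x \<and> vanish n (N x) \<and> vanish b (N x \<inter> A) \<and>
      (\<forall>z\<in>N x. N x \<subseteq> f z) \<and> (\<forall>z\<in>N x. N x \<subseteq> g z)" by metis
  obtain \<W> s \<kappa> where W: "open_cover Z \<W>" "\<And>W. W \<in> \<W> \<Longrightarrow> s W \<in> W \<and> (W \<inter> A \<noteq> {} \<longrightarrow> s W \<in> A)"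
    "\<And>y. y \<in> topspace Z \<Longrightarrow> \<kappa> y \<in> topspace Z" "\<And>y W. W \<in> \<W> \<Longrightarrow> y \<in> W \<Longrightarrow> W \<subseteq> N (\<kappa> y)"
    using section_cover[of N] N by metis
  have sW: "s W \<in> topspace Z" "W \<subseteq> f (s W)" "W \<subseteq> g (s W)" if "W \<in> \<W>" for W
  proof -
    show sZ: "s W \<in> topspace Z" using that W(1,2) unfolding open_cover_def by blast
    have "W \<subseteq> N (\<kappa> (s W))" using W(2,4) that by blast
    then show "W \<subseteq> f (s W)" "W \<subseteq> g (s W)" using N[OF W(3)[OF sZ]] W(2)[OF that] by blast+
  qed
  have p: "refinement_map \<W> \<U> (\<lambda>W. f (s W))" and r: "refinement_map \<W> \<V> (\<lambda>W. g (s W))"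
    using sW f(1) g(1) unfolding refinement_map_def selection_def by blast+
  have D: "nerve_pullback \<W> q (\<lambda>W. f (s W)) c \<sigma> - nerve_pullback \<W> q (\<lambda>W. g (s W)) e \<sigma> = lcob b (map s \<sigma>)"
    if s: "\<sigma> \<in> nerve_simplices \<W> q" for \<sigma>
  proof -
    from section_subset[OF s, of s \<kappa> N] W obtain y where "y \<in> topspace Z" "set (map s \<sigma>) \<subseteq> N y" by blast
    then have "n (map s \<sigma>) = 0" using N vanishD by blast
    then have "(pb f c - pb g e) (map s \<sigma>) = lcob b (map s \<sigma>)" unfolding bn(3) by simp
    then show ?thesis using s by (simp add: nerve_pullback_def comp_def)
  qed
  have "(\<lambda>\<sigma>. nerve_pullback \<W> q (\<lambda>W. f (s W)) c \<sigma> - nerve_pullback \<W> q (\<lambda>W. g (s W)) e \<sigma>) \<in> nerve_coboundaries \<W> A q"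
  proof (cases q)
    \<comment> \<open>In degree 0 the only coboundary is zero, and \<open>b\<close> lives at index
      0, so it is zero as well.\<close>
    case 0
    then have "b = 0" using bn(1) stableD(3)[OF stable_lzero] by blast
    then have "lcob b \<sigma> = 0" for \<sigma> using lcob_zero by (metis zero_fun_apply)
    then have "nerve_pullback \<W> q (\<lambda>W. f (s W)) c \<sigma> - nerve_pullback \<W> q (\<lambda>W. g (s W)) e \<sigma> = 0" for \<sigma>
      using D[of \<sigma>] by (cases "\<sigma> \<in> nerve_simplices \<W> q") (simp_all add: nerve_pullback_def)
    then have "(\<lambda>\<sigma>. nerve_pullback \<W> q (\<lambda>W. f (s W)) c \<sigma> - nerve_pullback \<W> q (\<lambda>W. g (s W)) e \<sigma>) = (\<lambda>_. 0)"
      by (rule ext)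
    then show ?thesis using 0 by (simp add: nerve_coboundaries_def)
  next
    case (Suc j)
    have b': "npull \<W> j s b \<in> nerve_cochains \<W> A j" using npull_relative[of b N \<W> s \<kappa>] N W by blast
    have "nerve_pullback \<W> q (\<lambda>W. f (s W)) c \<sigma> - nerve_pullback \<W> q (\<lambda>W. g (s W)) e \<sigma> = nerve_coboundary \<W> j (npull \<W> j s b) \<sigma>" for \<sigma>
    proof (cases "\<sigma> \<in> nerve_simplices \<W> q")
      case True
      then show ?thesis using D[OF True] nerve_coboundary_npull[of \<sigma> \<W> j s b] Suc by simp
    next
      case False
      then show ?thesis using Suc by (simp add: nerve_pullback_def nerve_coboundary_def)
    qed
    then have "(\<lambda>\<sigma>. nerve_pullback \<W> q (\<lambda>W. f (s W)) c \<sigma> - nerve_pullback \<W> q (\<lambda>W. g (s W)) e \<sigma>) = nerve_coboundary \<W> j (npull \<W> j s b)"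
      by (rule ext)
    then show ?thesis using Suc b' by (simp add: nerve_coboundaries_def)
  qed
  then show ?thesis unfolding cech_rel_def using c e W(1) p r by blast
qed

lemma diff_sym: "a - b \<in> bcob CA NZ l \<Longrightarrow> b - a \<in> bcob CA NZ l"
  using fs.subspace_neg[OF fsub_b, of "a - b"] by simp

lemma diff_trans: "a - b \<in> bcob CA NZ l \<Longrightarrow> b - c \<in> bcob CA NZ l \<Longrightarrow> a - c \<in> bcob CA NZ l"
  using fs.subspace_add[OF fsub_b, of "a - b" l "b - c"] by simp

lemma cech_rel_iff:
  fixes x y :: "'a set set \<times> ('a set list \<Rightarrow> 'k::field)"
  shows "(x, y) \<in> cech_rel Z A q \<longleftrightarrow> x \<in> cech_cocycles Z A q \<and> y \<in> cech_cocycles Z A q \<and>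
    rep_of x - rep_of y \<in> bcob CA NZ (Suc q)"
proof
  obtain \<U> c \<V> e where xy: "x = (\<U>, c)" "y = (\<V>, e)" by (cases x, cases y)
  assume "(x, y) \<in> cech_rel Z A q"
  then obtain \<W> p r where W: "x \<in> cech_cocycles Z A q" "y \<in> cech_cocycles Z A q" "open_cover Z \<W>"
    "refinement_map \<W> \<U> p" "refinement_map \<W> \<V> r"
    "(\<lambda>\<sigma>. npull \<W> q p c \<sigma> - npull \<W> q r e \<sigma>) \<in> nerve_coboundaries \<W> A q"
    unfolding cech_rel_def xy nerve_pullback_npull by blast
  have ce: "open_cover Z \<U>" "c \<in> nerve_cocycles \<U> A q" "open_cover Z \<V>" "e \<in> nerve_cocycles \<V> A q"
    using W(1,2) xy by (auto simp: cech_cocycles_def)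
  obtain g where g: "selection Z \<W> g" using selection_exists[OF Z W(3)] by blast
  have 1: "rep_of x - pb g (npull \<W> q p c) \<in> bcob CA NZ (Suc q)"
    unfolding xy by (rule rep_of_refine[OF ce(1) W(4) g ce(2)])
  have 2: "rep_of y - pb g (npull \<W> q r e) \<in> bcob CA NZ (Suc q)"
    unfolding xy by (rule rep_of_refine[OF ce(3) W(5) g ce(4)])
  have "pb g (\<lambda>\<sigma>. npull \<W> q p c \<sigma> - npull \<W> q r e \<sigma>) \<in> bcob CA NZ (Suc q)"
    by (rule pb_nerve_coboundaries[OF g W(6)])
  moreover have "pb g (\<lambda>\<sigma>. npull \<W> q p c \<sigma> - npull \<W> q r e \<sigma>) = pb g (npull \<W> q p c) - pb g (npull \<W> q r e)"
    by (simp add: fun_eq_iff)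
  ultimately have 3: "pb g (npull \<W> q p c) - pb g (npull \<W> q r e) \<in> bcob CA NZ (Suc q)" by metis
  have "rep_of x - rep_of y \<in> bcob CA NZ (Suc q)" by (rule diff_trans[OF 1 diff_trans[OF 3 diff_sym[OF 2]]])
  then show "x \<in> cech_cocycles Z A q \<and> y \<in> cech_cocycles Z A q \<and> rep_of x - rep_of y \<in> bcob CA NZ (Suc q)"
    using W by blast
next
  assume "x \<in> cech_cocycles Z A q \<and> y \<in> cech_cocycles Z A q \<and> rep_of x - rep_of y \<in> bcob CA NZ (Suc q)"
  then show "(x, y) \<in> cech_rel Z A q" using rep_of_injective by (metis prod.exhaust)
qed

text \<open>The comparison is turned round: a point cocycle is sent to the set of all its Cech
  representatives. Sums and multiples can then be formed on functions, whereas
  \<open>cech_add\<close> and \<open>cech_smult\<close> act on whole classes.\<close>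

definition cclass :: "nat \<Rightarrow> ('a list \<Rightarrow> 'k::field) \<Rightarrow> ('a set set \<times> ('a set list \<Rightarrow> 'k)) set" where
  "cclass q v = {x \<in> cech_cocycles Z A q. rep_of x - v \<in> bcob CA NZ (Suc q)}"

lemma cclass_eq_iff:
  assumes "v \<in> zcyc CA NZ (Suc q)"
  shows "cclass q v = cclass q w \<longleftrightarrow> v - w \<in> bcob CA NZ (Suc q)"
proof
  obtain x where x: "x \<in> cech_cocycles Z A q" "rep_of x - v \<in> bcob CA NZ (Suc q)" using rep_of_surjective[OF assms] by blast
  assume "cclass q v = cclass q w"
  then have "rep_of x - w \<in> bcob CA NZ (Suc q)" using x unfolding cclass_def by blast
  then show "v - w \<in> bcob CA NZ (Suc q)" using x diff_sym diff_trans by blast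
next
  assume "v - w \<in> bcob CA NZ (Suc q)"
  then show "cclass q v = cclass q w" unfolding cclass_def using diff_sym diff_trans by blast
qed

lemma cech_rel_image: "x \<in> cech_cocycles Z A q \<Longrightarrow> cech_rel Z A q `` {x} = cclass q (rep_of x)"
  unfolding cclass_def using cech_rel_iff diff_sym by blast

lemma cech_rel_Image:
  assumes "S \<noteq> {}" "S \<subseteq> cclass q v" "v \<in> zcyc CA NZ (Suc q)"
  shows "cech_rel Z A q `` S = cclass q v"
proof -
  have "cech_rel Z A q `` {x} = cclass q v" if "x \<in> S" for x
  proof -
    have x: "x \<in> cech_cocycles Z A q" "rep_of x - v \<in> bcob CA NZ (Suc q)" using that assms(2) unfolding cclass_def by auto
    show ?thesis unfolding cech_rel_image[OF x(1)] using cclass_eq_iff[OF rep_of_zcyc[OF x(1)]] x(2) by blast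
  qed
  then show ?thesis using assms(1) by (auto simp: Image_def)
qed

lemma cech_cohomology_dim:
  "vectorspace.fin_dim class_ring (cech_cohomology Z A q :: ('k::field, _) module) \<longleftrightarrow> hfd CA (NZ :: ('a, 'k) complex) (Suc q)"
  "vectorspace.dim class_ring (cech_cohomology Z A q :: ('k, _) module) = hdim CA (NZ :: ('a, 'k) complex) (Suc q)"
  "carrier (cech_cohomology Z A q :: ('k, _) module) = cclass q ` zcyc CA (NZ :: ('a, 'k) complex) (Suc q)"
  "cech_zero Z A q = cclass q (0 :: 'a list \<Rightarrow> 'k)"
proof -
  let ?Z = "zcyc CA (NZ :: ('a, 'k) complex) (Suc q)" and ?B = "bcob CA (NZ :: ('a, 'k) complex) (Suc q)"
  let ?V = "cech_cohomology Z A q :: ('k, _) module"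
  have fZ: "fsub ?Z" by (rule fsub_zcyc[OF stable_lzero stable_lzero])
  have Z0: "0 \<in> ?Z" by (rule fs.subspace_0[OF fZ])
  show carr: "carrier ?V = cclass q ` ?Z"
  proof
    show "carrier ?V \<subseteq> cclass q ` ?Z"
    proof
      fix u assume "u \<in> carrier ?V"
      then obtain x where x: "x \<in> cech_cocycles Z A q" "u = cech_rel Z A q `` {x}"
        unfolding cech_cohomology_def quotient_def by auto
      then show "u \<in> cclass q ` ?Z" using cech_rel_image[OF x(1)] rep_of_zcyc[OF x(1)] by simp
    qed
    show "cclass q ` ?Z \<subseteq> carrier ?V"
    proof (rule image_subsetI)
      fix v :: "'a list \<Rightarrow> 'k" assume v: "v \<in> ?Z"
      obtain x where x: "x \<in> cech_cocycles Z A q" "rep_of x - v \<in> ?B" using rep_of_surjective[OF v] by blast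
      have "cclass q v = cech_rel Z A q `` {x}"
        unfolding cech_rel_image[OF x(1)] using cclass_eq_iff[OF rep_of_zcyc[OF x(1)]] x(2) by blast
      then show "cclass q v \<in> carrier ?V" unfolding cech_cohomology_def quotient_def using x by auto
    qed
  qed
  show zero: "cech_zero Z A q = cclass q (0 :: 'a list \<Rightarrow> 'k)"
    unfolding cech_zero_def
  proof (rule cech_rel_Image[OF _ _ Z0])
    have "nerve_coboundary {topspace Z} q (\<lambda>_. 0 :: 'k) = (\<lambda>_. 0)" by (auto simp: nerve_coboundary_def fun_eq_iff)
    then have "({topspace Z}, \<lambda>_. 0 :: 'k) \<in> cech_cocycles Z A q"
      by (simp add: cech_cocycles_def open_cover_def nerve_cocycles_def nerve_cochains_def)
    moreover have "rep_of ({topspace Z}, \<lambda>_. 0 :: 'k) = 0" by (simp add: rep_of_def fun_eq_iff)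
    ultimately show "{({topspace Z}, \<lambda>_. 0)} \<subseteq> cclass q (0 :: 'a list \<Rightarrow> 'k)"
      unfolding cclass_def using fs.subspace_0[OF fsub_b] by simp
  qed simp
  have eq: "cclass q v = cclass q w \<longleftrightarrow> v - w \<in> ?B" if "v \<in> ?Z" "w \<in> ?Z" for v w
    by (rule cclass_eq_iff[OF that(1)])
  have add: "add ?V (cclass q v) (cclass q w) = cclass q (v + w)" if v: "v \<in> ?Z" and w: "w \<in> ?Z" for v w
  proof -
    let ?S = "{(\<W>, \<lambda>\<sigma>. npull \<W> q p c \<sigma> + npull \<W> q r e \<sigma>) | \<W> p r \<U> c \<V> e.
        (\<U>, c) \<in> cclass q v \<and> (\<V>, e) \<in> cclass q w \<and> open_cover Z \<W> \<and>
        refinement_map \<W> \<U> p \<and> refinement_map \<W> \<V> r}"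
    have "cech_rel Z A q `` ?S = cclass q (v + w)"
    proof (rule cech_rel_Image)
      show "v + w \<in> ?Z" by (rule fs.subspace_add[OF fZ v w])
      obtain \<U> c where c: "(\<U>, c) \<in> cclass q v" using rep_of_surjective[OF v] unfolding cclass_def by auto
      obtain \<V> e where e: "(\<V>, e) \<in> cclass q w" using rep_of_surjective[OF w] unfolding cclass_def by auto
      have oc: "open_cover Z \<U>" "open_cover Z \<V>" using c e unfolding cclass_def cech_cocycles_def by auto
      \<comment> \<open>Pairwise intersections form a common refinement, so the set of sums is not
        empty and generates a class.\<close>
      let ?W = "(\<lambda>(U, V). U \<inter> V) ` (\<U> \<times> \<V>)"
      have "\<Union>?W = \<Union>\<U> \<inter> \<Union>\<V>" by auto
      moreover have "openin Z W" if "W \<in> ?W" for W using that oc unfolding open_cover_def by (auto intro: openin_Int)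
      ultimately have "open_cover Z ?W" using oc unfolding open_cover_def by simp
      moreover have "\<forall>W\<in>?W. \<exists>U. U \<in> \<U> \<and> W \<subseteq> U" "\<forall>W\<in>?W. \<exists>U. U \<in> \<V> \<and> W \<subseteq> U" by auto
      then obtain p r where "refinement_map ?W \<U> p" "refinement_map ?W \<V> r"
        unfolding refinement_map_def bchoice_iff by auto
      ultimately show "?S \<noteq> {}" using c e by blast
      show "?S \<subseteq> cclass q (v + w)"
      proof
        fix x assume "x \<in> ?S"
        then obtain \<W> p r \<U> c \<V> e where x: "x = (\<W>, \<lambda>\<sigma>. npull \<W> q p c \<sigma> + npull \<W> q r e \<sigma>)"
          and ce: "(\<U>, c) \<in> cclass q v" "(\<V>, e) \<in> cclass q w" and W: "open_cover Z \<W>"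
          "refinement_map \<W> \<U> p" "refinement_map \<W> \<V> r" by blast
        have cc: "open_cover Z \<U>" "c \<in> nerve_cocycles \<U> A q" "open_cover Z \<V>" "e \<in> nerve_cocycles \<V> A q"
          using ce by (auto simp: cclass_def cech_cocycles_def)
        have n: "npull \<W> q p c \<in> nerve_cocycles \<W> A q" "npull \<W> q r e \<in> nerve_cocycles \<W> A q"
          using npull_cocycle W cc by blast+
        have "(\<lambda>\<sigma>. npull \<W> q p c \<sigma> + npull \<W> q r e \<sigma>) \<in> nerve_cocycles \<W> A q"
          unfolding nerve_cocycles_def
        proof (intro CollectI conjI)
          show "(\<lambda>\<sigma>. npull \<W> q p c \<sigma> + npull \<W> q r e \<sigma>) \<in> nerve_cochains \<W> A q"
            using n unfolding nerve_cocycles_def nerve_cochains_def by (smt (verit) add_0 mem_Collect_eq)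
          have "nerve_coboundary \<W> q (\<lambda>\<sigma>. npull \<W> q p c \<sigma> + npull \<W> q r e \<sigma>) \<sigma>
              = nerve_coboundary \<W> q (npull \<W> q p c) \<sigma> + nerve_coboundary \<W> q (npull \<W> q r e) \<sigma>" for \<sigma>
            by (simp add: nerve_coboundary_def distrib_left sum.distrib)
          then show "nerve_coboundary \<W> q (\<lambda>\<sigma>. npull \<W> q p c \<sigma> + npull \<W> q r e \<sigma>) = (\<lambda>_. 0)"
            using n by (simp add: nerve_cocycles_def fun_eq_iff)
        qed
        then have "x \<in> cech_cocycles Z A q" using x W by (simp add: cech_cocycles_def)
        from rep_of_selection[OF W(1)] obtain g where g: "selection Z \<W> g" "\<And>c :: 'a set list \<Rightarrow> 'k. rep_of (\<W>, c) = pb g c" by metis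
        have rx: "rep_of x = pb g (npull \<W> q p c) + pb g (npull \<W> q r e)" unfolding x g(2) by (simp add: fun_eq_iff)
        have 1: "pb g (npull \<W> q p c) - v \<in> ?B"
          by (rule diff_trans[OF diff_sym[OF rep_of_refine[OF cc(1) W(2) g(1) cc(2)]]])
            (use ce(1) in \<open>simp add: cclass_def\<close>)
        have 2: "pb g (npull \<W> q r e) - w \<in> ?B"
          by (rule diff_trans[OF diff_sym[OF rep_of_refine[OF cc(3) W(3) g(1) cc(4)]]])
            (use ce(2) in \<open>simp add: cclass_def\<close>)
        have "rep_of x - (v + w) \<in> ?B" using fs.subspace_add[OF fsub_b 1 2] unfolding rx add_diff_add .
        then show "x \<in> cclass q (v + w)" unfolding cclass_def using \<open>x \<in> cech_cocycles Z A q\<close> by blast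
      qed
    qed
    then show ?thesis unfolding cech_cohomology_def cech_add_def nerve_pullback_npull by simp
  qed
  have smult: "module.smult ?V a (cclass q v) = cclass q (fscale a v)" if v: "v \<in> ?Z" for a v
  proof -
    let ?S = "{(\<U>, \<lambda>\<sigma>. a * c \<sigma>) | \<U> c. (\<U>, c) \<in> cclass q v}"
    have "cech_rel Z A q `` ?S = cclass q (fscale a v)"
    proof (rule cech_rel_Image)
      show "fscale a v \<in> ?Z" by (rule fs.subspace_scale[OF fZ v])
      show "?S \<noteq> {}" using rep_of_surjective[OF v] unfolding cclass_def by auto
      show "?S \<subseteq> cclass q (fscale a v)"
      proof
        fix x assume "x \<in> ?S"
        then obtain \<U> c where x: "x = (\<U>, \<lambda>\<sigma>. a * c \<sigma>)" and c: "(\<U>, c) \<in> cclass q v" by blast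
        have cc: "open_cover Z \<U>" "c \<in> nerve_cocycles \<U> A q" using c by (auto simp: cclass_def cech_cocycles_def)
        have "(\<lambda>\<sigma>. a * c \<sigma>) \<in> nerve_cocycles \<U> A q"
          unfolding nerve_cocycles_def
        proof (intro CollectI conjI)
          show "(\<lambda>\<sigma>. a * c \<sigma>) \<in> nerve_cochains \<U> A q"
            using cc unfolding nerve_cocycles_def nerve_cochains_def by auto
          have "nerve_coboundary \<U> q (\<lambda>\<sigma>. a * c \<sigma>) \<sigma> = a * nerve_coboundary \<U> q c \<sigma>" for \<sigma>
            by (cases "\<sigma> \<in> nerve_simplices \<U> (Suc q)")
              (simp_all add: nerve_coboundary_lcob lcob_scale, simp_all add: nerve_coboundary_def)
          then show "nerve_coboundary \<U> q (\<lambda>\<sigma>. a * c \<sigma>) = (\<lambda>_. 0)" using cc by (simp add: nerve_cocycles_def fun_eq_iff)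
        qed
        then have "x \<in> cech_cocycles Z A q" using x cc by (simp add: cech_cocycles_def)
        moreover have eq: "rep_of x - fscale a v = fscale a (rep_of (\<U>, c) - v)"
          unfolding x rep_of_def by (simp add: fun_eq_iff right_diff_distrib)
        have "rep_of (\<U>, c) - v \<in> ?B" using c by (simp add: cclass_def)
        then have "rep_of x - fscale a v \<in> ?B" unfolding eq by (rule fs.subspace_scale[OF fsub_b])
        ultimately show "x \<in> cclass q (fscale a v)" unfolding cclass_def by blast
      qed
    qed
    then show ?thesis unfolding cech_cohomology_def cech_smult_def by simp
  qed
  have z: "zero ?V = cclass q 0" unfolding cech_cohomology_def using zero by simp
  show "vectorspace.fin_dim class_ring ?V \<longleftrightarrow> qfd ?Z ?B"
    by (rule quotient_vectorspace(1)[OF fZ fsub_b carr eq add smult z])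
  show "vectorspace.dim class_ring ?V = qdim ?Z ?B"
    by (rule quotient_vectorspace(2)[OF fZ fsub_b carr eq add smult z])
qed

end

theorem cech_lzero:
  assumes Z: "compact_space Z" "Hausdorff_space Z" and A: "closedin Z A"
  shows "cech_fin_dim TYPE('k::field) Z A q \<longleftrightarrow> hfd (lzero Z A) (lzero Z (topspace Z) :: ('a, 'k) complex) (Suc q)"
    and "cech_dim TYPE('k) Z A q = hdim (lzero Z A) (lzero Z (topspace Z) :: ('a, 'k) complex) (Suc q)"
    and "q \<notin> cech_support TYPE('k) Z A \<Longrightarrow> hdim (lzero Z A) (lzero Z (topspace Z) :: ('a, 'k) complex) (Suc q) = 0"
    and "q \<notin> cech_support TYPE('k) Z A \<Longrightarrow> hfd (lzero Z A) (lzero Z (topspace Z) :: ('a, 'k) complex) (Suc q)"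
proof -
  note dim = cech_cohomology_dim[OF Z A, where 'k='k and q=q]
  show "cech_fin_dim TYPE('k) Z A q \<longleftrightarrow> hfd (lzero Z A) (lzero Z (topspace Z) :: ('a, 'k) complex) (Suc q)"
    unfolding cech_fin_dim_def by (rule dim(1))
  show "cech_dim TYPE('k) Z A q = hdim (lzero Z A) (lzero Z (topspace Z) :: ('a, 'k) complex) (Suc q)"
    unfolding cech_dim_def by (rule dim(2))
  let ?Z = "zcyc (lzero Z A) (lzero Z (topspace Z) :: ('a, 'k) complex) (Suc q)"
  let ?B = "bcob (lzero Z A) (lzero Z (topspace Z) :: ('a, 'k) complex) (Suc q)"
  assume "q \<notin> cech_support TYPE('k) Z A"
  then have "carrier (cech_cohomology Z A q :: ('k, _) module) = {cech_zero Z A q}" by (simp add: cech_support_def)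
  then have "cclass Z A q ` ?Z = {cclass Z A q 0}" unfolding dim(3,4) .
  then have "v \<in> ?B" if "v \<in> ?Z" for v using cclass_eq_iff[OF Z A that, of 0] that by auto
  moreover have "?B \<subseteq> ?Z"
    by (rule bcob_zcyc[OF stable_lzero stable_lzero lzero_mono[OF closedin_subset[OF A]]])
  ultimately have "?Z = ?B" by blast
  then show "qdim ?Z ?B = 0" "qfd ?Z ?B"
    using qdim_self qfd_self fsub_bcob[OF stable_lzero stable_lzero] by metis+
qed

section \<open>Comparison of pairs\<close>

text \<open>The composites of the two pullbacks agree with the identity modulo \<open>S\<close> and
  \<open>S'\<close> already on cochains, so no homotopy enters.\<close>

lemma hdim_iso_pb:
  fixes T S :: "('x, 'k::field) complex" and T' S' :: "('y, 'k) complex"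
  assumes st: "stable T" "stable S" "stable T'" "stable S'"
    and f: "\<And>l c. c \<in> T l \<Longrightarrow> pb f c \<in> T' l" "\<And>l c. c \<in> S l \<Longrightarrow> pb f c \<in> S' l"
    and g: "\<And>l c. c \<in> T' l \<Longrightarrow> pb g c \<in> T l" "\<And>l c. c \<in> S' l \<Longrightarrow> pb g c \<in> S l"
    and fg: "\<And>c. c \<in> T l \<Longrightarrow> c - pb g (pb f c) \<in> S l" "\<And>c. c \<in> T' l \<Longrightarrow> c - pb f (pb g c) \<in> S' l"
  shows "hfd T S l = hfd T' S' l \<and> hdim T S l = hdim T' S' l"
proof (rule quotient_iso[OF flinear_pb[of f]])
  show "fsub (zcyc T S l)" by (rule fsub_zcyc[OF st(1,2)])
  show fB: "fsub (bcob T S l)" by (rule fsub_bcob[OF st(1,2)])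
  show "fsub (bcob T' S' l)" by (rule fsub_bcob[OF st(3,4)])
  show "pb f z \<in> zcyc T' S' l" if "z \<in> zcyc T S l" for z
    using pb_zcyc[OF f that] .
  show "\<exists>z\<in>zcyc T S l. w - pb f z \<in> bcob T' S' l" if w: "w \<in> zcyc T' S' l" for w
  proof
    show "pb g w \<in> zcyc T S l" using pb_zcyc[OF g w] .
    have "w \<in> T' l" using w by (simp add: zcyc_def)
    from fg(2)[OF this] show "w - pb f (pb g w) \<in> bcob T' S' l" using small_bcob[OF st(3), of S' l] by blast
  qed
  show "pb f z \<in> bcob T' S' l \<longleftrightarrow> z \<in> bcob T S l" if z: "z \<in> zcyc T S l" for z
  proof
    assume "pb f z \<in> bcob T' S' l"
    from pb_bcob[OF g this st(1)] have 1: "pb g (pb f z) \<in> bcob T S l" .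
    have "z \<in> T l" using z by (simp add: zcyc_def)
    from fg(1)[OF this] have "z - pb g (pb f z) \<in> bcob T S l" using small_bcob[OF st(1), of S l] by blast
    from fsub_diffD[OF fB this 1] show "z \<in> bcob T S l" .
  next
    assume "z \<in> bcob T S l"
    from pb_bcob[OF f this st(3)] show "pb f z \<in> bcob T' S' l" .
  qed
qed

lemma pb_inverse_null:
  assumes c: "c \<in> cochain l" and "\<And>x. x \<in> A \<Longrightarrow> f (g x) = x"
  shows "c - pb g (pb f c) \<in> lzero Z A l"
proof (rule lzero_vanish)
  show "c - pb g (pb f c) \<in> cochain l" by (intro fs.subspace_diff[OF fsub_cochain] pb_cochain c)
  show "vanish (c - pb g (pb f c)) A"
    unfolding vanish_def
  proof (intro allI impI)
    fix \<sigma> assume "set \<sigma> \<subseteq> A"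
    then have "map f (map g \<sigma>) = \<sigma>" using assms(2) unfolding map_map by (intro map_idI) auto
    then show "(c - pb g (pb f c)) \<sigma> = 0" by (simp del: map_map)
  qed
qed

text \<open>The pair on \<open>W\<close> computes the cohomology of \<open>A\<close> without leaving
  \<open>W\<close>: all cochains modulo those that vanish on small lists in \<open>A\<close>. So
  \<open>\<phi>\<close> is pulled back as a bare map on points; its values off \<open>A\<close>
  change a cochain only within \<open>lzero W A\<close>.\<close>

lemma lzero_subspace_hdim:
  fixes W :: "'x topology" and X :: "'y topology"
  assumes A: "closedin W A" and h: "homeomorphic_maps (subtopology W A) X \<phi> \<psi>"
  shows "hfd (lzero W {}) (lzero W A :: ('x, 'k::field) complex) l = hfd (lzero X {}) (lzero X (topspace X) :: ('y, 'k) complex) l \<and>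
    hdim (lzero W {}) (lzero W A :: ('x, 'k) complex) l = hdim (lzero X {}) (lzero X (topspace X) :: ('y, 'k) complex) l"
proof (rule hdim_iso_pb[OF stable_lzero stable_lzero stable_lzero stable_lzero, where f = \<psi> and g = \<phi>])
  have AW: "A \<subseteq> topspace W" by (rule closedin_subset[OF A])
  have c: "continuous_map (subtopology W A) X \<phi>" "continuous_map X (subtopology W A) \<psi>"
    "\<And>x. x \<in> A \<Longrightarrow> \<psi> (\<phi> x) = x" "\<And>y. y \<in> topspace X \<Longrightarrow> \<phi> (\<psi> y) = y"
    using h AW by (auto simp: homeomorphic_maps_def)
  have \<psi>: "continuous_map X W \<psi>" "\<psi> ` topspace X \<subseteq> A" using c(2) by (auto simp: continuous_map_in_subtopology)
  have \<phi>: "\<phi> x \<in> topspace X" if "x \<in> A" for x using c(1) AW that by (auto simp: continuous_map_def)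
  show "pb \<psi> c \<in> lzero X {} l" if "c \<in> lzero W {} l" for l and c :: "'x list \<Rightarrow> 'k"
    using that by (simp add: lzero_empty pb_cochain)
  show "pb \<phi> c \<in> lzero W {} l" if "c \<in> lzero X {} l" for l and c :: "'y list \<Rightarrow> 'k"
    using that by (simp add: lzero_empty pb_cochain)
  show "pb \<psi> c \<in> lzero X (topspace X) l" if "c \<in> lzero W A l" for l and c :: "'x list \<Rightarrow> 'k"
    by (rule pb_lzero_continuous[OF \<psi> that])
  show "pb \<phi> c \<in> lzero W A l" if e: "c \<in> lzero X (topspace X) l" for l and c :: "'y list \<Rightarrow> 'k"
  proof (rule lzeroI_closed[OF A pb_cochain[OF lzero_cochain[OF e]]])
    fix x assume x: "x \<in> A"
    from lzeroD[OF e \<phi>[OF x]] obtain V where V: "openin X V" "\<phi> x \<in> V" "vanish c (V \<inter> topspace X)" .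
    have "openin (subtopology W A) {x \<in> topspace (subtopology W A). \<phi> x \<in> V}"
      by (rule openin_continuous_map_preimage[OF c(1) V(1)])
    then obtain O' where O': "openin W O'" "{x \<in> topspace (subtopology W A). \<phi> x \<in> V} = O' \<inter> A"
      unfolding openin_subtopology by blast
    have "O' \<inter> A = {x \<in> A. \<phi> x \<in> V}" using O'(2) AW by auto
    then have "x \<in> O'" "\<phi> ` (O' \<inter> A) \<subseteq> V \<inter> topspace X" using x V \<phi> by auto
    then show "\<exists>V. openin W V \<and> x \<in> V \<and> vanish (pb \<phi> c) (V \<inter> A)" using O'(1) vanish_pb[OF V(3)] by blast
  qed
  show "c - pb \<phi> (pb \<psi> c) \<in> lzero W A l" if "c \<in> lzero W {} l" for c :: "'x list \<Rightarrow> 'k"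
    by (rule pb_inverse_null[OF lzero_cochain[OF that]]) (rule c(3))
  show "c - pb \<psi> (pb \<phi> c) \<in> lzero X (topspace X) l" if "c \<in> lzero X {} l" for c :: "'y list \<Rightarrow> 'k"
    by (rule pb_inverse_null[OF lzero_cochain[OF that]]) (rule c(4))
qed

text \<open>Each point of one set has a neighbourhood that misses the other, so a small list in the
  union lies in one of the two.\<close>

lemma lzero_Un:
  assumes "closedin W P" "closedin W Q" "P \<inter> Q = {}" "a \<in> lzero W P l" "a \<in> lzero W Q l"
  shows "a \<in> lzero W (P \<union> Q) l"
proof (rule lzeroI_closed[OF closedin_Un[OF assms(1,2)] lzero_cochain[OF assms(4)]])
  have *: "\<exists>V. openin W V \<and> x \<in> V \<and> vanish a (V \<inter> (P' \<union> Q'))"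
    if x: "x \<in> P'" and cl: "closedin W P'" "closedin W Q'" "P' \<inter> Q' = {}" "a \<in> lzero W P' l" for x P' Q'
  proof -
    have "x \<in> topspace W" using closedin_subset[OF cl(1)] x by blast
    from lzeroD[OF cl(4) this] obtain V where V: "openin W V" "x \<in> V" "vanish a (V \<inter> P')" .
    have "V \<inter> (topspace W - Q') \<inter> (P' \<union> Q') \<subseteq> V \<inter> P'" by blast
    with V(3) have "vanish a (V \<inter> (topspace W - Q') \<inter> (P' \<union> Q'))" by (rule vanish_mono)
    moreover have "openin W (V \<inter> (topspace W - Q'))" using V(1) cl(2) by (intro openin_Int openin_diff) auto
    ultimately show ?thesis using V(2) \<open>x \<in> topspace W\<close> x cl(3) by blast
  qed
  fix x assume "x \<in> P \<union> Q"
  then show "\<exists>V. openin W V \<and> x \<in> V \<and> vanish a (V \<inter> (P \<union> Q))"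
  proof
    assume "x \<in> P"
    from *[OF this assms(1,2,3,4)] show ?thesis .
  next
    assume "x \<in> Q"
    moreover have "Q \<inter> P = {}" using assms(3) by blast
    ultimately show ?thesis using *[of x Q P] assms by (simp add: Un_commute)
  qed
qed

text \<open>The cohomology of \<open>(P \<union> Q, P)\<close> is that of \<open>Q\<close>.
  Restriction to lists inside \<open>Q\<close> alters a cochain only by one that vanishes on
  \<open>Q\<close>, and the result vanishes on \<open>P\<close>. With \<open>P\<close> the point
  \<infinity> this removes the base point.\<close>

lemma lzero_disjoint_hdim:
  fixes W :: "'x topology"
  assumes P: "closedin W P" and Q: "closedin W Q" and PQ: "P \<inter> Q = {}"
  shows "hfd (lzero W P) (lzero W (P \<union> Q) :: ('x, 'k::field) complex) l = hfd (lzero W {}) (lzero W Q :: ('x, 'k) complex) l \<and>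
    hdim (lzero W P) (lzero W (P \<union> Q) :: ('x, 'k) complex) l = hdim (lzero W {}) (lzero W Q :: ('x, 'k) complex) l"
proof (rule quotient_iso[OF flinear_id])
  note st = stable_lzero[of W]
  let ?r = "restrict_cochain Q :: ('x list \<Rightarrow> 'k) \<Rightarrow> _"
  have rP: "?r c \<in> lzero W P l" if "c \<in> cochain l" for c l
  proof (rule lzero_vanish[OF restrict_cochain_cochain[OF that]])
    show "vanish (?r c) P" unfolding vanish_def restrict_cochain_def
    proof (intro allI impI)
      fix \<sigma> assume "set \<sigma> \<subseteq> P"
      then have "\<not> (\<sigma> \<noteq> [] \<and> set \<sigma> \<subseteq> Q)" using PQ by (cases \<sigma>) auto
      then show "(if \<sigma> \<noteq> [] \<and> set \<sigma> \<subseteq> Q then c \<sigma> else 0) = 0" by (rule if_not_P)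
    qed
  qed
  have rQ: "c - ?r c \<in> lzero W Q l" if c: "c \<in> cochain l" for c l
  proof (rule lzero_vanish)
    show "c - ?r c \<in> cochain l" by (intro fs.subspace_diff[OF fsub_cochain] c restrict_cochain_cochain)
    show "vanish (c - ?r c) Q" unfolding vanish_def restrict_cochain_def
    proof (intro allI impI)
      fix \<sigma> assume "set \<sigma> \<subseteq> Q"
      then show "(c - (\<lambda>\<sigma>. if \<sigma> \<noteq> [] \<and> set \<sigma> \<subseteq> Q then c \<sigma> else 0)) \<sigma> = 0"
        using cochainD(2)[OF c] by (cases "\<sigma> = []") auto
    qed
  qed
  show "fsub (zcyc (lzero W P) (lzero W (P \<union> Q) :: ('x, 'k) complex) l)" by (rule fsub_zcyc[OF st st])
  show fB1: "fsub (bcob (lzero W P) (lzero W (P \<union> Q) :: ('x, 'k) complex) l)" by (rule fsub_bcob[OF st st])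
  show "fsub (bcob (lzero W {}) (lzero W Q :: ('x, 'k) complex) l)" by (rule fsub_bcob[OF st st])
  show "z \<in> zcyc (lzero W {}) (lzero W Q) l" if "z \<in> zcyc (lzero W P) (lzero W (P \<union> Q)) l" for z :: "'x list \<Rightarrow> 'k"
    using that lzero_mono[of "{}" P W l] lzero_mono[of Q "P \<union> Q" W "Suc l"] unfolding zcyc_def by blast
  show "\<exists>z\<in>zcyc (lzero W P) (lzero W (P \<union> Q)) l. w - z \<in> bcob (lzero W {}) (lzero W Q) l"
    if w: "w \<in> zcyc (lzero W {}) (lzero W Q) l" for w :: "'x list \<Rightarrow> 'k"
  proof
    have wc: "w \<in> cochain l" and dw: "lcob w \<in> lzero W Q (Suc l)" using w by (auto simp: zcyc_def lzero_cochain)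
    show "w - ?r w \<in> bcob (lzero W {}) (lzero W Q) l" using rQ[OF wc] small_bcob[OF st, of "lzero W Q" l "{}"] by blast
    have "lcob w - lcob (w - ?r w) \<in> lzero W Q (Suc l)"
      by (rule fs.subspace_diff[OF stableD(1)[OF st] dw stableD(2)[OF st rQ[OF wc]]])
    then have "lcob (?r w) \<in> lzero W Q (Suc l)" unfolding lcob_minus by simp
    then have "lcob (?r w) \<in> lzero W (P \<union> Q) (Suc l)"
      by (rule lzero_Un[OF P Q PQ stableD(2)[OF st rP[OF wc]]])
    then show "?r w \<in> zcyc (lzero W P) (lzero W (P \<union> Q)) l" using rP[OF wc] by (simp add: zcyc_def)
  qed
  show "z \<in> bcob (lzero W {}) (lzero W Q) l \<longleftrightarrow> z \<in> bcob (lzero W P) (lzero W (P \<union> Q)) l"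
    if z: "z \<in> zcyc (lzero W P) (lzero W (P \<union> Q)) l" for z :: "'x list \<Rightarrow> 'k"
  proof
    assume "z \<in> bcob (lzero W P) (lzero W (P \<union> Q)) l"
    then show "z \<in> bcob (lzero W {}) (lzero W Q) l"
      using lzero_mono[of "{}" P W "l - 1"] lzero_mono[of Q "P \<union> Q" W l] unfolding bcob_def set_sum_def by blast
  next
    assume "z \<in> bcob (lzero W {}) (lzero W Q) l"
    then obtain b s where b: "b \<in> lzero W {} (l - 1)" "s \<in> lzero W Q l" "z = lcob b + s" by (rule bcobE)
    have bc: "b \<in> cochain (l - 1)" by (rule lzero_cochain[OF b(1)])
    have zP: "z \<in> lzero W P l" using z by (simp add: zcyc_def)
    show "z \<in> bcob (lzero W P) (lzero W (P \<union> Q)) l"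
    proof (cases l)
      case 0
      then have "z = 0" using zP unfolding 0 stableD(3)[OF st] by simp
      then show ?thesis using fs.subspace_0[OF fB1] by simp
    next
      case (Suc m)
      have dP: "lcob (?r b) \<in> lzero W P l" using stableD(2)[OF st rP[OF bc]] unfolding Suc diff_Suc_1 .
      have dQ: "lcob (b - ?r b) \<in> lzero W Q l" using stableD(2)[OF st rQ[OF bc]] unfolding Suc diff_Suc_1 .
      have "s + lcob (b - ?r b) \<in> lzero W Q l" by (rule fs.subspace_add[OF stableD(1)[OF st] b(2) dQ])
      moreover have "s + lcob (b - ?r b) = z - lcob (?r b)" unfolding b(3) lcob_minus by simp
      ultimately have 1: "z - lcob (?r b) \<in> lzero W Q l" by simp
      have 2: "z - lcob (?r b) \<in> lzero W P l" by (rule fs.subspace_diff[OF stableD(1)[OF st] zP dP])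
      have "z - lcob (?r b) \<in> lzero W (P \<union> Q) l" by (rule lzero_Un[OF P Q PQ 2 1])
      then have "lcob (?r b) + (z - lcob (?r b)) \<in> bcob (lzero W P) (lzero W (P \<union> Q)) l"
        by (intro bcobI st rP[OF bc])
      then show ?thesis by simp
    qed
  qed
qed

section \<open>Finite dimension for a point, and in degree 0 for a connected space\<close>

lemma hfd_single: "hfd (lzero Z {}) (lzero Z {p} :: ('x, 'k::field) complex) l"
proof -
  let ?T = "lzero Z {} :: ('x, 'k) complex" and ?S = "lzero Z {p} :: ('x, 'k) complex"
  \<comment> \<open>Modulo cochains that vanish on lists at \<open>p\<close>, a cochain is its value
    on the constant list of length \<open>l\<close>, so the indicator of that list spans.\<close>
  define \<delta> :: "'x list \<Rightarrow> 'k" where "\<delta> \<sigma> = (if \<sigma> \<noteq> [] \<and> \<sigma> = replicate l p then 1 else 0)" for \<sigma>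
  have \<delta>: "\<delta> \<in> cochain l" by (auto simp: \<delta>_def cochain_def)
  have "cochain l \<subseteq> set_sum B (fs.span {\<delta>})" if B: "?S l \<subseteq> B" for B
  proof
    fix c :: "'x list \<Rightarrow> 'k" assume c: "c \<in> cochain l"
    let ?c = "c - fscale (c (replicate l p)) \<delta>"
    have "vanish ?c {p}"
      unfolding vanish_def
    proof (intro allI impI)
      fix \<sigma> assume "set \<sigma> \<subseteq> {p}"
      then have s: "\<sigma> = replicate (length \<sigma>) p" by (metis replicate_length_same singletonD subsetD)
      show "?c \<sigma> = 0"
      proof (cases "\<sigma> = []")
        case True
        then show ?thesis using cochainD(2)[OF c] by (simp add: \<delta>_def)
      next
        case False
        then show ?thesis using s cochainD(1)[OF c, of \<sigma>] by (cases "length \<sigma> = l") (auto simp: \<delta>_def)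
      qed
    qed
    then have "?c \<in> ?S l" by (intro lzero_vanish fs.subspace_diff[OF fsub_cochain] fs.subspace_scale[OF fsub_cochain] c \<delta>)
    then have "?c + fscale (c (replicate l p)) \<delta> \<in> set_sum B (fs.span {\<delta>})"
      using B by (intro set_sumI fs.span_scale fs.span_base) auto
    then show "c \<in> set_sum B (fs.span {\<delta>})" by (simp only: diff_add_cancel)
  qed
  from this[OF small_bcob[OF stable_lzero[of Z "{}"], of ?S l]]
  have "qfd (cochain l) (bcob ?T ?S l)" unfolding qfd_def using \<delta> by (intro exI[of _ "{\<delta>}"]) auto
  moreover have "bcob ?T ?S l \<subseteq> zcyc ?T ?S l" by (rule bcob_zcyc[OF stable_lzero stable_lzero lzero_mono]) simp
  moreover have "zcyc ?T ?S l \<subseteq> cochain l" by (auto simp: zcyc_def lzero_empty)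
  ultimately show ?thesis
    using quotient_add(1)[OF fsub_bcob[OF stable_lzero stable_lzero] fsub_zcyc[OF stable_lzero stable_lzero] fsub_cochain, of Z "{}" Z "{p}" l Z "{}" Z "{p}" l l] by blast
qed

text \<open>In degree 0 a relative cocycle is a locally constant function of points, hence constant.
  This supplies the one degree that the finiteness assumption on \<open>X\<close> leaves
  out.\<close>

lemma hfd_connected:
  assumes X: "connected_space X"
  shows "hfd (lzero X {}) (lzero X (topspace X) :: ('x, 'k::field) complex) (Suc 0)"
proof -
  let ?T = "lzero X {} :: ('x, 'k) complex" and ?S = "lzero X (topspace X) :: ('x, 'k) complex"
  define u :: "'x list \<Rightarrow> 'k" where "u \<sigma> = (if length \<sigma> = 1 then 1 else 0)" for \<sigma>
  have uc: "u \<in> cochain (Suc 0)" by (auto simp: u_def cochain_def)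
  have "lcob u \<sigma> = 0" for \<sigma>
  proof (cases \<sigma>)
    case (Cons x \<tau>)
    then show ?thesis by (cases \<tau>; cases "tl \<tau>") (auto simp: u_def lcob_zero_fun)
  qed simp
  then have "lcob u = 0" by (simp add: fun_eq_iff)
  then have uZ: "u \<in> zcyc ?T ?S (Suc 0)" using uc stableD(4)[OF stable_lzero] by (simp add: zcyc_def lzero_empty)
  have "zcyc ?T ?S (Suc 0) \<subseteq> set_sum (bcob ?T ?S (Suc 0)) (fs.span {u})"
  proof
    fix c assume c: "c \<in> zcyc ?T ?S (Suc 0)"
    have cc: "c \<in> cochain (Suc 0)" and dc: "lcob c \<in> ?S (Suc (Suc 0))" using c by (auto simp: zcyc_def lzero_empty)
    have loc: "\<exists>V. openin X V \<and> x \<in> V \<and> (\<forall>y\<in>V. c [y] = c [x])" if x: "x \<in> topspace X" for x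
    proof -
      from lzeroD[OF dc x] obtain V where V: "openin X V" "x \<in> V" "vanish (lcob c) (V \<inter> topspace X)" .
      have "c [y] = c [x]" if "y \<in> V" for y
      proof -
        have "set [x, y] \<subseteq> V \<inter> topspace X" using that V x openin_subset[OF V(1)] by auto
        from vanishD[OF V(3) this] show ?thesis using cochainD(2)[OF cc] by simp
      qed
      then show ?thesis using V by blast
    qed
    have "\<exists>a. \<forall>x\<in>topspace X. c [x] = a"
    proof (cases "topspace X = {}")
      case False
      then obtain x0 where x0: "x0 \<in> topspace X" by blast
      have op: "openin X {x \<in> topspace X. Pr (c [x])}" for Pr
      proof (subst openin_subopen, intro ballI)
        fix x assume "x \<in> {x \<in> topspace X. Pr (c [x])}"
        then have x: "x \<in> topspace X" "Pr (c [x])" by auto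
        obtain V where V: "openin X V" "x \<in> V" "\<forall>y\<in>V. c [y] = c [x]" using loc[OF x(1)] by blast
        have "V \<subseteq> {x \<in> topspace X. Pr (c [x])}" using V(3) x(2) openin_subset[OF V(1)] by auto
        then show "\<exists>T. openin X T \<and> x \<in> T \<and> T \<subseteq> {x \<in> topspace X. Pr (c [x])}" using V by blast
      qed
      let ?U = "{x \<in> topspace X. c [x] = c [x0]}"
      have "topspace X - ?U = {x \<in> topspace X. c [x] \<noteq> c [x0]}" by blast
      then have "closedin X ?U" using op[of "\<lambda>t. t \<noteq> c [x0]"] unfolding closedin_def by auto
      then have "?U = {} \<or> ?U = topspace X" using op[of "\<lambda>t. t = c [x0]"] X unfolding connected_space_clopen_in by blast
      then show ?thesis using x0 by blast
    qed simp
    then obtain a where a: "\<And>x. x \<in> topspace X \<Longrightarrow> c [x] = a" by blast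
    have "vanish (c - fscale a u) (topspace X)"
      unfolding vanish_def
    proof (intro allI impI)
      fix \<sigma> assume s: "set \<sigma> \<subseteq> topspace X"
      show "(c - fscale a u) \<sigma> = 0"
      proof (cases "length \<sigma> = 1")
        case True
        then obtain x where "\<sigma> = [x]" by (auto simp: length_Suc_conv)
        then show ?thesis using s a[of x] by (simp add: u_def)
      next
        case False
        then show ?thesis using cochainD(1)[OF cc, of \<sigma>] by (simp add: u_def)
      qed
    qed
    then have "c - fscale a u \<in> ?S (Suc 0)"
      by (intro lzero_vanish fs.subspace_diff[OF fsub_cochain] fs.subspace_scale[OF fsub_cochain] cc uc)
    then have "(c - fscale a u) + fscale a u \<in> set_sum (bcob ?T ?S (Suc 0)) (fs.span {u})"
      using small_bcob[OF stable_lzero, of ?S "Suc 0"] by (intro set_sumI fs.span_scale fs.span_base) auto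
    then show "c \<in> set_sum (bcob ?T ?S (Suc 0)) (fs.span {u})" by (simp only: diff_add_cancel)
  qed
  then show ?thesis unfolding qfd_def using uZ by (intro exI[of _ "{u}"]) auto
qed

section \<open>Inverse limits\<close>

definition invlim :: "'x topology \<Rightarrow> ('x \<Rightarrow> 'x) \<Rightarrow> (nat \<Rightarrow> 'x) topology" where
  "invlim K g = subtopology (product_topology (\<lambda>_. K) UNIV) {\<xi>. \<forall>i. g (\<xi> (Suc i)) = \<xi> i}"

context
  fixes K :: "'x topology" and g :: "'x \<Rightarrow> 'x"
  assumes K: "compact_space K" "Hausdorff_space K" and g: "continuous_map K K g"
begin

lemma topspace_invlim: "\<xi> \<in> topspace (invlim K g) \<longleftrightarrow> (\<forall>i. \<xi> i \<in> topspace K) \<and> (\<forall>i. g (\<xi> (Suc i)) = \<xi> i)"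
  by (auto simp: invlim_def)

lemma compact_product: "compact_space (product_topology (\<lambda>_::nat. K) UNIV)"
  using K by (simp add: compact_space_product_topology)

lemma Hausdorff_product: "Hausdorff_space (product_topology (\<lambda>_::nat. K) UNIV)"
  using K by (simp add: Hausdorff_space_product_topology)

lemma coordinate_product: "continuous_map (product_topology (\<lambda>_::nat. K) UNIV) K (\<lambda>\<xi>. \<xi> i)"
  by (rule continuous_map_product_projection) simp

lemma closedin_step: "closedin (product_topology (\<lambda>_::nat. K) UNIV)
   {\<xi> \<in> topspace (product_topology (\<lambda>_. K) UNIV). g (\<xi> (Suc i)) = \<xi> i}"
  using continuous_map_compose[OF coordinate_product[of "Suc i"] g] coordinate_product[of i]
  by (intro closedin_continuous_maps_eq[OF K(2)]) (simp_all add: comp_def)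

lemma Hausdorff_invlim: "Hausdorff_space (invlim K g)"
  unfolding invlim_def by (rule Hausdorff_space_subtopology[OF Hausdorff_product])

lemma compact_invlim: "compact_space (invlim K g)"
proof -
  let ?P = "product_topology (\<lambda>_::nat. K) UNIV"
  have "closedin ?P (\<Inter>i. {\<xi> \<in> topspace ?P. g (\<xi> (Suc i)) = \<xi> i})"
    using closedin_step by (intro closedin_Inter) blast+
  then have "compactin ?P (\<Inter>i. {\<xi> \<in> topspace ?P. g (\<xi> (Suc i)) = \<xi> i})"
    by (rule closedin_compact_space[OF compact_product])
  moreover have "(\<Inter>i. {\<xi> \<in> topspace ?P. g (\<xi> (Suc i)) = \<xi> i}) = topspace ?P \<inter> {\<xi>. \<forall>i. g (\<xi> (Suc i)) = \<xi> i}" by auto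
  ultimately have "compactin ?P (topspace ?P \<inter> {\<xi>. \<forall>i. g (\<xi> (Suc i)) = \<xi> i})" by simp
  from compact_space_subtopology[OF this] show ?thesis unfolding invlim_def subtopology_restrict .
qed

lemma coordinate: "continuous_map (invlim K g) K (\<lambda>\<xi>. \<xi> i)"
  unfolding invlim_def by (rule continuous_map_from_subtopology[OF coordinate_product])

lemma iterate_continuous: "continuous_map K K (g ^^ m)"
proof (induction m)
  case (Suc m)
  from continuous_map_compose[OF Suc g] show ?case by (simp add: comp_def)
qed simp

lemma iterate_topspace: "z \<in> topspace K \<Longrightarrow> (g ^^ m) z \<in> topspace K"
  using iterate_continuous[of m] by (auto simp: continuous_map_def)

lemma iterate_invlim: "\<xi> \<in> topspace (invlim K g) \<Longrightarrow> (g ^^ m) (\<xi> (i + m)) = \<xi> i"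
proof (induction m arbitrary: i)
  case (Suc m)
  have "(g ^^ Suc m) (\<xi> (i + Suc m)) = (g ^^ m) (g (\<xi> (Suc (i + m))))" by (simp add: funpow_Suc_right del: funpow.simps)
  also have "g (\<xi> (Suc (i + m))) = \<xi> (i + m)" using Suc.prems topspace_invlim by blast
  finally show ?case using Suc by simp
qed simp

lemma iterate_invlim': "\<xi> \<in> topspace (invlim K g) \<Longrightarrow> k \<le> i \<Longrightarrow> (g ^^ (i - k)) (\<xi> i) = \<xi> k"
  using iterate_invlim[of \<xi> "i - k" k] by simp

text \<open>A basic open set of the product constrains finitely many coordinates; the iterates of
  \<open>g\<close> turn these into one constraint on a coordinate \<open>i\<close> at least as late
  as all of them.\<close>

lemma invlim_basis:
  assumes V: "openin (invlim K g) V" "\<xi> \<in> V"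
  shows "\<exists>i G. openin K G \<and> \<xi> i \<in> G \<and> (\<forall>\<eta>\<in>topspace (invlim K g). \<eta> i \<in> G \<longrightarrow> \<eta> \<in> V)"
proof -
  let ?P = "product_topology (\<lambda>_::nat. K) UNIV"
  obtain T where T: "openin ?P T" "V = T \<inter> {\<xi>. \<forall>i. g (\<xi> (Suc i)) = \<xi> i}"
    using V unfolding invlim_def openin_subtopology by blast
  have \<xi>: "\<xi> \<in> topspace (invlim K g)" using V openin_subset by blast
  obtain U where U: "finite {i. U i \<noteq> topspace K}" "\<And>i. openin K (U i)" "\<xi> \<in> Pi\<^sub>E UNIV U" "Pi\<^sub>E UNIV U \<subseteq> T"
    using T V unfolding openin_product_topology_alt by fastforce
  define F where "F = {i. U i \<noteq> topspace K}"
  have "finite F" using U(1) by (simp add: F_def)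
  then obtain i where i: "\<forall>k\<in>F. k \<le> i" using finite_nat_set_iff_bounded_le by blast
  define G where "G = (\<Inter>k\<in>F. {z \<in> topspace K. (g ^^ (i - k)) z \<in> U k}) \<inter> topspace K"
  show ?thesis
  proof (intro exI[of _ i] exI[of _ G] conjI ballI impI)
    show "openin K G" unfolding G_def
      using openin_continuous_map_preimage[OF iterate_continuous U(2)] by (intro openin_INT \<open>finite F\<close>) auto
    show "\<xi> i \<in> G"
    proof -
      have "(g ^^ (i - k)) (\<xi> i) \<in> U k" if "k \<in> F" for k
        using iterate_invlim'[OF \<xi>, of k i] i that U(3) by auto
      then show ?thesis unfolding G_def using \<xi> topspace_invlim by auto
    qed
    fix \<eta> assume \<eta>: "\<eta> \<in> topspace (invlim K g)" "\<eta> i \<in> G"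
    have "\<eta> k \<in> U k" for k
    proof (cases "k \<in> F")
      case True
      then have "(g ^^ (i - k)) (\<eta> i) \<in> U k" using \<eta>(2) unfolding G_def by blast
      then show ?thesis using iterate_invlim'[OF \<eta>(1), of k i] i True by auto
    next
      case False
      then show ?thesis using \<eta>(1) topspace_invlim unfolding F_def by blast
    qed
    then have "\<eta> \<in> T" using U(4) by auto
    then show "\<eta> \<in> V" using T(2) \<eta>(1) topspace_invlim by blast
  qed
qed

text \<open>Compactness of the limit makes one level \<open>i\<close> serve for all its points. A
  point of \<open>K\<close> off the closed image of coordinate \<open>i\<close> has a neighbourhood
  over which nothing lies.\<close>

lemma invlim_common_level:
  assumes e: "e \<in> lzero (invlim K g) (topspace (invlim K g)) l"
  shows "\<exists>i. \<forall>z\<in>topspace K. \<exists>G. openin K G \<and> z \<in> G \<and> vanish e {\<eta> \<in> topspace (invlim K g). \<eta> i \<in> G}"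
proof -
  let ?W = "invlim K g"
  define Pr where "Pr \<xi> i G \<longleftrightarrow> openin K G \<and> \<xi> i \<in> G \<and> vanish e {\<eta> \<in> topspace ?W. \<eta> i \<in> G}" for \<xi> i G
  have "\<exists>i G. Pr \<xi> i G" if x: "\<xi> \<in> topspace ?W" for \<xi>
  proof -
    from lzeroD[OF e x] obtain V where V: "openin ?W V" "\<xi> \<in> V" "vanish e (V \<inter> topspace ?W)" .
    from invlim_basis[OF V(1,2)] obtain i G where G: "openin K G" "\<xi> i \<in> G" "\<forall>\<eta>\<in>topspace ?W. \<eta> i \<in> G \<longrightarrow> \<eta> \<in> V" by blast
    have "vanish e {\<eta> \<in> topspace ?W. \<eta> i \<in> G}" by (rule vanish_mono[OF V(3)]) (use G(3) in blast)
    then show ?thesis using G unfolding Pr_def by blast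
  qed
  then obtain I G where "\<And>\<xi>. \<xi> \<in> topspace ?W \<Longrightarrow> Pr \<xi> (I \<xi>) (G \<xi>)" by metis
  then have G: "\<And>\<xi>. \<xi> \<in> topspace ?W \<Longrightarrow> openin K (G \<xi>) \<and> \<xi> (I \<xi>) \<in> G \<xi> \<and> vanish e {\<eta> \<in> topspace ?W. \<eta> (I \<xi>) \<in> G \<xi>}" unfolding Pr_def .
  define O' where "O' \<xi> = {\<eta> \<in> topspace ?W. \<eta> (I \<xi>) \<in> G \<xi>}" for \<xi>
  have op: "openin ?W (O' \<xi>)" if "\<xi> \<in> topspace ?W" for \<xi>
    unfolding O'_def using openin_continuous_map_preimage[OF coordinate] G[OF that] by blast
  have "compactin ?W (topspace ?W)" using compact_invlim by (simp add: compact_space_def)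
  moreover have "topspace ?W \<subseteq> \<Union>(O' ` topspace ?W)" using G unfolding O'_def by blast
  ultimately have "\<exists>\<F>. finite \<F> \<and> \<F> \<subseteq> O' ` topspace ?W \<and> topspace ?W \<subseteq> \<Union>\<F>"
    using op by (intro compactinD) auto
  then obtain F where F: "finite F" "F \<subseteq> topspace ?W" "topspace ?W \<subseteq> (\<Union>\<xi>\<in>F. O' \<xi>)"
    by (metis finite_subset_image)
  obtain i where i: "\<forall>\<xi>\<in>F. I \<xi> \<le> i" using finite_nat_set_iff_bounded_le[of "I ` F"] F(1) by auto
  show ?thesis
  proof (intro exI[of _ i] ballI)
    fix z assume z: "z \<in> topspace K"
    show "\<exists>G. openin K G \<and> z \<in> G \<and> vanish e {\<eta> \<in> topspace ?W. \<eta> i \<in> G}"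
    proof (cases "z \<in> (\<lambda>\<eta>. \<eta> i) ` topspace ?W")
      case True
      then obtain \<eta> where \<eta>: "\<eta> \<in> topspace ?W" "z = \<eta> i" by blast
      then obtain \<xi> where \<xi>: "\<xi> \<in> F" "\<eta> \<in> O' \<xi>" using F by blast
      let ?G = "{z \<in> topspace K. (g ^^ (i - I \<xi>)) z \<in> G \<xi>}"
      have *: "(g ^^ (i - I \<xi>)) (\<zeta> i) = \<zeta> (I \<xi>)" if "\<zeta> \<in> topspace ?W" for \<zeta>
        using iterate_invlim'[OF that] i \<xi> by blast
      have "\<xi> \<in> topspace ?W" using \<xi> F by blast
      note G\<xi> = G[OF this]
      have "openin K ?G" using openin_continuous_map_preimage[OF iterate_continuous] G\<xi> by blast
      moreover have "z \<in> ?G" using \<eta> z \<xi>(2) *[OF \<eta>(1)] by (simp add: O'_def)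
      moreover have "vanish e {\<eta> \<in> topspace ?W. \<eta> i \<in> ?G}"
        by (rule vanish_mono[of _ "{\<eta> \<in> topspace ?W. \<eta> (I \<xi>) \<in> G \<xi>}"]) (use G\<xi> * in auto)
      ultimately show ?thesis by blast
    next
      case False
      let ?G = "topspace K - (\<lambda>\<eta>. \<eta> i) ` topspace ?W"
      have "closedin K ((\<lambda>\<eta>. \<eta> i) ` topspace ?W)"
        by (rule compactin_imp_closedin[OF K(2) image_compactin[OF \<open>compactin ?W (topspace ?W)\<close> coordinate]])
      then have "openin K ?G" by blast
      moreover have "{\<eta> \<in> topspace ?W. \<eta> i \<in> ?G} = {}" by blast
      then have "vanish e {\<eta> \<in> topspace ?W. \<eta> i \<in> ?G}" using vanish_empty[OF lzero_cochain[OF e]] by metis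
      ultimately show ?thesis using False z by blast
    qed
  qed
qed

text \<open>If every \<open>g ^^ n\<close> sends some point outside \<open>G\<close>, the sequences
  that obey the first \<open>n\<close> bonding relations and are outside \<open>G\<close> at
  coordinate \<open>i\<close> form a decreasing family of nonempty closed sets. A common point lies
  in the limit and contradicts the assumption on \<open>G\<close>.\<close>

lemma invlim_absorb:
  assumes G: "openin K G" "(\<lambda>\<eta>. \<eta> i) ` topspace (invlim K g) \<subseteq> G"
  shows "\<exists>m. (g ^^ m) ` topspace K \<subseteq> G"
proof (rule ccontr)
  assume "\<not> ?thesis"
  then have bad: "\<exists>z\<in>topspace K. (g ^^ n) z \<notin> G" for n by blast
  let ?P = "product_topology (\<lambda>_::nat. K) UNIV"
  define C where "C n = (\<Inter>k<n. {\<xi> \<in> topspace ?P. g (\<xi> (Suc k)) = \<xi> k}) \<inter> {\<xi> \<in> topspace ?P. \<xi> i \<in> topspace K - G}" for n :: nat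
  have "(\<Inter>n. C n) \<noteq> {}"
  proof (rule compact_space_imp_nest[OF compact_product])
    show "closedin ?P (C n)" for n
    proof -
      have 1: "closedin ?P {\<xi> \<in> topspace ?P. \<xi> i \<in> topspace K - G}"
        by (rule closedin_continuous_map_preimage[OF coordinate_product]) (use G in auto)
      show ?thesis
      proof (cases "n = 0")
        case False
        then show ?thesis unfolding C_def using closedin_step by (intro closedin_Int 1 closedin_Inter) auto
      qed (use 1 in \<open>simp add: C_def\<close>)
    qed
    show "decseq C" unfolding decseq_def C_def by auto
    show "C n \<noteq> {}" for n
    proof -
      obtain z where z: "z \<in> topspace K" "(g ^^ n) z \<notin> G" using bad by blast
      \<comment> \<open>The iterates of \<open>z\<close> written backwards, placed so that
        coordinate \<open>i\<close> is \<open>(g ^^ n) z\<close>. Beyond \<open>i + n\<close> the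
        truncated exponent is 0, but the relations imposed involve only coordinates up to
        \<open>n\<close>.\<close>
      define \<xi> where "\<xi> k = (g ^^ (i + n - k)) z" for k
      have "\<xi> k \<in> topspace K" for k unfolding \<xi>_def by (rule iterate_topspace[OF z(1)])
      moreover have "g (\<xi> (Suc k)) = \<xi> k" if "k < n" for k
      proof -
        have "i + n - k = Suc (i + n - Suc k)" using that by simp
        then show ?thesis unfolding \<xi>_def by (metis comp_apply funpow.simps(2))
      qed
      moreover have "\<xi> i = (g ^^ n) z" by (simp add: \<xi>_def)
      ultimately have "\<xi> \<in> C n" unfolding C_def using z(2) iterate_topspace[OF z(1), of n] by auto
      then show ?thesis by blast
    qed
  qed
  then obtain \<xi> where \<xi>: "\<And>n. \<xi> \<in> C n" by blast
  have "g (\<xi> (Suc k)) = \<xi> k" for k using \<xi>[of "Suc k"] unfolding C_def by auto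
  moreover have "\<xi> k \<in> topspace K" for k using \<xi>[of 0] unfolding C_def by auto
  ultimately have "\<xi> \<in> topspace (invlim K g)" using topspace_invlim by blast
  moreover have "\<xi> i \<notin> G" using \<xi>[of 0] unfolding C_def by auto
  ultimately show False using G(2) by blast
qed

text \<open>The approximate inverse \<open>r\<close> of the projection to a late coordinate is not continuous, but it
  maps small simplices of \<open>K\<close> to small simplices of the limit.\<close>

lemma invlim_surjective:
  fixes c :: "(nat \<Rightarrow> 'x) list \<Rightarrow> 'k::field"
  assumes c: "c \<in> zcyc (lzero (invlim K g) {}) (lzero (invlim K g) (topspace (invlim K g))) (Suc q)"
  shows "\<exists>j. \<exists>e\<in>zcyc (lzero K {}) (lzero K (topspace K)) (Suc q).
    c - pb (\<lambda>\<xi>. \<xi> j) e \<in> bcob (lzero (invlim K g) {}) (lzero (invlim K g) (topspace (invlim K g))) (Suc q)"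
proof -
  let ?W = "invlim K g"
  have cc: "c \<in> cochain (Suc q)" and dc: "lcob c \<in> lzero ?W (topspace ?W) (Suc (Suc q))"
    using c by (auto simp: zcyc_def lzero_empty)
  obtain i where i: "\<forall>z\<in>topspace K. \<exists>G. openin K G \<and> z \<in> G \<and> vanish (lcob c) {\<eta> \<in> topspace ?W. \<eta> i \<in> G}"
    using invlim_common_level[OF dc] by blast
  then obtain N where "\<forall>z\<in>topspace K. openin K (N z) \<and> z \<in> N z \<and> vanish (lcob c) {\<eta> \<in> topspace ?W. \<eta> i \<in> N z}"
    unfolding bchoice_iff by blast
  then have N: "\<And>z. z \<in> topspace K \<Longrightarrow> openin K (N z) \<and> z \<in> N z \<and> vanish (lcob c) {\<eta> \<in> topspace ?W. \<eta> i \<in> N z}" by blast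
  have N': "openin K (N z) \<and> z \<in> N z" if "z \<in> topspace K" for z using N[OF that] by blast
  obtain \<kappa> V where V: "\<And>x. x \<in> topspace K \<Longrightarrow> \<kappa> x \<in> topspace K"
    "\<And>y. y \<in> topspace K \<Longrightarrow> openin K (V y) \<and> y \<in> V y"
    "\<And>x y. x \<in> topspace K \<Longrightarrow> y \<in> topspace K \<Longrightarrow> V x \<inter> V y \<noteq> {} \<Longrightarrow> V y \<subseteq> N (\<kappa> x)"
    using star_refinement[OF K N'] by metis
  \<comment> \<open>A usable \<open>V y\<close> contains the \<open>i\<close>-th coordinate of some
    point of the limit, which can then serve as a value of \<open>r\<close>; \<open>m\<close>
    iterations of \<open>g\<close> bring all of \<open>K\<close> into the union of these
    sets.\<close>
  define Y where "Y = {y \<in> topspace K. \<exists>\<eta>\<in>topspace ?W. \<eta> i \<in> V y}"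
  have "openin K (\<Union>y\<in>Y. V y)" using V(2) unfolding Y_def by (intro openin_Union) auto
  moreover have "(\<lambda>\<eta>. \<eta> i) ` topspace ?W \<subseteq> (\<Union>y\<in>Y. V y)"
  proof (rule image_subsetI)
    fix \<eta> assume \<eta>: "\<eta> \<in> topspace ?W"
    then have "\<eta> i \<in> topspace K" using topspace_invlim by blast
    then show "\<eta> i \<in> (\<Union>y\<in>Y. V y)" using V(2) \<eta> unfolding Y_def by blast
  qed
  ultimately obtain m where m: "(g ^^ m) ` topspace K \<subseteq> (\<Union>y\<in>Y. V y)" using invlim_absorb by blast
  have "\<exists>\<eta> y. \<eta> \<in> topspace ?W \<and> y \<in> topspace K \<and> (g ^^ m) z \<in> V y \<and> \<eta> i \<in> V y" if "z \<in> topspace K" for z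
    using m that unfolding Y_def by blast
  then obtain r Yz where r: "\<And>z. z \<in> topspace K \<Longrightarrow> r z \<in> topspace ?W \<and> Yz z \<in> topspace K \<and> (g ^^ m) z \<in> V (Yz z) \<and> r z i \<in> V (Yz z)" by metis
  have rN: "r z i \<in> N (\<kappa> y)" if "z \<in> topspace K" "y \<in> topspace K" "(g ^^ m) z \<in> V y" for z y
    using V(3)[of y "Yz z"] r[OF that(1)] that by blast
  have "pb r (lcob c) \<in> lzero K (topspace K) (Suc (Suc q))"
  proof (rule pb_lzero[OF lzero_cochain[OF dc]])
    fix z assume z: "z \<in> topspace K"
    let ?y = "(g ^^ m) z"
    have y: "?y \<in> topspace K" by (rule iterate_topspace[OF z])
    show "\<exists>U Q. openin K U \<and> z \<in> U \<and> vanish (lcob c) Q \<and> r ` (U \<inter> topspace K) \<subseteq> Q"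
    proof (intro exI conjI)
      show "openin K {z \<in> topspace K. (g ^^ m) z \<in> V ?y}"
        using openin_continuous_map_preimage[OF iterate_continuous] V(2)[OF y] by blast
      show "z \<in> {z \<in> topspace K. (g ^^ m) z \<in> V ?y}" using z V(2)[OF y] by blast
      show "vanish (lcob c) {\<eta> \<in> topspace ?W. \<eta> i \<in> N (\<kappa> ?y)}" using N[OF V(1)[OF y]] by blast
      show "r ` ({z \<in> topspace K. (g ^^ m) z \<in> V ?y} \<inter> topspace K) \<subseteq> {\<eta> \<in> topspace ?W. \<eta> i \<in> N (\<kappa> ?y)}"
        using rN[OF _ y] r by blast
    qed
  qed
  then have e: "pb r c \<in> zcyc (lzero K {}) (lzero K (topspace K)) (Suc q)"
    using cc by (simp add: zcyc_def lzero_empty pb_cochain lcob_pb)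
  \<comment> \<open>Since \<open>(g ^^ m) (\<xi> (i + m)) = \<xi> i\<close>, the point
    \<open>r (\<xi> (i + m))\<close> is close to \<open>\<xi>\<close> at coordinate
    \<open>i\<close>.\<close>
  let ?j = "i + m"
  have "pb (\<lambda>\<xi>. \<xi>) c - pb (\<lambda>\<xi>. r (\<xi> ?j)) c \<in> bcob (lzero ?W {}) (lzero ?W (topspace ?W)) (Suc q)"
  proof (rule homotopic_bcob[OF stable_lzero])
    show "lprism (\<lambda>\<xi>. r (\<xi> ?j)) (\<lambda>\<xi>. \<xi>) c \<in> lzero ?W {} q" using lprism_cochain[OF cc] by (simp add: lzero_empty)
    show "lprism (\<lambda>\<xi>. r (\<xi> ?j)) (\<lambda>\<xi>. \<xi>) (lcob c) \<in> lzero ?W (topspace ?W) (Suc q)"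
    proof (rule lprism_lzero[OF lzero_cochain[OF dc]])
      fix \<xi> assume \<xi>: "\<xi> \<in> topspace ?W"
      then have y: "\<xi> i \<in> topspace K" using topspace_invlim by blast
      let ?U = "{\<eta> \<in> topspace ?W. \<eta> i \<in> V (\<xi> i)}"
      show "\<exists>U Q. openin ?W U \<and> \<xi> \<in> U \<and> vanish (lcob c) Q \<and> (\<lambda>\<xi>. r (\<xi> ?j)) ` (U \<inter> topspace ?W) \<subseteq> Q \<and> (\<lambda>\<xi>. \<xi>) ` (U \<inter> topspace ?W) \<subseteq> Q"
      proof (intro exI conjI)
        show "openin ?W ?U" using openin_continuous_map_preimage[OF coordinate] V(2)[OF y] by blast
        show "\<xi> \<in> ?U" using \<xi> V(2)[OF y] by blast
        show "vanish (lcob c) {\<eta> \<in> topspace ?W. \<eta> i \<in> N (\<kappa> (\<xi> i))}" using N[OF V(1)[OF y]] by blast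
        show "(\<lambda>\<xi>. \<xi>) ` (?U \<inter> topspace ?W) \<subseteq> {\<eta> \<in> topspace ?W. \<eta> i \<in> N (\<kappa> (\<xi> i))}"
          using V(3)[OF y y] V(2)[OF y] by blast
        show "(\<lambda>\<xi>. r (\<xi> ?j)) ` (?U \<inter> topspace ?W) \<subseteq> {\<eta> \<in> topspace ?W. \<eta> i \<in> N (\<kappa> (\<xi> i))}"
        proof (rule image_subsetI)
          fix \<eta> assume \<eta>: "\<eta> \<in> ?U \<inter> topspace ?W"
          then have t: "\<eta> ?j \<in> topspace K" using topspace_invlim by blast
          have "(g ^^ m) (\<eta> ?j) = \<eta> i" using iterate_invlim \<eta> by blast
          then show "r (\<eta> ?j) \<in> {\<eta> \<in> topspace ?W. \<eta> i \<in> N (\<kappa> (\<xi> i))}" using rN[OF t y] r[OF t] \<eta> by auto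
        qed
      qed
    qed
  qed
  moreover have "pb (\<lambda>\<xi>. \<xi>) c = c" by (simp add: fun_eq_iff)
  ultimately have "c - pb (\<lambda>\<xi>. \<xi> ?j) (pb r c) \<in> bcob (lzero ?W {}) (lzero ?W (topspace ?W)) (Suc q)" by (simp add: pb_comp)
  then show ?thesis using e by blast
qed

text \<open>Stage \<open>I j\<close> holds the cocycles whose class comes from coordinate
  \<open>j\<close>, and the bonding map puts it into stage \<open>Suc j\<close>. Each stage is
  spanned by at most as many classes as \<open>K\<close> has, and this uniform bound survives the
  union.\<close>

theorem invlim_hfd:
  assumes fd: "hfd (lzero K {}) (lzero K (topspace K) :: ('x, 'k::field) complex) (Suc q)"
  shows "hfd (lzero (invlim K g) {}) (lzero (invlim K g) (topspace (invlim K g)) :: (nat \<Rightarrow> 'x, 'k) complex) (Suc q)"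
proof -
  let ?W = "invlim K g"
  define TW RW :: "(nat \<Rightarrow> 'x, 'k) complex" where "TW = lzero ?W {}" and "RW = lzero ?W (topspace ?W)"
  define TK RK :: "('x, 'k) complex" where "TK = lzero K {}" and "RK = lzero K (topspace K)"
  have st: "stable TW" "stable RW" "stable TK" "stable RK" unfolding TW_def RW_def TK_def RK_def by (rule stable_lzero)+
  let ?B = "bcob TW RW (Suc q)"
  define I where "I j = {c \<in> zcyc TW RW (Suc q). \<exists>e\<in>zcyc TK RK (Suc q). c - pb (\<lambda>\<xi>. \<xi> j) e \<in> ?B}" for j
  have fB: "fsub ?B" by (rule fsub_bcob[OF st(1,2)])
  have pT: "pb f c \<in> TW l" if "c \<in> TK l" for f :: "(nat \<Rightarrow> 'x) \<Rightarrow> 'x" and c l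
    using that unfolding TW_def TK_def by (simp add: lzero_empty pb_cochain)
  have pR: "pb (\<lambda>\<xi>. \<xi> j) c \<in> RW l" if "c \<in> RK l" for j c l
    using that unfolding RW_def RK_def
    by (intro pb_lzero_continuous[OF coordinate]) (auto simp: topspace_invlim)
  have gT: "pb g c \<in> TK l" if "c \<in> TK l" for c l
    using that unfolding TK_def by (simp add: lzero_empty pb_cochain)
  have gR: "pb g c \<in> RK l" if "c \<in> RK l" for c l
    using that unfolding RK_def by (intro pb_lzero_continuous[OF g]) (use g in \<open>auto simp: continuous_map_def\<close>)
  have "qfd (zcyc TW RW (Suc q)) ?B"
  proof (rule qfd_directed_union[where I = I and m = "hdim TK RK (Suc q)", OF fB])
    show "fsub (zcyc TW RW (Suc q))" by (rule fsub_zcyc[OF st(1,2)])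
    show "?B \<subseteq> zcyc TW RW (Suc q)"
      by (rule bcob_zcyc[OF st(1,2)]) (auto simp: TW_def RW_def intro: subsetD[OF lzero_mono])
    show "zcyc TW RW (Suc q) = (\<Union>j. I j)"
    proof
      show "zcyc TW RW (Suc q) \<subseteq> (\<Union>j. I j)"
      proof
        fix c assume c: "c \<in> zcyc TW RW (Suc q)"
        from invlim_surjective[OF c[unfolded TW_def RW_def], folded TW_def RW_def TK_def RK_def]
        obtain j e where "e \<in> zcyc TK RK (Suc q)" "c - pb (\<lambda>\<xi>. \<xi> j) e \<in> ?B" by blast
        then have "c \<in> I j" unfolding I_def using c by blast
        then show "c \<in> (\<Union>j. I j)" by blast
      qed
    qed (auto simp: I_def)
    show "I j \<subseteq> I (Suc j)" for j
    proof
      fix c assume "c \<in> I j"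
      then obtain e where c: "c \<in> zcyc TW RW (Suc q)" and e: "e \<in> zcyc TK RK (Suc q)" "c - pb (\<lambda>\<xi>. \<xi> j) e \<in> ?B"
        unfolding I_def by blast
      have ge: "pb g e \<in> zcyc TK RK (Suc q)" using pb_zcyc[OF gT gR e(1)] .
      have ec: "e \<in> cochain (Suc q)" using e(1) by (auto simp: zcyc_def TK_def lzero_cochain)
      have "pb (\<lambda>\<xi>. \<xi> j) e - pb (\<lambda>\<xi>. \<xi> (Suc j)) (pb g e) \<in> RW (Suc q)"
        unfolding RW_def
      proof (rule lzero_vanish)
        show "pb (\<lambda>\<xi>. \<xi> j) e - pb (\<lambda>\<xi>. \<xi> (Suc j)) (pb g e) \<in> cochain (Suc q)"
          by (intro fs.subspace_diff[OF fsub_cochain] pb_cochain ec)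
        show "vanish (pb (\<lambda>\<xi>. \<xi> j) e - pb (\<lambda>\<xi>. \<xi> (Suc j)) (pb g e)) (topspace ?W)"
          unfolding vanish_def
        proof (intro allI impI)
          fix \<sigma> assume "set \<sigma> \<subseteq> topspace ?W"
          then have "map (\<lambda>\<xi>. \<xi> j) \<sigma> = map g (map (\<lambda>\<xi>. \<xi> (Suc j)) \<sigma>)" using topspace_invlim by (auto simp: subset_iff)
          then show "(pb (\<lambda>\<xi>. \<xi> j) e - pb (\<lambda>\<xi>. \<xi> (Suc j)) (pb g e)) \<sigma> = 0" by (simp del: map_map)
        qed
      qed
      then have "pb (\<lambda>\<xi>. \<xi> j) e - pb (\<lambda>\<xi>. \<xi> (Suc j)) (pb g e) \<in> ?B" using small_bcob[OF st(1), of RW "Suc q"] by blast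
      from fs.subspace_add[OF fB e(2) this] have "c - pb (\<lambda>\<xi>. \<xi> (Suc j)) (pb g e) \<in> ?B" by simp
      then show "c \<in> I (Suc j)" unfolding I_def using c ge by blast
    qed
    show "\<exists>T. finite T \<and> card T \<le> hdim TK RK (Suc q) \<and> I j \<subseteq> set_sum ?B (fs.span T)" for j
    proof -
      obtain T where T: "finite T" "card T = hdim TK RK (Suc q)" "T \<subseteq> zcyc TK RK (Suc q)"
        "zcyc TK RK (Suc q) \<subseteq> set_sum (bcob TK RK (Suc q)) (fs.span T)"
        using qdim_witness[OF fd[folded TK_def RK_def]] .
      let ?p = "pb (\<lambda>\<xi> :: nat \<Rightarrow> 'x. \<xi> j) :: ('x list \<Rightarrow> 'k) \<Rightarrow> _"
      have "I j \<subseteq> set_sum ?B (fs.span (?p ` T))"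
      proof
        fix c assume "c \<in> I j"
        then obtain e where e: "e \<in> zcyc TK RK (Suc q)" "c - ?p e \<in> ?B" unfolding I_def by blast
        then have "e \<in> set_sum (bcob TK RK (Suc q)) (fs.span T)" using T(4) by blast
        then obtain b s where b: "b \<in> bcob TK RK (Suc q)" "s \<in> fs.span T" "e = b + s" by (rule set_sumE)
        have "?p b \<in> ?B" using pb_bcob[OF pT pR b(1) st(1)] .
        from fs.subspace_add[OF fB e(2) this] have "c - ?p s \<in> ?B" unfolding b(3) flinear_add[OF flinear_pb] by simp
        moreover have "?p s \<in> fs.span (?p ` T)" unfolding flinear_span_image[OF flinear_pb] using b(2) by blast
        ultimately have "(c - ?p s) + ?p s \<in> set_sum ?B (fs.span (?p ` T))" by (rule set_sumI)
        then show "c \<in> set_sum ?B (fs.span (?p ` T))" by (simp only: diff_add_cancel)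
      qed
      then show ?thesis using T(1,2) card_image_le[OF T(1), of ?p] by (intro exI[of _ "?p ` T"]) auto
    qed
  qed
  then show ?thesis unfolding TW_def RW_def .
qed

end

section \<open>Clopen sets between a repeller and an attracting point\<close>

text \<open>An injective self-map of a finite set consists of cycles. As \<open>n\<close> divides
  their lengths, the number of steps from a representative is well defined modulo
  \<open>n\<close>.\<close>

lemma cyclic_labelling:
  fixes f :: "'b \<Rightarrow> 'b"
  assumes E: "finite E" "f ` E \<subseteq> E" "inj_on f E" and n: "n > 0"
    and per: "\<And>F. F \<in> E \<Longrightarrow> n dvd (LEAST r. 1 \<le> r \<and> (f ^^ r) F = F)"
  shows "\<exists>lab. \<forall>F\<in>E. lab F < n \<and> lab (f F) = Suc (lab F) mod n"
proof -
  have iter: "(f ^^ i) F \<in> E" if "F \<in> E" for i F using that E(2) by (induction i) auto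
  have inj: "F = G" if "(f ^^ i) F = (f ^^ i) G" "F \<in> E" "G \<in> E" for i F G
    using that(1)
  proof (induction i)
    case (Suc i)
    then have "(f ^^ i) F = (f ^^ i) G" using inj_onD[OF E(3)] iter that by auto
    then show ?case by (rule Suc.IH)
  qed simp
  define P where "P F = (LEAST r. 1 \<le> r \<and> (f ^^ r) F = F)" for F
  have ex: "\<exists>r. 1 \<le> r \<and> (f ^^ r) F = F" if F: "F \<in> E" for F
  proof -
    have "\<not> inj_on (\<lambda>i. (f ^^ i) F) UNIV"
    proof
      assume "inj_on (\<lambda>i. (f ^^ i) F) UNIV"
      then have "infinite (range (\<lambda>i. (f ^^ i) F))" using finite_imageD infinite_UNIV_nat by blast
      moreover have "range (\<lambda>i. (f ^^ i) F) \<subseteq> E" using iter[OF F] by blast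
      ultimately show False using E(1) finite_subset by blast
    qed
    then obtain i j where "i < j" "(f ^^ i) F = (f ^^ j) F" unfolding inj_on_def by (metis linorder_neqE_nat)
    then have "(f ^^ i) F = (f ^^ i) ((f ^^ (j - i)) F)"
      by (metis comp_apply funpow_add le_add_diff_inverse less_imp_le)
    then have "F = (f ^^ (j - i)) F" using inj iter[OF F] F by blast
    then show ?thesis using \<open>i < j\<close> by (intro exI[of _ "j - i"]) auto
  qed
  have P: "1 \<le> P F" "(f ^^ P F) F = F" if "F \<in> E" for F
    using LeastI_ex[OF ex[OF that]] unfolding P_def by auto
  have Pm: "(f ^^ (P F * m)) F = F" if "F \<in> E" for F m
  proof (induction m)
    case (Suc m)
    have "(f ^^ (P F * Suc m)) F = (f ^^ P F) ((f ^^ (P F * m)) F)" by (simp add: funpow_add)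
    then show ?case using Suc P[OF that] by simp
  qed simp
  have dvd: "P F dvd m" if F: "F \<in> E" and m: "(f ^^ m) F = F" for F m
  proof -
    have "m = m mod P F + P F * (m div P F)" by simp
    then have "(f ^^ m) F = (f ^^ (m mod P F)) ((f ^^ (P F * (m div P F))) F)" by (metis comp_apply funpow_add)
    then have r: "(f ^^ (m mod P F)) F = F" using m Pm[OF F] by simp
    have "\<not> 1 \<le> m mod P F"
    proof
      assume "1 \<le> m mod P F"
      then have "P F \<le> m mod P F" unfolding P_def[of F] using r by (intro Least_le) (simp add: P_def)
      moreover have "m mod P F < P F" using P(1)[OF F] by simp
      ultimately show False by simp
    qed
    then show ?thesis by (auto simp: dvd_eq_mod_eq_0)
  qed
  have same: "(i :: nat) mod n = j mod n" if "(f ^^ i) F = (f ^^ j) F" "F \<in> E" for i j F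
    using that(1)
  proof (induction i j rule: linorder_wlog)
    case (le i j)
    then have "(f ^^ i) F = (f ^^ i) ((f ^^ (j - i)) F)" by (metis comp_apply funpow_add le_add_diff_inverse)
    then have "(f ^^ (j - i)) F = F" using inj iter[OF that(2)] that(2) by metis
    then have "n dvd j - i" using dvd[OF that(2)] per[OF that(2)] unfolding P_def by (meson dvd_trans)
    then show ?case using le(1) by (metis mod_eq_dvd_iff_nat)
  next
    case (sym i j)
    then show ?case by metis
  qed
  \<comment> \<open>The choice depends on the forward orbit only as a set, and on a cycle
    \<open>F\<close> and \<open>f F\<close> have the same one.\<close>
  define R where "R F = (SOME G. \<exists>i. G = (f ^^ i) F)" for F
  have R: "\<exists>i. R F = (f ^^ i) F" for F unfolding R_def by (rule someI[of _ F]) (rule exI[of _ 0], simp)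
  have RE: "R F \<in> E" if "F \<in> E" for F using R[of F] iter[OF that] by auto
  have Rf: "R (f F) = R F" if F: "F \<in> E" for F
  proof -
    have "(\<exists>i. G = (f ^^ i) (f F)) \<longleftrightarrow> (\<exists>i. G = (f ^^ i) F)" for G
    proof
      assume "\<exists>i. G = (f ^^ i) (f F)"
      then show "\<exists>i. G = (f ^^ i) F" by (metis comp_apply funpow_Suc_right)
    next
      assume "\<exists>i. G = (f ^^ i) F"
      then obtain i where "G = (f ^^ i) F" by blast
      also have "\<dots> = (f ^^ i) ((f ^^ (P F)) F)" using P[OF F] by simp
      also have "\<dots> = (f ^^ (i + (P F - 1))) (f F)"
      proof -
        have "P F = Suc (P F - 1)" using P(1)[OF F] by simp
        then have "(f ^^ (P F)) F = (f ^^ (P F - 1)) (f F)" by (metis comp_apply funpow_Suc_right)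
        then show ?thesis by (simp add: funpow_add)
      qed
      finally show "\<exists>i. G = (f ^^ i) (f F)" by blast
    qed
    then show ?thesis unfolding R_def by simp
  qed
  have bk: "\<exists>j. F = (f ^^ j) (R F)" if F: "F \<in> E" for F
  proof -
    obtain i where i: "R F = (f ^^ i) F" using R by blast
    have "i \<le> P F * i" using P(1)[OF F] by simp
    then have "(f ^^ (P F * i - i)) (R F) = F" unfolding i using Pm[OF F, of i] by (metis comp_apply funpow_add le_add_diff_inverse2)
    then show ?thesis by metis
  qed
  define J where "J F = (SOME j. F = (f ^^ j) (R F))" for F
  have J: "F = (f ^^ J F) (R F)" if "F \<in> E" for F unfolding J_def using bk[OF that] by (rule someI_ex)
  show ?thesis
  proof (intro exI[of _ "\<lambda>F. J F mod n"] ballI conjI)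
    fix F assume F: "F \<in> E"
    show "J F mod n < n" using n by simp
    have fF: "f F \<in> E" using E F by blast
    have "(f ^^ J (f F)) (R F) = f F" using J[OF fF] Rf[OF F] by simp
    also have "\<dots> = (f ^^ Suc (J F)) (R F)" using J[OF F] by simp
    finally have "J (f F) mod n = Suc (J F) mod n" using same RE[OF F] by blast
    then show "J (f F) mod n = Suc (J F mod n) mod n" by (simp add: mod_Suc_eq)
  qed
qed

text \<open>An infinite sum with finite support, written without a bound because along orbits the
  bound will vary from point to point.\<close>

definition support_sum :: "(nat \<Rightarrow> int) \<Rightarrow> int" where
  "support_sum a = (\<Sum>i | a i \<noteq> 0. a i)"

lemma support_sum_eq:
  assumes "\<And>i. i \<ge> m \<Longrightarrow> a i = 0"
  shows "support_sum a = (\<Sum>i<m. a i)"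
proof -
  have "{i. a i \<noteq> 0} \<subseteq> {..<m}" using assms by (force simp: not_le[symmetric])
  then show ?thesis unfolding support_sum_def by (intro sum.mono_neutral_left) auto
qed

lemma support_sum_Suc:
  assumes "\<And>i. i \<ge> m \<Longrightarrow> a i = 0"
  shows "support_sum a = a 0 + support_sum (\<lambda>i. a (Suc i))"
proof -
  have "support_sum a = (\<Sum>i<Suc m. a i)" by (rule support_sum_eq) (use assms in auto)
  also have "\<dots> = a 0 + (\<Sum>i<m. a (Suc i))" by (rule sum.lessThan_Suc_shift)
  also have "(\<Sum>i<m. a (Suc i)) = support_sum (\<lambda>i. a (Suc i))" by (rule support_sum_eq[symmetric]) (use assms in auto)
  finally show ?thesis .
qed

text \<open>Forward orbits off \<open>X \<union> {p}\<close> tend to \<open>p\<close> and backward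
  ones to \<open>X\<close>, uniformly on a neighbourhood \<open>V\<close> of each point. The
  uniformity is what keeps sums along orbits locally constant.\<close>

locale attractor_repeller =
  fixes W :: "'w topology" and h k :: "'w \<Rightarrow> 'w" and X :: "'w set" and p :: 'w
  assumes W: "compact_space W" "Hausdorff_space W"
    and hk: "homeomorphic_maps W W h k"
    and X: "closedin W X" and p: "p \<in> topspace W" "p \<notin> X"
    and hp: "h p = p" and hX: "h ` X = X"
    and attract: "\<And>y U. y \<in> topspace W - (X \<union> {p}) \<Longrightarrow> openin W U \<Longrightarrow> p \<in> U \<Longrightarrow>
      \<exists>V n0. openin W V \<and> y \<in> V \<and> (\<forall>n\<ge>n0. (h ^^ n) ` V \<subseteq> U)"
    and repel: "\<And>y U. y \<in> topspace W - (X \<union> {p}) \<Longrightarrow> openin W U \<Longrightarrow> X \<subseteq> U \<Longrightarrow>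
      \<exists>V n0. openin W V \<and> y \<in> V \<and> (\<forall>n\<ge>n0. (k ^^ n) ` V \<subseteq> U)"
begin

definition "Y = topspace W - (X \<union> {p})"

text \<open>Clopen in the subspace \<open>Y\<close>: as \<open>Y\<close> is open in
  \<open>W\<close>, both halves may be tested in \<open>W\<close>.\<close>

definition clop :: "'w set \<Rightarrow> bool" where
  "clop T \<longleftrightarrow> T \<subseteq> Y \<and> openin W T \<and> openin W (Y - T)"

definition away :: "'w set \<Rightarrow> 'w set \<Rightarrow> bool" where
  "away T Q \<longleftrightarrow> (\<exists>U. openin W U \<and> Q \<subseteq> U \<and> U \<inter> T = {})"

text \<open>These are the sets on which a defect can be removed: forward orbits finally leave
  \<open>T1\<close>, backward orbits finally leave \<open>T2\<close>.\<close>

definition splits :: "'w set \<Rightarrow> bool" where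
  "splits T \<longleftrightarrow> (\<exists>T1 T2. clop T1 \<and> clop T2 \<and> T = T1 \<union> T2 \<and> away T1 {p} \<and> away T2 X)"

lemma closedin_p: "closedin W {p}"
  using W p by (simp add: closedin_Hausdorff_singleton)

lemma closedin_B: "closedin W (X \<union> {p})"
  by (rule closedin_Un[OF X closedin_p])

lemma openin_Y: "openin W Y"
  unfolding Y_def using closedin_B by blast

lemma Y_topspace: "Y \<subseteq> topspace W"
  unfolding Y_def by blast

lemma XW: "X \<subseteq> topspace W"
  by (rule closedin_subset[OF X])

lemma clop_Y: "clop Y"
  unfolding clop_def using openin_Y by simp

lemma clop_compl: "clop T \<Longrightarrow> clop (Y - T)"
  unfolding clop_def by (auto simp: double_diff)

lemma clop_Int: "clop S \<Longrightarrow> clop T \<Longrightarrow> clop (S \<inter> T)"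
  unfolding clop_def by (auto simp: Diff_Int intro: openin_Int openin_Un)

lemma clop_Un: "clop S \<Longrightarrow> clop T \<Longrightarrow> clop (S \<union> T)"
  unfolding clop_def by (auto simp: Diff_Un intro: openin_Int openin_Un)

lemma clop_diff: "clop S \<Longrightarrow> clop T \<Longrightarrow> clop (S - T)"
proof -
  assume "clop S" "clop T"
  then have "clop (S \<inter> (Y - T))" by (intro clop_Int clop_compl)
  moreover have "S \<inter> (Y - T) = S - T" using \<open>clop S\<close> unfolding clop_def by blast
  ultimately show ?thesis by simp
qed

lemma clop_empty: "clop {}"
  unfolding clop_def using openin_Y by simp

lemma clop_Union: "finite \<D> \<Longrightarrow> (\<And>D. D \<in> \<D> \<Longrightarrow> clop D) \<Longrightarrow> clop (\<Union>\<D>)"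
  by (induction \<D> rule: finite_induct) (auto intro: clop_Un clop_empty)

lemma clop_subset: "clop T \<Longrightarrow> T \<subseteq> Y"
  unfolding clop_def by blast

lemma away_mono: "away T Q \<Longrightarrow> S \<subseteq> T \<Longrightarrow> away S Q"
  unfolding away_def by (meson disjoint_iff subsetD)

lemma away_Un: "away S Q \<Longrightarrow> away T Q \<Longrightarrow> away (S \<union> T) Q"
  unfolding away_def
proof (elim exE conjE)
  fix U V assume "openin W U" "Q \<subseteq> U" "U \<inter> S = {}" "openin W V" "Q \<subseteq> V" "V \<inter> T = {}"
  then show "\<exists>U. openin W U \<and> Q \<subseteq> U \<and> U \<inter> (S \<union> T) = {}"
    by (intro exI[of _ "U \<inter> V"]) (auto intro: openin_Int)
qed

lemma away_empty: "Q \<subseteq> topspace W \<Longrightarrow> away {} Q"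
  unfolding away_def by (intro exI[of _ "topspace W"]) auto

lemma splits_Un: "splits S \<Longrightarrow> splits T \<Longrightarrow> splits (S \<union> T)"
  unfolding splits_def
proof (elim exE conjE)
  fix S1 S2 T1 T2 assume *: "clop S1" "clop S2" "S = S1 \<union> S2" "away S1 {p}" "away S2 X"
    "clop T1" "clop T2" "T = T1 \<union> T2" "away T1 {p}" "away T2 X"
  then show "\<exists>T1 T2. clop T1 \<and> clop T2 \<and> S \<union> T = T1 \<union> T2 \<and> away T1 {p} \<and> away T2 X"
    by (intro exI[of _ "S1 \<union> T1"] exI[of _ "S2 \<union> T2"]) (auto intro: clop_Un away_Un)
qed

lemma splits_empty: "splits {}"
  unfolding splits_def using clop_empty away_empty p XW by (metis Un_absorb empty_subsetI insert_subset)

lemma splits_Union: "finite \<D> \<Longrightarrow> (\<And>D. D \<in> \<D> \<Longrightarrow> splits D) \<Longrightarrow> splits (\<Union>\<D>)"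
  by (induction \<D> rule: finite_induct) (auto intro: splits_Un splits_empty)

definition qrel :: "'w \<Rightarrow> 'w \<Rightarrow> bool" where
  "qrel y z \<longleftrightarrow> y \<in> Y \<and> z \<in> Y \<and> (\<forall>T. clop T \<longrightarrow> (y \<in> T \<longleftrightarrow> z \<in> T))"

lemma clop_iff: "clop T \<longleftrightarrow> closedin (subtopology W Y) T \<and> openin (subtopology W Y) T"
  unfolding clop_def closedin_def openin_open_subtopology[OF openin_Y] using Y_topspace
  by (auto simp: Int_absorb1)

lemma quasi_components_qrel:
  "F \<in> quasi_components_of (subtopology W Y) \<longleftrightarrow> (\<exists>y\<in>Y. F = {z. qrel y z})"
proof -
  have "quasi_component_of (subtopology W Y) y z \<longleftrightarrow> qrel y z" for y z
    unfolding quasi_component_of_def qrel_def clop_iff using Y_topspace by (auto simp: Int_absorb1)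
  then show ?thesis unfolding quasi_components_of_def using Y_topspace by (auto simp: Int_absorb1 image_iff)
qed

definition essential :: "'w set set" where
  "essential = {F \<in> quasi_components_of (subtopology W Y). p \<in> W closure_of F \<and> W closure_of F \<inter> X \<noteq> {}}"

lemma essentialE:
  assumes "F \<in> essential"
  obtains y where "y \<in> Y" "y \<in> F" "F = {z. qrel y z}" "F \<subseteq> Y"
proof -
  obtain y where y: "y \<in> Y" "F = {z. qrel y z}" using assms unfolding essential_def quasi_components_qrel by blast
  then have "y \<in> F" by (simp add: qrel_def)
  then show thesis using that y by (auto simp: qrel_def)
qed

text \<open>A quasicomponent lies wholly in any clopen set that meets it. Inside \<open>T1\<close>
  its closure would miss \<open>p\<close>, inside \<open>T2\<close> it would miss
  \<open>X\<close>.\<close>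

lemma essential_not_splits:
  assumes F: "F \<in> essential" and T: "F \<subseteq> T" "splits T"
  shows False
proof -
  obtain y where y: "y \<in> F" "F = {z. qrel y z}" using essentialE[OF F] by metis
  obtain T1 T2 where s: "clop T1" "clop T2" "T = T1 \<union> T2" "away T1 {p}" "away T2 X" using T(2) unfolding splits_def by blast
  have inside: "F \<subseteq> S" if "clop S" "y \<in> S" for S using that y(2) unfolding qrel_def by blast
  have meets: "U \<inter> F \<noteq> {}" if "x \<in> W closure_of F" "openin W U" "x \<in> U" for U x
    using that unfolding in_closure_of by blast
  have "y \<in> T1 \<or> y \<in> T2" using y T s by blast
  then show False
  proof
    assume "y \<in> T1"
    obtain U where U: "openin W U" "{p} \<subseteq> U" "U \<inter> T1 = {}" using s(4) unfolding away_def by blast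
    have "p \<in> W closure_of F" using F by (simp add: essential_def)
    from meets[OF this U(1)] show False using U inside[OF s(1) \<open>y \<in> T1\<close>] by blast
  next
    assume "y \<in> T2"
    obtain U where U: "openin W U" "X \<subseteq> U" "U \<inter> T2 = {}" using s(5) unfolding away_def by blast
    obtain x where x: "x \<in> W closure_of F" "x \<in> X" using F unfolding essential_def by blast
    from meets[OF x(1) U(1)] show False using U x inside[OF s(2) \<open>y \<in> T2\<close>] by blast
  qed
qed

lemma normal: "normal_space W"
  by (rule compact_Hausdorff_or_regular_imp_normal_space) (use W in auto)

lemma separate:
  assumes "closedin W P" "closedin W Q" "P \<inter> Q = {}"
  obtains U V where "openin W U" "openin W V" "P \<subseteq> U" "Q \<subseteq> V" "U \<inter> V = {}"
  using normal assms unfolding normal_space_def disjnt_def by metis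

text \<open>An open \<open>U\<close> around \<open>Q\<close> is separated from the closure of
  \<open>F\<close> and from \<open>Q'\<close>. Its boundary is a compact subset of \<open>Y\<close>
  that misses \<open>F\<close>, so finitely many clopen sets avoiding \<open>y\<close> cover it.
  Removing these and the closure of \<open>U\<close> from \<open>Y\<close> leaves a clopen
  set.\<close>

lemma clop_away:
  assumes Q: "closedin W Q" "closedin W Q'" "Q \<inter> Q' = {}" "X \<union> {p} = Q \<union> Q'"
    and y: "y \<in> Y" and F: "F = {z. qrel y z}" and disj: "Q \<inter> W closure_of F = {}"
  shows "\<exists>T. clop T \<and> y \<in> T \<and> away T Q"
proof -
  have FW: "F \<subseteq> topspace W" using F Y_topspace unfolding qrel_def by blast
  have FC: "F \<subseteq> W closure_of F" by (rule closure_of_subset[OF FW])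
  have yF: "y \<in> F" using F y by (simp add: qrel_def)
  have "closedin W (W closure_of F \<union> Q')" using Q by (intro closedin_Un closedin_closure_of)
  moreover have "Q \<inter> (W closure_of F \<union> Q') = {}" using disj Q by blast
  ultimately obtain U V where U: "openin W U" "openin W V" "Q \<subseteq> U" "W closure_of F \<union> Q' \<subseteq> V" "U \<inter> V = {}"
    using separate[OF Q(1)] by metis
  define C where "C = W closure_of U"
  have UC: "U \<subseteq> C" unfolding C_def by (rule closure_of_subset[OF openin_subset[OF U(1)]])
  have CV: "C \<inter> V = {}" unfolding C_def using openin_Int_closure_of_eq_empty[OF U(2), of U] U(5) by blast
  have Ccl: "closedin W C" unfolding C_def by simp
  let ?bd = "C - U"
  have bdY: "?bd \<subseteq> Y" using closedin_subset[OF Ccl] U(3,4) CV Q(4) unfolding Y_def by blast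
  have "compactin W ?bd" by (rule closedin_compact_space[OF W(1) closedin_diff[OF Ccl U(1)]])
  moreover have sep: "\<exists>D. clop D \<and> z \<in> D \<and> y \<notin> D" if z: "z \<in> ?bd" for z
  proof -
    have "z \<notin> F" using z CV U(4) FC by blast
    then obtain T where T: "clop T" "(y \<in> T) \<noteq> (z \<in> T)" using F y z bdY unfolding qrel_def by blast
    show ?thesis
    proof (cases "z \<in> T")
      case False
      have "z \<in> Y - T" "y \<notin> Y - T" using T False z bdY by blast+
      then show ?thesis using clop_compl[OF T(1)] by blast
    qed (use T in blast)
  qed
  then obtain D where D: "\<And>z. z \<in> ?bd \<Longrightarrow> clop (D z) \<and> z \<in> D z \<and> y \<notin> D z" by metis
  have "\<forall>U\<in>D ` ?bd. openin W U" "?bd \<subseteq> \<Union>(D ` ?bd)" using D unfolding clop_def by blast+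
  ultimately obtain \<F> where \<F>: "finite \<F>" "\<F> \<subseteq> D ` ?bd" "?bd \<subseteq> \<Union>\<F>"
    unfolding compactin_def by metis
  define E where "E = \<Union>\<F>"
  have E: "clop E" unfolding E_def by (rule clop_Union[OF \<F>(1)]) (use \<F> D in blast)
  have yE: "y \<notin> E" using \<F> D unfolding E_def by blast
  define T where "T = (Y - E) - C"
  have "openin W T" unfolding T_def using E Ccl unfolding clop_def by (intro openin_diff[OF _ Ccl]) simp
  \<comment> \<open>\<open>E\<close> covers the boundary, so in the complement of \<open>T\<close>
    the closed \<open>C\<close> may be replaced by the open \<open>U\<close>.\<close>
  moreover have "Y - T = E \<union> (Y \<inter> U)" using E UC \<F>(3) bdY unfolding T_def E_def clop_def by blast
  then have "openin W (Y - T)" using E U(1) openin_Y unfolding clop_def by (simp add: openin_Un openin_Int)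
  ultimately have "clop T" unfolding clop_def T_def by blast
  moreover have "y \<in> T" using y yE yF FC U(4) CV unfolding T_def by blast
  moreover have "away T Q" unfolding away_def T_def using U UC by blast
  ultimately show ?thesis by blast
qed

lemma nonessential_clop:
  assumes y: "y \<in> Y" and F: "{z. qrel y z} \<notin> essential"
  shows "\<exists>T. clop T \<and> y \<in> T \<and> (away T {p} \<or> away T X)"
proof -
  let ?F = "{z. qrel y z}"
  have "?F \<in> quasi_components_of (subtopology W Y)" unfolding quasi_components_qrel using y by blast
  then have "p \<notin> W closure_of ?F \<or> W closure_of ?F \<inter> X = {}" using F unfolding essential_def by blast
  then show ?thesis
  proof
    assume "p \<notin> W closure_of ?F"
    then have "{p} \<inter> W closure_of ?F = {}" by blast
    from clop_away[OF closedin_p X _ _ y refl this] show ?thesis using p(2) by blast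
  next
    assume "W closure_of ?F \<inter> X = {}"
    then have "X \<inter> W closure_of ?F = {}" by blast
    from clop_away[OF X closedin_p _ _ y refl this] show ?thesis using p(2) by blast
  qed
qed

text \<open>Between neighbourhoods \<open>U\<close> of \<open>X\<close> and \<open>V\<close> of
  \<open>p\<close> only a compact set \<open>K\<close> remains. Finitely many clopen subsets of
  \<open>D\<close>, each away from \<open>p\<close> or from \<open>X\<close>, cover the part of
  \<open>D\<close> in \<open>K\<close>, and what is left of \<open>D\<close> falls into the disjoint
  \<open>U\<close> and \<open>V\<close>.\<close>

lemma splits_if_no_essential:
  assumes D: "clop D" and ne: "\<And>F. F \<in> essential \<Longrightarrow> F \<inter> D = {}"
  shows "splits D"
proof -
  have "X \<inter> {p} = {}" using p(2) by blast
  then obtain U V where U: "openin W U" "openin W V" "X \<subseteq> U" "{p} \<subseteq> V" "U \<inter> V = {}"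
    using separate[OF X closedin_p] by metis
  define K where "K = topspace W - (U \<union> V)"
  have KY: "K \<subseteq> Y" unfolding K_def Y_def using U by blast
  have "closedin W K" unfolding K_def using U by (intro closedin_diff openin_Un) auto
  moreover have "openin W (Y - D)" using D unfolding clop_def by blast
  ultimately have "closedin W (K - (Y - D))" by (rule closedin_diff)
  moreover have "K - (Y - D) = D \<inter> K" using KY clop_subset[OF D] by blast
  ultimately have "compactin W (D \<inter> K)" using closedin_compact_space[OF W(1)] by simp
  moreover have loc: "\<exists>T. clop T \<and> y \<in> T \<and> splits T \<and> T \<subseteq> D" if y: "y \<in> D \<inter> K" for y
  proof -
    have yY: "y \<in> Y" using y clop_subset[OF D] by blast
    have "y \<in> {z. qrel y z}" using yY by (simp add: qrel_def)
    then have "{z. qrel y z} \<notin> essential" using ne y by blast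
    from nonessential_clop[OF yY this] obtain T where T: "clop T" "y \<in> T" "away T {p} \<or> away T X" by blast
    have c: "clop (T \<inter> D)" by (rule clop_Int[OF T(1) D])
    have "splits (T \<inter> D)" using T(3)
    proof
      assume "away T {p}"
      then have "away (T \<inter> D) {p}" by (rule away_mono) blast
      then show ?thesis unfolding splits_def using c clop_empty away_empty[OF XW] by (intro exI[of _ "T \<inter> D"] exI[of _ "{}"]) simp
    next
      assume "away T X"
      then have "away (T \<inter> D) X" by (rule away_mono) blast
      then show ?thesis unfolding splits_def using c clop_empty away_empty[of "{p}"] p by (intro exI[of _ "{}"] exI[of _ "T \<inter> D"]) simp
    qed
    then show ?thesis using c y T(2) by blast
  qed
  then obtain T where T: "\<And>y. y \<in> D \<inter> K \<Longrightarrow> clop (T y) \<and> y \<in> T y \<and> splits (T y) \<and> T y \<subseteq> D" by metis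
  have "\<forall>U\<in>T ` (D \<inter> K). openin W U" "D \<inter> K \<subseteq> \<Union>(T ` (D \<inter> K))" using T unfolding clop_def by blast+
  ultimately obtain \<F> where \<F>: "finite \<F>" "\<F> \<subseteq> T ` (D \<inter> K)" "D \<inter> K \<subseteq> \<Union>\<F>"
    unfolding compactin_def by metis
  define E where "E = \<Union>\<F>"
  have E: "clop E" "splits E" "E \<subseteq> D" unfolding E_def
    by (rule clop_Union[OF \<F>(1)], use \<F> T in blast) (rule splits_Union[OF \<F>(1)], use \<F> T in blast, use \<F> T in blast)
  define R where "R = D - E"
  have R: "clop R" unfolding R_def by (rule clop_diff[OF D E(1)])
  have RUV: "R \<subseteq> U \<union> V" using \<F>(3) clop_subset[OF D] Y_topspace unfolding R_def E_def K_def by blast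
  have "Y - R \<union> (R \<inter> V) = Y - (R \<inter> U)" "Y - R \<union> (R \<inter> U) = Y - (R \<inter> V)" using RUV clop_subset[OF R] U(5) by blast+
  moreover have "openin W (Y - R \<union> (R \<inter> V))" "openin W (Y - R \<union> (R \<inter> U))" "openin W (R \<inter> U)" "openin W (R \<inter> V)"
    using R U(1,2) unfolding clop_def by (auto intro: openin_Un openin_Int)
  ultimately have "clop (R \<inter> U)" "clop (R \<inter> V)" unfolding clop_def using clop_subset[OF R] by auto
  moreover have "away (R \<inter> U) {p}" unfolding away_def using U by (intro exI[of _ V]) blast
  moreover have "away (R \<inter> V) X" unfolding away_def using U by (intro exI[of _ U]) blast
  moreover have "R = (R \<inter> U) \<union> (R \<inter> V)" using RUV by blast
  ultimately have "splits R" unfolding splits_def by blast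
  then have "splits (R \<union> E)" using E(2) by (rule splits_Un)
  moreover have "R \<union> E = D" unfolding R_def using E(3) by blast
  ultimately show ?thesis by simp
qed

subsection \<open>Finiteness of the essential quasicomponents\<close>

abbreviation (input) HS :: "('w, 'k::field) complex" where "HS \<equiv> lzero W (X \<union> {p})"
abbreviation (input) HR :: "('w, 'k::field) complex" where "HR \<equiv> lzero W (topspace W)"

text \<open>A clopen set \<open>T\<close> of \<open>Y\<close> yields a 1-cocycle: the coboundary of the indicator of the part of
  \<open>T\<close> away from \<open>p\<close>, suppressed near \<open>X\<close>. A relation between such cocycles makes one of the sets
  split.\<close>

lemma unsplit_le_hdim:
  assumes fd: "hfd HS (HR :: ('w, 'k::field) complex) 2"
    and T: "\<And>i. i < n \<Longrightarrow> clop (T i)" "\<And>i. i < n \<Longrightarrow> \<not> splits (T i)"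
      "\<And>i j. i < n \<Longrightarrow> j < n \<Longrightarrow> i \<noteq> j \<Longrightarrow> T i \<inter> T j = {}"
  shows "n \<le> hdim HS (HR :: ('w, 'k) complex) 2"
proof -
  have "X \<inter> {p} = {}" using p(2) by blast
  then obtain U V0 where U: "openin W U" "openin W V0" "X \<subseteq> U" "{p} \<subseteq> V0" "U \<inter> V0 = {}"
    using separate[OF X closedin_p] by metis
  \<comment> \<open>A second separation inserts a closed \<open>C\<close> with
    \<open>V \<subseteq> C \<subseteq> V0\<close>. Every point then has a neighbourhood that misses
    \<open>U\<close> or misses \<open>V\<close>, which mere disjointness of \<open>U\<close> and
    \<open>V\<close> would not give.\<close>
  have "{p} \<inter> (topspace W - V0) = {}" "closedin W (topspace W - V0)" using U by auto
  then obtain V G where V: "openin W V" "openin W G" "{p} \<subseteq> V" "topspace W - V0 \<subseteq> G" "V \<inter> G = {}"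
    using separate[OF closedin_p] by metis
  define C where "C = topspace W - G"
  have C: "closedin W C" "V \<subseteq> C" "C \<subseteq> V0" unfolding C_def using V openin_subset[OF V(1)] by blast+
  define e where "e i y = (if y \<in> T i - V then 1 else (0::'k))" for i y
  \<comment> \<open>Setting pairs inside \<open>U\<close> to 0 makes \<open>c i\<close> vanish near
    \<open>X\<close>; near \<open>p\<close> it vanishes because \<open>e i\<close> is 0 on
    \<open>V\<close>.\<close>
  define c where "c i \<sigma> = (if length \<sigma> = 2 \<and> \<not> (\<sigma> ! 0 \<in> U \<and> \<sigma> ! 1 \<in> U) then e i (\<sigma> ! 1) - e i (\<sigma> ! 0) else 0)" for i \<sigma>
  define E where "E i \<sigma> = (if length \<sigma> = 1 then e i (\<sigma> ! 0) else 0)" for i \<sigma>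
  have cc: "c i \<in> cochain 2" for i by (auto simp: c_def cochain_def)
  have lE: "lcob (E i) [x, y] = e i y - e i x" for i x y by (simp add: E_def)
  have Ec: "E i \<in> cochain 1" for i by (auto simp: E_def cochain_def)
  have lEc: "lcob (E i) \<in> cochain 2" for i using stableD(2)[OF stable_cochain Ec] by (simp add: numeral_2_eq_2)
  have two: "\<exists>x y. \<sigma> = [x, y]" if "length \<sigma> = 2" for \<sigma> :: "'w list" using that by (auto simp: length_Suc_conv numeral_2_eq_2)
  have c0: "vanish (c i) N" if "\<And>x y. x \<in> N \<Longrightarrow> y \<in> N \<Longrightarrow> x \<in> U \<and> y \<in> U \<or> e i x = e i y" for i N
  proof (rule vanish_cochain[OF cc])
    fix \<sigma> assume s: "set \<sigma> \<subseteq> N" "length \<sigma> = 2"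
    then obtain x y where "\<sigma> = [x, y]" using two by blast
    then show "c i \<sigma> = 0" using that[of x y] s by (auto simp: c_def)
  qed
  have cE: "vanish (c i - lcob (E i)) N" if "N \<inter> U = {}" for i N
  proof (rule vanish_cochain)
    show "c i - lcob (E i) \<in> cochain 2" by (rule fs.subspace_diff[OF fsub_cochain cc lEc])
    fix \<sigma> assume s: "set \<sigma> \<subseteq> N" "length \<sigma> = 2"
    then obtain x y where xy: "\<sigma> = [x, y]" using two by blast
    then have "x \<notin> U" using s that by auto
    then have "c i [x, y] = e i y - e i x" by (simp add: c_def)
    then show "(c i - lcob (E i)) \<sigma> = 0" using lE[of i x y] xy by simp
  qed
  have cases: "\<exists>N. openin W N \<and> x \<in> N \<and> N \<subseteq> Y \<and> (N \<inter> U = {} \<or> N \<inter> V = {}) \<and> (\<forall>j<n. N \<subseteq> T j \<or> N \<inter> T j = {})"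
    if x: "x \<in> Y" for x
  proof -
    define N1 where "N1 = (if x \<in> C then V0 else topspace W - C)"
    have N1: "openin W N1" "x \<in> N1" "N1 \<inter> U = {} \<or> N1 \<inter> V = {}"
      unfolding N1_def using U C x Y_topspace by auto
    define N2 where "N2 = (\<Inter>j<n. if x \<in> T j then T j else Y - T j) \<inter> topspace W"
    have "openin W N2" unfolding N2_def using T(1) unfolding clop_def by (intro openin_INT) auto
    moreover have "x \<in> N2" unfolding N2_def using x Y_topspace by auto
    moreover have "N2 \<subseteq> T j \<or> N2 \<inter> T j = {}" if "j < n" for j
      using that unfolding N2_def by (cases "x \<in> T j") auto
    ultimately show ?thesis using N1 x openin_Y
      by (intro exI[of _ "N1 \<inter> N2 \<inter> Y"]) (auto intro: openin_Int)
  qed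
  \<comment> \<open>Where \<open>U\<close> is missed, \<open>c i\<close> is the coboundary of
    \<open>E i\<close> on small lists; where \<open>V\<close> is missed, \<open>e i\<close> is
    locally constant on \<open>Y\<close> and \<open>c i\<close> vanishes on small lists.\<close>
  have dc: "lcob (c i) \<in> HR (Suc 2)" if i: "i < n" for i
  proof (rule lzeroI[OF stableD(2)[OF stable_cochain cc]])
    fix x assume "x \<in> topspace W"
    then consider "x \<in> X" | "x = p" | "x \<in> Y" unfolding Y_def by blast
    then have "\<exists>N. openin W N \<and> x \<in> N \<and> vanish (lcob (c i)) N"
    proof cases
      case 1
      have "vanish (lcob (c i)) U" by (rule vanish_lcob[OF c0]) blast
      then show ?thesis using 1 U by blast
    next
      case 2
      have "vanish (lcob (c i)) V" by (rule vanish_lcob[OF c0]) (simp add: e_def)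
      then show ?thesis using 2 V by blast
    next
      case 3
      from cases[OF this] obtain N where N: "openin W N" "x \<in> N" "N \<inter> U = {} \<or> N \<inter> V = {}" "\<forall>j<n. N \<subseteq> T j \<or> N \<inter> T j = {}" by blast
      from N(3) have "vanish (lcob (c i)) N"
      proof
        assume "N \<inter> U = {}"
        from vanish_lcob[OF cE[OF this]] show ?thesis by (simp add: lcob_minus lcob_lcob_fun)
      next
        assume NV: "N \<inter> V = {}"
        have "N \<subseteq> T i \<or> N \<inter> T i = {}" using N(4) i by blast
        then have "e i x = e i y" if "x \<in> N" "y \<in> N" for x y using NV that unfolding e_def by auto
        then show ?thesis by (intro vanish_lcob[OF c0]) blast
      qed
      then show ?thesis using N by blast
    qed
    then show "\<exists>N. openin W N \<and> x \<in> N \<and> vanish (lcob (c i)) (N \<inter> topspace W)"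
      by (meson Int_lower1 vanish_mono)
  qed
  have cB: "c i \<in> HS 2" for i
  proof (rule lzeroI_closed[OF closedin_B cc])
    fix x assume "x \<in> X \<union> {p}"
    then consider "x \<in> X" | "x = p" by blast
    then have "\<exists>N. openin W N \<and> x \<in> N \<and> vanish (c i) N"
    proof cases
      case 1
      have "vanish (c i) U" by (rule c0) blast
      then show ?thesis using 1 U by blast
    next
      case 2
      have "vanish (c i) V" by (rule c0) (simp add: e_def)
      then show ?thesis using 2 V by blast
    qed
    then show "\<exists>N. openin W N \<and> x \<in> N \<and> vanish (c i) (N \<inter> (X \<union> {p}))" by (meson Int_lower1 vanish_mono)
  qed
  show ?thesis
  proof (rule independent_mod_le_qdim[OF fsub_bcob[OF stable_lzero stable_lzero] fsub_zcyc[OF stable_lzero stable_lzero] _ fd])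
    show "bcob HS HR 2 \<subseteq> (zcyc HS HR 2 :: ('w list \<Rightarrow> 'k) set)"
      by (rule bcob_zcyc[OF stable_lzero stable_lzero lzero_mono[OF closedin_subset[OF closedin_B]]])
    show "c i \<in> zcyc HS HR 2" if "i < n" for i using cB dc[OF that] by (simp add: zcyc_def)
    fix a :: "nat \<Rightarrow> 'k" assume "(\<Sum>i<n. fscale (a i) (c i)) \<in> bcob HS HR 2"
    then obtain b r where br: "b \<in> HS 1" "r \<in> HR 2" "(\<Sum>i<n. fscale (a i) (c i)) = lcob b + r"
      by (rule bcobE) simp
    have bc: "b [] = 0" using cochainD(2)[OF lzero_cochain[OF br(1)]] .
    have rel: "(\<Sum>i<n. a i * c i [x, y]) = (b [y] - b [x]) + r [x, y]" for x y
      using fun_cong[OF br(3), of "[x, y]"] bc by (simp add: fsum_apply)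
    have rloc: "\<exists>N. openin W N \<and> x \<in> N \<and> (\<forall>y\<in>N. \<forall>z\<in>N. (\<Sum>i<n. a i * c i [y, z]) = b [z] - b [y])" if x: "x \<in> topspace W" for x
    proof -
      from lzeroD[OF br(2) x] obtain N where N: "openin W N" "x \<in> N" "vanish r (N \<inter> topspace W)" .
      have "r [y, z] = 0" if "y \<in> N" "z \<in> N" for y z
        by (rule vanishD[OF N(3)]) (use that openin_subset[OF N(1)] in auto)
      then show ?thesis using N rel by (intro exI[of _ N]) simp
    qed
    have bB: "b [x] = 0" if x: "x \<in> X \<union> {p}" for x
    proof -
      have "x \<in> topspace W" using x closedin_subset[OF closedin_B] by blast
      from lzeroD[OF br(1) this] obtain N where N: "x \<in> N" "vanish b (N \<inter> (X \<union> {p}))" .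
      show ?thesis by (rule vanishD[OF N(2)]) (use N x in auto)
    qed
    \<comment> \<open>The relation makes \<open>w\<close> locally constant on \<open>Y\<close>. Near
      \<open>p\<close> it is 0, and near \<open>X\<close> it equals \<open>a i\<close> on
      \<open>T i\<close>: there \<open>b\<close> is 0 and only \<open>e i\<close> contributes. If
      \<open>a i \<noteq> 0\<close>, the level set at \<open>a i\<close> and its complement
      therefore split \<open>T i\<close>.\<close>
    define w where "w y = (\<Sum>i<n. a i * e i y) - b [y]" for y
    have wloc: "\<exists>N. openin W N \<and> x \<in> N \<and> (\<forall>y\<in>N. w y = w x)" if x: "x \<in> Y" for x
    proof -
      have xW: "x \<in> topspace W" using x Y_topspace by blast
      from cases[OF x] obtain N where N: "openin W N" "x \<in> N" "N \<inter> U = {} \<or> N \<inter> V = {}" "\<forall>j<n. N \<subseteq> T j \<or> N \<inter> T j = {}" by blast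
      from rloc[OF xW] obtain M where M: "openin W M" "x \<in> M" "\<forall>y\<in>M. \<forall>z\<in>M. (\<Sum>i<n. a i * c i [y, z]) = b [z] - b [y]" by blast
      have "w y = w x" if y: "y \<in> N \<inter> M" for y
      proof -
        have eq: "(\<Sum>i<n. a i * c i [x, y]) = b [y] - b [x]" using M y by blast
        have "c i [x, y] = e i y - e i x" if i: "i < n" for i
          using N(3)
        proof
          assume "N \<inter> U = {}"
          then have "x \<notin> U" using N(2) by blast
          then show ?thesis by (simp add: c_def)
        next
          assume NV: "N \<inter> V = {}"
          have "N \<subseteq> T i \<or> N \<inter> T i = {}" using N(4) i by blast
          then have "e i x = e i y" using NV N(2) y unfolding e_def by auto
          then show ?thesis by (simp add: c_def)
        qed
        then have "(\<Sum>i<n. a i * (e i y - e i x)) = b [y] - b [x]" using eq by simp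
        then show ?thesis unfolding w_def by (simp add: right_diff_distrib sum_subtractf algebra_simps)
      qed
      then show ?thesis using openin_Int[OF N(1) M(1)] N(2) M(2) by (intro exI[of _ "N \<inter> M"]) blast
    qed
    show "\<forall>i<n. a i = 0"
    proof (intro allI impI, rule ccontr)
      fix i assume i: "i < n" and ai: "a i \<noteq> 0"
      have Ti: "clop (T i)" by (rule T(1)[OF i])
      have op: "openin W {y \<in> T i. Pr (w y)}" for Pr
      proof (subst openin_subopen, intro ballI)
        fix x assume x: "x \<in> {y \<in> T i. Pr (w y)}"
        then have "x \<in> Y" using clop_subset[OF Ti] by blast
        from wloc[OF this] obtain N where N: "openin W N" "x \<in> N" "\<forall>y\<in>N. w y = w x" by blast
        have "openin W (N \<inter> T i)" using N Ti unfolding clop_def by blast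
        moreover have "N \<inter> T i \<subseteq> {y \<in> T i. Pr (w y)}"
        proof
          fix y assume y: "y \<in> N \<inter> T i"
          then have "w y = w x" using N(3) by blast
          then show "y \<in> {y \<in> T i. Pr (w y)}" using x y by simp
        qed
        ultimately show "\<exists>S. openin W S \<and> x \<in> S \<and> S \<subseteq> {y \<in> T i. Pr (w y)}" using N x by blast
      qed
      have cl: "clop {y \<in> T i. Pr (w y)}" for Pr
      proof -
        have "Y - {y \<in> T i. Pr (w y)} = (Y - T i) \<union> {y \<in> T i. \<not> Pr (w y)}" using clop_subset[OF Ti] by blast
        then have "openin W (Y - {y \<in> T i. Pr (w y)})" using op[of "\<lambda>t. \<not> Pr t"] Ti unfolding clop_def by (simp add: openin_Un)
        then show ?thesis unfolding clop_def using op[of Pr] clop_subset[OF Ti] by blast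
      qed
      have 1: "away {y \<in> T i. w y = a i} {p}"
      proof -
        from rloc[OF p(1)] obtain N where N: "openin W N" "p \<in> N" "\<forall>y\<in>N. \<forall>z\<in>N. (\<Sum>i<n. a i * c i [y, z]) = b [z] - b [y]" by blast
        have "w y = 0" if y: "y \<in> N \<inter> V" for y
        proof -
          have e0: "e j y = 0" "e j p = 0" for j using y V(3) by (auto simp: e_def)
          then have "c j [p, y] = 0" for j by (simp add: c_def)
          then have "b [y] - b [p] = 0" using N y by (metis (no_types, lifting) IntD1 mult_zero_right sum.neutral)
          then show ?thesis using e0 bB[of p] by (simp add: w_def)
        qed
        then show ?thesis unfolding away_def using N V ai by (intro exI[of _ "N \<inter> V"]) (auto intro: openin_Int)
      qed
      have 2: "away {y \<in> T i. w y \<noteq> a i} X"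
      proof -
        have "\<exists>N. openin W N \<and> x \<in> N \<and> (\<forall>y\<in>N \<inter> T i. w y = a i)" if x: "x \<in> X" for x
        proof -
          have "x \<in> topspace W" using x XW by blast
          from rloc[OF this] obtain N where N: "openin W N" "x \<in> N" "\<forall>y\<in>N. \<forall>z\<in>N. (\<Sum>i<n. a i * c i [y, z]) = b [z] - b [y]" by blast
          have "w y = a i" if y: "y \<in> N \<inter> U \<inter> T i" for y
          proof -
            have "c j [x, y] = 0" for j using x y U(3) by (auto simp: c_def)
            then have "b [y] - b [x] = 0" using N y by (metis (no_types, lifting) IntD1 mult_zero_right sum.neutral)
            then have b0: "b [y] = 0" using bB[of x] x by simp
            have "y \<notin> V" using y U(5) C by blast
            then have "a j * e j y = (if j = i then a i else 0)" if "j < n" for j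
              using T(3)[OF that i] y by (auto simp: e_def)
            then have "(\<Sum>j<n. a j * e j y) = (\<Sum>j<n. if j = i then a i else 0)" by (intro sum.cong) auto
            then show ?thesis using b0 i by (simp add: w_def)
          qed
          then show ?thesis using N U x by (intro exI[of _ "N \<inter> U"]) (auto intro: openin_Int)
        qed
        then obtain N where N: "\<And>x. x \<in> X \<Longrightarrow> openin W (N x) \<and> x \<in> N x \<and> (\<forall>y\<in>N x \<inter> T i. w y = a i)" by metis
        show ?thesis unfolding away_def
          by (intro exI[of _ "\<Union>(N ` X)"] conjI openin_Union) (use N in auto)
      qed
      have "T i = {y \<in> T i. w y = a i} \<union> {y \<in> T i. w y \<noteq> a i}" by blast
      then have "splits (T i)" unfolding splits_def using 1 2 cl[of "\<lambda>t. t = a i"] cl[of "\<lambda>t. t \<noteq> a i"] by metis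
      then show False using T(2)[OF i] by blast
    qed
  qed
qed

lemma clop_cell:
  assumes "finite \<C>" "\<And>C. C \<in> \<C> \<Longrightarrow> clop C"
  shows "clop {z \<in> Y. \<forall>C\<in>\<C>. z \<in> C \<longleftrightarrow> y \<in> C}"
  using assms
proof (induction \<C> rule: finite_induct)
  case empty
  then show ?case using clop_Y by simp
next
  case (insert C \<C>)
  have "{z \<in> Y. \<forall>D\<in>insert C \<C>. z \<in> D \<longleftrightarrow> y \<in> D} = {z \<in> Y. \<forall>D\<in>\<C>. z \<in> D \<longleftrightarrow> y \<in> D} \<inter> (if y \<in> C then C else Y - C)"
    using clop_subset[of C] insert.prems by auto
  moreover have "clop (if y \<in> C then C else Y - C)" using insert.prems clop_compl by simp
  ultimately show ?case using insert clop_Int by simp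
qed

text \<open>Finitely many clopen sets separate representatives pairwise; the cells of the partition
  of \<open>Y\<close> they generate are disjoint clopen neighbourhoods.\<close>

lemma separate_quasicomponents:
  assumes E: "finite \<E>" "\<E> \<subseteq> essential"
  obtains T where "\<And>F. F \<in> \<E> \<Longrightarrow> clop (T F) \<and> F \<subseteq> T F" "\<And>F G. F \<in> \<E> \<Longrightarrow> G \<in> \<E> \<Longrightarrow> F \<noteq> G \<Longrightarrow> T F \<inter> T G = {}"
proof -
  have "\<exists>y. y \<in> Y \<and> y \<in> F \<and> F = {z. qrel y z}" if "F \<in> \<E>" for F
    using essentialE[of F] E that by (metis subsetD)
  then obtain y where y: "\<And>F. F \<in> \<E> \<Longrightarrow> y F \<in> Y \<and> y F \<in> F \<and> F = {z. qrel (y F) z}" by metis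
  have "\<exists>C. clop C \<and> (y F \<in> C) \<noteq> (y G \<in> C)" if "F \<in> \<E>" "G \<in> \<E>" "F \<noteq> G" for F G
  proof (rule ccontr)
    assume "\<not> ?thesis"
    then have "qrel (y F) z \<longleftrightarrow> qrel (y G) z" for z using y[OF that(1)] y[OF that(2)] unfolding qrel_def by blast
    then have "F = G" using y[OF that(1)] y[OF that(2)] by simp
    then show False using that by blast
  qed
  then obtain C where C: "\<And>F G. F \<in> \<E> \<Longrightarrow> G \<in> \<E> \<Longrightarrow> F \<noteq> G \<Longrightarrow> clop (C F G) \<and> (y F \<in> C F G) \<noteq> (y G \<in> C F G)" by metis
  define \<C> where "\<C> = (\<lambda>(F, G). C F G) ` {(F, G) \<in> \<E> \<times> \<E>. F \<noteq> G}"
  have fin: "finite \<C>" unfolding \<C>_def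
    by (rule finite_imageI, rule finite_subset[of _ "\<E> \<times> \<E>"]) (use E(1) in auto)
  have cl: "clop D" if "D \<in> \<C>" for D using that C unfolding \<C>_def by auto
  show thesis
  proof (rule that[of "\<lambda>F. {z \<in> Y. \<forall>D\<in>\<C>. z \<in> D \<longleftrightarrow> y F \<in> D}"])
    show "clop {z \<in> Y. \<forall>D\<in>\<C>. z \<in> D \<longleftrightarrow> y F \<in> D} \<and> F \<subseteq> {z \<in> Y. \<forall>D\<in>\<C>. z \<in> D \<longleftrightarrow> y F \<in> D}" if F: "F \<in> \<E>" for F
    proof
      show "clop {z \<in> Y. \<forall>D\<in>\<C>. z \<in> D \<longleftrightarrow> y F \<in> D}" by (rule clop_cell[OF fin cl])
      show "F \<subseteq> {z \<in> Y. \<forall>D\<in>\<C>. z \<in> D \<longleftrightarrow> y F \<in> D}"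
      proof
        fix z assume "z \<in> F"
        then have "qrel (y F) z" using y[OF F] by blast
        then show "z \<in> {z \<in> Y. \<forall>D\<in>\<C>. z \<in> D \<longleftrightarrow> y F \<in> D}" using cl unfolding qrel_def by auto
      qed
    qed
    show "{z \<in> Y. \<forall>D\<in>\<C>. z \<in> D \<longleftrightarrow> y F \<in> D} \<inter> {z \<in> Y. \<forall>D\<in>\<C>. z \<in> D \<longleftrightarrow> y G \<in> D} = {}"
      if FG: "F \<in> \<E>" "G \<in> \<E>" "F \<noteq> G" for F G
    proof -
      have "C F G \<in> \<C>" unfolding \<C>_def using FG by force
      then show ?thesis using C[OF FG] by blast
    qed
  qed
qed

text \<open>Disjoint clopen sets around distinct essential quasicomponents never split, so their
  number is at most the dimension at index 2, that is in degree 1.\<close>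

lemma finite_essential:
  assumes fd: "hfd HS (HR :: ('w, 'k::field) complex) 2"
  shows "finite essential"
proof -
  have "card \<E> \<le> hdim HS (HR :: ('w, 'k) complex) 2" if E: "\<E> \<subseteq> essential" "finite \<E>" for \<E>
  proof -
    obtain T where T: "\<And>F. F \<in> \<E> \<Longrightarrow> clop (T F) \<and> F \<subseteq> T F" "\<And>F G. F \<in> \<E> \<Longrightarrow> G \<in> \<E> \<Longrightarrow> F \<noteq> G \<Longrightarrow> T F \<inter> T G = {}"
      using separate_quasicomponents[OF E(2,1)] by metis
    obtain \<phi> where "bij_betw \<phi> {0..<card \<E>} \<E>" using ex_bij_betw_nat_finite[OF E(2)] by blast
    then have \<phi>: "\<And>i. i < card \<E> \<Longrightarrow> \<phi> i \<in> \<E>" "inj_on \<phi> {0..<card \<E>}" by (auto simp: bij_betw_def)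
    show ?thesis
    proof (rule unsplit_le_hdim[OF fd, of _ "\<lambda>i. T (\<phi> i)"])
      show "clop (T (\<phi> i))" if "i < card \<E>" for i using T(1)[OF \<phi>(1)[OF that]] by blast
      show "\<not> splits (T (\<phi> i))" if "i < card \<E>" for i
        using T(1)[OF \<phi>(1)[OF that]] essential_not_splits[of "\<phi> i"] \<phi>(1)[OF that] E(1) by blast
      show "T (\<phi> i) \<inter> T (\<phi> j) = {}" if "i < card \<E>" "j < card \<E>" "i \<noteq> j" for i j
        using T(2)[OF \<phi>(1)[OF that(1)] \<phi>(1)[OF that(2)]] inj_onD[OF \<phi>(2), of i j] that by auto
    qed
  qed
  then show ?thesis using finite_if_finite_subsets_card_bdd by blast
qed

end

section \<open>The dynamics on quasicomponents and on locally constant functions\<close>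

context attractor_repeller
begin

lemma hkW: "x \<in> topspace W \<Longrightarrow> h x \<in> topspace W" "x \<in> topspace W \<Longrightarrow> k x \<in> topspace W"
    "x \<in> topspace W \<Longrightarrow> k (h x) = x" "x \<in> topspace W \<Longrightarrow> h (k x) = x"
  using hk by (auto simp: homeomorphic_maps_def continuous_map_def)

lemma hk_continuous: "continuous_map W W h" "continuous_map W W k"
  using hk by (auto simp: homeomorphic_maps_def)

lemma kX: "k ` X \<subseteq> X"
proof (rule image_subsetI)
  fix x assume "x \<in> X"
  then obtain y where "y \<in> X" "x = h y" using hX by blast
  then show "k x \<in> X" using hkW(3) XW by auto
qed

lemma kp: "k p = p"
  using hkW(3)[OF p(1)] hp by simp

lemma hY: "y \<in> Y \<Longrightarrow> h y \<in> Y"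
proof -
  assume y: "y \<in> Y"
  then have yW: "y \<in> topspace W" "y \<notin> X" "y \<noteq> p" by (auto simp: Y_def)
  have "h y \<notin> X"
  proof
    assume "h y \<in> X"
    then have "k (h y) \<in> X" using kX by blast
    then show False using yW hkW(3) by simp
  qed
  moreover have "h y \<noteq> p" using hkW(3)[OF yW(1)] kp yW by metis
  ultimately show ?thesis using hkW(1)[OF yW(1)] by (simp add: Y_def)
qed

lemma kY: "y \<in> Y \<Longrightarrow> k y \<in> Y"
proof -
  assume y: "y \<in> Y"
  then have yW: "y \<in> topspace W" "y \<notin> X" "y \<noteq> p" by (auto simp: Y_def)
  have "k y \<notin> X"
  proof
    assume "k y \<in> X"
    then have "h (k y) \<in> X" using hX by blast
    then show False using yW hkW(4) by simp
  qed
  moreover have "k y \<noteq> p" using hkW(4)[OF yW(1)] hp yW by metis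
  ultimately show ?thesis using hkW(2)[OF yW(1)] by (simp add: Y_def)
qed

lemma clop_preimage:
  assumes f: "continuous_map W W f" "\<And>y. y \<in> Y \<Longrightarrow> f y \<in> Y" and T: "clop T"
  shows "clop {y \<in> Y. f y \<in> T}"
proof -
  have op: "openin W {y \<in> Y. f y \<in> S}" if "openin W S" for S
  proof -
    have "openin W (Y \<inter> {x \<in> topspace W. f x \<in> S})"
      by (rule openin_Int[OF openin_Y openin_continuous_map_preimage[OF f(1) that]])
    moreover have "Y \<inter> {x \<in> topspace W. f x \<in> S} = {y \<in> Y. f y \<in> S}" using Y_topspace by blast
    ultimately show ?thesis by simp
  qed
  have "Y - {y \<in> Y. f y \<in> T} = {y \<in> Y. f y \<in> Y - T}" using f(2) by blast
  then show ?thesis unfolding clop_def using op[of T] op[of "Y - T"] T unfolding clop_def by auto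
qed

text \<open>Preimages of clopen sets under \<open>h\<close> and \<open>k\<close> are clopen, so
  \<open>h\<close> maps quasicomponents onto quasicomponents; it preserves \<open>p\<close> and
  \<open>X\<close>, hence both closure conditions.\<close>

lemma image_essential:
  assumes F: "F \<in> essential"
  shows "h ` F \<in> essential"
proof -
  obtain y where y: "y \<in> Y" "F = {z. qrel y z}" "F \<subseteq> Y" using essentialE[OF F] by metis
  have FW: "F \<subseteq> topspace W" using y Y_topspace by blast
  have "h ` F = {z. qrel (h y) z}"
  proof
    show "h ` F \<subseteq> {z. qrel (h y) z}"
    proof (rule image_subsetI)
      fix z assume "z \<in> F"
      then have z: "qrel y z" using y(2) by blast
      then have "z \<in> Y" by (simp add: qrel_def)
      have "h y \<in> T \<longleftrightarrow> h z \<in> T" if "clop T" for T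
        using z clop_preimage[OF hk_continuous(1) hY that] \<open>z \<in> Y\<close> y(1) unfolding qrel_def by blast
      then show "h z \<in> {z. qrel (h y) z}" using hY \<open>z \<in> Y\<close> y(1) by (simp add: qrel_def)
    qed
    show "{z. qrel (h y) z} \<subseteq> h ` F"
    proof
      fix z assume "z \<in> {z. qrel (h y) z}"
      then have z: "qrel (h y) z" "z \<in> Y" by (auto simp: qrel_def)
      have e: "k (h y) = y" "h (k z) = z" using y(1) z(2) Y_topspace hkW by blast+
      have "y \<in> T \<longleftrightarrow> k z \<in> T" if "clop T" for T
      proof -
        have "h y \<in> {x \<in> Y. k x \<in> T} \<longleftrightarrow> z \<in> {x \<in> Y. k x \<in> T}"
          using z(1) clop_preimage[OF hk_continuous(2) kY that] unfolding qrel_def by blast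
        then show ?thesis using e hY[OF y(1)] z(2) by simp
      qed
      then have "k z \<in> F" using y kY[OF z(2)] by (simp add: qrel_def)
      then show "z \<in> h ` F" using e(2) by (metis imageI)
    qed
  qed
  then have "h ` F \<in> quasi_components_of (subtopology W Y)" unfolding quasi_components_qrel using hY[OF y(1)] by blast
  moreover have cl: "W closure_of (h ` F) = h ` (W closure_of F)"
    using homeomorphic_map_closure_of[of W W h F] homeomorphic_maps_map[of W W h k] hk FW by blast
  moreover have "p \<in> h ` (W closure_of F)" using F hp unfolding essential_def by force
  moreover have "h ` (W closure_of F) \<inter> X \<noteq> {}"
  proof -
    obtain x where "x \<in> W closure_of F" "x \<in> X" using F unfolding essential_def by blast
    then show ?thesis using hX by blast
  qed
  ultimately show ?thesis unfolding essential_def by simp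
qed

definition period :: "'w set \<Rightarrow> nat" where
  "period F = (LEAST r. 1 \<le> r \<and> (h ^^ r) ` F = F)"

lemma image_funpow: "((`) h ^^ r) F = (h ^^ r) ` F"
  by (induction r) (simp_all add: image_comp)

definition lc :: "('w \<Rightarrow> 'c) \<Rightarrow> bool" where
  "lc G \<longleftrightarrow> (\<forall>y\<in>Y. \<exists>V. openin W V \<and> y \<in> V \<and> V \<subseteq> Y \<and> (\<forall>z\<in>V. G z = G y))"

lemma lc_const: "lc (\<lambda>_. c)"
  unfolding lc_def using openin_Y by blast

lemma lc_comb:
  assumes "lc F" "lc G"
  shows "lc (\<lambda>y. f (F y) (G y))"
  unfolding lc_def
proof
  fix y assume y: "y \<in> Y"
  from assms(1) y obtain U where U: "openin W U" "y \<in> U" "U \<subseteq> Y" "\<forall>z\<in>U. F z = F y" unfolding lc_def by blast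
  from assms(2) y obtain V where V: "openin W V" "y \<in> V" "\<forall>z\<in>V. G z = G y" unfolding lc_def by blast
  have eq: "f (F z) (G z) = f (F y) (G y)" if "z \<in> U \<inter> V" for z
  proof -
    have "F z = F y" "G z = G y" using U V that by blast+
    then show ?thesis by simp
  qed
  show "\<exists>V. openin W V \<and> y \<in> V \<and> V \<subseteq> Y \<and> (\<forall>z\<in>V. f (F z) (G z) = f (F y) (G y))"
    using openin_Int[OF U(1) V(1)] U(2,3) V(2) eq by (intro exI[of _ "U \<inter> V"]) blast
qed

lemma lc_compose:
  assumes f: "continuous_map W W f" "\<And>y. y \<in> Y \<Longrightarrow> f y \<in> Y" and G: "lc G"
  shows "lc (\<lambda>y. G (f y))"
  unfolding lc_def
proof
  fix y assume y: "y \<in> Y"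
  from G f(2)[OF y] obtain V where V: "openin W V" "f y \<in> V" "V \<subseteq> Y" "\<forall>z\<in>V. G z = G (f y)" unfolding lc_def by blast
  have "openin W (Y \<inter> {x \<in> topspace W. f x \<in> V})"
    by (rule openin_Int[OF openin_Y openin_continuous_map_preimage[OF f(1) V(1)]])
  then show "\<exists>V. openin W V \<and> y \<in> V \<and> V \<subseteq> Y \<and> (\<forall>z\<in>V. G (f z) = G (f y))"
    using y Y_topspace V by (intro exI[of _ "Y \<inter> {x \<in> topspace W. f x \<in> V}"]) blast
qed

lemma lc_clop:
  assumes "clop T"
  shows "lc (\<lambda>y. y \<in> T)"
  unfolding lc_def
proof
  fix y assume y: "y \<in> Y"
  show "\<exists>V. openin W V \<and> y \<in> V \<and> V \<subseteq> Y \<and> (\<forall>z\<in>V. (z \<in> T) = (y \<in> T))"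
    by (rule exI[of _ "if y \<in> T then T else Y - T"]) (use assms y in \<open>auto simp: clop_def\<close>)
qed

lemma lc_if: "clop T \<Longrightarrow> lc F \<Longrightarrow> lc (\<lambda>y. if y \<in> T then F y else c)"
  using lc_comb[OF lc_clop, of T F "\<lambda>b x. if b then x else c"] by simp

lemma lc_sum: "finite I \<Longrightarrow> (\<And>i. i \<in> I \<Longrightarrow> lc (F i)) \<Longrightarrow> lc (\<lambda>y. \<Sum>i\<in>I. F i y :: 'c :: comm_monoid_add)"
proof (induction I rule: finite_induct)
  case empty
  show ?case by (simp add: lc_const)
next
  case (insert i I)
  have 1: "lc (F i)" by (rule insert.prems) simp
  have 2: "lc (\<lambda>y. \<Sum>i\<in>I. F i y)" by (rule insert.IH, rule insert.prems) simp
  show ?case using lc_comb[OF 1 2, of "(+)"] unfolding sum.insert[OF insert.hyps] .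
qed

lemma clop_lc:
  assumes "lc G"
  shows "clop {y \<in> Y. Pr (G y)}"
proof -
  have op: "openin W {y \<in> Y. Q (G y)}" for Q
  proof (subst openin_subopen, intro ballI)
    fix x assume x: "x \<in> {y \<in> Y. Q (G y)}"
    then obtain V where V: "openin W V" "x \<in> V" "V \<subseteq> Y" "\<forall>z\<in>V. G z = G x" using assms unfolding lc_def by blast
    have "V \<subseteq> {y \<in> Y. Q (G y)}"
    proof
      fix z assume z: "z \<in> V"
      then have "G z = G x" using V(4) by blast
      then show "z \<in> {y \<in> Y. Q (G y)}" using x z V(3) by auto
    qed
    then show "\<exists>T. openin W T \<and> x \<in> T \<and> T \<subseteq> {y \<in> Y. Q (G y)}" using V by blast
  qed
  have "Y - {y \<in> Y. Pr (G y)} = {y \<in> Y. \<not> Pr (G y)}" by blast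
  then show ?thesis unfolding clop_def using op[of Pr] op[of "\<lambda>x. \<not> Pr x"] by auto
qed

text \<open>The coboundary equation is solved by summing \<open>c\<close> along the orbit. By
  \<open>conv\<close> the number of terms is locally bounded, so the sum is locally
  constant.\<close>

lemma tail_sum:
  assumes f: "continuous_map W W f" "\<And>y. y \<in> Y \<Longrightarrow> f y \<in> Y" and c: "lc (c :: 'w \<Rightarrow> int)"
    and conv: "\<And>y. y \<in> Y \<Longrightarrow> \<exists>V n0. openin W V \<and> y \<in> V \<and> (\<forall>n\<ge>n0. \<forall>z\<in>V. c ((f ^^ n) z) = 0)"
  obtains S where "lc S" "\<And>y. y \<in> Y \<Longrightarrow> S y = c y + S (f y)"
proof
  define S where "S y = support_sum (\<lambda>i. c ((f ^^ i) y))" for y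
  have iter: "lc (\<lambda>y. c ((f ^^ i) y))" for i
  proof (induction i)
    case (Suc i)
    from lc_compose[OF f Suc] show ?case by (simp add: funpow_swap1)
  qed (simp add: c)
  show "lc S"
    unfolding lc_def
  proof
    fix y assume y: "y \<in> Y"
    from conv[OF y] obtain V m where V: "openin W V" "y \<in> V" "\<forall>n\<ge>m. \<forall>z\<in>V. c ((f ^^ n) z) = 0" by blast
    have eq: "S z = (\<Sum>i<m. c ((f ^^ i) z))" if "z \<in> V" for z
      unfolding S_def by (rule support_sum_eq) (use V(3) that in blast)
    have "lc (\<lambda>y. \<Sum>i<m. c ((f ^^ i) y))" by (rule lc_sum) (simp_all add: iter)
    then obtain U where U: "openin W U" "y \<in> U" "U \<subseteq> Y" "\<forall>z\<in>U. (\<Sum>i<m. c ((f ^^ i) z)) = (\<Sum>i<m. c ((f ^^ i) y))"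
      using y unfolding lc_def by blast
    have Sz: "S z = S y" if "z \<in> U \<inter> V" for z
    proof -
      have "z \<in> U" "z \<in> V" using that by auto
      then show ?thesis using eq[OF \<open>z \<in> V\<close>] eq[OF V(2)] U(4) by simp
    qed
    show "\<exists>V. openin W V \<and> y \<in> V \<and> V \<subseteq> Y \<and> (\<forall>z\<in>V. S z = S y)"
      using openin_Int[OF U(1) V(1)] U(2,3) V(2) Sz by (intro exI[of _ "U \<inter> V"]) blast
  qed
  show "S y = c y + S (f y)" if y: "y \<in> Y" for y
  proof -
    from conv[OF y] obtain V m where V: "y \<in> V" "\<forall>n\<ge>m. \<forall>z\<in>V. c ((f ^^ n) z) = 0" by blast
    have "S y = c ((f ^^ 0) y) + support_sum (\<lambda>i. c ((f ^^ Suc i) y))"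
      unfolding S_def by (rule support_sum_Suc[where m = m]) (use V in blast)
    then show ?thesis unfolding S_def by (simp add: funpow_swap1)
  qed
qed

text \<open>A labelling of the essential quasicomponents extends to a locally constant function that is
  equivariant off a splitting set; the defect on the two parts is removed by summing it along
  forward and backward orbits.\<close>

lemma equivariant_function:
  assumes fin: "finite essential" and n: "n > 0" and per: "\<And>F. F \<in> essential \<Longrightarrow> n dvd period F"
  obtains g :: "'w \<Rightarrow> nat" where "\<And>y. y \<in> Y \<Longrightarrow> g y < n" "lc g" "\<And>y. y \<in> Y \<Longrightarrow> g (h y) = Suc (g y) mod n"
proof -
  have "inj_on ((`) h) essential"
  proof (rule inj_onI)
    fix F G assume FG: "F \<in> essential" "G \<in> essential" "h ` F = h ` G"
    have "k ` h ` F = F" if "F \<in> essential" for F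
    proof -
      have "F \<subseteq> topspace W" using essentialE[OF that] Y_topspace by (metis order_trans)
      then show ?thesis using hkW(3) by (force simp: image_iff)
    qed
    then show "F = G" using FG by metis
  qed
  moreover have "(`) h ` essential \<subseteq> essential" using image_essential by blast
  moreover have "n dvd (LEAST r. 1 \<le> r \<and> ((`) h ^^ r) F = F)" if "F \<in> essential" for F
    using per[OF that] unfolding period_def image_funpow .
  ultimately obtain lab where lab: "\<forall>F\<in>essential. lab F < n \<and> lab (h ` F) = Suc (lab F) mod n"
    using cyclic_labelling[OF fin _ _ n, of "(`) h"] by blast
  obtain T where T: "\<And>F. F \<in> essential \<Longrightarrow> clop (T F) \<and> F \<subseteq> T F"
    "\<And>F G. F \<in> essential \<Longrightarrow> G \<in> essential \<Longrightarrow> F \<noteq> G \<Longrightarrow> T F \<inter> T G = {}"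
    using separate_quasicomponents[OF fin subset_refl] by metis
  \<comment> \<open>On each of the disjoint sets \<open>T F\<close> this is the label of
    \<open>F\<close>, elsewhere 0.\<close>
  define g0 where "g0 y = (\<Sum>F\<in>essential. if y \<in> T F then int (lab F) else 0)" for y
  have g0: "lc g0" unfolding g0_def
  proof (rule lc_sum[OF fin])
    fix F assume "F \<in> essential"
    then have "clop (T F)" using T(1) by blast
    then show "lc (\<lambda>y. if y \<in> T F then int (lab F) else 0)" by (rule lc_if[OF _ lc_const])
  qed
  have g0F: "g0 y = int (lab F)" if "F \<in> essential" "y \<in> F" for F y
  proof -
    have "(if y \<in> T G then int (lab G) else 0) = (if G = F then int (lab F) else 0)" if G: "G \<in> essential" for G
      using T(1)[OF \<open>F \<in> essential\<close>] T(2)[OF G \<open>F \<in> essential\<close>] \<open>y \<in> F\<close> by auto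
    then have "g0 y = (\<Sum>G\<in>essential. if G = F then int (lab F) else 0)" unfolding g0_def by (intro sum.cong) auto
    then show ?thesis using fin that(1) by simp
  qed
  \<comment> \<open>The defect of equivariance, as an integer. It is a multiple of \<open>n\<close>
    on essential quasicomponents, so the clopen set \<open>D\<close> where it is not meets none of
    them and splits.\<close>
  define c where "c y = g0 (h y) - g0 y - 1" for y
  have lcc: "lc c" unfolding c_def
    using lc_comb[OF lc_compose[OF hk_continuous(1) hY g0] g0, of "\<lambda>a b. a - b - 1"] by simp
  define D where "D = {y \<in> Y. \<not> int n dvd c y}"
  have D: "clop D" unfolding D_def by (rule clop_lc[OF lcc])
  have "F \<inter> D = {}" if F: "F \<in> essential" for F
  proof (rule ccontr)
    assume "F \<inter> D \<noteq> {}"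
    then obtain y where y: "y \<in> F" "y \<in> D" by blast
    have "g0 (h y) = int (Suc (lab F) mod n)" using g0F[OF image_essential[OF F], of "h y"] lab F y by simp
    moreover have "g0 y = int (lab F)" by (rule g0F[OF F y(1)])
    ultimately have "c y = int (Suc (lab F)) mod int n - int (Suc (lab F))" unfolding c_def by (simp add: zmod_int)
    then have "int n dvd c y" by (metis mod_eq_dvd_iff mod_mod_trivial)
    then show False using y(2) unfolding D_def by blast
  qed
  then have "splits D" by (rule splits_if_no_essential[OF D])
  then obtain D1 D2 where D12: "clop D1" "clop D2" "D = D1 \<union> D2" "away D1 {p}" "away D2 X" unfolding splits_def by blast
  define c1 where "c1 y = (if y \<in> D1 then c y else 0)" for y
  \<comment> \<open>\<open>D1\<close> is taken out of \<open>D2\<close> so that the two corrections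
    never act at the same point.\<close>
  define c2 where "c2 y = (if y \<in> D2 - D1 then c y else 0)" for y
  have l1: "lc c1" unfolding c1_def by (rule lc_if[OF D12(1) lcc])
  have l2: "lc c2" unfolding c2_def by (rule lc_if[OF clop_diff[OF D12(2,1)] lcc])
  have "\<exists>V n0. openin W V \<and> y \<in> V \<and> (\<forall>n\<ge>n0. \<forall>z\<in>V. c1 ((h ^^ n) z) = 0)" if y: "y \<in> Y" for y
  proof -
    obtain U where U: "openin W U" "{p} \<subseteq> U" "U \<inter> D1 = {}" using D12(4) unfolding away_def by blast
    have "y \<in> topspace W - (X \<union> {p})" "p \<in> U" using y U unfolding Y_def by blast+
    from attract[OF this(1) U(1) this(2)] obtain V n0 where V: "openin W V" "y \<in> V" "\<forall>n\<ge>n0. (h ^^ n) ` V \<subseteq> U" by blast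
    have "c1 ((h ^^ n) z) = 0" if "n \<ge> n0" "z \<in> V" for n z
    proof -
      have "(h ^^ n) z \<in> U" using V(3) that by blast
      then have "(h ^^ n) z \<notin> D1" using U(3) by blast
      then show ?thesis by (simp add: c1_def)
    qed
    then show ?thesis using V by blast
  qed
  from tail_sum[OF hk_continuous(1) hY l1 this] obtain S1 where S1: "lc S1" "\<And>y. y \<in> Y \<Longrightarrow> S1 y = c1 y + S1 (h y)" by metis
  have "\<exists>V n0. openin W V \<and> y \<in> V \<and> (\<forall>n\<ge>n0. \<forall>z\<in>V. c2 ((k ^^ n) z) = 0)" if y: "y \<in> Y" for y
  proof -
    obtain U where U: "openin W U" "X \<subseteq> U" "U \<inter> D2 = {}" using D12(5) unfolding away_def by blast
    have "y \<in> topspace W - (X \<union> {p})" using y unfolding Y_def by blast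
    from repel[OF this U(1,2)] obtain V n0 where V: "openin W V" "y \<in> V" "\<forall>n\<ge>n0. (k ^^ n) ` V \<subseteq> U" by blast
    have "c2 ((k ^^ n) z) = 0" if "n \<ge> n0" "z \<in> V" for n z
    proof -
      have "(k ^^ n) z \<in> U" using V(3) that by blast
      then have "(k ^^ n) z \<notin> D2" using U(3) by blast
      then show ?thesis by (simp add: c2_def)
    qed
    then show ?thesis using V by blast
  qed
  from tail_sum[OF hk_continuous(2) kY l2 this] obtain S2 where S2: "lc S2" "\<And>y. y \<in> Y \<Longrightarrow> S2 y = c2 y + S2 (k y)" by metis
  \<comment> \<open>From \<open>y\<close> to \<open>h y\<close>, \<open>S1\<close> changes by
    \<open>- c1 y\<close> and the backward sum, precomposed with \<open>k\<close>, by
    \<open>c2 y\<close>. The defect of \<open>G\<close> is thus \<open>c - c1 - c2\<close>, a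
    multiple of \<open>n\<close>.\<close>
  define G where "G y = g0 y + S1 y - S2 (k y)" for y
  have lG: "lc G"
    using lc_comb[OF lc_comb[OF g0 S1(1), of "(+)"] lc_compose[OF hk_continuous(2) kY S2(1)], of "(-)"] unfolding G_def by simp
  have GG: "int n dvd G (h y) - (G y + 1)" if y: "y \<in> Y" for y
  proof -
    have "k (h y) = y" using hkW(3) y Y_topspace by blast
    then have "G (h y) - (G y + 1) = c y - c1 y - c2 y"
      using S1(2)[OF y] S2(2)[OF y] unfolding G_def c_def by simp
    moreover have "int n dvd c y - c1 y - c2 y"
    proof (cases "y \<in> D")
      case True
      then show ?thesis using D12(3) unfolding c1_def c2_def by auto
    next
      case False
      then have "int n dvd c y" using y unfolding D_def by blast
      then show ?thesis using False D12(3) unfolding c1_def c2_def by auto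
    qed
    ultimately show ?thesis by simp
  qed
  show thesis
  proof (rule that[of "\<lambda>y. nat (G y mod int n)"])
    show "nat (G y mod int n) < n" for y using n by (simp add: nat_less_iff)
    show "lc (\<lambda>y. nat (G y mod int n))" using lc_comb[OF lG lG, of "\<lambda>a b. nat (a mod int n)"] .
    show "nat (G (h y) mod int n) = Suc (nat (G y mod int n)) mod n" if y: "y \<in> Y" for y
    proof -
      have "G (h y) mod int n = (G y + 1) mod int n" using GG[OF y] by (simp add: mod_eq_dvd_iff)
      moreover have "int (Suc (nat (G y mod int n)) mod n) = (G y mod int n + 1) mod int n"
        using n by (simp add: zmod_int add.commute)
      moreover have "(G y mod int n + 1) mod int n = (G y + 1) mod int n" by (rule mod_add_left_eq)
      ultimately show ?thesis by (metis nat_int)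
    qed
  qed
qed

theorem period_gcd_dvd_hdim:
  assumes fd: "hfd HS (HR :: ('w, 'k::field) complex) 2" "hfd HS (HR :: ('w, 'k) complex) (Suc l)"
  shows "Gcd (period ` essential) dvd hdim HS (HR :: ('w, 'k) complex) (Suc l)"
proof -
  have fin: "finite essential" by (rule finite_essential[OF fd(1)])
  have div: "n dvd hdim HS (HR :: ('w, 'k) complex) (Suc l)"
    if n: "n > 0" and per: "\<And>F. F \<in> essential \<Longrightarrow> n dvd period F" for n
  proof -
    obtain g where g: "\<And>y. y \<in> Y \<Longrightarrow> g y < n" "lc g" "\<And>y. y \<in> Y \<Longrightarrow> g (h y) = Suc (g y) mod n"
      using equivariant_function[OF fin n per] by metis
    show ?thesis
    proof (rule equivariant_decomposition_dvd[OF W closedin_B hk _ _ n _ _ _ fd(2)])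
      show "h ` (X \<union> {p}) \<subseteq> X \<union> {p}" using hX hp by auto
      show "k ` (X \<union> {p}) \<subseteq> X \<union> {p}" using kX kp by auto
      show "g x < n" if "x \<in> topspace W - (X \<union> {p})" for x using g(1) that unfolding Y_def by blast
      show "g (h x) = Suc (g x) mod n" if "x \<in> topspace W - (X \<union> {p})" for x using g(3) that unfolding Y_def by blast
      show "\<exists>V. openin W V \<and> x \<in> V \<and> V \<inter> (X \<union> {p}) = {} \<and> (\<forall>y\<in>V. g y = g x)" if "x \<in> topspace W - (X \<union> {p})" for x
      proof -
        have "x \<in> Y" using that unfolding Y_def .
        with g(2) obtain V where V: "openin W V" "x \<in> V" "V \<subseteq> Y" "\<forall>y\<in>V. g y = g x" unfolding lc_def by metis
        have "V \<inter> (X \<union> {p}) = {}" using V(3) unfolding Y_def by blast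
        then show ?thesis using V(1,2,4) by blast
      qed
    qed
  qed
  show ?thesis
  proof (cases "Gcd (period ` essential) = 0")
      case True
      then have sub: "period ` essential \<subseteq> {0}" unfolding Gcd_0_iff by simp
      have p0: "n dvd period F" if F: "F \<in> essential" for n F
      proof -
        have "period F \<in> {0}" using sub imageI[OF F, of period] by (rule subsetD)
        then show ?thesis by simp
      qed
      \<comment> \<open>Every positive number divides the periods here, so one exceeding the
        dimension may be used; it divides the dimension only if that is 0.\<close>
      have "Suc (hdim HS (HR :: ('w, 'k) complex) (Suc l)) dvd hdim HS (HR :: ('w, 'k) complex) (Suc l)"
        by (rule div[OF zero_less_Suc p0])
      then have "hdim HS (HR :: ('w, 'k) complex) (Suc l) = 0" by (meson dvd_imp_le not_less_eq_eq order_refl neq0_conv)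
      then show ?thesis by simp
    next
      case False
      then have "Gcd (period ` essential) > 0" by (rule neq0_conv[THEN iffD1])
      then show ?thesis by (rule div) (intro Gcd_dvd imageI)
  qed
qed

end

section \<open>Index pairs\<close>

lemma hfd_0: "stable T \<Longrightarrow> stable S \<Longrightarrow> hfd T S 0"
proof -
  assume T: "stable T" and S: "stable S"
  have "zcyc T S 0 \<subseteq> {0}" using stableD(3)[OF T] by (auto simp: zcyc_def)
  also have "{0} \<subseteq> set_sum (bcob T S 0) (fs.span {})"
    using set_sumI[OF fs.subspace_0[OF fsub_bcob[OF T S]] fs.span_zero[of "{}"], of 0] by simp
  finally show ?thesis unfolding qfd_def by (intro exI[of _ "{}"]) simp
qed

lemma alternating_telescope:
  fixes r :: "nat \<Rightarrow> int"
  shows "(\<Sum>q<n. (-1) ^ q * (r q + r (Suc q))) = r 0 - (-1) ^ n * r n"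
  by (induction n) (auto simp: algebra_simps)

context
  fixes M :: "'a topology" and f :: "'a \<Rightarrow> 'a" and D X N L :: "'a set"
  assumes M: "Hausdorff_space M" and D: "openin M D"
    and hf: "homeomorphic_map (subtopology M D) (subtopology M (f ` D)) f"
    and iso: "isolated_invariant M D f X" and ip: "index_pair M D f X N L"
begin

abbreviation (input) "KK \<equiv> pointed_quotient M N L"
abbreviation (input) "gg \<equiv> index_map f N L"
abbreviation (input) "MN \<equiv> subtopology M N"
abbreviation (input) "WW \<equiv> unstable_space M f N L"
abbreviation (input) "CC \<equiv> unstable_core M f N L X"

lemma ip_compact: "compactin M N" "compactin M L" "compactin M X"
  and ip_sub: "L \<subseteq> N" "N \<subseteq> D" "X \<inter> L = {}" "X \<subseteq> D" "f ` X = X"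
  and ip_map: "p \<in> N - L \<Longrightarrow> f p \<in> N" "p \<in> L \<Longrightarrow> f p \<in> N \<Longrightarrow> f p \<in> L"
  using ip iso unfolding index_pair_def isolated_invariant_def by auto

lemma ip_closed: "closedin M N" "closedin M L" "closedin M X"
  using ip_compact compactin_imp_closedin[OF M] by blast+

lemma D_top: "D \<subseteq> topspace M"
  by (rule openin_subset[OF D])

lemma N_top: "topspace MN = N"
  using ip_sub D_top by auto

lemma isolating: "compactin M (M closure_of (N - L))" "X \<subseteq> M interior_of (M closure_of (N - L))"
    "X = invariant_part f (M closure_of (N - L))"
  using ip unfolding index_pair_def isolating_neighbourhood_def by auto

lemma closure_N: "M closure_of (N - L) \<subseteq> N"
  by (rule closure_of_minimal[OF _ ip_closed(1)]) blast

lemma X_sub: "X \<subseteq> N - L"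
  using isolating(2) interior_of_subset[of M "M closure_of (N - L)"] closure_N ip_sub(3) by blast

lemma f_continuous: "continuous_map (subtopology M D) M f"
  using homeomorphic_imp_continuous_map[OF hf] continuous_map_into_fulltopology by blast

lemma f_continuous_on: "S \<subseteq> D \<Longrightarrow> continuous_map (subtopology M S) M f"
  using continuous_map_from_subtopology[OF f_continuous, of S] by (simp add: subtopology_subtopology Int_absorb1)

lemma f_inj: "inj_on f D"
proof -
  have "topspace (subtopology M D) = D" using D_top by auto
  then show ?thesis using hf by (metis homeomorphic_imp_injective_map)
qed

lemma openin_N_preimage: "openin M S \<Longrightarrow> openin MN {p \<in> N. f p \<in> S}"
  using openin_continuous_map_preimage[OF f_continuous_on[OF ip_sub(2)], of S] unfolding N_top .

lemma openin_NL: "openin MN (N - L)"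
  using openin_diff[OF openin_topspace[of MN] closedin_subset_topspace[OF ip_closed(2) ip_sub(1)]] N_top by simp

section \<open>The quotient N/L and the index map\<close>

lemma topspace_KK: "topspace KK = insert None (Some ` (N - L))"
proof
  show "topspace KK \<subseteq> insert None (Some ` (N - L))"
    using openin_topspace[of KK] unfolding openin_pointed_quotient by blast
  have "{p \<in> N. collapse L p \<in> insert None (Some ` (N - L))} = N" by (auto simp: collapse_def)
  then have "openin KK (insert None (Some ` (N - L)))"
    unfolding openin_pointed_quotient using openin_topspace[of MN] N_top by simp
  then show "insert None (Some ` (N - L)) \<subseteq> topspace KK" by (rule openin_subset)
qed

lemma openin_Some: "openin MN U \<Longrightarrow> U \<subseteq> N - L \<Longrightarrow> openin KK (Some ` U)"
proof -
  assume U: "openin MN U" "U \<subseteq> N - L"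
  then have "{p \<in> N. collapse L p \<in> Some ` U} = U" by (auto simp: collapse_def split: if_splits)
  then show ?thesis unfolding openin_pointed_quotient using U by (auto intro!: image_mono)
qed

lemma openin_None: "openin MN U \<Longrightarrow> L \<subseteq> U \<Longrightarrow> openin KK (insert None (Some ` (U - L)))"
proof -
  assume U: "openin MN U" "L \<subseteq> U"
  have UN: "U \<subseteq> N" using openin_subset[OF U(1)] N_top by simp
  then have "{p \<in> N. collapse L p \<in> insert None (Some ` (U - L))} = U" using U(2) by (auto simp: collapse_def split: if_splits)
  then show ?thesis unfolding openin_pointed_quotient using U UN by auto
qed

lemma compact_MN: "compact_space MN" by (rule compact_space_subtopology[OF ip_compact(1)])

lemma Hausdorff_MN: "Hausdorff_space MN" by (rule Hausdorff_space_subtopology[OF M])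

lemma Hausdorff_KK: "Hausdorff_space KK"
  unfolding Hausdorff_space_def
proof (intro allI impI)
  have ns: "\<exists>U V. openin KK U \<and> openin KK V \<and> None \<in> U \<and> Some q \<in> V \<and> disjnt U V" if q: "q \<in> N - L" for q
  proof -
    have "normal_space MN"
      by (rule compact_Hausdorff_or_regular_imp_normal_space) (use compact_MN Hausdorff_MN in auto)
    moreover have "closedin MN L" by (rule closedin_subset_topspace[OF ip_closed(2) ip_sub(1)])
    moreover have "closedin MN {q}" using Hausdorff_MN q N_top by (simp add: closedin_Hausdorff_singleton)
    ultimately obtain U V where U: "openin MN U" "openin MN V" "L \<subseteq> U" "{q} \<subseteq> V" "disjnt U V"
      unfolding normal_space_def using q by (metis DiffE disjnt_insert2 disjnt_empty2)
    have "openin KK (Some ` (V \<inter> (N - L)))" by (rule openin_Some[OF openin_Int[OF U(2) openin_NL]]) blast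
    moreover have "openin KK (insert None (Some ` (U - L)))" by (rule openin_None[OF U(1,3)])
    moreover have "disjnt (insert None (Some ` (U - L))) (Some ` (V \<inter> (N - L)))" using U(5) unfolding disjnt_def by blast
    ultimately show ?thesis using U(4) q by blast
  qed
  fix x y assume xy: "x \<in> topspace KK \<and> y \<in> topspace KK \<and> x \<noteq> y"
  then consider (n1) q where "x = None" "y = Some q" "q \<in> N - L" | (n2) q where "y = None" "x = Some q" "q \<in> N - L"
    | (s) a b where "x = Some a" "y = Some b" "a \<in> N - L" "b \<in> N - L" "a \<noteq> b"
    unfolding topspace_KK by blast
  then show "\<exists>U V. openin KK U \<and> openin KK V \<and> x \<in> U \<and> y \<in> V \<and> disjnt U V"
  proof cases
    case n1
    then show ?thesis using ns by blast
  next
    case n2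
    then show ?thesis using ns[OF n2(3)] by (metis disjnt_sym)
  next
    case s
    then obtain U V where U: "openin MN U" "openin MN V" "a \<in> U" "b \<in> V" "disjnt U V"
      using Hausdorff_MN N_top unfolding Hausdorff_space_def by (metis DiffD1)
    have "openin KK (Some ` (U \<inter> (N - L)))" by (rule openin_Some[OF openin_Int[OF U(1) openin_NL]]) blast
    moreover have "openin KK (Some ` (V \<inter> (N - L)))" by (rule openin_Some[OF openin_Int[OF U(2) openin_NL]]) blast
    moreover have "disjnt (Some ` (U \<inter> (N - L))) (Some ` (V \<inter> (N - L)))" using U(5) unfolding disjnt_def by blast
    ultimately show ?thesis using U s by blast
  qed
qed

lemma compact_KK: "compact_space KK"
proof -
  have "continuous_map MN KK (collapse L)"
    unfolding continuous_map_def
  proof (intro conjI allI impI)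
    show "collapse L \<in> topspace MN \<rightarrow> topspace KK" unfolding N_top topspace_KK by (auto simp: collapse_def)
    show "openin MN {x \<in> topspace MN. collapse L x \<in> U}" if "openin KK U" for U
      using that unfolding N_top openin_pointed_quotient by blast
  qed
  then have "compactin KK (collapse L ` N)"
    using image_compactin[of MN "topspace MN" KK "collapse L"] compact_MN N_top by (simp add: compact_space_def)
  moreover have "compactin KK {None}" using topspace_KK by (intro finite_imp_compactin) auto
  ultimately have "compactin KK (collapse L ` N \<union> {None})" by (rule compactin_Un)
  moreover have "collapse L ` N \<union> {None} = topspace KK" unfolding topspace_KK by (force simp: collapse_def)
  ultimately show ?thesis by (simp add: compact_space_def)
qed

lemma gg_collapse: "p \<in> N - L \<Longrightarrow> gg (Some p) = collapse L (f p)" "gg None = None"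
  using ip_map(1) by (auto simp: index_map_def collapse_def)

lemma gg_topspace: "x \<in> topspace KK \<Longrightarrow> gg x \<in> topspace KK"
  unfolding topspace_KK by (auto simp: index_map_def split: if_splits)

text \<open>Continuity is tested on \<open>N\<close>, where points of \<open>L\<close> are the
  delicate ones. If \<open>f\<close> maps such a point into \<open>N\<close>, it maps it into
  \<open>L\<close>. If it maps it outside \<open>N\<close>, it does so with all points close by, and
  points of \<open>N\<close> that leave \<open>N\<close> lie in \<open>L\<close>. In both cases
  values nearby stay close to the base point.\<close>

lemma gg_continuous: "continuous_map KK KK gg"
  unfolding continuous_map_def
proof (intro conjI allI impI)
  show "gg \<in> topspace KK \<rightarrow> topspace KK" using gg_topspace by blast
  fix U assume U: "openin KK U"
  obtain S where S: "openin M S" "{q \<in> N. collapse L q \<in> U} = S \<inter> N"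
    using U unfolding openin_pointed_quotient openin_subtopology by blast
  have SU: "collapse L q \<in> U \<longleftrightarrow> q \<in> S" if "q \<in> N" for q using S(2) that by blast
  have in_L: "gg (collapse L q) = None" if "q \<in> L" for q using that gg_collapse(2) by (simp add: collapse_def)
  have out_L: "gg (collapse L q) = collapse L (f q)" "f q \<in> N" if "q \<in> N - L" for q
    using that gg_collapse(1)[OF that] ip_map(1)[OF that] by (auto simp: collapse_def)
  have "openin MN {q \<in> N. gg (collapse L q) \<in> U}"
  proof (subst openin_subopen, intro ballI)
    fix q assume q: "q \<in> {q \<in> N. gg (collapse L q) \<in> U}"
    show "\<exists>T. openin MN T \<and> q \<in> T \<and> T \<subseteq> {q \<in> N. gg (collapse L q) \<in> U}"
    proof (cases "q \<in> L")
      case False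
      then have qN: "q \<in> N - L" using q by blast
      then have "f q \<in> S" using q SU[OF out_L(2)[OF qN]] out_L(1)[OF qN] by simp
      moreover have "gg (collapse L z) \<in> U" if "z \<in> N - L" "f z \<in> S" for z
        using SU[OF out_L(2)[OF that(1)]] out_L(1)[OF that(1)] that(2) by simp
      ultimately show ?thesis using openin_Int[OF openin_N_preimage[OF S(1)] openin_NL] qN
        by (intro exI[of _ "{p \<in> N. f p \<in> S} \<inter> (N - L)"]) auto
    next
      case True
      then have None: "None \<in> U" using q in_L by auto
      show ?thesis
      proof (cases "f q \<in> N")
        case fq: True
        then have "f q \<in> L" using ip_map(2)[OF True] by blast
        then have "f q \<in> S" using SU[OF fq] None by (simp add: collapse_def)
        moreover have "gg (collapse L z) \<in> U" if "z \<in> N" "f z \<in> S" for z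
        proof (cases "z \<in> L")
          case True then show ?thesis using in_L None by simp
        next
          case False
          then have "z \<in> N - L" using that by blast
          then show ?thesis using SU[OF out_L(2)] out_L(1) that(2) by simp
        qed
        ultimately show ?thesis using openin_N_preimage[OF S(1)] q
          by (intro exI[of _ "{p \<in> N. f p \<in> S}"]) auto
      next
        case False
        have o: "openin M (topspace M - N)" using ip_closed(1) by blast
        have "f q \<in> topspace M"
          using f_continuous_on[OF ip_sub(2)] q N_top by (auto simp: continuous_map_def)
        moreover have "gg (collapse L z) \<in> U" if "z \<in> N" "f z \<in> topspace M - N" for z
          using ip_map(1)[of z] that in_L[of z] None by (cases "z \<in> L") auto
        ultimately show ?thesis using openin_N_preimage[OF o] q False
          by (intro exI[of _ "{p \<in> N. f p \<in> topspace M - N}"]) auto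
      qed
    qed
  qed
  moreover have "{q \<in> N. collapse L q \<in> {x \<in> topspace KK. gg x \<in> U}} = {q \<in> N. gg (collapse L q) \<in> U}"
    unfolding topspace_KK by (auto simp: collapse_def)
  ultimately show "openin KK {x \<in> topspace KK. gg x \<in> U}"
    unfolding openin_pointed_quotient using topspace_KK by auto
qed

section \<open>The inverse limit and its homeomorphism\<close>

lemma WW_invlim: "WW = invlim KK gg"
  by (simp add: unstable_space_def invlim_def)

lemmas topspace_WW = topspace_invlim[OF compact_KK Hausdorff_KK gg_continuous, folded WW_invlim]

lemma WW_coordinate: "\<xi> \<in> topspace WW \<Longrightarrow> \<xi> i \<in> topspace KK"
  by (simp add: topspace_WW)
lemmas compact_WW = compact_invlim[OF compact_KK Hausdorff_KK gg_continuous, folded WW_invlim]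
lemmas Hausdorff_WW = Hausdorff_invlim[OF compact_KK Hausdorff_KK gg_continuous, folded WW_invlim]
lemmas coordinate_WW = coordinate[OF compact_KK Hausdorff_KK gg_continuous, folded WW_invlim]

abbreviation (input) "hh \<equiv> unstable_homeo f N L"
definition shift :: "(nat \<Rightarrow> 'a option) \<Rightarrow> nat \<Rightarrow> 'a option" where
  "shift \<xi> = (\<lambda>i. \<xi> (Suc i))"

lemma continuous_into_WW:
  assumes "\<And>i. continuous_map WW KK (\<lambda>\<xi>. F \<xi> i)" "\<And>\<xi> i. \<xi> \<in> topspace WW \<Longrightarrow> gg (F \<xi> (Suc i)) = F \<xi> i"
  shows "continuous_map WW WW F"
  unfolding unstable_space_def[of M f N L] continuous_map_in_subtopology
  using assms by (auto simp: continuous_map_componentwise_UNIV unstable_space_def[symmetric])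

lemma homeo_WW: "homeomorphic_maps WW WW hh shift"
  unfolding homeomorphic_maps_def
proof (intro conjI ballI)
  show "continuous_map WW WW hh"
  proof (rule continuous_into_WW)
    show "continuous_map WW KK (\<lambda>\<xi>. hh \<xi> i)" for i
      using continuous_map_compose[OF coordinate_WW gg_continuous, of 0] coordinate_WW
      by (cases i) (simp_all add: unstable_homeo_def comp_def)
    show "gg (hh \<xi> (Suc i)) = hh \<xi> i" if "\<xi> \<in> topspace WW" for \<xi> i
      using that topspace_WW by (cases i) (simp_all add: unstable_homeo_def)
  qed
  show "continuous_map WW WW shift"
  proof (rule continuous_into_WW)
    show "continuous_map WW KK (\<lambda>\<xi>. shift \<xi> i)" for i
      using coordinate_WW by (simp add: shift_def)
    show "gg (shift \<xi> (Suc i)) = shift \<xi> i" if "\<xi> \<in> topspace WW" for \<xi> i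
      using that topspace_WW by (simp add: shift_def)
  qed
  show "shift (hh \<xi>) = \<xi>" for \<xi> by (simp add: shift_def unstable_homeo_def)
  show "hh (shift \<xi>) = \<xi>" if "\<xi> \<in> topspace WW" for \<xi>
  proof
    fix i show "hh (shift \<xi>) i = \<xi> i"
      using that topspace_WW by (cases i) (simp_all add: shift_def unstable_homeo_def)
  qed
qed

lemma infinity_WW: "unstable_infinity \<in> topspace WW"
  using topspace_WW gg_collapse(2) topspace_KK by (simp add: unstable_infinity_def)

lemma hh_infinity: "hh unstable_infinity = unstable_infinity"
  using gg_collapse(2) by (auto simp: unstable_homeo_def unstable_infinity_def fun_eq_iff split: nat.split)

lemma WW_Some:
  assumes "\<xi> \<in> topspace WW" "\<xi> i = Some x"
  shows "\<exists>q. \<xi> (Suc i) = Some q \<and> q \<in> N - L \<and> f q = x"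
proof -
  have "gg (\<xi> (Suc i)) = Some x" using assms topspace_WW by simp
  then show ?thesis unfolding index_map_def by (auto split: option.splits if_splits)
qed

text \<open>\<open>f\<close> is injective on \<open>D\<close> and maps \<open>X\<close> onto
  \<open>X\<close>, so a preimage in \<open>N\<close> of a point of \<open>X\<close> lies in
  \<open>X\<close>. Coordinate 0 therefore decides membership in the core, which becomes the
  preimage of a closed set.\<close>

lemma core_0: "\<xi> \<in> topspace WW \<Longrightarrow> \<xi> 0 \<in> Some ` X \<Longrightarrow> \<xi> \<in> CC"
proof -
  assume \<xi>: "\<xi> \<in> topspace WW" "\<xi> 0 \<in> Some ` X"
  have "\<xi> i \<in> Some ` X" for i
  proof (induction i)
    case (Suc i)
    then obtain x where x: "\<xi> i = Some x" "x \<in> X" by blast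
    obtain q where q: "\<xi> (Suc i) = Some q" "q \<in> N - L" "f q = x" using WW_Some[OF \<xi>(1) x(1)] by blast
    obtain x' where x': "x' \<in> X" "f x' = x"
    proof -
      have "x \<in> f ` X" unfolding ip_sub(5) by (rule x(2))
      then show thesis using that by blast
    qed
    have "q = x'" by (rule inj_onD[OF f_inj]) (use q x' ip_sub in auto)
    then show ?case using q x' by blast
  qed (rule \<xi>(2))
  then show ?thesis unfolding unstable_core_def using \<xi>(1) by blast
qed

lemma core_eq: "CC = {\<xi> \<in> topspace WW. \<xi> 0 \<in> Some ` X}"
  using core_0 unfolding unstable_core_def by blast

lemma closedin_Some_X: "closedin KK (Some ` X)"
proof -
  have "{p \<in> N. collapse L p \<in> topspace KK - Some ` X} = N - X"
    unfolding topspace_KK using ip_sub(3) by (auto simp: collapse_def)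
  moreover have "openin MN (N - X)"
  proof -
    have "openin MN (N \<inter> (topspace M - X))" using ip_closed(3) by (intro openin_subtopology_Int2) auto
    moreover have "N \<inter> (topspace M - X) = N - X" using ip_sub(2) D_top by blast
    ultimately show ?thesis by simp
  qed
  ultimately have "openin KK (topspace KK - Some ` X)" unfolding openin_pointed_quotient using topspace_KK by auto
  then show ?thesis unfolding closedin_def topspace_KK using X_sub by blast
qed

lemma closedin_CC: "closedin WW CC"
  unfolding core_eq by (rule closedin_continuous_map_preimage[OF coordinate_WW closedin_Some_X])

lemma hh_CC: "hh ` CC = CC"
proof
  show "hh ` CC \<subseteq> CC"
  proof (rule image_subsetI)
    fix \<xi> assume \<xi>: "\<xi> \<in> CC"
    then obtain x where x: "x \<in> X" "\<xi> 0 = Some x" unfolding core_eq by blast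
    have fx: "f x \<in> X" using ip_sub(5) x(1) by blast
    have "x \<in> N - L" "f x \<notin> L" using X_sub x(1) fx by blast+
    then have "gg (Some x) = Some (f x)" using gg_collapse(1)[of x] by (simp add: collapse_def)
    then have "hh \<xi> 0 \<in> Some ` X" using x fx by (simp add: unstable_homeo_def)
    moreover have "\<xi> \<in> topspace WW" using \<xi> by (simp add: core_eq)
    then have "hh \<xi> \<in> topspace WW" using homeo_WW by (auto simp: homeomorphic_maps_def continuous_map_def)
    ultimately show "hh \<xi> \<in> CC" by (simp add: core_eq)
  qed
  show "CC \<subseteq> hh ` CC"
  proof
    fix \<xi> assume \<xi>: "\<xi> \<in> CC"
    then have t: "\<xi> \<in> topspace WW" by (simp add: core_eq)
    then have "shift \<xi> \<in> topspace WW" "hh (shift \<xi>) = \<xi>" using homeo_WW by (auto simp: homeomorphic_maps_def continuous_map_def)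
    moreover have "shift \<xi> \<in> CC" using \<xi> calculation(1) unfolding unstable_core_def by (simp add: shift_def)
    ultimately show "\<xi> \<in> hh ` CC" by (metis imageI)
  qed
qed

section \<open>Attraction to infinity and repulsion from the core\<close>

lemma shift_funpow: "(shift ^^ n) \<xi> = (\<lambda>i. \<xi> (i + n))"
  by (induction n arbitrary: \<xi>) (simp_all add: shift_def)

lemma not_None: "\<xi> \<in> topspace WW \<Longrightarrow> \<xi> i \<noteq> None \<Longrightarrow> i \<le> j \<Longrightarrow> \<exists>q. \<xi> j = Some q \<and> q \<in> N - L"
proof -
  assume \<xi>: "\<xi> \<in> topspace WW" "\<xi> i \<noteq> None" "i \<le> j"
  have "\<xi> j \<noteq> None" using \<xi>(3)
  proof (induction j rule: dec_induct)
    case base then show ?case by (rule \<xi>(2))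
  next
    case (step j)
    from step.IH obtain x where x: "\<xi> j = Some x" by auto
    from WW_Some[OF \<xi>(1) x] show ?case by auto
  qed
  moreover have "\<xi> j \<in> topspace KK" by (rule WW_coordinate[OF \<xi>(1)])
  then have "\<xi> j = None \<or> \<xi> j \<in> Some ` (N - L)" unfolding topspace_KK by simp
  ultimately show ?thesis by auto
qed

text \<open>Backward orbits approach \<open>X\<close> uniformly: otherwise compactness yields a full orbit in the
  isolating neighbourhood that leaves \<open>X\<close>.\<close>

lemma uniform_coordinates:
  assumes G: "openin KK G" "Some ` X \<subseteq> G"
  shows "\<exists>n. \<forall>i\<ge>n. \<forall>\<xi>\<in>topspace WW. \<xi> 0 \<noteq> None \<longrightarrow> \<xi> i \<in> G"
proof (rule ccontr)
  assume "\<not> ?thesis"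
  then have bad: "\<exists>i\<ge>n. \<exists>\<xi>\<in>topspace WW. \<xi> 0 \<noteq> None \<and> \<xi> i \<notin> G" for n by blast
  define A where "A = M closure_of (N - L)"
  have AN: "A \<subseteq> N" unfolding A_def by (rule closure_N)
  have Atop: "topspace (subtopology M A) = A" using AN ip_sub(2) D_top by auto
  have NLA: "N - L \<subseteq> A" unfolding A_def using ip_sub(2) D_top by (intro closure_of_subset) blast
  let ?P = "product_topology (\<lambda>_::int. subtopology M A) UNIV"
  have cP: "compact_space ?P"
    using compact_space_subtopology[OF isolating(1)] unfolding A_def[symmetric] by (simp add: compact_space_product_topology)
  have proj: "continuous_map ?P (subtopology M A) (\<lambda>s. s j)" for j
    by (rule continuous_map_product_projection) simp
  obtain S where S: "openin M S" "{q \<in> N. collapse L q \<in> G} = S \<inter> N"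
    using G(1) unfolding openin_pointed_quotient openin_subtopology by blast
  have SG: "collapse L q \<in> G \<longleftrightarrow> q \<in> S" if "q \<in> N" for q using S(2) that by blast
  define E where "E j = {s \<in> topspace ?P. f (s j) = s (j + 1)}" for j :: int
  define F where "F = {s \<in> topspace ?P. s 0 \<in> A - S}"
  have E: "closedin ?P (E j)" for j
  proof -
    have "continuous_map ?P M (\<lambda>s. f (s j))"
      using continuous_map_compose[OF proj f_continuous_on, of j] AN ip_sub(2) by (simp add: comp_def)
    moreover have "continuous_map ?P M (\<lambda>s. s (j + 1))" by (rule continuous_map_into_fulltopology[OF proj])
    ultimately show ?thesis unfolding E_def by (rule closedin_continuous_maps_eq[OF M])
  qed
  have "closedin (subtopology M A) (A - S)"
  proof -
    have "A - S = A \<inter> (topspace M - S)" using AN ip_sub(2) D_top by blast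
    then show ?thesis using S(1) closedin_subtopology_Int_closed[of M "topspace M - S" A] by (simp add: closedin_diff)
  qed
  then have F: "closedin ?P F" unfolding F_def by (rule closedin_continuous_map_preimage[OF proj])
  \<comment> \<open>All relations at negative times are imposed, but only \<open>n\<close> of the
    others. These closed sets decrease to the full orbits in \<open>A\<close> with
    \<open>s 0\<close> outside \<open>S\<close>.\<close>
  define K where "K n = (\<Inter>j\<in>{j. j < int n}. E j) \<inter> F" for n
  have "(\<Inter>n. K n) \<noteq> {}"
  proof (rule compact_space_imp_nest[OF cP])
    show "closedin ?P (K n)" for n
    proof -
      have "{j. j < int n} \<noteq> {}" by (metis Collect_empty_eq int_one_le_iff_zero_less lt_ex)
      then show ?thesis unfolding K_def using E by (intro closedin_Int F closedin_Inter) auto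
    qed
    show "decseq K" unfolding decseq_def K_def by auto
    show "K n \<noteq> {}" for n
    proof -
      obtain i \<xi> where i: "i \<ge> n" "\<xi> \<in> topspace WW" "\<xi> 0 \<noteq> None" "\<xi> i \<notin> G" using bad by blast
      define q where "q m = the (\<xi> m)" for m
      have q: "\<xi> m = Some (q m)" "q m \<in> N - L" for m using not_None[OF i(2,3), of m] by (auto simp: q_def)
      have fq: "f (q (Suc m)) = q m" for m using WW_Some[OF i(2) q(1)[of m]] q(1)[of "Suc m"] by auto
      \<comment> \<open>A point of the limit is a backward orbit. It is recentred at the bad
        coordinate \<open>i\<close>, so that time 0 lies outside \<open>S\<close> and
        \<open>i \<ge> n\<close> forward steps are available.\<close>
      define s where "s j = q (nat (int i - j))" for j
      have "f (s j) = s (j + 1)" if "j < int n" for j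
      proof -
        have "nat (int i - j) = Suc (nat (int i - (j + 1)))" using that i(1) by auto
        then show ?thesis unfolding s_def using fq by simp
      qed
      moreover have "s j \<in> A" for j unfolding s_def using q(2) NLA by blast
      moreover have "s 0 \<notin> S"
      proof -
        have "collapse L (q i) = \<xi> i" using q[of i] by (simp add: collapse_def)
        then show ?thesis using SG[of "q i"] q(2)[of i] i(4) unfolding s_def by auto
      qed
      ultimately have "s \<in> K n" unfolding K_def E_def F_def using Atop by auto
      then show ?thesis by blast
    qed
  qed
  then obtain s where s: "\<And>n. s \<in> K n" by blast
  have "f (s j) = s (j + 1)" for j
    using s[of "nat (j + 1)"] unfolding K_def E_def by auto
  moreover have sF: "s \<in> F" using s[of 0] unfolding K_def by blast
  then have "s j \<in> A" for j using Atop unfolding F_def by auto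
  ultimately have "s 0 \<in> invariant_part f A" unfolding invariant_part_def by blast
  then have sX: "s 0 \<in> X" using isolating(3) by (simp add: A_def)
  then have "s 0 \<in> N - L" using X_sub by blast
  then have "collapse L (s 0) \<in> G" "s 0 \<in> N" using sX G(2) by (auto simp: collapse_def)
  then have "s 0 \<in> S" using SG by blast
  then show False using sF unfolding F_def by blast
qed

text \<open>The complement of \<open>U\<close> has a closed image under coordinate 0. This image
  misses \<open>X\<close>, because coordinate 0 decides membership in the core. So \<open>U\<close>
  contains all sequences that start in some open \<open>G\<close> around \<open>X\<close>.\<close>

lemma uniform_backward:
  assumes O': "openin WW U" "CC \<subseteq> U"
  shows "\<exists>n. \<forall>i\<ge>n. \<forall>\<xi>\<in>topspace WW. \<xi> 0 \<noteq> None \<longrightarrow> (shift ^^ i) \<xi> \<in> U"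
proof -
  have "closedin WW (topspace WW - U)" using O' by blast
  then have "compactin WW (topspace WW - U)" by (rule closedin_compact_space[OF compact_WW])
  from image_compactin[OF this coordinate_WW[of 0]]
  have cl: "closedin KK ((\<lambda>\<xi>. \<xi> 0) ` (topspace WW - U))" by (rule compactin_imp_closedin[OF Hausdorff_KK])
  define G where "G = topspace KK - (\<lambda>\<xi>. \<xi> 0) ` (topspace WW - U)"
  have "openin KK G" unfolding G_def using cl by blast
  moreover have "Some ` X \<subseteq> G"
  proof
    fix x assume x: "x \<in> Some ` X"
    have "x \<notin> (\<lambda>\<xi>. \<xi> 0) ` (topspace WW - U)"
    proof
      assume "x \<in> (\<lambda>\<xi>. \<xi> 0) ` (topspace WW - U)"
      then obtain \<xi> where \<xi>: "\<xi> \<in> topspace WW" "\<xi> \<notin> U" "x = \<xi> 0" by blast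
      then have "\<xi> \<in> CC" using core_0 x by simp
      then show False using \<xi>(2) O'(2) by blast
    qed
    moreover have "x \<in> topspace KK" using x X_sub unfolding topspace_KK by blast
    ultimately show "x \<in> G" by (simp add: G_def)
  qed
  ultimately obtain n where n: "\<forall>i\<ge>n. \<forall>\<xi>\<in>topspace WW. \<xi> 0 \<noteq> None \<longrightarrow> \<xi> i \<in> G" using uniform_coordinates by blast
  show ?thesis
  proof (intro exI[of _ n] allI ballI impI)
    fix i \<xi> assume i: "n \<le> i" "\<xi> \<in> topspace WW" "\<xi> 0 \<noteq> None"
    have "(shift ^^ i) \<xi> \<in> topspace WW" unfolding shift_funpow using i(2) topspace_WW by simp
    moreover have "(shift ^^ i) \<xi> 0 \<in> G" unfolding shift_funpow using n i by simp
    ultimately show "(shift ^^ i) \<xi> \<in> U" unfolding G_def by blast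
  qed
qed

lemma hh_topspace: "\<xi> \<in> topspace WW \<Longrightarrow> (hh ^^ n) \<xi> \<in> topspace WW"
  by (induction n) (use homeo_WW in \<open>auto simp: homeomorphic_maps_def continuous_map_def\<close>)

lemma hh_coordinate: "j \<le> n \<Longrightarrow> (hh ^^ n) \<xi> j = (hh ^^ (n - j)) \<xi> 0"
proof (induction n arbitrary: j)
  case (Suc n)
  show ?case
  proof (cases j)
    case (Suc i)
    then have "(hh ^^ Suc n) \<xi> j = (hh ^^ n) \<xi> i" by (simp add: unstable_homeo_def)
    then show ?thesis using Suc.IH[of i] Suc.prems Suc by simp
  qed simp
qed simp

text \<open>A sequence with the base point at \<open>j\<close> has it at all earlier coordinates, so
  the sets given by \<open>\<xi> j = None\<close> decrease as \<open>j\<close> grows, and only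
  \<infinity> lies in all of them. Compactness does the rest.\<close>

lemma near_infinity:
  assumes U: "openin WW U" "unstable_infinity \<in> U"
  shows "\<exists>j. \<forall>\<xi>\<in>topspace WW. \<xi> j = None \<longrightarrow> \<xi> \<in> U"
proof (rule ccontr)
  assume "\<not> ?thesis"
  then have bad: "\<exists>\<xi>\<in>topspace WW. \<xi> j = None \<and> \<xi> \<notin> U" for j by blast
  define A where "A j = {\<xi> \<in> topspace WW. \<xi> j \<in> {None}} \<inter> (topspace WW - U)" for j
  have None: "closedin KK {None}" using Hausdorff_KK topspace_KK by (simp add: closedin_Hausdorff_singleton)
  have "(\<Inter>j. A j) \<noteq> {}"
  proof (rule compact_space_imp_nest[OF compact_WW])
    show "closedin WW (A j)" for j unfolding A_def
      using U(1) by (intro closedin_Int closedin_continuous_map_preimage[OF coordinate_WW None]) blast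
    show "A j \<noteq> {}" for j using bad[of j] unfolding A_def by blast
    show "decseq A" unfolding decseq_def
    proof (intro allI impI subsetI)
      fix i j \<xi> assume ij: "i \<le> j" and "\<xi> \<in> A j"
      then have \<xi>: "\<xi> \<in> topspace WW" "\<xi> j = None" "\<xi> \<notin> U" by (auto simp: A_def)
      have "\<xi> i = None"
      proof (rule ccontr)
        assume "\<xi> i \<noteq> None"
        from not_None[OF \<xi>(1) this ij] show False using \<xi>(2) by auto
      qed
      then show "\<xi> \<in> A i" using \<xi> by (simp add: A_def)
    qed
  qed
  then obtain \<xi> where \<xi>: "\<And>j. \<xi> \<in> A j" by blast
  then have "\<xi> = unstable_infinity" by (auto simp: A_def unstable_infinity_def fun_eq_iff)
  then show False using \<xi>[of 0] U(2) by (simp add: A_def)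
qed

lemma attractor_repeller_WW: "attractor_repeller WW hh shift CC unstable_infinity"
proof
  show "compact_space WW" "Hausdorff_space WW" by (rule compact_WW Hausdorff_WW)+
  show "homeomorphic_maps WW WW hh shift" by (rule homeo_WW)
  show "closedin WW CC" by (rule closedin_CC)
  show "unstable_infinity \<in> topspace WW" by (rule infinity_WW)
  show "unstable_infinity \<notin> CC" unfolding core_eq by (auto simp: unstable_infinity_def)
  show "hh unstable_infinity = unstable_infinity" by (rule hh_infinity)
  show "hh ` CC = CC" by (rule hh_CC)
  fix \<zeta> U assume \<zeta>: "\<zeta> \<in> topspace WW - (CC \<union> {unstable_infinity})" and U: "openin WW U"
  show "\<exists>V n0. openin WW V \<and> \<zeta> \<in> V \<and> (\<forall>n\<ge>n0. (hh ^^ n) ` V \<subseteq> U)" if Up: "unstable_infinity \<in> U"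
  proof -
    obtain j where j: "\<forall>\<xi>\<in>topspace WW. \<xi> j = None \<longrightarrow> \<xi> \<in> U" using near_infinity[OF U Up] by blast
    have "normal_space WW"
      by (rule compact_Hausdorff_or_regular_imp_normal_space) (use compact_WW Hausdorff_WW in auto)
    moreover have "closedin WW {\<zeta>}" using Hausdorff_WW \<zeta> by (simp add: closedin_Hausdorff_singleton)
    moreover have "disjnt CC {\<zeta>}" using \<zeta> by simp
    ultimately obtain Q V where V: "openin WW Q" "openin WW V" "CC \<subseteq> Q" "{\<zeta>} \<subseteq> V" "disjnt Q V"
      using closedin_CC unfolding normal_space_def by metis
    obtain m where m: "\<forall>i\<ge>m. \<forall>\<xi>\<in>topspace WW. \<xi> 0 \<noteq> None \<longrightarrow> (shift ^^ i) \<xi> \<in> Q"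
      using uniform_backward[OF V(1,3)] by blast
    \<comment> \<open>If coordinate 0 of \<open>(hh ^^ i) \<eta>\<close> were not the base point for
      some \<open>i \<ge> m\<close>, shifting back \<open>i\<close> times would put
      \<open>\<eta>\<close> into \<open>Q\<close>, which is disjoint from \<open>V\<close>. The
      extra \<open>j\<close> steps push the base point on to coordinate \<open>j\<close>.\<close>
    have "(hh ^^ n) \<eta> \<in> U" if n: "n \<ge> m + j" and \<eta>: "\<eta> \<in> V" for n \<eta>
    proof -
      have \<eta>W: "\<eta> \<in> topspace WW" using \<eta> openin_subset[OF V(2)] by blast
      have "(shift ^^ i) ((hh ^^ i) \<eta>) = \<eta>" for i
        unfolding shift_funpow
      proof
        fix l show "(hh ^^ i) \<eta> (l + i) = \<eta> l"
          by (induction i) (simp_all add: unstable_homeo_def)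
      qed
      then have "(hh ^^ i) \<eta> 0 = None" if "i \<ge> m" for i
        using m that hh_topspace[OF \<eta>W, of i] V(5) \<eta> unfolding disjnt_def by (metis IntI empty_iff)
      then have "(hh ^^ n) \<eta> j = None" using hh_coordinate[of j n \<eta>] n by simp
      then show ?thesis using j hh_topspace[OF \<eta>W] by blast
    qed
    then show ?thesis using V by (intro exI[of _ V] exI[of _ "m + j"]) blast
  qed
  show "\<exists>V n0. openin WW V \<and> \<zeta> \<in> V \<and> (\<forall>n\<ge>n0. (shift ^^ n) ` V \<subseteq> U)" if UC: "CC \<subseteq> U"
  proof -
    have "\<zeta> \<noteq> unstable_infinity" "\<zeta> \<in> topspace WW" using \<zeta> by blast+
    then obtain j where j: "\<zeta> j \<noteq> None" by (auto simp: unstable_infinity_def fun_eq_iff)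
    have "closedin KK {None}" using Hausdorff_KK topspace_KK by (simp add: closedin_Hausdorff_singleton)
    then have o: "openin KK (topspace KK - {None})" by blast
    \<comment> \<open>After \<open>j\<close> shifts coordinate \<open>j\<close> becomes coordinate
      0, so \<open>uniform_backward\<close> applies to every point of this open set.\<close>
    define V where "V = {\<xi> \<in> topspace WW. \<xi> j \<in> topspace KK - {None}}"
    have "openin WW V" unfolding V_def by (rule openin_continuous_map_preimage[OF coordinate_WW o])
    moreover have "\<zeta> \<in> V" unfolding V_def using j \<open>\<zeta> \<in> topspace WW\<close> WW_coordinate[of \<zeta> j] by blast
    moreover obtain m where m: "\<forall>i\<ge>m. \<forall>\<xi>\<in>topspace WW. \<xi> 0 \<noteq> None \<longrightarrow> (shift ^^ i) \<xi> \<in> U"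
      using uniform_backward[OF U UC] by blast
    have "(shift ^^ n) \<eta> \<in> U" if n: "n \<ge> m + j" and \<eta>: "\<eta> \<in> V" for n \<eta>
    proof -
      have "\<eta> \<in> topspace WW" "\<eta> j \<noteq> None" using \<eta> unfolding V_def by auto
      then have "(shift ^^ j) \<eta> \<in> topspace WW" "(shift ^^ j) \<eta> 0 \<noteq> None" unfolding shift_funpow by (simp_all add: topspace_WW)
      then have "(shift ^^ (n - j)) ((shift ^^ j) \<eta>) \<in> U" using m n by simp
      then show ?thesis using n by (simp add: shift_funpow)
    qed
    ultimately show ?thesis by (intro exI[of _ V] exI[of _ "m + j"]) blast
  qed
qed

text \<open>A continuous bijection from a compact to a Hausdorff space; injectivity of
  \<open>f\<close> on \<open>D\<close> recovers a sequence from coordinate 0, and following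
  \<open>f\<close> backwards inside \<open>X\<close> shows surjectivity.\<close>

lemma core_homeomorphic: "\<exists>\<psi>. homeomorphic_maps (subtopology WW CC) (subtopology M X) (\<lambda>\<xi>. the (\<xi> 0)) \<psi>"
proof -
  have CW: "CC \<subseteq> topspace WW" unfolding core_eq by blast
  have tC: "topspace (subtopology WW CC) = CC" using CW by auto
  have tX: "topspace (subtopology M X) = X" using ip_sub(4) D_top by auto
  have cont: "continuous_map (subtopology WW CC) (subtopology M X) (\<lambda>\<xi>. the (\<xi> 0))"
    unfolding continuous_map_in_subtopology
  proof
    show "(\<lambda>\<xi>. the (\<xi> 0)) \<in> topspace (subtopology WW CC) \<rightarrow> X" unfolding tC core_eq by auto
    show "continuous_map (subtopology WW CC) M (\<lambda>\<xi>. the (\<xi> 0))"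
      unfolding continuous_map_def
    proof (intro conjI allI impI)
      show "(\<lambda>\<xi>. the (\<xi> 0)) \<in> topspace (subtopology WW CC) \<rightarrow> topspace M"
        unfolding tC core_eq using ip_sub(4) D_top by auto
      fix S assume S: "openin M S"
      have "openin MN (N \<inter> S)" using S by (rule openin_subtopology_Int2)
      then have "openin KK (Some ` (N \<inter> S \<inter> (N - L)))" by (intro openin_Some openin_Int[OF _ openin_NL]) auto
      then have "openin WW {\<xi> \<in> topspace WW. \<xi> 0 \<in> Some ` (N \<inter> S \<inter> (N - L))}"
        by (rule openin_continuous_map_preimage[OF coordinate_WW])
      then have "openin (subtopology WW CC) (CC \<inter> {\<xi> \<in> topspace WW. \<xi> 0 \<in> Some ` (N \<inter> S \<inter> (N - L))})"
        by (rule openin_subtopology_Int2)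
      moreover have "CC \<inter> {\<xi> \<in> topspace WW. \<xi> 0 \<in> Some ` (N \<inter> S \<inter> (N - L))} = {\<xi> \<in> CC. the (\<xi> 0) \<in> S}"
        unfolding core_eq using X_sub by auto
      ultimately show "openin (subtopology WW CC) {\<xi> \<in> topspace (subtopology WW CC). the (\<xi> 0) \<in> S}" unfolding tC by simp
    qed
  qed
  have "homeomorphic_map (subtopology WW CC) (subtopology M X) (\<lambda>\<xi>. the (\<xi> 0))"
  proof (rule continuous_imp_homeomorphic_map[OF cont])
    show "compact_space (subtopology WW CC)"
      by (rule compact_space_subtopology[OF closedin_compact_space[OF compact_WW closedin_CC]])
    show "Hausdorff_space (subtopology M X)" by (rule Hausdorff_space_subtopology[OF M])
    show "inj_on (\<lambda>\<xi>. the (\<xi> 0)) (topspace (subtopology WW CC))"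
      unfolding tC
    proof (rule inj_onI)
      fix \<xi> \<eta> assume c: "\<xi> \<in> CC" "\<eta> \<in> CC" "the (\<xi> 0) = the (\<eta> 0)"
      have W: "\<xi> \<in> topspace WW" "\<eta> \<in> topspace WW" using c CW by blast+
      have "\<xi> i = \<eta> i" for i
      proof (induction i)
        case 0
        then show ?case using c unfolding core_eq by auto
      next
        case (Suc i)
        obtain x where x: "\<xi> i = Some x" using c(1) unfolding unstable_core_def by blast
        obtain q r where "\<xi> (Suc i) = Some q" "q \<in> N - L" "f q = x" "\<eta> (Suc i) = Some r" "r \<in> N - L" "f r = x"
          using WW_Some[OF W(1) x] WW_Some[OF W(2), of i x] x Suc by auto
        then show ?case using inj_onD[OF f_inj, of q r] ip_sub(2) by auto
      qed
      then show "\<xi> = \<eta>" by (rule ext)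
    qed
    show "(\<lambda>\<xi>. the (\<xi> 0)) ` topspace (subtopology WW CC) = topspace (subtopology M X)"
      unfolding tC tX
    proof
      show "(\<lambda>\<xi>. the (\<xi> 0)) ` CC \<subseteq> X" unfolding core_eq by auto
      show "X \<subseteq> (\<lambda>\<xi>. the (\<xi> 0)) ` CC"
      proof
        fix x assume x: "x \<in> X"
        have "\<forall>y\<in>f ` X. \<exists>z. z \<in> X \<and> f z = y" by blast
        then have "\<forall>y\<in>X. \<exists>z. z \<in> X \<and> f z = y" unfolding ip_sub(5) .
        then obtain b where b: "\<And>y. y \<in> X \<Longrightarrow> b y \<in> X \<and> f (b y) = y" by metis
        define \<xi> where "\<xi> i = Some ((b ^^ i) x)" for i
        have bX: "(b ^^ i) x \<in> X" for i by (induction i) (use b x in auto)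
        have "gg (\<xi> (Suc i)) = \<xi> i" for i
        proof -
          have *: "f ((b ^^ Suc i) x) = (b ^^ i) x" using b[OF bX[of i]] by simp
          have "(b ^^ Suc i) x \<in> N - L" "(b ^^ i) x \<in> N - L" using bX X_sub by blast+
          then show ?thesis unfolding \<xi>_def using gg_collapse(1)[of "(b ^^ Suc i) x"] * by (simp add: collapse_def del: funpow.simps)
        qed
        moreover have "\<xi> i \<in> topspace KK" for i unfolding \<xi>_def topspace_KK using bX X_sub by blast
        ultimately have "\<xi> \<in> topspace WW" unfolding topspace_WW by simp
        then have "\<xi> \<in> CC" using core_0 x by (simp add: \<xi>_def)
        then show "x \<in> (\<lambda>\<xi>. the (\<xi> 0)) ` CC" by (force simp: \<xi>_def)
      qed
    qed
  qed
  then show ?thesis by (simp add: homeomorphic_map_maps)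
qed

section \<open>Comparison of the Euler characteristics\<close>

lemma period_gcd_eq:
  "period_gcd M f N L X = Gcd (attractor_repeller.period hh `
     attractor_repeller.essential WW CC unstable_infinity)"
proof -
  interpret AR: attractor_repeller WW hh shift CC unstable_infinity by (rule attractor_repeller_WW)
  have "essential_quasicomponents M f N L X = AR.essential"
    unfolding essential_quasicomponents_def AR.essential_def AR.Y_def Let_def ..
  moreover have "quasicomponent_period f N L = AR.period"
    unfolding quasicomponent_period_def AR.period_def ..
  ultimately show ?thesis by (simp add: period_gcd_def)
qed

lemma euler_congruence:
  assumes fdK: "\<forall>q. cech_fin_dim TYPE('k::field) KK {} q"
    and fdX: "\<forall>q\<ge>1. cech_fin_dim TYPE('k) (subtopology M X) {} q"
    and sX: "finite (cech_support TYPE('k) (subtopology M X) {})"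
    and sW: "finite (cech_support TYPE('k) WW {unstable_infinity})"
    and conn: "connectedin M X"
  shows "[euler_char TYPE('k) WW {unstable_infinity} = euler_char TYPE('k) (subtopology M X) {}]
    (mod int (period_gcd M f N L X))"
proof -
  interpret AR: attractor_repeller WW hh shift CC unstable_infinity by (rule attractor_repeller_WW)
  let ?p = "unstable_infinity :: nat \<Rightarrow> 'a option" and ?X = "subtopology M X"
  \<comment> \<open>\<open>T / R\<close> computes the pair \<open>(W, {\<infinity>})\<close>,
    \<open>S / R\<close> the pair \<open>(W, X \<union> {\<infinity>})\<close> and
    \<open>T / S\<close> the space \<open>X\<close>. \<open>T0 / R\<close>, which computes
    \<open>W\<close> itself, receives the finite dimension of \<open>N/L\<close>.\<close>
  define T0 T S R :: "(nat \<Rightarrow> 'a option, 'k) complex"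
    where "T0 = lzero WW {}" and "T = lzero WW {?p}" and "S = lzero WW (CC \<union> {?p})" and "R = lzero WW (topspace WW)"
  have st: "stable T0" "stable T" "stable S" "stable R" unfolding T0_def T_def S_def R_def by (rule stable_lzero)+
  have sub: "R l \<subseteq> S l" "S l \<subseteq> T l" "T l \<subseteq> T0 l" "R l \<subseteq> T l" for l
    unfolding T0_def T_def S_def R_def using AR.XW infinity_WW by (intro lzero_mono; simp)+
  have cX: "compact_space ?X" "Hausdorff_space ?X"
    using compact_space_subtopology[OF ip_compact(3)] Hausdorff_space_subtopology[OF M] by blast+
  note chX = cech_lzero[OF cX closedin_empty, where 'k='k]
  note chW = cech_lzero[OF compact_WW Hausdorff_WW AR.closedin_p, where 'k='k, folded T_def R_def]
  note chK = cech_lzero[OF compact_KK Hausdorff_KK closedin_empty, where 'k='k]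
  have T0R: "hfd T0 R (Suc q)" for q
    using invlim_hfd[OF compact_KK Hausdorff_KK gg_continuous] fdK chK(1) unfolding T0_def R_def WW_invlim by blast
  \<comment> \<open>From \<open>W\<close> to \<open>(W, {\<infinity>})\<close> by the triple with
    the empty set, as the cohomology of a point is finite dimensional.\<close>
  have TR: "hfd T R (Suc q)" for q
    by (rule long_exact_sequence_fd[OF st(1,2,4) sub(3,4) T0R]) (unfold T0_def T_def, rule hfd_single)
  obtain \<psi> where \<psi>: "homeomorphic_maps (subtopology WW CC) ?X (\<lambda>\<xi>. the (\<xi> 0)) \<psi>" using core_homeomorphic by blast
  have disj: "{?p} \<inter> CC = {}" using AR.p(2) by blast
  have TS: "hfd T S l = hfd (lzero ?X {}) (lzero ?X (topspace ?X) :: ('a, 'k) complex) l"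
    "hdim T S l = hdim (lzero ?X {}) (lzero ?X (topspace ?X) :: ('a, 'k) complex) l" for l
    using lzero_disjoint_hdim[OF AR.closedin_p closedin_CC disj, where 'k='k and l=l]
      lzero_subspace_hdim[OF closedin_CC \<psi>, where 'k='k and l=l]
    unfolding T_def S_def by (simp_all add: Un_commute)
  have fTS: "hfd T S l" for l
  proof (cases l)
    case 0
    then show ?thesis using hfd_0[OF st(2,3)] by simp
  next
    case (Suc q)
    show ?thesis
    proof (cases "q = 0")
      \<comment> \<open>Only in this degree does finite dimension come from connectedness of
        \<open>X\<close>.\<close>
      case True
      have "connected_space ?X" using conn by (simp add: connectedin_def)
      then show ?thesis unfolding TS Suc True by (rule hfd_connected)
    next
      case False
      then show ?thesis unfolding TS Suc using fdX chX(1) by auto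
    qed
  qed
  have SR: "hfd S R (Suc q)" for q
    by (rule long_exact_sequence_fd[OF st(2,3,4) sub(2,1) TR fTS])
  define r where "r l = int (connecting_rank T S R l)" for l
  have les: "int (hdim T R (Suc q)) + r q + r (Suc q) = int (hdim S R (Suc q)) + int (hdim T S (Suc q))" for q
    unfolding r_def using long_exact_sequence_dim[OF st(2,3,4) sub(2,1) TR fTS fTS, of q] by linarith
  let ?d = "period_gcd M f N L X"
  have dvd: "?d dvd hdim S R (Suc q)" for q
    unfolding period_gcd_eq S_def R_def
    by (rule AR.period_gcd_dvd_hdim) (use SR[of 1] SR[of q] in \<open>simp_all add: S_def R_def numeral_2_eq_2\<close>)
  \<comment> \<open>The sums run through degree \<open>Q0\<close>, just beyond both supports. There
    the cohomology of \<open>X\<close> vanishes, so the connecting rank at \<open>Suc Q0\<close> is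
    0 and the telescope closes.\<close>
  obtain Q0 where Q0: "cech_support TYPE('k) ?X {} \<union> cech_support TYPE('k) WW {?p} \<subseteq> {..<Q0}"
    using finite_nat_bounded[of "cech_support TYPE('k) ?X {} \<union> cech_support TYPE('k) WW {?p}"] sX sW by blast
  have "Q0 \<notin> cech_support TYPE('k) ?X {}" using Q0 by blast
  then have "hdim T S (Suc Q0) = 0" using chX(3) unfolding TS by blast
  then have rQ: "r (Suc Q0) = 0" unfolding r_def using connecting_rank_le[OF st(2,3,4) sub(2,1) fTS, of "Suc Q0"] by simp
  have r0: "r 0 = 0" unfolding r_def using connecting_rank_0[OF st(2,3,4) sub(2,1)] by simp
  have eX: "euler_char TYPE('k) ?X {} = (\<Sum>q<Suc Q0. (-1) ^ q * int (hdim T S (Suc q)))"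
    unfolding euler_char_def TS chX(2)
    by (rule sum.mono_neutral_left) (use Q0 chX(3) in \<open>auto simp: less_Suc_eq\<close>)
  have eW: "euler_char TYPE('k) WW {?p} = (\<Sum>q<Suc Q0. (-1) ^ q * int (hdim T R (Suc q)))"
    unfolding euler_char_def chW(2)
    by (rule sum.mono_neutral_left) (use Q0 chW(3) in \<open>auto simp: less_Suc_eq\<close>)
  have "euler_char TYPE('k) WW {?p} - euler_char TYPE('k) ?X {}
      = (\<Sum>q<Suc Q0. (-1) ^ q * int (hdim S R (Suc q)) - (-1) ^ q * (r q + r (Suc q)))"
    unfolding eX eW sum_subtractf[symmetric]
  proof (rule sum.cong[OF refl])
    fix q
    have "int (hdim T R (Suc q)) = int (hdim S R (Suc q)) + int (hdim T S (Suc q)) - (r q + r (Suc q))"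
      using les[of q] by linarith
    then show "(-1) ^ q * int (hdim T R (Suc q)) - (-1) ^ q * int (hdim T S (Suc q))
        = (-1) ^ q * int (hdim S R (Suc q)) - (-1) ^ q * (r q + r (Suc q))"
      by (simp only:) (simp add: algebra_simps)
  qed
  also have "\<dots> = (\<Sum>q<Suc Q0. (-1) ^ q * int (hdim S R (Suc q)))"
    unfolding sum_subtractf alternating_telescope using r0 rQ by simp
  finally have "int ?d dvd euler_char TYPE('k) WW {?p} - euler_char TYPE('k) ?X {}"
    using dvd by (simp add: dvd_sum)
  then show ?thesis by (simp add: cong_iff_dvd_diff)
qed

end

theorem theorem6:
  fixes M :: "'a topology" and f :: "'a \<Rightarrow> 'a" and D X N L :: "'a set"
  assumes "Hausdorff_space M" and "locally_compact_space M" and "paracompact_space M"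
    and "openin M D" and "f ` D \<subseteq> topspace M"
    and "homeomorphic_map (subtopology M D) (subtopology M (f ` D)) f"
    and "isolated_invariant M D f X" and "X \<noteq> {}" and "connectedin M X"
    and "index_pair M D f X N L"
    and "\<forall>q. cech_fin_dim TYPE('k::field_char_0) (pointed_quotient M N L) {} q"
    and "\<forall>q\<ge>1. cech_fin_dim TYPE('k) (subtopology M X) {} q"
    and "finite (cech_support TYPE('k) (subtopology M X) {})"
    and "finite (cech_support TYPE('k) (unstable_space M f N L) {unstable_infinity})"
  shows "[euler_char TYPE('k) (unstable_space M f N L) {unstable_infinity}
          = euler_char TYPE('k) (subtopology M X) {}] (mod int (period_gcd M f N L X))"
  by (rule euler_congruence[OF assms(1,4,6,7,10,11,12,13,14,9)])

end
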